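(* Let $\Omega=B(0,1)\subset\mathbb R^3$ and write $r=|x|$. Define \[ w_1(r)=\frac{27+7r^2}{17(9-7r^2)},\qquad w(r)=\frac{143+27r^{10}}{17(13-3r^{10})},\qquad w_2(r)=\frac{225+13r^{14}}{17(15-r^{14})}, \] and set $\gamma_1=w_1^2$, $\gamma=w^2$, $\gamma_2=w_2^2$. Then $\gamma,\gamma_1,\gamma_2$ are positive real analytic radial conductivities in a neighborhood of $\overline{B(0,1)}$, they are pairwise distinct, and \[ \Lambda_\gamma=\tfrac12\Lambda_{\gamma_1}+\tfrac12\Lambda_{\gamma_2}. \]
   Context: For a bounded domain $\Omega$ with smooth boundary and a positive conductivity $\gamma\in C^\infty(\overline\Omega;\mathbb R)$, the conductivity Dirichlet-to-Neumann map is $\Lambda_\gamma f=\gamma\partial_\nu u_f|_{\partial\Omega}$, where $\nabla\cdot(\gamma\nabla u_f)=0$ in $\Omega$, $u_f|_{\partial\Omega}=f$, and $\nu$ is the outer unit normal; it is a bounded operator $H^{1/2}(\partial\Omega)\to H^{-1/2}(\partial\Omega)$. *)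

theory Defs
  imports "HOL-Analysis.Analysis"
begin

section \<open>Smooth and real analytic functions\<close>

definition partial_deriv :: "'a::euclidean_space \<Rightarrow> ('a \<Rightarrow> real) \<Rightarrow> 'a \<Rightarrow> real" where
  "partial_deriv b f x = frechet_derivative f (at x) b"

definition grad :: "('a::euclidean_space \<Rightarrow> real) \<Rightarrow> 'a \<Rightarrow> 'a" where
  "grad f x = (\<Sum>b\<in>Basis. partial_deriv b f x *\<^sub>R b)"

(* Only meant for open U. *)
fun Ck_on :: "nat \<Rightarrow> 'a::euclidean_space set \<Rightarrow> ('a \<Rightarrow> real) \<Rightarrow> bool" where
  "Ck_on 0 U f \<longleftrightarrow> continuous_on U f"
| "Ck_on (Suc k) U f \<longleftrightarrow>
     f differentiable_on U \<and> (\<forall>b\<in>Basis. Ck_on k U (partial_deriv b f))"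

definition smooth_on :: "'a::euclidean_space set \<Rightarrow> ('a \<Rightarrow> real) \<Rightarrow> bool" where
  "smooth_on U f \<longleftrightarrow> (\<forall>k. Ck_on k U f)"

definition smooth_up_to_boundary :: "'a::euclidean_space set \<Rightarrow> ('a \<Rightarrow> real) \<Rightarrow> bool" where
  "smooth_up_to_boundary \<Omega> f \<longleftrightarrow> (\<exists>U. open U \<and> closure \<Omega> \<subseteq> U \<and> smooth_on U f)"

definition test_function :: "'a::euclidean_space set \<Rightarrow> ('a \<Rightarrow> real) \<Rightarrow> bool" where
  "test_function \<Omega> \<phi> \<longleftrightarrow>
     smooth_on UNIV \<phi> \<and> (\<exists>K. compact K \<and> K \<subseteq> \<Omega> \<and> (\<forall>x. x \<notin> K \<longrightarrow> \<phi> x = 0))"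

(* Multi-indices are the functions 'n => nat; for real series, has_sum means absolute convergence. *)
definition real_analytic_on :: "(real ^ 'n) set \<Rightarrow> (real ^ 'n \<Rightarrow> real) \<Rightarrow> bool" where
  "real_analytic_on U f \<longleftrightarrow>
     (\<forall>a\<in>U. \<exists>\<rho>>0. \<exists>c :: ('n \<Rightarrow> nat) \<Rightarrow> real. \<forall>x\<in>ball a \<rho>.
        ((\<lambda>\<alpha>. c \<alpha> * (\<Prod>i\<in>UNIV. (x $ i - a $ i) ^ \<alpha> i)) has_sum f x) UNIV)"

definition radial_on :: "'a::real_normed_vector set \<Rightarrow> ('a \<Rightarrow> 'b) \<Rightarrow> bool" where
  "radial_on U f \<longleftrightarrow> (\<forall>x\<in>U. \<forall>y\<in>U. norm x = norm y \<longrightarrow> f x = f y)"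


section \<open>Lebesgue and Sobolev spaces\<close>

text \<open>Elements of function spaces are represented by functions; almost everywhere equal
  functions are not identified. Functions on a subset are total functions whose values
  outside the subset are ignored.\<close>

definition L2 :: "'a measure \<Rightarrow> ('a \<Rightarrow> real) set" where
  "L2 M = {f \<in> borel_measurable M. integrable M (\<lambda>x. (f x)\<^sup>2)}"

definition L2_norm :: "'a measure \<Rightarrow> ('a \<Rightarrow> real) \<Rightarrow> real" where
  "L2_norm M f = sqrt (\<integral>x. (f x)\<^sup>2 \<partial>M)"

abbreviation volume_on :: "'a::euclidean_space set \<Rightarrow> 'a measure" where
  "volume_on \<Omega> \<equiv> restrict_space lborel \<Omega>"

definition has_weak_gradient ::
  "'a::euclidean_space set \<Rightarrow> ('a \<Rightarrow> real) \<Rightarrow> ('a \<Rightarrow> 'a) \<Rightarrow> bool" where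
  "has_weak_gradient \<Omega> u G \<longleftrightarrow>
     (\<forall>b\<in>Basis. (\<lambda>x. G x \<bullet> b) \<in> L2 (volume_on \<Omega>)) \<and>
     (\<forall>\<phi>. test_function \<Omega> \<phi> \<longrightarrow> (\<forall>b\<in>Basis.
        (\<integral>x. u x * partial_deriv b \<phi> x \<partial>volume_on \<Omega>) =
        - (\<integral>x. (G x \<bullet> b) * \<phi> x \<partial>volume_on \<Omega>)))"

definition H1 :: "'a::euclidean_space set \<Rightarrow> ('a \<Rightarrow> real) set" where
  "H1 \<Omega> = {u \<in> L2 (volume_on \<Omega>). \<exists>G. has_weak_gradient \<Omega> u G}"

(* On open sets the weak gradient is unique up to null sets; it only occurs under integrals. *)
definition weak_grad :: "'a::euclidean_space set \<Rightarrow> ('a \<Rightarrow> real) \<Rightarrow> 'a \<Rightarrow> 'a" where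
  "weak_grad \<Omega> u = (SOME G. has_weak_gradient \<Omega> u G)"

definition H1_norm :: "'a::euclidean_space set \<Rightarrow> ('a \<Rightarrow> real) \<Rightarrow> real" where
  "H1_norm \<Omega> u =
     sqrt ((\<integral>x. (u x)\<^sup>2 \<partial>volume_on \<Omega>) + (\<integral>x. (norm (weak_grad \<Omega> u x))\<^sup>2 \<partial>volume_on \<Omega>))"


section \<open>Boundary values\<close>

text \<open>The definitions below take a bounded domain \<open>\<Omega>\<close> with smooth boundary together
  with the surface measure \<open>\<sigma>\<close> of its boundary. The trace is the continuous extension to
  \<open>H1 \<Omega>\<close> of the restriction to the boundary of functions smooth up to the boundary.
  The space \<open>H\<^sup>1\<^sup>/\<^sup>2\<close> is the range of the trace with the quotient norm, and
  \<open>H\<^sup>-\<^sup>1\<^sup>/\<^sup>2\<close> is its dual. Since \<open>H_half_norm\<close> vanishes on functions that are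
  zero almost everywhere on the boundary, the functionals in the dual do not distinguish
  almost everywhere equal boundary values.\<close>

definition has_trace ::
  "'a::euclidean_space set \<Rightarrow> 'a measure \<Rightarrow> ('a \<Rightarrow> real) \<Rightarrow> ('a \<Rightarrow> real) \<Rightarrow> bool" where
  "has_trace \<Omega> \<sigma> u f \<longleftrightarrow> u \<in> H1 \<Omega> \<and> f \<in> L2 \<sigma> \<and>
     (\<exists>\<phi> :: nat \<Rightarrow> 'a \<Rightarrow> real. (\<forall>n. smooth_up_to_boundary \<Omega> (\<phi> n)) \<and>
        (\<lambda>n. H1_norm \<Omega> (\<lambda>x. \<phi> n x - u x)) \<longlonglongrightarrow> 0 \<and>
        (\<lambda>n. L2_norm \<sigma> (\<lambda>x. \<phi> n x - f x)) \<longlonglongrightarrow> 0)"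

definition H_half :: "'a::euclidean_space set \<Rightarrow> 'a measure \<Rightarrow> ('a \<Rightarrow> real) set" where
  "H_half \<Omega> \<sigma> = {f. \<exists>u. has_trace \<Omega> \<sigma> u f}"

definition H_half_norm :: "'a::euclidean_space set \<Rightarrow> 'a measure \<Rightarrow> ('a \<Rightarrow> real) \<Rightarrow> real" where
  "H_half_norm \<Omega> \<sigma> f = (INF u\<in>{u. has_trace \<Omega> \<sigma> u f}. H1_norm \<Omega> u)"

definition H_minus_half ::
  "'a::euclidean_space set \<Rightarrow> 'a measure \<Rightarrow> (('a \<Rightarrow> real) \<Rightarrow> real) set" where
  "H_minus_half \<Omega> \<sigma> = {\<xi> \<in> extensional (H_half \<Omega> \<sigma>).
     (\<forall>f\<in>H_half \<Omega> \<sigma>. \<forall>g\<in>H_half \<Omega> \<sigma>. \<xi> (\<lambda>x. f x + g x) = \<xi> f + \<xi> g) \<and>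
     (\<forall>c. \<forall>f\<in>H_half \<Omega> \<sigma>. \<xi> (\<lambda>x. c * f x) = c * \<xi> f) \<and>
     (\<exists>C. \<forall>f\<in>H_half \<Omega> \<sigma>. \<bar>\<xi> f\<bar> \<le> C * H_half_norm \<Omega> \<sigma> f)}"


section \<open>The Dirichlet-to-Neumann map\<close>

definition weak_solution ::
  "'a::euclidean_space set \<Rightarrow> ('a \<Rightarrow> real) \<Rightarrow> ('a \<Rightarrow> real) \<Rightarrow> bool" where
  "weak_solution \<Omega> \<gamma> u \<longleftrightarrow> u \<in> H1 \<Omega> \<and>
     (\<forall>\<phi>. test_function \<Omega> \<phi> \<longrightarrow>
        (\<integral>x. \<gamma> x * (weak_grad \<Omega> u x \<bullet> grad \<phi> x) \<partial>volume_on \<Omega>) = 0)"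

text \<open>For a weak solution \<open>u\<close> of \<open>\<nabla> \<cdot> (\<gamma> \<nabla> u) = 0\<close> the normal derivative
  \<open>\<gamma> \<partial>\<^sub>\<nu> u\<close>, taken with respect to the outer unit normal, is the element of
  \<open>H\<^sup>-\<^sup>1\<^sup>/\<^sup>2\<close> determined by Green's formula: its value at \<open>g\<close> is the integral of
  \<open>\<gamma> \<nabla> u \<cdot> \<nabla> v\<close> for every \<open>v\<close> in \<open>H1 \<Omega>\<close> with trace \<open>g\<close>.\<close>

definition is_conormal_derivative ::
  "'a::euclidean_space set \<Rightarrow> 'a measure \<Rightarrow> ('a \<Rightarrow> real) \<Rightarrow> ('a \<Rightarrow> real)
    \<Rightarrow> (('a \<Rightarrow> real) \<Rightarrow> real) \<Rightarrow> bool" where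
  "is_conormal_derivative \<Omega> \<sigma> \<gamma> u \<xi> \<longleftrightarrow> \<xi> \<in> H_minus_half \<Omega> \<sigma> \<and>
     (\<forall>v g. has_trace \<Omega> \<sigma> v g \<longrightarrow>
        \<xi> g = (\<integral>x. \<gamma> x * (weak_grad \<Omega> u x \<bullet> weak_grad \<Omega> v x) \<partial>volume_on \<Omega>))"

definition DN_map ::
  "'a::euclidean_space set \<Rightarrow> 'a measure \<Rightarrow> ('a \<Rightarrow> real)
    \<Rightarrow> ('a \<Rightarrow> real) \<Rightarrow> ('a \<Rightarrow> real) \<Rightarrow> real" where
  "DN_map \<Omega> \<sigma> \<gamma> f = (THE \<xi>. \<exists>u. weak_solution \<Omega> \<gamma> u \<and> has_trace \<Omega> \<sigma> u f \<and>
     is_conormal_derivative \<Omega> \<sigma> \<gamma> u \<xi>)"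


section \<open>The unit ball\<close>

text \<open>The surface measure of the unit sphere in dimension \<open>d\<close>: the area of \<open>A\<close> is
  \<open>d\<close> times the volume of the cone \<open>{t *\<^sub>R x | 0 < t < 1, x \<in> A}\<close>.\<close>

definition sphere_measure :: "'a::euclidean_space measure" where
  "sphere_measure = scale_measure (of_nat DIM('a))
     (distr (restrict_space lborel (ball 0 1 - {0})) (restrict_space borel (sphere 0 1)) sgn)"

definition DN_ball :: "(real ^ 3 \<Rightarrow> real) \<Rightarrow> (real ^ 3 \<Rightarrow> real) \<Rightarrow> (real ^ 3 \<Rightarrow> real) \<Rightarrow> real" where
  "DN_ball = DN_map (ball 0 1) sphere_measure"

definition H_half_sphere :: "(real ^ 3 \<Rightarrow> real) set" where
  "H_half_sphere = H_half (ball 0 1) sphere_measure"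

end

theory Submission
  imports Defs "HOL-Complex_Analysis.Cauchy_Integral_Formula" "HOL-Real_Asymp.Real_Asymp"
begin

text \<open>
  In the variable \<open>s = \<bar>x\<bar>\<^sup>2\<close> each of the three functions has the form \<open>w = (2 K + 1) / 17\<close> with
  \<open>K = m (c + s\<^sup>m) / (c - s\<^sup>m)\<close> for \<open>m = 1, 5, 7\<close>, where \<open>c\<close> is chosen such that \<open>K = 8\<close> on the
  sphere. So \<open>w\<close> is built from a one-soliton potential \<open>\<Delta>w / w\<close>, whose solutions are the Darboux
  transforms \<open>(x \<bullet> \<nabla> + 1/2 + K) h\<close> of harmonic functions \<open>h\<close>. If \<open>u\<close> is the harmonic function with
  boundary values \<open>f\<close> and \<open>x \<bullet> \<nabla>h + 17/2 h = u\<close>, then \<open>(u + (K - 8) h) / w\<close> solves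
  the conductivity equation of \<open>w\<^sup>2\<close> and has the boundary values \<open>f\<close>, with the same \<open>u\<close> and \<open>h\<close>
  for all three conductivities. Its flux on the sphere is affine in \<open>m\<^sup>2\<close>, and \<open>25\<close> is the mean
  of \<open>1\<close> and \<open>49\<close>.

  Everything is done weakly. Existence of \<open>u\<close> follows by minimising the Dirichlet integral;
  \<open>h\<close> is an explicit integral of \<open>u\<close> along rays. That the conormal derivative
  is well defined and that the averaged flux vanishes as a functional both
  follow by cutting off near the sphere, in the first case with the help of Hardy's inequality.
\<close>

section \<open>Calculus of smooth functions\<close>

text \<open>\<open>w\<close> is itself a transform, that of the constant \<open>h = 1\<close>,
  normalised by 2/17 to be 1 on the sphere; so \<open>w\<close> and all other transforms solve the
  same equation, and their quotients by \<open>w\<close> solve the conductivity equation. On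
  harmonic polynomials of degree \<open>l\<close> the boundary map has the eigenvalue
  \<open>l - 8 d l / (17 (2 l + 17))\<close>, where \<open>d = (64 - m^2) / 2\<close> is the
  derivative of \<open>K\<close> at \<open>s = 1\<close> by the Riccati equation; hence the affine
  dependence on \<open>m^2\<close>. The exponents are natural numbers to keep \<open>s^m\<close>
  analytic at 0, and 1, 25, 49 is the smallest non-constant arithmetic progression of positive
  squares. The boundary value 8 exceeds every \<open>m\<close>, so that
  \<open>c = (8 + m) / (8 - m)\<close> is greater than 1 and no pole enters the ball. The obstacle
  is low regularity. Data in \<open>H_half\<close> have extensions with weak gradients only, so
  fluxes cannot be compared pointwise on the sphere; and \<open>DN_map\<close> is a definite
  description over chosen gradients, so existence and uniqueness come before any value. Identities
  are therefore proved for functions smooth up to the boundary or against test functions, and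
  carried to L2 limits.\<close>

lemma has_derivative_grad:
  assumes "(f has_derivative D) (at x)"
  shows "grad f x \<bullet> v = D v" "partial_deriv b f x = D b"
proof -
  have D: "frechet_derivative f (at x) = D"
    using frechet_derivative_at[OF assms] by simp
  then show "partial_deriv b f x = D b"
    by (simp add: partial_deriv_def)
  have "D v = D (\<Sum>b\<in>Basis. (v \<bullet> b) *\<^sub>R b)"
    by (simp add: euclidean_representation)
  also have "\<dots> = (\<Sum>b\<in>Basis. (v \<bullet> b) * D b)"
    using has_derivative_linear[OF assms] by (simp add: linear_sum linear_cmul o_def)
  finally show "grad f x \<bullet> v = D v"
    by (simp add: grad_def partial_deriv_def D inner_sum_left inner_sum_right inner_commute mult.commute)
qed

lemma grad_eqI: "(f has_derivative (\<lambda>h. g \<bullet> h)) (at x) \<Longrightarrow> grad f x = g"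
  by (rule vector_eq_rdot[THEN iffD1]) (simp add: has_derivative_grad)

lemma grad_inner_Basis: "b \<in> Basis \<Longrightarrow> grad f x \<bullet> b = partial_deriv b f x"
  by (simp add: grad_def inner_sum_left inner_Basis if_distrib cong: if_cong)

section \<open>Closure properties of the classes \<open>Ck_on\<close>\<close>

lemma Ck_on_has_derivative:
  assumes "Ck_on (Suc k) U f" "open U" "x \<in> U"
  shows "(f has_derivative (\<lambda>h. grad f x \<bullet> h)) (at x)"
proof -
  have "f differentiable_on U"
    using assms(1) by simp
  then have "f differentiable (at x)"
    using assms(2,3) by (metis at_within_open differentiable_on_def)
  then have *: "(f has_derivative frechet_derivative f (at x)) (at x)"
    by (rule frechet_derivative_works[THEN iffD1])
  show ?thesis
    by (rule has_derivative_eq_rhs[OF *]) (simp only: fun_eq_iff has_derivative_grad(1)[OF *] simp_thms)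
qed

text \<open>The congruence rule at level \<open>k\<close> is a premise because its proof,
  \<open>Ck_on_cong\<close>, is an induction that uses this very rule; there the induction
  hypothesis supplies it. \<open>Ck_on_SucI'\<close> is the version in which
  \<open>Ck_on_cong\<close> discharges the premise.\<close>

lemma Ck_on_SucI:
  assumes "open U" "\<And>x. x \<in> U \<Longrightarrow> (f has_derivative D x) (at x)"
    and "\<And>b. b \<in> Basis \<Longrightarrow> Ck_on k U (\<lambda>x. D x b)"
    and cong: "\<And>f g. (\<And>x. x \<in> U \<Longrightarrow> f x = g x) \<Longrightarrow> Ck_on k U f \<Longrightarrow> Ck_on k U g"
  shows "Ck_on (Suc k) U f"
proof -
  have "f differentiable_on U"
    unfolding differentiable_on_def differentiable_def
    using assms(1,2) by (metis at_within_open)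
  moreover have "Ck_on k U (partial_deriv b f)" if "b \<in> Basis" for b
    by (rule cong[OF _ assms(3)[OF that]])
       (simp add: has_derivative_grad(2)[OF assms(2)])
  ultimately show ?thesis by simp
qed

lemma Ck_on_cong:
  assumes "open U" "\<And>x. x \<in> U \<Longrightarrow> f x = g x" "Ck_on k U f"
  shows "Ck_on k U g"
  using assms(2,3)
proof (induction k arbitrary: f g)
  case 0
  then show ?case by (simp cong: continuous_on_cong)
next
  case (Suc k)
  have 1: "(g has_derivative (\<lambda>h. grad f x \<bullet> h)) (at x)" if "x \<in> U" for x
    by (rule has_derivative_transform_within_open[OF Ck_on_has_derivative[OF Suc.prems(2) \<open>open U\<close> that] \<open>open U\<close> that])
       (use Suc.prems(1) in auto)
  show ?case
  proof (rule Ck_on_SucI[OF \<open>open U\<close> 1])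
    fix b :: 'a assume b: "b \<in> Basis"
    have "(\<lambda>x. grad f x \<bullet> b) = partial_deriv b f"
      using b by (auto simp: grad_inner_Basis)
    then show "Ck_on k U (\<lambda>x. grad f x \<bullet> b)"
      using Suc.prems(2) b by simp
  qed (use Suc.IH in auto)
qed

lemmas Ck_on_SucI' = Ck_on_SucI[OF _ _ _ Ck_on_cong]

lemma Ck_on_partial: "Ck_on (Suc k) U f \<Longrightarrow> b \<in> Basis \<Longrightarrow> Ck_on k U (\<lambda>x. grad f x \<bullet> b)"
  by (simp add: grad_inner_Basis)

lemma Ck_on_SucD: "Ck_on (Suc k) U f \<Longrightarrow> Ck_on k U f"
proof (induction k arbitrary: f)
  case 0
  then show ?case by (auto intro: differentiable_imp_continuous_on)
next
  case (Suc k)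
  then show ?case by (metis Ck_on.simps(2))
qed

lemma Ck_on_subset: "Ck_on k U f \<Longrightarrow> V \<subseteq> U \<Longrightarrow> Ck_on k V f"
  by (induction k arbitrary: f) (auto intro: continuous_on_subset differentiable_on_subset)

lemma Ck_on_Un:
  assumes "open U" "open V" "Ck_on k U f" "Ck_on k V f"
  shows "Ck_on k (U \<union> V) f"
  using assms(3,4)
proof (induction k arbitrary: f)
  case 0
  then show ?case using assms(1,2) by (auto intro: continuous_on_open_Un)
next
  case (Suc k)
  have *: "f differentiable_on S \<longleftrightarrow> (\<forall>x\<in>S. f differentiable (at x))" if "open S" for S
    using that by (metis at_within_open differentiable_on_def)
  show ?case
    using Suc assms(1,2) by (auto simp: *[OF assms(1)] *[OF assms(2)] *[OF open_Un[OF assms(1,2)]])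
qed

lemma Ck_on_const: "open U \<Longrightarrow> Ck_on k U (\<lambda>x. c)"
proof (induction k arbitrary: c)
  case (Suc k)
  then show ?case
    by (intro Ck_on_SucI'[where D = "\<lambda>x h. 0"]) auto
qed simp

lemma Ck_on_linear:
  assumes "open U" "bounded_linear L"
  shows "Ck_on k U L"
proof (cases k)
  case 0
  then show ?thesis using assms by (simp add: linear_continuous_on)
next
  case (Suc n)
  show ?thesis unfolding Suc
    by (intro Ck_on_SucI'[where D = "\<lambda>x. L"] assms bounded_linear.has_derivative[OF assms(2) has_derivative_ident]
          Ck_on_const) auto
qed

lemma Ck_on_add:
  assumes "open U" "Ck_on k U f" "Ck_on k U g"
  shows "Ck_on k U (\<lambda>x. f x + g x)"
  using assms(2,3)
proof (induction k arbitrary: f g)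
  case 0
  then show ?case by (auto intro: continuous_intros)
next
  case (Suc k)
  show ?case
    by (rule Ck_on_SucI'[where D = "\<lambda>x h. grad f x \<bullet> h + grad g x \<bullet> h"])
       (use Suc assms(1) in \<open>auto intro!: has_derivative_add Ck_on_has_derivative[of k U] Suc.IH Ck_on_partial simp del: Ck_on.simps\<close>)
qed

lemma Ck_on_mult:
  assumes "open U" "Ck_on k U f" "Ck_on k U g"
  shows "Ck_on k U (\<lambda>x. f x * g x)"
  using assms(2,3)
proof (induction k arbitrary: f g)
  case 0
  then show ?case by (auto intro: continuous_intros)
next
  case (Suc k)
  note fg = Ck_on_SucD[OF Suc.prems(1)] Ck_on_SucD[OF Suc.prems(2)]
  show ?case
  proof (rule Ck_on_SucI'[where D = "\<lambda>x h. f x * (grad g x \<bullet> h) + (grad f x \<bullet> h) * g x"])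
    show "((\<lambda>x. f x * g x) has_derivative (\<lambda>h. f x * (grad g x \<bullet> h) + (grad f x \<bullet> h) * g x)) (at x)"
      if "x \<in> U" for x
      by (intro has_derivative_mult Ck_on_has_derivative[OF Suc.prems(1) assms(1) that]
          Ck_on_has_derivative[OF Suc.prems(2) assms(1) that])
    show "Ck_on k U (\<lambda>x. f x * (grad g x \<bullet> b) + (grad f x \<bullet> b) * g x)" if "b \<in> Basis" for b
      by (intro Ck_on_add Suc.IH fg Ck_on_partial[OF _ that] Suc.prems assms(1))
  qed (use assms(1) in auto)
qed

text \<open>A class \<open>S\<close> closed under differentiation on \<open>T\<close> replaces a
  formula for higher derivatives of a composite: the induction only uses that the outer derivative
  lies in \<open>S\<close> again. The two instances are the multiples of powers of
  \<open>inverse\<close> and the functions \<open>exp_recip p\<close>.\<close>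

lemma Ck_on_compose:
  fixes f :: "real \<Rightarrow> real"
  assumes "open U" "Ck_on k U g" "g ` U \<subseteq> T" "f \<in> S"
    and S: "\<And>f. f \<in> S \<Longrightarrow> \<exists>f'\<in>S. \<forall>t\<in>T. (f has_real_derivative f' t) (at t)"
  shows "Ck_on k U (\<lambda>x. f (g x))"
  using assms(2,4)
proof (induction k arbitrary: f)
  case 0
  obtain f' where "\<forall>t\<in>T. (f has_real_derivative f' t) (at t)"
    using S 0 by blast
  then have "continuous_on T f"
    by (intro continuous_at_imp_continuous_on) (auto intro: DERIV_isCont)
  then show ?case
    using 0 assms(3) by (auto intro: continuous_on_compose2)
next
  case (Suc k)
  obtain f' where f': "f' \<in> S" "\<forall>t\<in>T. (f has_real_derivative f' t) (at t)"
    using S Suc by blast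
  show ?case
  proof (rule Ck_on_SucI'[where D = "\<lambda>x h. f' (g x) * (grad g x \<bullet> h)"])
    fix x assume x: "x \<in> U"
    have "(f has_derivative (\<lambda>h. f' (g x) * h)) (at (g x))"
      using f'(2) x assms(3) by (auto simp: has_field_derivative_def)
    from has_derivative_compose[OF Ck_on_has_derivative[OF Suc.prems(1) assms(1) x] this]
    show "((\<lambda>x. f (g x)) has_derivative (\<lambda>h. f' (g x) * (grad g x \<bullet> h))) (at x)" .
  next
    fix b :: 'a assume "b \<in> Basis"
    then show "Ck_on k U (\<lambda>x. f' (g x) * (grad g x \<bullet> b))"
      by (intro Ck_on_mult[OF assms(1)] Suc.IH[OF Ck_on_SucD[OF Suc.prems(1)] f'(1)] Ck_on_partial[OF Suc.prems(1)])
  qed (use assms(1) in auto)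
qed

lemma Ck_on_inverse:
  assumes "open U" "Ck_on k U g" "\<And>x. x \<in> U \<Longrightarrow> g x \<noteq> 0"
  shows "Ck_on k U (\<lambda>x. inverse (g x))"
proof (rule Ck_on_compose[OF assms(1,2), where T = "- {0}" and S = "{(\<lambda>t. c * inverse t ^ n) | c n. True}"])
  show "(inverse :: real \<Rightarrow> real) \<in> {(\<lambda>t. c * inverse t ^ n) | c n. True}"
    by (auto simp: fun_eq_iff intro!: exI[of _ 1] exI[of _ "Suc 0"])
  fix f :: "real \<Rightarrow> real" assume "f \<in> {(\<lambda>t. c * inverse t ^ n) | c n. True}"
  then obtain c n where f: "f = (\<lambda>t. c * inverse t ^ n)" by auto
  have "(f has_real_derivative (c * - real n) * inverse t ^ Suc n) (at t)" if "t \<noteq> 0" for t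
  proof (cases n)
    case 0
    then show ?thesis by (simp add: f)
  next
    case (Suc m)
    have "(inverse has_real_derivative - (inverse t * inverse t)) (at t)"
      using DERIV_inverse[OF that] by (simp add: power2_eq_square)
    from DERIV_cmult[OF DERIV_power[OF this, of "Suc m"], of c] show ?thesis
      unfolding f Suc by (rule DERIV_cong) (simp add: algebra_simps)
  qed
  then show "\<exists>f'\<in>{(\<lambda>t. c * inverse t ^ n) | c n. True}. \<forall>t\<in>- {0}. (f has_real_derivative f' t) (at t)"
    by (intro bexI[of _ "\<lambda>t. (c * - real n) * inverse t ^ Suc n"]) blast+
qed (use assms(3) in auto)

lemma Ck_on_scale:
  assumes "open U" "open V" "\<And>x. x \<in> V \<Longrightarrow> c *\<^sub>R x \<in> U" "Ck_on k U f"
  shows "Ck_on k V (\<lambda>x. f (c *\<^sub>R x))"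
  using assms(4)
proof (induction k arbitrary: f)
  case 0
  then show ?case using assms(3) by (auto intro!: continuous_on_compose2[of U f] continuous_intros)
next
  case (Suc k)
  show ?case
  proof (rule Ck_on_SucI'[where D = "\<lambda>x h. grad f (c *\<^sub>R x) \<bullet> (c *\<^sub>R h)"])
    fix x assume x: "x \<in> V"
    have "((\<lambda>x. c *\<^sub>R x) has_derivative (\<lambda>h. c *\<^sub>R h)) (at x)"
      by (auto intro!: derivative_eq_intros)
    from has_derivative_compose[OF this Ck_on_has_derivative[OF Suc.prems(1) assms(1) assms(3)[OF x]]]
    show "((\<lambda>x. f (c *\<^sub>R x)) has_derivative (\<lambda>h. grad f (c *\<^sub>R x) \<bullet> (c *\<^sub>R h))) (at x)" .
  next
    fix b :: 'a assume "b \<in> Basis"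
    then show "Ck_on k V (\<lambda>x. grad f (c *\<^sub>R x) \<bullet> (c *\<^sub>R b))"
      using Suc.IH[OF Ck_on_partial[OF Suc.prems]] Ck_on_mult[OF assms(2) Ck_on_const[OF assms(2)]] by simp
  qed (use assms in auto)
qed

section \<open>The same rules for smooth functions, and gradients of combinations\<close>

lemma smooth_onD: "smooth_on U f \<Longrightarrow> Ck_on k U f"
  by (simp add: smooth_on_def)

lemma smooth_on_has_derivative:
  "smooth_on U f \<Longrightarrow> open U \<Longrightarrow> x \<in> U \<Longrightarrow> (f has_derivative (\<lambda>h. grad f x \<bullet> h)) (at x)"
  by (meson Ck_on_has_derivative smooth_onD)

lemma smooth_on_continuous: "smooth_on U f \<Longrightarrow> continuous_on U f"
  using smooth_onD[of U f 0] by simp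

lemma smooth_on_partial: "smooth_on U f \<Longrightarrow> b \<in> Basis \<Longrightarrow> smooth_on U (\<lambda>x. grad f x \<bullet> b)"
  unfolding smooth_on_def using Ck_on_partial by blast

lemma smooth_on_partial_deriv: "smooth_on U f \<Longrightarrow> b \<in> Basis \<Longrightarrow> smooth_on U (partial_deriv b f)"
  using smooth_on_partial[of U f b] by (simp add: grad_inner_Basis)

lemma smooth_on_continuous_grad: "smooth_on U f \<Longrightarrow> continuous_on U (grad f)"
  unfolding grad_def[abs_def]
  by (intro continuous_intros) (auto intro: smooth_on_continuous smooth_on_partial_deriv)

lemma smooth_on_cong: "open U \<Longrightarrow> smooth_on U f \<Longrightarrow> (\<And>x. x \<in> U \<Longrightarrow> f x = g x) \<Longrightarrow> smooth_on U g"
  unfolding smooth_on_def using Ck_on_cong by blast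

lemma smooth_on_subset: "smooth_on U f \<Longrightarrow> V \<subseteq> U \<Longrightarrow> smooth_on V f"
  unfolding smooth_on_def using Ck_on_subset by blast

lemma smooth_on_Un: "open U \<Longrightarrow> open V \<Longrightarrow> smooth_on U f \<Longrightarrow> smooth_on V f \<Longrightarrow> smooth_on (U \<union> V) f"
  unfolding smooth_on_def using Ck_on_Un by blast

lemma smooth_on_const [simp]: "open U \<Longrightarrow> smooth_on U (\<lambda>x. c)"
  unfolding smooth_on_def using Ck_on_const by blast

lemma smooth_on_linear: "open U \<Longrightarrow> bounded_linear L \<Longrightarrow> smooth_on U L"
  unfolding smooth_on_def using Ck_on_linear by blast

lemma smooth_on_add: "open U \<Longrightarrow> smooth_on U f \<Longrightarrow> smooth_on U g \<Longrightarrow> smooth_on U (\<lambda>x. f x + g x)"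
  unfolding smooth_on_def using Ck_on_add by blast

lemma smooth_on_mult: "open U \<Longrightarrow> smooth_on U f \<Longrightarrow> smooth_on U g \<Longrightarrow> smooth_on U (\<lambda>x. f x * g x)"
  unfolding smooth_on_def using Ck_on_mult by blast

lemma smooth_on_cmult: "open U \<Longrightarrow> smooth_on U f \<Longrightarrow> smooth_on U (\<lambda>x. c * f x)"
  by (intro smooth_on_mult smooth_on_const)

lemma smooth_on_diff: "open U \<Longrightarrow> smooth_on U f \<Longrightarrow> smooth_on U g \<Longrightarrow> smooth_on U (\<lambda>x. f x - g x)"
  using smooth_on_add[of U f "\<lambda>x. (-1) * g x"] smooth_on_cmult[of U g "-1"] by simp

lemma smooth_on_inverse:
  "open U \<Longrightarrow> smooth_on U f \<Longrightarrow> (\<And>x. x \<in> U \<Longrightarrow> f x \<noteq> 0) \<Longrightarrow> smooth_on U (\<lambda>x. inverse (f x))"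
  unfolding smooth_on_def using Ck_on_inverse by blast

lemma smooth_on_divide:
  "open U \<Longrightarrow> smooth_on U f \<Longrightarrow> smooth_on U g \<Longrightarrow> (\<And>x. x \<in> U \<Longrightarrow> g x \<noteq> 0) \<Longrightarrow> smooth_on U (\<lambda>x. f x / g x)"
  unfolding divide_inverse by (intro smooth_on_mult smooth_on_inverse)

lemma smooth_on_power: "open U \<Longrightarrow> smooth_on U f \<Longrightarrow> smooth_on U (\<lambda>x. f x ^ n)"
  by (induction n) (auto intro: smooth_on_mult)

lemma smooth_on_prod:
  "finite I \<Longrightarrow> open U \<Longrightarrow> (\<And>i. i \<in> I \<Longrightarrow> smooth_on U (f i)) \<Longrightarrow> smooth_on U (\<lambda>x. \<Prod>i\<in>I. f i x)"
  by (induction I rule: finite_induct) (auto intro: smooth_on_mult)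

lemma smooth_on_scale:
  "open U \<Longrightarrow> open V \<Longrightarrow> (\<And>x. x \<in> V \<Longrightarrow> c *\<^sub>R x \<in> U) \<Longrightarrow> smooth_on U f \<Longrightarrow> smooth_on V (\<lambda>x. f (c *\<^sub>R x))"
  unfolding smooth_on_def using Ck_on_scale by blast

lemma smooth_on_inner_self: "open U \<Longrightarrow> smooth_on U (\<lambda>x. x \<bullet> x)"
proof -
  assume U: "open U"
  have "smooth_on U (\<lambda>x. \<Sum>b\<in>A. (x \<bullet> b) * (x \<bullet> b))" if "finite A" for A :: "'a set"
    using that by (induction A rule: finite_induct)
      (use U in \<open>auto intro!: smooth_on_add smooth_on_mult smooth_on_linear[OF _ bounded_linear_inner_left]\<close>)
  from this[of Basis] show ?thesis
    by (simp add: euclidean_inner[symmetric])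
qed

lemma grad_add:
  assumes "smooth_on U f" "smooth_on U g" "open U" "x \<in> U"
  shows "grad (\<lambda>x. f x + g x) x = grad f x + grad g x"
  by (rule grad_eqI) (auto simp: inner_add_left intro!: derivative_eq_intros smooth_on_has_derivative[of U] assms)

lemma grad_diff:
  assumes "smooth_on U f" "smooth_on U g" "open U" "x \<in> U"
  shows "grad (\<lambda>x. f x - g x) x = grad f x - grad g x"
  by (rule grad_eqI) (auto simp: inner_diff_left intro!: derivative_eq_intros smooth_on_has_derivative[of U] assms)

lemma grad_mult:
  assumes "smooth_on U f" "smooth_on U g" "open U" "x \<in> U"
  shows "grad (\<lambda>x. f x * g x) x = f x *\<^sub>R grad g x + g x *\<^sub>R grad f x"
  by (rule grad_eqI)
     (rule has_derivative_eq_rhs[OF has_derivative_mult[OF smooth_on_has_derivative[of U] smooth_on_has_derivative[of U]]],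
      use assms in \<open>auto simp: inner_add_left mult.commute\<close>)

lemma grad_cmult:
  assumes "smooth_on U f" "open U" "x \<in> U"
  shows "grad (\<lambda>x. c * f x) x = c *\<^sub>R grad f x"
  by (rule grad_eqI) (auto intro!: derivative_eq_intros smooth_on_has_derivative[of U] assms)

lemma grad_scale:
  assumes "smooth_on U f" "open U" "c *\<^sub>R x \<in> U"
  shows "grad (\<lambda>x. f (c *\<^sub>R x)) x = c *\<^sub>R grad f (c *\<^sub>R x)"
proof (rule grad_eqI)
  have "((\<lambda>x. c *\<^sub>R x) has_derivative (\<lambda>h. c *\<^sub>R h)) (at x)"
    by (auto intro!: derivative_eq_intros)
  from has_derivative_compose[OF this smooth_on_has_derivative[OF assms]]
  show "((\<lambda>x. f (c *\<^sub>R x)) has_derivative (\<lambda>h. (c *\<^sub>R grad f (c *\<^sub>R x)) \<bullet> h)) (at x)" by simp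
qed

text \<open>Radial functions are written in the variable \<open>x \<bullet> x\<close> instead of the
  norm, which keeps them smooth at the origin; the gradient of that variable is
  \<open>2 x\<close>.\<close>

lemma has_derivative_radial:
  assumes "(\<alpha> has_real_derivative d) (at (x \<bullet> x))"
  shows "((\<lambda>x. \<alpha> (x \<bullet> x)) has_derivative (\<lambda>h. ((2 * d) *\<^sub>R x) \<bullet> h)) (at x)"
proof -
  have 1: "((\<lambda>x. x \<bullet> x) has_derivative (\<lambda>h. 2 * (x \<bullet> h))) (at x)"
    by (auto intro!: derivative_eq_intros simp: inner_commute)
  have "(\<alpha> has_derivative (\<lambda>h. d * h)) (at (x \<bullet> x))"
    using assms by (simp add: has_field_derivative_def)
  from has_derivative_compose[OF 1 this] show ?thesis
    by (rule has_derivative_eq_rhs) (auto simp: inner_commute)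
qed

lemma grad_radial:
  "(\<alpha> has_real_derivative d) (at (x \<bullet> x)) \<Longrightarrow> grad (\<lambda>x. \<alpha> (x \<bullet> x)) x = (2 * d) *\<^sub>R x"
  by (intro grad_eqI has_derivative_radial)

subsection \<open>Test functions\<close>

text \<open>\<open>test_function\<close> asks for smoothness on the whole space. The open sets
  \<open>U\<close> and \<open>- K\<close> cover it, and on \<open>- K\<close> the function is 0, so
  smoothness on the neighbourhood \<open>U\<close> of \<open>K\<close> suffices.\<close>

lemma test_functionI:
  assumes "open U" "smooth_on U f" "compact K" "K \<subseteq> U" "K \<subseteq> \<Omega>" "\<And>x. x \<notin> K \<Longrightarrow> f x = 0"
  shows "test_function \<Omega> f"
proof -
  have "smooth_on (- K) (\<lambda>x. 0)"
    using \<open>compact K\<close> by (simp add: compact_imp_closed open_Compl)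
  then have "smooth_on (- K) f"
    by (rule smooth_on_cong[rotated]) (use assms in \<open>auto simp: compact_imp_closed open_Compl\<close>)
  then have "smooth_on (U \<union> - K) f"
    using assms by (intro smooth_on_Un) (auto simp: compact_imp_closed open_Compl)
  moreover have "U \<union> - K = UNIV" using assms(4) by auto
  ultimately show ?thesis
    using assms unfolding test_function_def by auto
qed

lemma test_function_smooth_mult:
  assumes "test_function \<Omega> \<phi>" "open U" "\<Omega> \<subseteq> U" "smooth_on U a"
  shows "test_function \<Omega> (\<lambda>x. a x * \<phi> x)"
proof -
  obtain K where K: "compact K" "K \<subseteq> \<Omega>" "\<forall>x. x \<notin> K \<longrightarrow> \<phi> x = 0" and \<phi>: "smooth_on UNIV \<phi>"
    using assms(1) unfolding test_function_def by auto
  show ?thesis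
    by (rule test_functionI[where K = K and U = U])
       (use K assms smooth_on_subset[OF \<phi>, of U] in \<open>auto intro!: smooth_on_mult\<close>)
qed

lemma test_function_smooth: "test_function \<Omega> \<phi> \<Longrightarrow> smooth_on UNIV \<phi>"
  by (simp add: test_function_def)

lemma test_function_cmult: "test_function \<Omega> \<phi> \<Longrightarrow> test_function \<Omega> (\<lambda>x. c * \<phi> x)"
  by (rule test_function_smooth_mult[where U = UNIV]) auto

lemma test_function_add: 
  assumes "test_function \<Omega> \<phi>" "test_function \<Omega> \<psi>"
  shows "test_function \<Omega> (\<lambda>x. \<phi> x + \<psi> x)"
proof -
  obtain K where K: "compact K" "K \<subseteq> \<Omega>" "\<forall>x. x \<notin> K \<longrightarrow> \<phi> x = 0"
    using assms(1) unfolding test_function_def by auto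
  obtain L where L: "compact L" "L \<subseteq> \<Omega>" "\<forall>x. x \<notin> L \<longrightarrow> \<psi> x = 0"
    using assms(2) unfolding test_function_def by auto
  show ?thesis
    by (rule test_functionI[where K = "K \<union> L" and U = UNIV])
       (use K L smooth_on_add[OF open_UNIV assms[THEN test_function_smooth]] in auto)
qed

lemma test_function_diff: 
  "test_function \<Omega> \<phi> \<Longrightarrow> test_function \<Omega> \<psi> \<Longrightarrow> test_function \<Omega> (\<lambda>x. \<phi> x - \<psi> x)"
  using test_function_add[of \<Omega> \<phi> "\<lambda>x. (-1) * \<psi> x"] test_function_cmult[of \<Omega> \<psi> "-1"] by simp

lemma grad_zero_outside:
  assumes "closed K" "\<forall>x. x \<notin> K \<longrightarrow> \<phi> x = 0" "x \<notin> K"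
  shows "grad \<phi> x = 0"
proof (rule grad_eqI)
  have "((\<lambda>x. 0) has_derivative (\<lambda>h. 0 \<bullet> h)) (at x)" by simp
  then show "(\<phi> has_derivative (\<lambda>h. 0 \<bullet> h)) (at x)"
    by (rule has_derivative_transform_within_open[OF _ open_Compl[OF assms(1)]]) (use assms in auto)
qed

subsection \<open>The function \<open>exp (- 1 / t)\<close>\<close>

text \<open>With \<open>y = 1 / t\<close> the derivative of \<open>p(y) exp(-y)\<close> in
  \<open>t\<close> is \<open>y^2 (p(y) - p'(y)) exp(-y)\<close>. Keeping the polynomial as a
  parameter makes the family closed under differentiation, as \<open>Ck_on_compose\<close>
  requires.\<close>

definition exp_recip :: "real poly \<Rightarrow> real \<Rightarrow> real" where
  "exp_recip p t = (if t \<le> 0 then 0 else poly p (1 / t) * exp (- (1 / t)))"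

abbreviation ramp :: "real \<Rightarrow> real" where
  "ramp \<equiv> exp_recip 1"

lemma poly_exp_tendsto_0: "((\<lambda>y::real. poly p y * exp (- y)) \<longlongrightarrow> 0) at_top"
proof -
  have "((\<lambda>y::real. \<Sum>i\<le>degree p. coeff p i * (y ^ i / exp y)) \<longlongrightarrow> (\<Sum>i\<le>degree p. coeff p i * 0)) at_top"
    by (intro tendsto_intros tendsto_power_div_exp_0)
  then show ?thesis
    by (simp add: poly_altdef exp_minus sum_distrib_right divide_inverse mult.assoc)
qed

lemma exp_recip_has_derivative:
  "(exp_recip p has_real_derivative exp_recip ([:0, 0, 1:] * (p - pderiv p)) t) (at t)"
proof (cases t "0 :: real" rule: linorder_cases)
  case less
  have "((\<lambda>t. 0) has_real_derivative 0) (at t)" by simp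
  then have "(exp_recip p has_real_derivative 0) (at t)"
    by (rule has_field_derivative_transform_within_open[where S = "{..<0}"])
       (use less in \<open>auto simp: exp_recip_def\<close>)
  then show ?thesis using less by (simp add: exp_recip_def)
next
  case greater
  have "((\<lambda>t. poly p (1 / t) * exp (- (1 / t))) has_real_derivative
      exp_recip ([:0, 0, 1:] * (p - pderiv p)) t) (at t)"
    using greater
    by (auto intro!: derivative_eq_intros DERIV_chain2[OF poly_DERIV] simp: exp_recip_def field_simps power2_eq_square)
  then show ?thesis
    by (rule has_field_derivative_transform_within_open[where S = "{0<..}"])
       (use greater in \<open>auto simp: exp_recip_def\<close>)
next
  case equal
  have "((\<lambda>h. exp_recip p h / h) \<longlongrightarrow> 0) (at_right 0)"
  proof -
    \<comment> \<open>Division by \<open>h\<close> multiplies the polynomial by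
      \<open>y = 1 / h\<close>, so the right-hand quotient at 0 is the limit of
      \<open>poly_exp_tendsto_0\<close> for a new polynomial.\<close>
    have "((\<lambda>h. poly [:0, 1:] (inverse h) * poly p (inverse h) * exp (- inverse h)) \<longlongrightarrow> 0) (at_right (0::real))"
      using filterlim_compose[OF poly_exp_tendsto_0[of "[:0, 1:] * p"] filterlim_inverse_at_top_right]
      by (simp add: mult.assoc)
    then show ?thesis
      by (rule Lim_transform_eventually)
         (auto simp: eventually_at_filter exp_recip_def field_simps)
  qed
  moreover have "((\<lambda>h. exp_recip p h / h) \<longlongrightarrow> 0) (at_left 0)"
    by (rule Lim_transform_eventually[OF tendsto_const])
       (auto simp: eventually_at_filter exp_recip_def)
  ultimately have "((\<lambda>h. exp_recip p h / h) \<longlongrightarrow> 0) (at 0)"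
    by (rule filterlim_split_at[rotated])
  moreover have 0: "exp_recip q 0 = 0" for q
    by (simp add: exp_recip_def)
  ultimately have "(exp_recip p has_real_derivative 0) (at 0)"
    by (simp add: has_field_derivative_iff)
  then show ?thesis
    by (simp add: equal 0)
qed

lemma smooth_on_exp_recip: "open U \<Longrightarrow> smooth_on U g \<Longrightarrow> smooth_on U (\<lambda>x. exp_recip p (g x))"
  unfolding smooth_on_def
proof
  fix k assume U: "open U" and g: "\<forall>k. Ck_on k U g"
  show "Ck_on k U (\<lambda>x. exp_recip p (g x))"
    by (rule Ck_on_compose[where f = "exp_recip p" and S = "range exp_recip" and T = UNIV])
       (use U g exp_recip_has_derivative in blast)+
qed

lemma ramp_bounds: "0 \<le> ramp t" "ramp t \<le> 1"
  by (auto simp: exp_recip_def)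

lemma ramp_eq_0: "t \<le> 0 \<Longrightarrow> ramp t = 0"
  by (simp add: exp_recip_def)

lemma ramp_tendsto_1: "filterlim g at_top F \<Longrightarrow> ((\<lambda>x. ramp (g x)) \<longlongrightarrow> 1) F"
proof -
  assume g: "filterlim g at_top F"
  have "((\<lambda>t::real. exp (- inverse t)) \<longlongrightarrow> exp (- 0)) at_top"
    by (intro tendsto_intros tendsto_inverse_0_at_top filterlim_ident)
  then have "(ramp \<longlongrightarrow> 1) at_top"
    by (auto elim!: Lim_transform_eventually intro!: eventually_mono[OF eventually_gt_at_top[of 0]]
        simp: exp_recip_def field_simps)
  from filterlim_compose[OF this g] show ?thesis .
qed

text \<open>The factor \<open>n\<close> steepens the ramps: each tends to 1 inside the open box and
  is 0 outside, so the bumps converge pointwise to the indicator of \<open>box l u\<close> while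
  staying between 0 and 1. This serves dominated convergence in
  \<open>fundamental_lemma\<close>.\<close>

definition box_bump :: "'a::euclidean_space \<Rightarrow> 'a \<Rightarrow> nat \<Rightarrow> 'a \<Rightarrow> real" where
  "box_bump l u n x = (\<Prod>b\<in>Basis. ramp (real n * (x \<bullet> b - l \<bullet> b)) * ramp (real n * (u \<bullet> b - x \<bullet> b)))"

lemma test_function_box_bump:
  assumes "cbox l u \<subseteq> \<Omega>"
  shows "test_function \<Omega> (box_bump l u n)"
proof (rule test_functionI[where K = "cbox l u" and U = UNIV])
  show "smooth_on UNIV (box_bump l u n)"
    unfolding box_bump_def[abs_def]
    by (intro smooth_on_prod smooth_on_mult smooth_on_exp_recip smooth_on_diff smooth_on_const
        smooth_on_linear bounded_linear_inner_left) auto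
  show "box_bump l u n x = 0" if x: "x \<notin> cbox l u" for x
  proof -
    obtain b where b: "b \<in> Basis" "x \<bullet> b - l \<bullet> b \<le> 0 \<or> u \<bullet> b - x \<bullet> b \<le> 0"
      using x by (force simp: mem_box)
    then have "ramp (real n * (x \<bullet> b - l \<bullet> b)) * ramp (real n * (u \<bullet> b - x \<bullet> b)) = 0"
      by (auto intro!: ramp_eq_0 simp: mult_nonneg_nonpos)
    then show ?thesis
      unfolding box_bump_def using b(1) by (intro prod_zero) auto
  qed
qed (use assms in auto)

lemma box_bump_bounds: "0 \<le> box_bump l u n x" "box_bump l u n x \<le> 1"
  unfolding box_bump_def
  by (auto intro!: prod_nonneg prod_le_1 mult_nonneg_nonneg ramp_bounds mult_le_one)

lemma box_bump_tendsto: "(\<lambda>n. box_bump l u n x) \<longlonglongrightarrow> indicator (box l u) x"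
proof (cases "x \<in> box l u")
  case True
  have lim: "filterlim (\<lambda>n. real n * c) at_top sequentially" if "c > 0" for c
    using that by (intro filterlim_at_top_mult_tendsto_pos[OF tendsto_const] filterlim_real_sequentially) auto
  have "(\<lambda>n. box_bump l u n x) \<longlonglongrightarrow> (\<Prod>b\<in>(Basis::'a set). 1 * 1)"
    unfolding box_bump_def
    by (intro tendsto_prod tendsto_mult ramp_tendsto_1 lim) (use True in \<open>auto simp: mem_box\<close>)
  then show ?thesis using True by simp
next
  case False
  then obtain b where b: "b \<in> Basis" "x \<bullet> b - l \<bullet> b \<le> 0 \<or> u \<bullet> b - x \<bullet> b \<le> 0"
    by (force simp: mem_box)
  have "box_bump l u n x = 0" for n
  proof -
    have "ramp (real n * (x \<bullet> b - l \<bullet> b)) * ramp (real n * (u \<bullet> b - x \<bullet> b)) = 0"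
      using b by (auto intro!: ramp_eq_0 simp: mult_nonneg_nonpos)
    then show ?thesis
      unfolding box_bump_def using b(1) by (intro prod_zero) auto
  qed
  then show ?thesis using False by simp
qed

section \<open>Square integrable functions\<close>

lemma L2_D: "f \<in> L2 M \<Longrightarrow> f \<in> borel_measurable M" "f \<in> L2 M \<Longrightarrow> integrable M (\<lambda>x. (f x)\<^sup>2)"
  by (auto simp: L2_def)

lemma L2_I: "f \<in> borel_measurable M \<Longrightarrow> integrable M (\<lambda>x. (f x)\<^sup>2) \<Longrightarrow> f \<in> L2 M"
  by (auto simp: L2_def)

lemma L2_mult_integrable:
  assumes "f \<in> L2 M" "g \<in> L2 M"
  shows "integrable M (\<lambda>x. f x * g x)"
proof (rule Bochner_Integration.integrable_bound)
  show "integrable M (\<lambda>x. (f x)\<^sup>2 + (g x)\<^sup>2)"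
    using assms by (intro Bochner_Integration.integrable_add L2_D)
  show "(\<lambda>x. f x * g x) \<in> borel_measurable M"
    using assms by (intro borel_measurable_times L2_D)
  have "\<bar>a * b\<bar> \<le> a\<^sup>2 + b\<^sup>2" for a b :: real
    using sum_squares_bound[of a b] sum_squares_bound[of a "-b"] by (auto simp: abs_if)
  then show "AE x in M. norm (f x * g x) \<le> norm ((f x)\<^sup>2 + (g x)\<^sup>2)"
    by auto
qed

lemma L2_bounded_mult:
  assumes "f \<in> L2 M" "a \<in> borel_measurable M" "\<And>x. x \<in> space M \<Longrightarrow> \<bar>a x\<bar> \<le> C"
  shows "(\<lambda>x. a x * f x) \<in> L2 M"
proof (rule L2_I)
  show m: "(\<lambda>x. a x * f x) \<in> borel_measurable M"
    by (intro borel_measurable_times L2_D(1)[OF assms(1)] assms(2))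
  show "integrable M (\<lambda>x. (a x * f x)\<^sup>2)"
  proof (rule Bochner_Integration.integrable_bound)
    show "integrable M (\<lambda>x. C\<^sup>2 * (f x)\<^sup>2)"
      using assms by (intro integrable_mult_right L2_D)
    show "AE x in M. norm ((a x * f x)\<^sup>2) \<le> norm (C\<^sup>2 * (f x)\<^sup>2)"
      using order_trans[OF assms(3) abs_ge_self]
      by (intro AE_I2) (auto simp: power_mult_distrib abs_le_square_iff[symmetric] intro!: mult_right_mono)
  qed (use m in measurable)
qed

lemma L2_cmult: "f \<in> L2 M \<Longrightarrow> (\<lambda>x. c * f x) \<in> L2 M"
  by (rule L2_bounded_mult[where C = "\<bar>c\<bar>"]) auto

lemma L2_add:
  assumes "f \<in> L2 M" "g \<in> L2 M"
  shows "(\<lambda>x. f x + g x) \<in> L2 M"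
proof (rule L2_I)
  show "(\<lambda>x. f x + g x) \<in> borel_measurable M"
    using assms by (intro borel_measurable_add L2_D)
  have "integrable M (\<lambda>x. (f x)\<^sup>2 + (g x)\<^sup>2 + 2 * (f x * g x))"
    using assms by (intro Bochner_Integration.integrable_add integrable_mult_right L2_D L2_mult_integrable)
  then show "integrable M (\<lambda>x. (f x + g x)\<^sup>2)"
    by (simp add: power2_sum algebra_simps)
qed

lemma L2_diff: "f \<in> L2 M \<Longrightarrow> g \<in> L2 M \<Longrightarrow> (\<lambda>x. f x - g x) \<in> L2 M"
  using L2_add[of f M "\<lambda>x. (-1) * g x"] L2_cmult[of g M "-1"] by simp

lemma L2_abs: "f \<in> L2 M \<Longrightarrow> (\<lambda>x. \<bar>f x\<bar>) \<in> L2 M"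
  by (auto simp: L2_def)

lemma L2_zero [simp]: "(\<lambda>x. 0) \<in> L2 M"
  by (auto simp: L2_def)

lemma L2_sum: "finite I \<Longrightarrow> (\<And>i. i \<in> I \<Longrightarrow> f i \<in> L2 M) \<Longrightarrow> (\<lambda>x. \<Sum>i\<in>I. f i x) \<in> L2 M"
  by (induction I rule: finite_induct) (auto intro: L2_add)

lemma L2_bounded:
  assumes "finite_measure M" "f \<in> borel_measurable M" "\<And>x. x \<in> space M \<Longrightarrow> \<bar>f x\<bar> \<le> C"
  shows "f \<in> L2 M"
proof -
  have "(\<lambda>x. 1) \<in> L2 M"
    using assms(1) by (auto simp: L2_def finite_measure.integrable_const)
  from L2_bounded_mult[OF this assms(2,3)] show ?thesis by simp
qed

lemma L2_norm_nonneg [simp]: "0 \<le> L2_norm M f"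
  by (simp add: L2_norm_def)

lemma L2_norm_square: "(L2_norm M f)\<^sup>2 = (\<integral>x. (f x)\<^sup>2 \<partial>M)"
  by (simp add: L2_norm_def)

lemma L2_norm_cong_AE:
  assumes "f \<in> borel_measurable M" "g \<in> borel_measurable M" "AE x in M. f x = g x"
  shows "L2_norm M f = L2_norm M g"
  unfolding L2_norm_def using assms by (intro arg_cong[where f = sqrt] integral_cong_AE) auto

lemma L2_norm_commute: "L2_norm M (\<lambda>x. f x - g x) = L2_norm M (\<lambda>x. g x - f x)"
  by (simp add: L2_norm_def power2_commute)

lemma L2_norm_cmult: "L2_norm M (\<lambda>x. c * f x) = \<bar>c\<bar> * L2_norm M f"
  by (simp add: L2_norm_def power_mult_distrib real_sqrt_mult)

lemma L2_norm_mono: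
  assumes "f \<in> borel_measurable M" "g \<in> L2 M" "AE x in M. \<bar>f x\<bar> \<le> \<bar>g x\<bar>"
  shows "L2_norm M f \<le> L2_norm M g"
proof -
  have le: "AE x in M. (f x)\<^sup>2 \<le> (g x)\<^sup>2"
    using assms(3) by (simp add: abs_le_square_iff)
  have "integrable M (\<lambda>x. (f x)\<^sup>2)"
    by (rule Bochner_Integration.integrable_bound[OF L2_D(2)[OF assms(2)]])
       (use assms(1) le in auto)
  then show ?thesis
    unfolding L2_norm_def using le L2_D(2)[OF assms(2)]
    by (intro real_sqrt_le_mono integral_mono_AE) auto
qed

lemma L2_Cauchy_Schwarz:
  assumes f: "f \<in> L2 M" and g: "g \<in> L2 M"
  shows "\<bar>\<integral>x. f x * g x \<partial>M\<bar> \<le> L2_norm M f * L2_norm M g"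
proof -
  define A where "A = (\<integral>x. (f x)\<^sup>2 \<partial>M)"
  define B where "B = (\<integral>x. f x * g x \<partial>M)"
  define C where "C = (\<integral>x. (g x)\<^sup>2 \<partial>M)"
  have *: "0 \<le> A - 2 * t * B + t\<^sup>2 * C" for t
  proof -
    have "0 \<le> (\<integral>x. (f x - t * g x)\<^sup>2 \<partial>M)" by simp
    also have "\<dots> = (\<integral>x. (f x)\<^sup>2 - (2 * t) * (f x * g x) + t\<^sup>2 * (g x)\<^sup>2 \<partial>M)"
      by (intro Bochner_Integration.integral_cong) (auto simp: power2_eq_square algebra_simps)
    also have "\<dots> = A - 2 * t * B + t\<^sup>2 * C"
      using assms by (simp add: A_def B_def C_def L2_D L2_mult_integrable)
    finally show ?thesis .
  qed
  have C0: "0 \<le> C" and A0: "0 \<le> A" by (simp_all add: C_def A_def)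
  have "B\<^sup>2 \<le> A * C"
  proof (cases "C = 0")
    case True
    have "B = 0"
    proof (rule ccontr)
      assume "B \<noteq> 0"
      \<comment> \<open>With \<open>C = 0\<close> the quadratic is linear in \<open>t\<close>, and
        this \<open>t\<close> gives it the value -1.\<close>
      then show False using *[of "(A + 1) / (2 * B)"] True by (simp add: field_simps)
    qed
    then show ?thesis using True by simp
  next
    case False
    then show ?thesis using *[of "B / C"] C0 by (simp add: field_simps power2_eq_square)
  qed
  then have "sqrt (B\<^sup>2) \<le> sqrt (A * C)" by (rule real_sqrt_le_mono)
  then show ?thesis
    by (simp add: real_sqrt_mult A_def B_def C_def L2_norm_def)
qed

lemma L2_norm_triangle:
  assumes f: "f \<in> L2 M" and g: "g \<in> L2 M"
  shows "L2_norm M (\<lambda>x. f x + g x) \<le> L2_norm M f + L2_norm M g"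
proof -
  have "(L2_norm M (\<lambda>x. f x + g x))\<^sup>2 = (\<integral>x. (f x)\<^sup>2 + 2 * (f x * g x) + (g x)\<^sup>2 \<partial>M)"
    unfolding L2_norm_square
    by (intro Bochner_Integration.integral_cong) (auto simp: power2_eq_square algebra_simps)
  also have "\<dots> = (L2_norm M f)\<^sup>2 + 2 * (\<integral>x. f x * g x \<partial>M) + (L2_norm M g)\<^sup>2"
    using assms by (simp add: L2_D L2_mult_integrable L2_norm_square)
  also have "\<dots> \<le> (L2_norm M f)\<^sup>2 + 2 * (L2_norm M f * L2_norm M g) + (L2_norm M g)\<^sup>2"
    using L2_Cauchy_Schwarz[OF assms] by simp
  also have "\<dots> = (L2_norm M f + L2_norm M g)\<^sup>2"
    by (simp add: power2_eq_square algebra_simps)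
  finally show ?thesis
    by (rule power2_le_imp_le) simp
qed

lemma L2_norm_triangle_diff:
  assumes "f \<in> L2 M" "g \<in> L2 M" "h \<in> L2 M"
  shows "L2_norm M (\<lambda>x. f x - h x) \<le> L2_norm M (\<lambda>x. f x - g x) + L2_norm M (\<lambda>x. g x - h x)"
  using L2_norm_triangle[of "\<lambda>x. f x - g x" M "\<lambda>x. g x - h x"] assms by (simp add: L2_diff)

lemma L2_norm_bounded_mult:
  assumes "f \<in> L2 M" "a \<in> borel_measurable M" "\<And>x. x \<in> space M \<Longrightarrow> \<bar>a x\<bar> \<le> C" "0 \<le> C"
  shows "L2_norm M (\<lambda>x. a x * f x) \<le> C * L2_norm M f"
proof -
  have "L2_norm M (\<lambda>x. a x * f x) \<le> L2_norm M (\<lambda>x. C * f x)"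
    using assms by (intro L2_norm_mono L2_cmult borel_measurable_times AE_I2)
      (auto simp: abs_mult L2_D intro!: mult_right_mono)
  then show ?thesis using assms by (simp add: L2_norm_cmult)
qed

lemma L2_norm_eq_0_AE:
  assumes "f \<in> L2 M" "L2_norm M f = 0"
  shows "AE x in M. f x = 0"
  using assms integral_nonneg_eq_0_iff_AE[OF L2_D(2)[OF assms(1)]] by (simp add: L2_norm_def)

text \<open>Membership is part of the notion because \<open>L2_norm\<close> is built on the Bochner
  integral, which is 0 for functions that are not integrable: a small norm alone would say
  nothing.\<close>

definition L2_tendsto :: "'a measure \<Rightarrow> (nat \<Rightarrow> 'a \<Rightarrow> real) \<Rightarrow> ('a \<Rightarrow> real) \<Rightarrow> bool" where
  "L2_tendsto M F f \<longleftrightarrow> (\<forall>n. F n \<in> L2 M) \<and> f \<in> L2 M \<and> (\<lambda>n. L2_norm M (\<lambda>x. F n x - f x)) \<longlonglongrightarrow> 0"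

lemma L2_tendstoD:
  assumes "L2_tendsto M F f"
  shows "F n \<in> L2 M" "f \<in> L2 M" "(\<lambda>n. L2_norm M (\<lambda>x. F n x - f x)) \<longlonglongrightarrow> 0"
  using assms by (auto simp: L2_tendsto_def)

lemma L2_tendsto_boundI:
  assumes "\<And>n. F n \<in> L2 M" "f \<in> L2 M" "\<And>n. L2_norm M (\<lambda>x. F n x - f x) \<le> c n" "c \<longlonglongrightarrow> 0"
  shows "L2_tendsto M F f"
  unfolding L2_tendsto_def
proof (intro conjI allI assms(1,2))
  show "(\<lambda>n. L2_norm M (\<lambda>x. F n x - f x)) \<longlonglongrightarrow> 0"
    by (rule tendsto_sandwich[OF _ _ tendsto_const assms(4)]) (use assms(3) in auto)
qed

lemma L2_tendsto_const: "f \<in> L2 M \<Longrightarrow> L2_tendsto M (\<lambda>n. f) f"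
  by (simp add: L2_tendsto_def L2_norm_def)

lemma L2_tendsto_add:
  assumes "L2_tendsto M F f" "L2_tendsto M G g"
  shows "L2_tendsto M (\<lambda>n x. F n x + G n x) (\<lambda>x. f x + g x)"
proof (rule L2_tendsto_boundI)
  note D = L2_tendstoD[OF assms(1)] L2_tendstoD[OF assms(2)]
  show "(\<lambda>n. L2_norm M (\<lambda>x. F n x - f x) + L2_norm M (\<lambda>x. G n x - g x)) \<longlonglongrightarrow> 0"
    using tendsto_add[OF D(3,6)] by simp
  show "L2_norm M (\<lambda>x. F n x + G n x - (f x + g x)) \<le> L2_norm M (\<lambda>x. F n x - f x) + L2_norm M (\<lambda>x. G n x - g x)" for n
    using L2_norm_triangle[of "\<lambda>x. F n x - f x" M "\<lambda>x. G n x - g x"] D(1,2,4,5) by (simp add: L2_diff algebra_simps)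
qed (use assms in \<open>auto intro: L2_add dest: L2_tendstoD\<close>)

lemma L2_tendsto_bounded_mult:
  assumes "L2_tendsto M F f" "a \<in> borel_measurable M" "\<And>x. x \<in> space M \<Longrightarrow> \<bar>a x\<bar> \<le> C"
  shows "L2_tendsto M (\<lambda>n x. a x * F n x) (\<lambda>x. a x * f x)"
proof (rule L2_tendsto_boundI)
  note D = L2_tendstoD[OF assms(1)]
  have C: "\<bar>a x\<bar> \<le> \<bar>C\<bar>" if "x \<in> space M" for x using assms(3)[OF that] by linarith
  show "(\<lambda>n. \<bar>C\<bar> * L2_norm M (\<lambda>x. F n x - f x)) \<longlonglongrightarrow> 0"
    using tendsto_mult_right_zero[OF D(3)] by simp
  show "L2_norm M (\<lambda>x. a x * F n x - a x * f x) \<le> \<bar>C\<bar> * L2_norm M (\<lambda>x. F n x - f x)" for n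
    using L2_norm_bounded_mult[of "\<lambda>x. F n x - f x" M a "\<bar>C\<bar>"] D(1,2) assms(2) C
    by (simp add: L2_diff right_diff_distrib)
qed (use assms in \<open>auto intro!: L2_bounded_mult dest: L2_tendstoD\<close>)

lemma L2_tendsto_cmult: "L2_tendsto M F f \<Longrightarrow> L2_tendsto M (\<lambda>n x. c * F n x) (\<lambda>x. c * f x)"
  by (rule L2_tendsto_bounded_mult[where C = "\<bar>c\<bar>"]) auto

lemma L2_tendsto_diff:
  assumes "L2_tendsto M F f" "L2_tendsto M G g"
  shows "L2_tendsto M (\<lambda>n x. F n x - G n x) (\<lambda>x. f x - g x)"
  using L2_tendsto_add[OF assms(1) L2_tendsto_cmult[OF assms(2), of "-1"]] by simp

lemma L2_tendsto_sum:
  "finite I \<Longrightarrow> (\<And>i. i \<in> I \<Longrightarrow> L2_tendsto M (\<lambda>n. F n i) (f i)) \<Longrightarrow>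
   L2_tendsto M (\<lambda>n x. \<Sum>i\<in>I. F n i x) (\<lambda>x. \<Sum>i\<in>I. f i x)"
  by (induction I rule: finite_induct) (auto intro: L2_tendsto_add L2_tendsto_const)

lemma L2_tendsto_norm:
  assumes "L2_tendsto M F f"
  shows "(\<lambda>n. L2_norm M (F n)) \<longlonglongrightarrow> L2_norm M f"
proof (rule Lim_null[THEN iffD2], rule tendsto_rabs_zero_cancel, rule tendsto_sandwich[OF _ _ tendsto_const L2_tendstoD(3)[OF assms]])
  note D = L2_tendstoD[OF assms]
  have "\<bar>L2_norm M (F n) - L2_norm M f\<bar> \<le> L2_norm M (\<lambda>x. F n x - f x)" for n
    using L2_norm_triangle[of "\<lambda>x. F n x - f x" M f] L2_norm_triangle[of "\<lambda>x. f x - F n x" M "F n"] D(1,2)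
    by (simp add: L2_diff L2_norm_commute[of M f])
  then show "\<forall>\<^sub>F n in sequentially. \<bar>L2_norm M (F n) - L2_norm M f\<bar> \<le> L2_norm M (\<lambda>x. F n x - f x)"
    by simp
qed auto

lemma L2_tendsto_inner:
  assumes "L2_tendsto M F f" "g \<in> L2 M"
  shows "(\<lambda>n. \<integral>x. F n x * g x \<partial>M) \<longlonglongrightarrow> (\<integral>x. f x * g x \<partial>M)"
proof (rule Lim_null[THEN iffD2], rule tendsto_rabs_zero_cancel, rule tendsto_sandwich[OF _ _ tendsto_const])
  note D = L2_tendstoD[OF assms(1)]
  show "(\<lambda>n. L2_norm M (\<lambda>x. F n x - f x) * L2_norm M g) \<longlonglongrightarrow> 0"
    using tendsto_mult_left_zero[OF D(3)] .
  have "\<bar>(\<integral>x. F n x * g x \<partial>M) - (\<integral>x. f x * g x \<partial>M)\<bar> \<le> L2_norm M (\<lambda>x. F n x - f x) * L2_norm M g" for n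
  proof -
    have "(\<integral>x. F n x * g x \<partial>M) - (\<integral>x. f x * g x \<partial>M) = (\<integral>x. (F n x - f x) * g x \<partial>M)"
      using D(1,2) assms(2) by (simp add: left_diff_distrib L2_mult_integrable)
    then show ?thesis
      using L2_Cauchy_Schwarz[OF L2_diff[OF D(1,2)] assms(2)] by simp
  qed
  then show "\<forall>\<^sub>F n in sequentially. \<bar>(\<integral>x. F n x * g x \<partial>M) - (\<integral>x. f x * g x \<partial>M)\<bar> \<le> L2_norm M (\<lambda>x. F n x - f x) * L2_norm M g"
    by simp
qed auto

lemma L2_tendsto_unique_AE:
  assumes "L2_tendsto M F f" "L2_tendsto M F g"
  shows "AE x in M. f x = g x"
proof -
  note f = L2_tendstoD[OF assms(1)] and g = L2_tendstoD[OF assms(2)]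
  have "L2_tendsto M (\<lambda>n x. F n x - F n x) (\<lambda>x. f x - g x)"
    by (rule L2_tendsto_diff[OF assms])
  from L2_tendsto_norm[OF this] have "(\<lambda>n. 0) \<longlonglongrightarrow> L2_norm M (\<lambda>x. f x - g x)"
    by (simp add: L2_norm_def)
  from LIMSEQ_unique[OF this tendsto_const] have "L2_norm M (\<lambda>x. f x - g x) = 0" .
  from L2_norm_eq_0_AE[OF L2_diff[OF f(2) g(2)] this] show ?thesis by simp
qed

text \<open>The sums \<open>S N\<close> of the absolute increments have L2 norm at most 2 by the
  geometric series, so by monotone convergence their squares have an integrable supremum. Almost
  everywhere the increments are thus absolutely summable and the telescoping series
  converges.\<close>

lemma L2_AE_convergent_subseq:
  assumes F: "\<And>n. F n \<in> L2 M" and d: "\<And>k. L2_norm M (\<lambda>x. F (Suc k) x - F k x) \<le> (1/2) ^ k"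
  shows "AE x in M. convergent (\<lambda>n. F n x)"
proof -
  define S where "S N x = (\<Sum>k<N. \<bar>F (Suc k) x - F k x\<bar>)" for N x
  have S: "S N \<in> L2 M" for N
    unfolding S_def[abs_def] by (intro L2_sum L2_abs L2_diff F) auto
  have "L2_norm M (S N) \<le> (\<Sum>k<N. (1/2) ^ k)" for N
  proof (induction N)
    case 0
    then show ?case by (simp add: S_def[abs_def] L2_norm_def)
  next
    case (Suc N)
    have "L2_norm M (S (Suc N)) \<le> L2_norm M (S N) + L2_norm M (\<lambda>x. \<bar>F (Suc N) x - F N x\<bar>)"
      using L2_norm_triangle[OF S[of N] L2_abs[OF L2_diff[OF F[of "Suc N"] F[of N]]]]
      by (simp add: S_def[abs_def])
    also have "L2_norm M (\<lambda>x. \<bar>F (Suc N) x - F N x\<bar>) = L2_norm M (\<lambda>x. F (Suc N) x - F N x)"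
      by (simp add: L2_norm_def)
    finally show ?case using Suc d[of N] by simp
  qed
  also have "(\<Sum>k<N. (1/2) ^ k) \<le> (2::real)" for N
    by (simp add: geometric_sum)
  finally have S2: "L2_norm M (S N) \<le> 2" for N .
  have int: "(\<integral>\<^sup>+x. ennreal ((S N x)\<^sup>2) \<partial>M) \<le> ennreal 4" for N
  proof -
    have "(\<integral>\<^sup>+x. ennreal ((S N x)\<^sup>2) \<partial>M) = ennreal (\<integral>x. (S N x)\<^sup>2 \<partial>M)"
      using S by (intro nn_integral_eq_integral L2_D) auto
    also have "(\<integral>x. (S N x)\<^sup>2 \<partial>M) \<le> 2\<^sup>2"
      unfolding L2_norm_square[symmetric] by (intro power_mono S2) auto
    finally show ?thesis by (simp add: ennreal_leI)
  qed
  have S_meas: "S N \<in> borel_measurable M" for N using S by (rule L2_D)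
  have S_mono: "S m x \<le> S n x" if "m \<le> n" for m n x
    unfolding S_def using that by (intro sum_mono2) auto
  have S_nonneg: "0 \<le> S n x" for n x
    unfolding S_def by (intro sum_nonneg) auto
  have "(\<integral>\<^sup>+x. (SUP N. ennreal ((S N x)\<^sup>2)) \<partial>M) = (SUP N. \<integral>\<^sup>+x. ennreal ((S N x)\<^sup>2) \<partial>M)"
    using S_meas S_mono S_nonneg
    by (intro nn_integral_monotone_convergence_SUP)
       (auto simp: incseq_def le_fun_def intro!: ennreal_leI power_mono)
  also have "\<dots> \<le> ennreal 4"
    by (intro SUP_least int)
  finally have "(\<integral>\<^sup>+x. (SUP N. ennreal ((S N x)\<^sup>2)) \<partial>M) \<noteq> \<infinity>"
    by (auto simp: top_unique)
  then have "AE x in M. (SUP N. ennreal ((S N x)\<^sup>2)) \<noteq> \<infinity>"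
    using S_meas by (intro nn_integral_PInf_AE) auto
  then show ?thesis
  proof eventually_elim
    case (elim x)
    then obtain c where c: "0 \<le> c" "(SUP N. ennreal ((S N x)\<^sup>2)) = ennreal c"
      by (cases "SUP N. ennreal ((S N x)\<^sup>2)") auto
    have "S N x \<le> sqrt c" for N
    proof -
      have "ennreal ((S N x)\<^sup>2) \<le> ennreal c"
        unfolding c(2)[symmetric] by (rule SUP_upper) auto
      then show ?thesis using c(1) by (intro real_le_rsqrt) (simp add: ennreal_le_iff)
    qed
    then have "summable (\<lambda>k. \<bar>F (Suc k) x - F k x\<bar>)"
      unfolding S_def by (intro summableI_nonneg_bounded[where x = "sqrt c"]) auto
    then have "summable (\<lambda>k. F (Suc k) x - F k x)"
      by (rule summable_rabs_cancel)
    then have "convergent (\<lambda>n. (\<Sum>k<n. F (Suc k) x - F k x))"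
      by (simp add: summable_iff_convergent)
    then have "convergent (\<lambda>n. F n x - F 0 x)"
      by (simp add: sum_lessThan_telescope[of "\<lambda>k. F k x"])
    then show ?case
      using convergent_add[OF _ convergent_const[of "F 0 x"]] by fastforce
  qed
qed

text \<open>Riesz-Fischer: a rapidly converging subsequence has a pointwise limit \<open>f\<close>,
  and Fatou's lemma along the subsequence turns the Cauchy bound into a bound for
  \<open>F n - f\<close>.\<close>

lemma L2_complete:
  assumes F: "\<And>n. F n \<in> L2 M"
    and Cauchy: "\<And>e. 0 < e \<Longrightarrow> \<exists>N. \<forall>m\<ge>N. \<forall>n\<ge>N. L2_norm M (\<lambda>x. F m x - F n x) < e"
  shows "\<exists>f. L2_tendsto M F f"
proof -
  have "\<exists>N. \<forall>m\<ge>N. \<forall>n\<ge>N. L2_norm M (\<lambda>x. F m x - F n x) < (1/2) ^ k" for k :: nat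
    by (rule Cauchy) simp
  then obtain N where N: "\<And>k m n. m \<ge> N k \<Longrightarrow> n \<ge> N k \<Longrightarrow> L2_norm M (\<lambda>x. F m x - F n x) < (1/2) ^ k"
    by metis
  \<comment> \<open>Partial sums of the thresholds: an index sequence with \<open>r j\<close> at
    least \<open>N k\<close> whenever \<open>j\<close> is at least \<open>k\<close>.\<close>
  define r where "r k = (\<Sum>i\<le>k. N i)" for k
  have r: "N k \<le> r j" if "k \<le> j" for k j
  proof -
    have "N k \<le> r k" unfolding r_def by (intro member_le_sum) auto
    also have "r k \<le> r j" unfolding r_def using that by (intro sum_mono2) auto
    finally show ?thesis .
  qed
  have conv: "AE x in M. convergent (\<lambda>k. F (r k) x)"
    by (rule L2_AE_convergent_subseq[of "\<lambda>k. F (r k)"]) (auto intro!: F less_imp_le[OF N] r)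
  define f where "f x = lim (\<lambda>k. F (r k) x)" for x
  have Fm: "F n \<in> borel_measurable M" for n using F by (rule L2_D)
  have fm: "f \<in> borel_measurable M"
    unfolding f_def[abs_def] using Fm by measurable
  have bound: "(\<integral>\<^sup>+x. ennreal ((F n x - f x)\<^sup>2) \<partial>M) \<le> ennreal (((1/2) ^ k)\<^sup>2)" if "n \<ge> N k" for n k
  proof -
    have "(\<integral>\<^sup>+x. ennreal ((F n x - f x)\<^sup>2) \<partial>M) = (\<integral>\<^sup>+x. liminf (\<lambda>j. ennreal ((F n x - F (r j) x)\<^sup>2)) \<partial>M)"
    proof (rule nn_integral_cong_AE, use conv in eventually_elim)
      case (elim x)
      then have "(\<lambda>j. F (r j) x) \<longlonglongrightarrow> f x"
        by (simp add: f_def convergent_LIMSEQ_iff)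
      then have "(\<lambda>j. ennreal ((F n x - F (r j) x)\<^sup>2)) \<longlonglongrightarrow> ennreal ((F n x - f x)\<^sup>2)"
        by (intro tendsto_intros tendsto_ennrealI)
      then show ?case
        using lim_imp_Liminf[OF sequentially_bot] by metis
    qed
    also have "\<dots> \<le> liminf (\<lambda>j. \<integral>\<^sup>+x. ennreal ((F n x - F (r j) x)\<^sup>2) \<partial>M)"
      using Fm by (intro nn_integral_liminf) auto
    also have "\<dots> \<le> ennreal (((1/2) ^ k)\<^sup>2)"
    proof (rule Liminf_le)
      show "\<forall>\<^sub>F j in sequentially. (\<integral>\<^sup>+x. ennreal ((F n x - F (r j) x)\<^sup>2) \<partial>M) \<le> ennreal (((1/2) ^ k)\<^sup>2)"
        using eventually_ge_at_top[of k]
      proof eventually_elim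
        case (elim j)
        have "(\<integral>\<^sup>+x. ennreal ((F n x - F (r j) x)\<^sup>2) \<partial>M) = ennreal (\<integral>x. (F n x - F (r j) x)\<^sup>2 \<partial>M)"
          by (intro nn_integral_eq_integral L2_D L2_diff F) auto
        also have "(\<integral>x. (F n x - F (r j) x)\<^sup>2 \<partial>M) \<le> ((1/2) ^ k)\<^sup>2"
          unfolding L2_norm_square[symmetric]
          using N[OF that r[OF elim]] by (intro power_mono) auto
        finally show ?case by (simp add: ennreal_leI)
      qed
    qed simp
    finally show ?thesis .
  qed
  have FfL2: "(\<lambda>x. F n x - f x) \<in> L2 M" if "n \<ge> N k" for n k
  proof (rule L2_I)
    show "(\<lambda>x. F n x - f x) \<in> borel_measurable M" using Fm fm by measurable
    show "integrable M (\<lambda>x. (F n x - f x)\<^sup>2)"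
      using Fm fm bound[OF that] by (intro integrableI_bounded) (auto simp: le_less_trans)
  qed
  have "f \<in> L2 M"
    using L2_diff[OF F[of "N 0"] FfL2[of 0 "N 0"]] by simp
  have small: "L2_norm M (\<lambda>x. F n x - f x) \<le> (1/2) ^ k" if "n \<ge> N k" for n k
  proof -
    have "ennreal (\<integral>x. (F n x - f x)\<^sup>2 \<partial>M) \<le> ennreal (((1/2) ^ k)\<^sup>2)"
      using bound[OF that] FfL2[OF that] by (subst nn_integral_eq_integral[symmetric]) (auto dest: L2_D)
    then have "(L2_norm M (\<lambda>x. F n x - f x))\<^sup>2 \<le> ((1/2) ^ k)\<^sup>2"
      by (simp add: L2_norm_square)
    then show ?thesis by (rule power2_le_imp_le) simp
  qed
  have "(\<lambda>n. L2_norm M (\<lambda>x. F n x - f x)) \<longlonglongrightarrow> 0"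
  proof (rule LIMSEQ_I)
    fix e :: real assume "0 < e"
    then obtain k where k: "(1/2 :: real) ^ k < e"
      using real_arch_pow_inv[of e "1/2"] by auto
    then show "\<exists>no. \<forall>n\<ge>no. norm (L2_norm M (\<lambda>x. F n x - f x) - 0) < e"
      using small[of k] by (intro exI[of _ "N k"]) force
  qed
  then show ?thesis
    using F \<open>f \<in> L2 M\<close> by (auto simp: L2_tendsto_def)
qed

lemma L2_tendsto_cong:
  assumes "L2_tendsto M F f" "\<And>n x. x \<in> space M \<Longrightarrow> F n x = F' n x" "\<And>x. x \<in> space M \<Longrightarrow> f x = f' x"
  shows "L2_tendsto M F' f'"
proof -
  have L: "(g \<in> L2 M) = (g' \<in> L2 M)" if "\<And>x. x \<in> space M \<Longrightarrow> g x = g' x" for g g'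
    unfolding L2_def using that
    by (auto cong: measurable_cong Bochner_Integration.integrable_cong)
  have N: "L2_norm M (\<lambda>x. F n x - f x) = L2_norm M (\<lambda>x. F' n x - f' x)" for n
    unfolding L2_norm_def using assms(2,3)
    by (intro arg_cong[where f = sqrt] Bochner_Integration.integral_cong) auto
  show ?thesis
    using assms(1) L[of f f'] L[of "F _" "F' _"] assms(2,3) by (simp add: L2_tendsto_def N)
qed

lemma L2_tendsto_Cauchy:
  assumes "L2_tendsto M F f" "0 < e"
  shows "\<exists>N. \<forall>m\<ge>N. \<forall>n\<ge>N. L2_norm M (\<lambda>x. F m x - F n x) < e"
proof -
  note D = L2_tendstoD[OF assms(1)]
  obtain N where N: "\<And>n. n \<ge> N \<Longrightarrow> L2_norm M (\<lambda>x. F n x - f x) < e / 2"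
    using LIMSEQ_D[OF D(3), of "e / 2"] assms(2) by auto
  have "L2_norm M (\<lambda>x. F m x - F n x) < e" if "m \<ge> N" "n \<ge> N" for m n
    using L2_norm_triangle_diff[OF D(1)[of m] D(2) D(1)[of n]] N[OF that(1)] N[OF that(2)]
    by (simp add: L2_norm_commute[of M f])
  then show ?thesis by blast
qed

section \<open>Square integrable vector fields\<close>

definition L2v :: "'b measure \<Rightarrow> ('b \<Rightarrow> 'a::euclidean_space) \<Rightarrow> bool" where
  "L2v M G \<longleftrightarrow> (\<forall>b\<in>Basis. (\<lambda>x. G x \<bullet> b) \<in> L2 M)"

definition L2v_tendsto :: "'b measure \<Rightarrow> (nat \<Rightarrow> 'b \<Rightarrow> 'a::euclidean_space) \<Rightarrow> ('b \<Rightarrow> 'a) \<Rightarrow> bool" where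
  "L2v_tendsto M F G \<longleftrightarrow> (\<forall>b\<in>Basis. L2_tendsto M (\<lambda>n x. F n x \<bullet> b) (\<lambda>x. G x \<bullet> b))"

lemma L2v_inner_integrable: "L2v M G \<Longrightarrow> L2v M H \<Longrightarrow> integrable M (\<lambda>x. G x \<bullet> H x)"
  unfolding L2v_def by (subst euclidean_inner) (auto intro!: L2_mult_integrable)

lemma L2v_add: "L2v M G \<Longrightarrow> L2v M H \<Longrightarrow> L2v M (\<lambda>x. G x + H x)"
  unfolding L2v_def by (auto simp: inner_add_left intro: L2_add)

lemma L2v_diff: "L2v M G \<Longrightarrow> L2v M H \<Longrightarrow> L2v M (\<lambda>x. G x - H x)"
  unfolding L2v_def by (auto simp: inner_diff_left intro: L2_diff)

lemma L2v_scaleR: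
  "L2v M G \<Longrightarrow> a \<in> borel_measurable M \<Longrightarrow> (\<And>x. x \<in> space M \<Longrightarrow> \<bar>a x\<bar> \<le> C) \<Longrightarrow> L2v M (\<lambda>x. a x *\<^sub>R G x)"
  unfolding L2v_def by (auto intro!: L2_bounded_mult[where C = C])

lemma L2v_cmult: "L2v M G \<Longrightarrow> L2v M (\<lambda>x. c *\<^sub>R G x)"
  unfolding L2v_def by (auto intro: L2_cmult)

lemma L2v_scalar_field:
  assumes "f \<in> L2 M" "X \<in> borel_measurable M" "\<And>x. x \<in> space M \<Longrightarrow> norm (X x) \<le> C"
  shows "L2v M (\<lambda>x. f x *\<^sub>R X x)"
  unfolding L2v_def
proof
  fix b :: 'b assume b: "b \<in> Basis"
  have "(\<lambda>x. (X x \<bullet> b) * f x) \<in> L2 M"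
    using assms(2) by (intro L2_bounded_mult[where C = C] assms(1))
      (auto intro: order_trans[OF Basis_le_norm[OF b] assms(3)])
  then show "(\<lambda>x. (f x *\<^sub>R X x) \<bullet> b) \<in> L2 M"
    by (simp add: mult.commute)
qed

lemma L2v_measurable: "L2v M G \<Longrightarrow> G \<in> borel_measurable M"
  unfolding L2v_def by (subst borel_measurable_euclidean_space) (auto dest: L2_D)

lemma L2v_norm: "L2v M G \<Longrightarrow> (\<lambda>x. norm (G x)) \<in> L2 M"
proof (rule L2_I)
  assume G: "L2v M G"
  then have [measurable]: "G \<in> borel_measurable M" by (rule L2v_measurable)
  show "(\<lambda>x. norm (G x)) \<in> borel_measurable M" by measurable
  show "integrable M (\<lambda>x. (norm (G x))\<^sup>2)"
    using L2v_inner_integrable[OF G G] by (simp add: power2_norm_eq_inner)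
qed

lemma L2v_norm_square:
  assumes "L2v M G"
  shows "(\<integral>x. (norm (G x))\<^sup>2 \<partial>M) = (\<Sum>b\<in>Basis. (L2_norm M (\<lambda>x. G x \<bullet> b))\<^sup>2)"
proof -
  have "(\<integral>x. (norm (G x))\<^sup>2 \<partial>M) = (\<integral>x. (\<Sum>b\<in>Basis. (G x \<bullet> b)\<^sup>2) \<partial>M)"
    by (intro Bochner_Integration.integral_cong refl) (subst power2_norm_eq_inner, subst euclidean_inner, simp add: power2_eq_square)
  also have "\<dots> = (\<Sum>b\<in>Basis. (\<integral>x. (G x \<bullet> b)\<^sup>2 \<partial>M))"
    using assms by (intro Bochner_Integration.integral_sum) (auto simp: L2v_def dest: L2_D)
  finally show ?thesis by (simp add: L2_norm_square)
qed

lemma L2v_Cauchy_Schwarz: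
  assumes "L2v M G" "L2v M H" "\<gamma> \<in> borel_measurable M" "\<And>x. x \<in> space M \<Longrightarrow> \<bar>\<gamma> x\<bar> \<le> C" "0 \<le> C"
  shows "\<bar>\<integral>x. \<gamma> x * (G x \<bullet> H x) \<partial>M\<bar> \<le> C * (L2_norm M (\<lambda>x. norm (G x)) * L2_norm M (\<lambda>x. norm (H x)))"
proof -
  have int: "integrable M (\<lambda>x. C * (norm (G x) * norm (H x)))"
    using assms by (intro integrable_mult_right L2_mult_integrable L2v_norm)
  have "\<bar>\<integral>x. \<gamma> x * (G x \<bullet> H x) \<partial>M\<bar> \<le> (\<integral>x. \<bar>\<gamma> x * (G x \<bullet> H x)\<bar> \<partial>M)"
    by (rule integral_abs_bound)
  also have "\<dots> \<le> (\<integral>x. C * (norm (G x) * norm (H x)) \<partial>M)"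
  proof (rule integral_mono_AE'[OF int])
    show "AE x in M. \<bar>\<gamma> x * (G x \<bullet> H x)\<bar> \<le> C * (norm (G x) * norm (H x))"
      using assms(4,5) by (intro AE_I2) (auto simp: abs_mult intro!: mult_mono Cauchy_Schwarz_ineq2)
  qed (use assms(5) in auto)
  also have "\<dots> \<le> C * (L2_norm M (\<lambda>x. norm (G x)) * L2_norm M (\<lambda>x. norm (H x)))"
    using L2_Cauchy_Schwarz[OF L2v_norm L2v_norm, OF assms(1,2)] assms(5) by (auto intro!: mult_left_mono)
  finally show ?thesis .
qed

lemma L2v_tendstoD: "L2v_tendsto M F G \<Longrightarrow> L2v M (F n)" "L2v_tendsto M F G \<Longrightarrow> L2v M G"
  by (auto simp: L2v_tendsto_def L2v_def dest: L2_tendstoD)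

lemma L2v_tendsto_const: "L2v M G \<Longrightarrow> L2v_tendsto M (\<lambda>n. G) G"
  by (auto simp: L2v_tendsto_def L2v_def intro: L2_tendsto_const)

lemma L2v_tendsto_add:
  "L2v_tendsto M F f \<Longrightarrow> L2v_tendsto M G g \<Longrightarrow> L2v_tendsto M (\<lambda>n x. F n x + G n x) (\<lambda>x. f x + g x)"
  unfolding L2v_tendsto_def by (auto simp: inner_add_left intro: L2_tendsto_add)

lemma L2v_tendsto_diff:
  "L2v_tendsto M F f \<Longrightarrow> L2v_tendsto M G g \<Longrightarrow> L2v_tendsto M (\<lambda>n x. F n x - G n x) (\<lambda>x. f x - g x)"
  unfolding L2v_tendsto_def by (auto simp: inner_diff_left intro: L2_tendsto_diff)

lemma L2v_tendsto_scaleR: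
  "L2v_tendsto M F f \<Longrightarrow> a \<in> borel_measurable M \<Longrightarrow> (\<And>x. x \<in> space M \<Longrightarrow> \<bar>a x\<bar> \<le> C) \<Longrightarrow>
   L2v_tendsto M (\<lambda>n x. a x *\<^sub>R F n x) (\<lambda>x. a x *\<^sub>R f x)"
  unfolding L2v_tendsto_def by (auto intro!: L2_tendsto_bounded_mult[where C = C])

lemma L2v_tendsto_scalar_field:
  assumes "L2_tendsto M F f" "X \<in> borel_measurable M" "\<And>x. x \<in> space M \<Longrightarrow> norm (X x) \<le> C"
  shows "L2v_tendsto M (\<lambda>n x. F n x *\<^sub>R X x) (\<lambda>x. f x *\<^sub>R X x)"
  unfolding L2v_tendsto_def
proof
  fix b :: 'b assume b: "b \<in> Basis"
  have "L2_tendsto M (\<lambda>n x. (X x \<bullet> b) * F n x) (\<lambda>x. (X x \<bullet> b) * f x)"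
    using assms(2) by (intro L2_tendsto_bounded_mult[where C = C] assms(1))
      (auto intro: order_trans[OF Basis_le_norm[OF b] assms(3)])
  then show "L2_tendsto M (\<lambda>n x. (F n x *\<^sub>R X x) \<bullet> b) (\<lambda>x. (f x *\<^sub>R X x) \<bullet> b)"
    by (simp add: mult.commute)
qed

lemma L2v_tendsto_inner:
  assumes "L2v_tendsto M F G" "L2v M H"
  shows "(\<lambda>n. \<integral>x. F n x \<bullet> H x \<partial>M) \<longlonglongrightarrow> (\<integral>x. G x \<bullet> H x \<partial>M)"
proof -
  have *: "(\<integral>x. A x \<bullet> H x \<partial>M) = (\<Sum>b\<in>Basis. \<integral>x. (A x \<bullet> b) * (H x \<bullet> b) \<partial>M)" if "L2v M A" for A
    using that assms(2) unfolding L2v_def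
    by (subst euclidean_inner) (auto intro!: Bochner_Integration.integral_sum L2_mult_integrable)
  have "(\<lambda>n. \<Sum>b\<in>Basis. \<integral>x. (F n x \<bullet> b) * (H x \<bullet> b) \<partial>M) \<longlonglongrightarrow> (\<Sum>b\<in>Basis. \<integral>x. (G x \<bullet> b) * (H x \<bullet> b) \<partial>M)"
    using assms by (intro tendsto_sum L2_tendsto_inner) (auto simp: L2v_tendsto_def L2v_def)
  then show ?thesis
    using assms by (simp add: * L2v_tendstoD)
qed

lemma L2v_tendsto_norm_diff:
  assumes "L2v_tendsto M F G"
  shows "(\<lambda>n. L2_norm M (\<lambda>x. norm (F n x - G x))) \<longlonglongrightarrow> 0"
proof -
  have L: "L2v M (\<lambda>x. F n x - G x)" for n
    using L2v_diff L2v_tendstoD[OF assms] by blast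
  have "(\<lambda>n. sqrt (\<Sum>b\<in>Basis. (L2_norm M (\<lambda>x. (F n x - G x) \<bullet> b))\<^sup>2)) \<longlonglongrightarrow> sqrt (\<Sum>b\<in>(Basis :: 'b set). 0\<^sup>2)"
    using assms by (intro tendsto_intros) (auto simp: L2v_tendsto_def L2_tendsto_def inner_diff_left)
  then show ?thesis
    by (simp add: L2_norm_def[of M "\<lambda>x. norm (F _ x - G x)"] L2v_norm_square[OF L])
qed

lemma L2v_tendsto_inner_field:
  assumes "L2v_tendsto M F G" "X \<in> borel_measurable M" "\<And>x. x \<in> space M \<Longrightarrow> norm (X x) \<le> C"
  shows "L2_tendsto M (\<lambda>n x. X x \<bullet> F n x) (\<lambda>x. X x \<bullet> G x)"
proof -
  have "L2_tendsto M (\<lambda>n x. \<Sum>b\<in>Basis. (X x \<bullet> b) * (F n x \<bullet> b)) (\<lambda>x. \<Sum>b\<in>Basis. (X x \<bullet> b) * (G x \<bullet> b))"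
  proof (rule L2_tendsto_sum)
    fix b :: 'b assume b: "b \<in> Basis"
    show "L2_tendsto M (\<lambda>n x. (X x \<bullet> b) * (F n x \<bullet> b)) (\<lambda>x. (X x \<bullet> b) * (G x \<bullet> b))"
      using assms b by (intro L2_tendsto_bounded_mult[where C = C])
        (auto simp: L2v_tendsto_def intro: order_trans[OF Basis_le_norm[OF b] assms(3)])
  qed simp
  then show ?thesis by (simp add: euclidean_inner[symmetric])
qed

lemma L2v_tendsto_cong:
  assumes "L2v_tendsto M F G" "\<And>n x. x \<in> space M \<Longrightarrow> F n x = F' n x" "\<And>x. x \<in> space M \<Longrightarrow> G x = G' x"
  shows "L2v_tendsto M F' G'"
  unfolding L2v_tendsto_def
proof
  fix b :: 'b assume "b \<in> Basis"
  then have "L2_tendsto M (\<lambda>n x. F n x \<bullet> b) (\<lambda>x. G x \<bullet> b)"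
    using assms(1) by (simp add: L2v_tendsto_def)
  then show "L2_tendsto M (\<lambda>n x. F' n x \<bullet> b) (\<lambda>x. G' x \<bullet> b)"
    by (rule L2_tendsto_cong) (simp_all add: assms(2,3))
qed

lemma L2v_cong: "L2v M F \<Longrightarrow> (\<And>x. x \<in> space M \<Longrightarrow> F x = G x) \<Longrightarrow> L2v M G"
  by (rule L2v_tendstoD(2)[OF L2v_tendsto_cong[OF L2v_tendsto_const, of M F "\<lambda>n. G" G]]) auto

lemma L2v_tendsto_norm:
  assumes "L2v_tendsto M F G"
  shows "(\<lambda>n. L2_norm M (\<lambda>x. norm (F n x))) \<longlonglongrightarrow> L2_norm M (\<lambda>x. norm (G x))"
proof -
  have "(\<lambda>n. sqrt (\<Sum>b\<in>Basis. (L2_norm M (\<lambda>x. F n x \<bullet> b))\<^sup>2)) \<longlonglongrightarrow> sqrt (\<Sum>b\<in>Basis. (L2_norm M (\<lambda>x. G x \<bullet> b))\<^sup>2)"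
    using assms by (intro tendsto_intros L2_tendsto_norm) (auto simp: L2v_tendsto_def)
  then show ?thesis
    using L2v_norm_square[OF L2v_tendstoD(1)[OF assms]] L2v_norm_square[OF L2v_tendstoD(2)[OF assms]]
    by (simp add: L2_norm_def[of M "\<lambda>x. norm (_ x)"])
qed

lemma L2v_complete:
  fixes F :: "nat \<Rightarrow> 'b \<Rightarrow> 'a::euclidean_space"
  assumes "\<And>n. L2v M (F n)"
    and "\<And>b e. b \<in> Basis \<Longrightarrow> 0 < e \<Longrightarrow> \<exists>N. \<forall>m\<ge>N. \<forall>n\<ge>N. L2_norm M (\<lambda>x. F m x \<bullet> b - F n x \<bullet> b) < e"
  shows "\<exists>G. L2v_tendsto M F G"
proof -
  have "\<exists>P. L2_tendsto M (\<lambda>n x. F n x \<bullet> b) P" if "b \<in> Basis" for b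
    using assms that by (intro L2_complete) (auto simp: L2v_def)
  then obtain Q where Q: "\<And>b. b \<in> Basis \<Longrightarrow> L2_tendsto M (\<lambda>n x. F n x \<bullet> b) (Q b)"
    by metis
  have "L2v_tendsto M F (\<lambda>x. \<Sum>b\<in>Basis. Q b x *\<^sub>R b)"
    unfolding L2v_tendsto_def using Q by (auto simp: inner_sum_left inner_Basis if_distrib cong: if_cong)
  then show ?thesis by blast
qed

section \<open>Weak gradients\<close>

lemma test_function_bounded_grad:
  assumes "test_function \<Omega> \<phi>"
  obtains L where "0 \<le> L" "\<And>x. norm (grad \<phi> x) \<le> L"
proof -
  obtain K where K: "compact K" "K \<subseteq> \<Omega>" "\<forall>x. x \<notin> K \<longrightarrow> \<phi> x = 0" and \<phi>: "smooth_on UNIV \<phi>"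
    using assms(1) unfolding test_function_def by auto
  have "compact (grad \<phi> ` K)"
    using smooth_on_continuous_grad[OF \<phi>] K(1) by (intro compact_continuous_image) (auto intro: continuous_on_subset)
  then obtain L where "\<forall>y\<in>grad \<phi> ` K. norm y \<le> L"
    using compact_imp_bounded bounded_iff by metis
  then have "norm (grad \<phi> x) \<le> max L 0" for x
    using grad_zero_outside[OF compact_imp_closed[OF K(1)] K(3), of x] by (cases "x \<in> K") auto
  then show ?thesis by (intro that[of "max L 0"]) auto
qed

lemma test_function_Lipschitz:
  assumes "test_function \<Omega> \<phi>" "\<And>x. norm (grad \<phi> x) \<le> L"
  shows "\<bar>\<phi> x - \<phi> y\<bar> \<le> L * norm (x - y)"
proof -
  have "norm (\<phi> x - \<phi> y) \<le> L * norm (x - y)"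
  proof (rule differentiable_bound[of UNIV \<phi> "\<lambda>x h. grad \<phi> x \<bullet> h"])
    show "(\<phi> has_derivative (\<lambda>h. grad \<phi> x \<bullet> h)) (at x)" for x
      using smooth_on_has_derivative[OF test_function_smooth[OF assms(1)]] by simp
    show "onorm (\<lambda>h. grad \<phi> x \<bullet> h) \<le> L" for x
    proof (rule onorm_le)
      show "norm (grad \<phi> x \<bullet> h) \<le> L * norm h" for h
        using Cauchy_Schwarz_ineq2[of "grad \<phi> x" h] mult_right_mono[OF assms(2)[of x], of "norm h"] by simp
    qed
  qed auto
  then show ?thesis by simp
qed

lemma test_function_integrable:
  assumes "test_function \<Omega> \<phi>"
  shows "integrable lborel \<phi>"
proof -
  obtain K where K: "compact K" "K \<subseteq> \<Omega>" "\<forall>x. x \<notin> K \<longrightarrow> \<phi> x = 0" and \<phi>: "smooth_on UNIV \<phi>"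
    using assms(1) unfolding test_function_def by auto
  have "integrable lborel (\<lambda>x. indicator K x *\<^sub>R \<phi> x)"
    using smooth_on_continuous[OF \<phi>] by (intro borel_integrable_compact K(1)) (auto intro: continuous_on_subset)
  moreover have "(\<lambda>x. indicator K x *\<^sub>R \<phi> x) = \<phi>"
    using K(3) by (auto simp: indicator_def fun_eq_iff)
  ultimately show ?thesis by simp
qed

text \<open>Translation invariance of Lebesgue measure: each difference quotient of \<phi> has
  integral 0, and the quotients converge to the derivative under a common integrable bound.\<close>

lemma integral_partial_deriv_eq_0:
  assumes "test_function \<Omega> \<phi>" "b \<in> Basis"
  shows "(\<integral>x. partial_deriv b \<phi> x \<partial>lborel) = 0"
proof -
  obtain K where K: "compact K" "K \<subseteq> \<Omega>" "\<forall>x. x \<notin> K \<longrightarrow> \<phi> x = 0" and \<phi>: "smooth_on UNIV \<phi>"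
    using assms(1) unfolding test_function_def by auto
  obtain r where r: "K \<subseteq> cball 0 r"
    using compact_imp_bounded[OF K(1)] by (auto simp: bounded_iff subset_eq)
  obtain L where L: "0 \<le> L" "\<And>x. norm (grad \<phi> x) \<le> L"
    using test_function_bounded_grad[OF assms(1)] by blast
  have cont: "continuous_on UNIV \<phi>" using smooth_on_continuous[OF \<phi>] .
  then have meas[measurable]: "\<phi> \<in> borel_measurable borel"
    by (rule borel_measurable_continuous_onI)
  define g where "g n x = (\<phi> (x + (1 / real (Suc n)) *\<^sub>R b) - \<phi> x) / (1 / real (Suc n))" for n x
  have "(\<lambda>n. \<integral>x. g n x \<partial>lborel) \<longlonglongrightarrow> (\<integral>x. partial_deriv b \<phi> x \<partial>lborel)"
  \<comment> \<open>The shifts have length at most 1, so the quotients live in the ball of radius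
    \<open>r + 1\<close>, where the Lipschitz constant \<open>L\<close> bounds them.\<close>
  proof (rule integral_dominated_convergence[where w = "\<lambda>x. L * indicator (cball 0 (r + 1)) x"])
    show "partial_deriv b \<phi> \<in> borel_measurable lborel"
      using smooth_on_continuous[OF smooth_on_partial_deriv[OF \<phi> assms(2)]]
      by (simp add: borel_measurable_continuous_onI)
    show "g n \<in> borel_measurable lborel" for n
      unfolding g_def[abs_def] by measurable
    show "integrable lborel (\<lambda>x. L * indicator (cball 0 (r + 1)) x :: real)"
      by (intro integrable_mult_right integrable_real_indicator emeasure_lborel_cball_finite) auto
    show "AE x in lborel. (\<lambda>n. g n x) \<longlonglongrightarrow> partial_deriv b \<phi> x"
    proof (rule AE_I2)
      fix x
      have 1: "((\<lambda>t. x + t *\<^sub>R b) has_derivative (\<lambda>t. t *\<^sub>R b)) (at (0::real))"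
        by (auto intro!: derivative_eq_intros)
      have "((\<lambda>t. \<phi> (x + t *\<^sub>R b)) has_derivative (\<lambda>t. grad \<phi> (x + 0 *\<^sub>R b) \<bullet> (t *\<^sub>R b))) (at 0)"
        by (rule has_derivative_compose[OF 1 smooth_on_has_derivative[OF \<phi>]]) auto
      then have "((\<lambda>t. \<phi> (x + t *\<^sub>R b)) has_real_derivative partial_deriv b \<phi> x) (at 0)"
        using grad_inner_Basis[OF assms(2), of \<phi> x]
        by (simp add: has_field_derivative_def mult.commute[of _ "partial_deriv b \<phi> x"])
      then have "((\<lambda>h. (\<phi> (x + h *\<^sub>R b) - \<phi> x) / h) \<longlongrightarrow> partial_deriv b \<phi> x) (at 0)"
        by (simp add: DERIV_def)
      moreover have "filterlim (\<lambda>n. 1 / real (Suc n)) (at 0) sequentially"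
        using LIMSEQ_inverse_real_of_nat by (intro filterlim_atI) (auto simp: field_simps)
      ultimately show "(\<lambda>n. g n x) \<longlonglongrightarrow> partial_deriv b \<phi> x"
        unfolding g_def by (rule filterlim_compose)
    qed
    show "AE x in lborel. norm (g n x) \<le> L * indicator (cball 0 (r + 1)) x" for n
    proof (rule AE_I2)
      fix x
      let ?y = "x + (1 / real (Suc n)) *\<^sub>R b"
      have nb: "norm ((1 / real (Suc n)) *\<^sub>R b) = 1 / real (Suc n)"
        using assms(2) by simp
      show "norm (g n x) \<le> L * indicator (cball 0 (r + 1)) x"
      proof (cases "x \<in> cball 0 (r + 1)")
        case True
        have "\<bar>\<phi> ?y - \<phi> x\<bar> \<le> L * (1 / real (Suc n))"
          using test_function_Lipschitz[OF assms(1) L(2), of ?y x] nb by simp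
        moreover have "norm (g n x) = \<bar>\<phi> ?y - \<phi> x\<bar> / (1 / real (Suc n))"
          unfolding g_def real_norm_def abs_divide by simp
        ultimately have "norm (g n x) \<le> L"
          by (subst (asm) pos_divide_le_eq[symmetric]) auto
        then show ?thesis using True by simp
      next
        case False
        have "norm x \<le> norm ?y + 1 / real (Suc n)"
          using norm_triangle_ineq4[of ?y "(1 / real (Suc n)) *\<^sub>R b"] nb by simp
        moreover have "1 / real (Suc n) \<le> 1" by simp
        ultimately have "norm x \<le> norm ?y + 1" by linarith
        then have "?y \<notin> cball 0 r" "x \<notin> cball 0 r"
          using False unfolding mem_cball_0 by linarith+
        then have "?y \<notin> K" "x \<notin> K"
          using r by auto
        then show ?thesis using K(3) False by (simp add: g_def)
      qed
    qed
  qed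
  moreover have "(\<integral>x. g n x \<partial>lborel) = 0" for n
  proof -
    let ?c = "(1 / real (Suc n)) *\<^sub>R b"
    have int: "integrable lborel \<phi>" using test_function_integrable[OF assms(1)] .
    have int2: "integrable lborel (\<lambda>x. \<phi> (?c + x))"
      using int by (subst (asm) lborel_distr_plus[of ?c, symmetric]) (simp add: integrable_distr_eq)
    have "(\<integral>x. \<phi> x \<partial>lborel) = (\<integral>x. \<phi> (?c + x) \<partial>lborel)"
      by (subst lborel_distr_plus[of ?c, symmetric]) (simp add: integral_distr)
    then show ?thesis
      using int int2 unfolding g_def by (simp add: add.commute)
  qed
  ultimately show ?thesis
    by (simp add: LIMSEQ_const_iff)
qed

locale bounded_open =
  fixes \<Omega> :: "'a::euclidean_space set"
  assumes open_Omega: "open \<Omega>" and bounded_Omega: "bounded \<Omega>"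
begin

abbreviation "M \<equiv> volume_on \<Omega>"

lemma sets_Omega [measurable, simp]: "\<Omega> \<in> sets borel" "\<Omega> \<inter> space lborel \<in> sets lborel"
  using open_Omega by auto

lemma space_M [simp]: "space M = \<Omega>"
  by (simp add: space_restrict_space)

lemma integral_M: "(\<integral>x. f x \<partial>M) = (\<integral>x. indicator \<Omega> x *\<^sub>R (f x :: real) \<partial>lborel)"
  by (rule integral_restrict_space) simp

lemma integrable_M: "integrable M f \<longleftrightarrow> integrable lborel (\<lambda>x. indicator \<Omega> x *\<^sub>R (f x :: real))"
  by (rule integrable_restrict_space) simp

lemma finite_M: "finite_measure M"
  by (rule finite_measureI)
     (use emeasure_bounded_finite[OF bounded_Omega] in \<open>auto simp: emeasure_restrict_space\<close>)

lemma continuous_measurable_M: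
  fixes f :: "'a \<Rightarrow> 'b::topological_space"
  shows "continuous_on \<Omega> f \<Longrightarrow> f \<in> borel_measurable M"
  using borel_measurable_continuous_on_restrict[of \<Omega> f]
  by (simp add: measurable_cong_sets[OF sets_restrict_space_cong[OF sets_lborel] refl])

lemma compact_closure: "compact (closure \<Omega>)"
  using bounded_Omega by (simp add: compact_closure)

lemma continuous_closure_bounded:
  fixes f :: "'a \<Rightarrow> 'b::real_normed_vector"
  assumes "continuous_on (closure \<Omega>) f"
  obtains C where "0 \<le> C" "\<And>x. x \<in> \<Omega> \<Longrightarrow> norm (f x) \<le> C"
proof -
  have "bounded (f ` closure \<Omega>)"
    using assms compact_closure by (intro compact_imp_bounded compact_continuous_image)
  then obtain C where "\<forall>y\<in>f ` closure \<Omega>. norm y \<le> C" by (auto simp: bounded_iff)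
  then have "norm (f x) \<le> max C 0" if "x \<in> \<Omega>" for x
    using closure_subset that by (force simp: le_max_iff_disj)
  then show ?thesis by (intro that[of "max C 0"]) auto
qed

lemma continuous_closure_measurable:
  fixes f :: "'a \<Rightarrow> 'b::real_normed_vector"
  shows "continuous_on (closure \<Omega>) f \<Longrightarrow> f \<in> borel_measurable M"
  using continuous_on_subset[OF _ closure_subset] by (intro continuous_measurable_M)

lemma continuous_closure_L2: "continuous_on (closure \<Omega>) f \<Longrightarrow> f \<in> L2 M"
  by (rule continuous_closure_bounded[of f], assumption)
     (auto intro!: L2_bounded[OF finite_M] continuous_closure_measurable)

lemma L2_integrable: "f \<in> L2 M \<Longrightarrow> integrable M f"
  using L2_mult_integrable[of f M "\<lambda>x. 1"] continuous_closure_L2[of "\<lambda>x. 1"] by simp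

lemma smooth_up_L2:
  assumes "open U" "closure \<Omega> \<subseteq> U" "smooth_on U f"
  shows "f \<in> L2 M" "L2v M (grad f)"
proof -
  show "f \<in> L2 M"
    using assms by (intro continuous_closure_L2) (auto intro: smooth_on_continuous continuous_on_subset)
  show "L2v M (grad f)"
    unfolding L2v_def using assms
    by (auto intro!: continuous_closure_L2 continuous_on_inner continuous_on_const
        intro: continuous_on_subset[OF smooth_on_continuous_grad])
qed

lemma test_function_L2:
  assumes "test_function \<Omega> \<phi>"
  shows "\<phi> \<in> L2 M" "L2v M (grad \<phi>)"
  using smooth_up_L2[of UNIV] test_function_smooth[OF assms] by auto

lemma integral_partial_deriv_M:
  assumes "test_function \<Omega> \<phi>" "b \<in> Basis"
  shows "(\<integral>x. partial_deriv b \<phi> x \<partial>M) = 0"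
proof -
  obtain K where K: "compact K" "K \<subseteq> \<Omega>" "\<forall>x. x \<notin> K \<longrightarrow> \<phi> x = 0"
    using assms(1) unfolding test_function_def by auto
  have "(\<lambda>x. indicator \<Omega> x *\<^sub>R partial_deriv b \<phi> x) = partial_deriv b \<phi>"
  proof
    fix x show "indicator \<Omega> x *\<^sub>R partial_deriv b \<phi> x = partial_deriv b \<phi> x"
    proof (cases "x \<in> \<Omega>")
      case False
      then have "x \<notin> K" using K(2) by auto
      then show ?thesis
        using grad_zero_outside[OF compact_imp_closed[OF K(1)] K(3), of x] grad_inner_Basis[OF assms(2), of \<phi> x]
        by simp
    qed simp
  qed
  then show ?thesis
    using integral_partial_deriv_eq_0[OF assms] by (simp add: integral_M)
qed

text \<open>Bumps give vanishing integrals of \<open>g\<close> over all boxes whose closure lies in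
  \<Omega>. On one such box the positive and the negative part of \<open>g\<close> then define
  measures that agree on the intersection-stable system of boxes, so the two parts agree almost
  everywhere and \<open>g\<close> vanishes there.\<close>

lemma fundamental_lemma:
  assumes g: "g \<in> L2 M" and 0: "\<And>\<phi>. test_function \<Omega> \<phi> \<Longrightarrow> (\<integral>x. g x * \<phi> x \<partial>M) = 0"
  shows "AE x in M. g x = 0"
proof -
  have gm: "g \<in> borel_measurable M" and gi: "integrable M g"
    using g by (auto intro: L2_D L2_integrable)
  have indm: "(indicator (box a b) :: 'a \<Rightarrow> real) \<in> borel_measurable M" for a b
    by (intro measurable_restrict_space1) auto
  have box0: "(\<integral>x. g x * indicator (box l u) x \<partial>M) = 0" if "cbox l u \<subseteq> \<Omega>" for l u
  proof -
    have bm: "box_bump l u n \<in> borel_measurable M" for n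
      using test_function_L2[OF test_function_box_bump[OF that]] by (blast intro: L2_D)
    have "(\<lambda>n. \<integral>x. g x * box_bump l u n x \<partial>M) \<longlonglongrightarrow> (\<integral>x. g x * indicator (box l u) x \<partial>M)"
    proof (rule integral_dominated_convergence[where w = "\<lambda>x. \<bar>g x\<bar>"])
      show "AE x in M. (\<lambda>n. g x * box_bump l u n x) \<longlonglongrightarrow> g x * indicator (box l u) x"
        by (intro AE_I2 tendsto_intros box_bump_tendsto)
      show "AE x in M. norm (g x * box_bump l u n x) \<le> \<bar>g x\<bar>" for n
        using box_bump_bounds[of l u n] by (intro AE_I2) (auto simp: abs_mult intro!: mult_left_le)
      show "(\<lambda>x. g x * indicator (box l u) x) \<in> borel_measurable M"
        by (rule borel_measurable_times[OF gm indm])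
    qed (use gm gi bm in \<open>auto intro!: borel_measurable_times\<close>)
    then show ?thesis
      by (simp add: 0[OF test_function_box_bump[OF that]] LIMSEQ_const_iff)
  qed
  have AE_box: "AE x in lborel. x \<in> cbox l u \<longrightarrow> g x = 0" if sub: "cbox l u \<subseteq> \<Omega>" for l u
  proof -
    \<comment> \<open>Cutting \<open>g\<close> to the box makes it integrable on the whole space, so
      both measures below are finite on every box.\<close>
    define g0 where "g0 x = indicator (box l u) x * g x" for x
    have sub': "box l u \<subseteq> \<Omega>" using sub box_subset_cbox by blast
    have int: "integrable lborel (\<lambda>x. g0 x * indicator (box a b) x)"
      and int0: "(\<integral>x. g0 x * indicator (box a b) x \<partial>lborel) = 0" for a b
    proof -
      obtain l' u' where lu: "box l u \<inter> box a b = box l' u'" "cbox l' u' \<subseteq> cbox l u"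
        by (rule that[OF box_Int_box]) (auto simp: mem_box)
      have eq: "g0 x * indicator (box a b) x = indicator \<Omega> x *\<^sub>R (g x * indicator (box l' u') x)" for x
        using lu(1) sub' by (auto simp: g0_def indicator_def)
      have "integrable M (\<lambda>x. g x * indicator (box l' u') x)"
        by (rule Bochner_Integration.integrable_bound[OF gi])
           (use borel_measurable_times[OF gm indm] in \<open>auto simp: indicator_def\<close>)
      then show "integrable lborel (\<lambda>x. g0 x * indicator (box a b) x)"
        unfolding eq integrable_M .
      show "(\<integral>x. g0 x * indicator (box a b) x \<partial>lborel) = 0"
        unfolding eq integral_M[symmetric] using lu(2) sub by (intro box0) auto
    qed
    have g0m: "g0 \<in> borel_measurable borel"
    proof -
      have "(\<lambda>x. indicator \<Omega> x *\<^sub>R g x) \<in> borel_measurable lborel"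
        using gm by (subst (asm) borel_measurable_restrict_space_iff) auto
      then have [measurable]: "(\<lambda>x. indicator \<Omega> x *\<^sub>R g x) \<in> borel_measurable borel" by simp
      have "(\<lambda>x. indicator (box l u) x * (indicator \<Omega> x *\<^sub>R g x)) \<in> borel_measurable borel"
        by measurable
      moreover have "(\<lambda>x. indicator (box l u) x * (indicator \<Omega> x *\<^sub>R g x)) = g0"
        using sub' by (auto simp: g0_def fun_eq_iff indicator_def)
      ultimately show ?thesis by simp
    qed
    have fin: "(\<integral>\<^sup>+x. ennreal (g0 x * indicator (box a b) x) \<partial>lborel) \<noteq> \<infinity>"
      "(\<integral>\<^sup>+x. ennreal (- (g0 x * indicator (box a b) x)) \<partial>lborel) \<noteq> \<infinity>" for a b
      using int[of a b] by (auto simp: real_integrable_def)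
    have pm: "(\<integral>\<^sup>+x. ennreal (g0 x * indicator (box a b) x) \<partial>lborel) =
      (\<integral>\<^sup>+x. ennreal (- (g0 x * indicator (box a b) x)) \<partial>lborel)" for a b
    proof -
      let ?A = "\<integral>\<^sup>+x. ennreal (g0 x * indicator (box a b) x) \<partial>lborel"
      let ?B = "\<integral>\<^sup>+x. ennreal (- (g0 x * indicator (box a b) x)) \<partial>lborel"
      have "enn2real ?A = enn2real ?B"
        using real_lebesgue_integral_def[OF int[of a b]] int0[of a b] by linarith
      moreover have "ennreal (enn2real ?A) = ?A" "ennreal (enn2real ?B) = ?B"
        using fin[of a b] by (auto intro!: ennreal_enn2real simp: less_top)
      ultimately show ?thesis by metis
    qed
    have em: "emeasure (density lborel (\<lambda>x. ennreal (c * g0 x))) (box a b) = (\<integral>\<^sup>+x. ennreal (c * (g0 x * indicator (box a b) x)) \<partial>lborel)" for a b c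
      using g0m by (subst emeasure_density) (auto intro!: nn_integral_cong simp: indicator_def)
    \<comment> \<open>\<open>ennreal\<close> sends negative numbers to 0, so these are the densities
      of the positive and of the negative part of \<open>g0\<close>.\<close>
    have "density lborel (\<lambda>x. ennreal (1 * g0 x)) = density lborel (\<lambda>x. ennreal ((-1) * g0 x))"
    proof (rule measure_eqI_generator_eq[where E = "range (\<lambda>(a, b). box a b :: 'a set)" and \<Omega> = UNIV
           and A = "\<lambda>n::nat. box (- (real n *\<^sub>R One)) (real n *\<^sub>R One)"])
      show "Int_stable (range (\<lambda>(a, b). box a b :: 'a set))"
        by (auto simp: Int_stable_def box_Int_box)
      show "(\<Union>i::nat. box (- (real i *\<^sub>R One)) (real i *\<^sub>R One)) = (UNIV :: 'a set)"
        unfolding UN_box_eq_UNIV by auto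
      show "emeasure (density lborel (\<lambda>x. ennreal (1 * g0 x))) X = emeasure (density lborel (\<lambda>x. ennreal ((-1) * g0 x))) X"
        if "X \<in> range (\<lambda>(a, b). box a b :: 'a set)" for X
        using that pm unfolding image_iff by (auto simp: em[of 1, simplified] em[of "-1", simplified])
      show "emeasure (density lborel (\<lambda>x. ennreal (1 * g0 x))) (box (- (real i *\<^sub>R One)) (real i *\<^sub>R One)) \<noteq> \<infinity>" for i :: nat
        unfolding em using fin(1) by simp
    qed (auto simp: borel_eq_box)
    then have "AE x in lborel. ennreal (1 * g0 x) = ennreal ((-1) * g0 x)"
      using g0m by (intro sigma_finite_measure.density_unique[OF sigma_finite_lborel]) auto
    then have "AE x in lborel. g0 x = 0"
    proof eventually_elim
      case (elim x)
      then show ?case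
        by (cases "g0 x" "0 :: real" rule: linorder_cases) (auto simp: ennreal_eq_0_iff ennreal_neg)
    qed
    moreover have "AE x in lborel. x \<notin> cbox l u - box l u"
      using null_sets_cbox_Diff_box by (rule AE_not_in)
    ultimately show ?thesis
      by eventually_elim (auto simp: g0_def)
  qed
  \<comment> \<open>An open set is a countable union of closed boxes, so the exceptional null sets
    can be collected.\<close>
  obtain D where D: "countable D" "D \<subseteq> Pow \<Omega>" "\<And>X. X \<in> D \<Longrightarrow> \<exists>a b. X = cbox a b" "\<Union>D = \<Omega>"
    using open_countable_Union_open_cbox[OF open_Omega] by metis
  have "AE x in lborel. \<forall>X\<in>D. x \<in> X \<longrightarrow> g x = 0"
    unfolding AE_ball_countable[OF D(1)]
  proof
    fix X assume "X \<in> D"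
    then obtain a b where "X = cbox a b" "cbox a b \<subseteq> \<Omega>" using D by blast
    then show "AE x in lborel. x \<in> X \<longrightarrow> g x = 0" using AE_box by simp
  qed
  then have "AE x in lborel. x \<in> \<Omega> \<longrightarrow> g x = 0"
    by eventually_elim (use D(4) in auto)
  then show ?thesis
    by (simp add: AE_restrict_space_iff)
qed

section \<open>Calculus of weak gradients\<close>

lemma has_weak_gradientD:
  assumes "has_weak_gradient \<Omega> u G"
  shows "L2v M G"
    "test_function \<Omega> \<phi> \<Longrightarrow> b \<in> Basis \<Longrightarrow> (\<integral>x. u x * (grad \<phi> x \<bullet> b) \<partial>M) = - (\<integral>x. (G x \<bullet> b) * \<phi> x \<partial>M)"
  using assms by (auto simp: has_weak_gradient_def L2v_def grad_inner_Basis)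

lemma has_weak_gradientI:
  assumes "L2v M G"
    "\<And>\<phi> b. test_function \<Omega> \<phi> \<Longrightarrow> b \<in> Basis \<Longrightarrow> (\<integral>x. u x * (grad \<phi> x \<bullet> b) \<partial>M) = - (\<integral>x. (G x \<bullet> b) * \<phi> x \<partial>M)"
  shows "has_weak_gradient \<Omega> u G"
  using assms by (auto simp: has_weak_gradient_def L2v_def grad_inner_Basis)

lemma H1_D: "u \<in> H1 \<Omega> \<Longrightarrow> u \<in> L2 M" "u \<in> H1 \<Omega> \<Longrightarrow> has_weak_gradient \<Omega> u (weak_grad \<Omega> u)"
  unfolding H1_def weak_grad_def by (auto intro: someI_ex[of "has_weak_gradient \<Omega> u"])

lemma H1_I: "u \<in> L2 M \<Longrightarrow> has_weak_gradient \<Omega> u G \<Longrightarrow> u \<in> H1 \<Omega>"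
  unfolding H1_def by auto

lemma weak_gradient_unique:
  assumes "has_weak_gradient \<Omega> u G" "has_weak_gradient \<Omega> u H"
  shows "AE x in M. G x = H x"
proof -
  have "AE x in M. (G x - H x) \<bullet> b = 0" if b: "b \<in> Basis" for b
  proof (rule fundamental_lemma)
    note G = has_weak_gradientD[OF assms(1)] and H = has_weak_gradientD[OF assms(2)]
    show "(\<lambda>x. (G x - H x) \<bullet> b) \<in> L2 M"
      using L2v_diff[OF G(1) H(1)] b by (simp add: L2v_def)
    fix \<phi> assume \<phi>: "test_function \<Omega> \<phi>"
    show "(\<integral>x. (G x - H x) \<bullet> b * \<phi> x \<partial>M) = 0"
      using G(2)[OF \<phi> b] H(2)[OF \<phi> b] G(1) H(1) b test_function_L2[OF \<phi>]
      by (simp add: inner_diff_left left_diff_distrib L2_mult_integrable L2v_def)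
  qed
  then have "AE x in M. \<forall>b\<in>Basis. (G x - H x) \<bullet> b = 0"
    by (simp add: AE_ball_countable countable_finite)
  then show ?thesis
    by eventually_elim (metis euclidean_eqI inner_diff_left inner_zero_left right_minus_eq)
qed

text \<open>\<open>weak_grad\<close> is a choice among weak gradients; uniqueness up to null sets
  lets any computed field stand for it under integrals.\<close>

lemma weak_grad_AE:
  assumes "u \<in> L2 M" "has_weak_gradient \<Omega> u G"
  shows "AE x in M. weak_grad \<Omega> u x = G x"
  using weak_gradient_unique[OF H1_D(2)[OF H1_I[OF assms]] assms(2)] .

lemma has_weak_gradient_add:
  assumes "u \<in> L2 M" "v \<in> L2 M" "has_weak_gradient \<Omega> u G" "has_weak_gradient \<Omega> v H"
  shows "has_weak_gradient \<Omega> (\<lambda>x. u x + v x) (\<lambda>x. G x + H x)"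
proof (rule has_weak_gradientI)
  note G = has_weak_gradientD[OF assms(3)] and H = has_weak_gradientD[OF assms(4)]
  show "L2v M (\<lambda>x. G x + H x)" using G H by (intro L2v_add)
  fix \<phi> b assume \<phi>: "test_function \<Omega> \<phi>" and b: "b \<in> (Basis :: 'a set)"
  show "(\<integral>x. (u x + v x) * (grad \<phi> x \<bullet> b) \<partial>M) = - (\<integral>x. (G x + H x) \<bullet> b * \<phi> x \<partial>M)"
    using G(2)[OF \<phi> b] H(2)[OF \<phi> b] G(1) H(1) b test_function_L2[OF \<phi>] assms(1,2)
    by (simp add: inner_add_left distrib_right L2_mult_integrable L2v_def)
qed

lemma has_weak_gradient_cmult:
  assumes "has_weak_gradient \<Omega> u G"
  shows "has_weak_gradient \<Omega> (\<lambda>x. c * u x) (\<lambda>x. c *\<^sub>R G x)"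
proof (rule has_weak_gradientI)
  note G = has_weak_gradientD[OF assms]
  show "L2v M (\<lambda>x. c *\<^sub>R G x)" using G by (intro L2v_cmult)
  fix \<phi> b assume \<phi>: "test_function \<Omega> \<phi>" and b: "b \<in> (Basis :: 'a set)"
  show "(\<integral>x. c * u x * (grad \<phi> x \<bullet> b) \<partial>M) = - (\<integral>x. (c *\<^sub>R G x) \<bullet> b * \<phi> x \<partial>M)"
    using G(2)[OF \<phi> b] by (simp add: mult.assoc)
qed

lemma has_weak_gradient_diff:
  assumes "u \<in> L2 M" "v \<in> L2 M" "has_weak_gradient \<Omega> u G" "has_weak_gradient \<Omega> v H"
  shows "has_weak_gradient \<Omega> (\<lambda>x. u x - v x) (\<lambda>x. G x - H x)"
  using has_weak_gradient_add[OF assms(1) L2_cmult[OF assms(2)] assms(3) has_weak_gradient_cmult[OF assms(4)], of "-1"]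
  by simp

text \<open>For a test function \<phi> the product \<open>a \<phi>\<close> is again one. Testing the
  weak gradient of \<open>u\<close> with it and expanding the classical gradient of
  \<open>a \<phi>\<close> leaves exactly the two terms of the product rule.\<close>

lemma has_weak_gradient_mult:
  assumes "open U" "closure \<Omega> \<subseteq> U" "smooth_on U a" "u \<in> L2 M" "has_weak_gradient \<Omega> u G"
  shows "has_weak_gradient \<Omega> (\<lambda>x. a x * u x) (\<lambda>x. a x *\<^sub>R G x + u x *\<^sub>R grad a x)"
proof (rule has_weak_gradientI)
  note G = has_weak_gradientD[OF assms(5)]
  have ca: "continuous_on (closure \<Omega>) a" and cg: "continuous_on (closure \<Omega>) (grad a)"
    using assms(1-3) by (auto intro: continuous_on_subset smooth_on_continuous smooth_on_continuous_grad)
  obtain C where C: "0 \<le> C" "\<And>x. x \<in> \<Omega> \<Longrightarrow> norm (a x) \<le> C" using continuous_closure_bounded[OF ca] by auto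
  obtain C' where C': "0 \<le> C'" "\<And>x. x \<in> \<Omega> \<Longrightarrow> norm (grad a x) \<le> C'" using continuous_closure_bounded[OF cg] by auto
  have m: "a \<in> borel_measurable M" "grad a \<in> borel_measurable M"
    using ca cg by (auto intro: continuous_closure_measurable)
  have L1: "L2v M (\<lambda>x. a x *\<^sub>R G x)" using G(1) m C by (intro L2v_scaleR) auto
  have L2: "L2v M (\<lambda>x. u x *\<^sub>R grad a x)" using assms(4) m C' by (intro L2v_scalar_field) auto
  show "L2v M (\<lambda>x. a x *\<^sub>R G x + u x *\<^sub>R grad a x)" using L1 L2 by (rule L2v_add)
  fix \<phi> b assume \<phi>: "test_function \<Omega> \<phi>" and b: "b \<in> (Basis :: 'a set)"
  have \<Omega>U: "\<Omega> \<subseteq> U" using assms(2) closure_subset by blast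
  have a\<phi>: "test_function \<Omega> (\<lambda>x. a x * \<phi> x)"
    by (rule test_function_smooth_mult[OF \<phi> assms(1) \<Omega>U assms(3)])
  have gr: "grad (\<lambda>x. a x * \<phi> x) x = a x *\<^sub>R grad \<phi> x + \<phi> x *\<^sub>R grad a x" if "x \<in> \<Omega>" for x
    using smooth_on_subset[OF test_function_smooth[OF \<phi>], of U] assms \<Omega>U that by (intro grad_mult[of U]) auto
  have "- (\<integral>x. (G x \<bullet> b) * (a x * \<phi> x) \<partial>M) = (\<integral>x. u x * (grad (\<lambda>x. a x * \<phi> x) x \<bullet> b) \<partial>M)"
    using G(2)[OF a\<phi> b] by simp
  also have "\<dots> = (\<integral>x. a x * u x * (grad \<phi> x \<bullet> b) + ((u x *\<^sub>R grad a x) \<bullet> b) * \<phi> x \<partial>M)"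
  proof (intro Bochner_Integration.integral_cong refl)
    fix x assume "x \<in> space M"
    then have x: "x \<in> \<Omega>" by simp
    show "u x * (grad (\<lambda>x. a x * \<phi> x) x \<bullet> b) = a x * u x * (grad \<phi> x \<bullet> b) + ((u x *\<^sub>R grad a x) \<bullet> b) * \<phi> x"
      unfolding gr[OF x] by (simp add: inner_add_left algebra_simps)
  qed
  also have "\<dots> = (\<integral>x. a x * u x * (grad \<phi> x \<bullet> b) \<partial>M) + (\<integral>x. ((u x *\<^sub>R grad a x) \<bullet> b) * \<phi> x \<partial>M)"
    using b test_function_L2[OF \<phi>] L2 L2_bounded_mult[OF assms(4) m(1)] C(2)
    by (intro Bochner_Integration.integral_add L2_mult_integrable) (auto simp: L2v_def)
  finally have "(\<integral>x. a x * u x * (grad \<phi> x \<bullet> b) \<partial>M) =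
      - ((\<integral>x. ((a x *\<^sub>R G x) \<bullet> b) * \<phi> x \<partial>M) + (\<integral>x. ((u x *\<^sub>R grad a x) \<bullet> b) * \<phi> x \<partial>M))"
    by (simp add: algebra_simps)
  also have "(\<integral>x. ((a x *\<^sub>R G x) \<bullet> b) * \<phi> x \<partial>M) + (\<integral>x. ((u x *\<^sub>R grad a x) \<bullet> b) * \<phi> x \<partial>M) =
      (\<integral>x. ((a x *\<^sub>R G x) \<bullet> b) * \<phi> x + ((u x *\<^sub>R grad a x) \<bullet> b) * \<phi> x \<partial>M)"
    using b test_function_L2[OF \<phi>] L1 L2
    by (intro Bochner_Integration.integral_add[symmetric] L2_mult_integrable) (auto simp: L2v_def)
  also have "\<dots> = (\<integral>x. (a x *\<^sub>R G x + u x *\<^sub>R grad a x) \<bullet> b * \<phi> x \<partial>M)"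
    by (simp add: inner_add_left distrib_right)
  finally show "(\<integral>x. a x * u x * (grad \<phi> x \<bullet> b) \<partial>M) = - (\<integral>x. (a x *\<^sub>R G x + u x *\<^sub>R grad a x) \<bullet> b * \<phi> x \<partial>M)" .
qed

lemma has_weak_gradient_const: "has_weak_gradient \<Omega> (\<lambda>x. c) (\<lambda>x. 0)"
proof (rule has_weak_gradientI)
  fix \<phi> b assume \<phi>: "test_function \<Omega> \<phi>" and b: "b \<in> (Basis :: 'a set)"
  show "(\<integral>x. c * (grad \<phi> x \<bullet> b) \<partial>M) = - (\<integral>x. 0 \<bullet> b * \<phi> x \<partial>M)"
    using integral_partial_deriv_M[OF \<phi> b] b by (simp add: grad_inner_Basis)
qed (simp add: L2v_def)

text \<open>A smooth function is its product with the constant 1, whose weak gradient is 0 because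
  derivatives of test functions integrate to 0.\<close>

lemma has_weak_gradient_smooth:
  assumes "open U" "closure \<Omega> \<subseteq> U" "smooth_on U f"
  shows "has_weak_gradient \<Omega> f (grad f)"
  using has_weak_gradient_mult[OF assms _ has_weak_gradient_const[of 1]] continuous_closure_L2[of "\<lambda>x. 1"]
  by simp

lemma has_weak_gradient_tendsto:
  assumes "L2_tendsto M U u" "L2v_tendsto M F G" "\<And>n. has_weak_gradient \<Omega> (U n) (F n)"
  shows "has_weak_gradient \<Omega> u G"
proof (rule has_weak_gradientI)
  show "L2v M G" using assms(2) by (rule L2v_tendstoD)
  fix \<phi> b assume \<phi>: "test_function \<Omega> \<phi>" and b: "b \<in> (Basis :: 'a set)"
  have 1: "(\<lambda>n. \<integral>x. U n x * (grad \<phi> x \<bullet> b) \<partial>M) \<longlonglongrightarrow> (\<integral>x. u x * (grad \<phi> x \<bullet> b) \<partial>M)"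
    using assms(1) test_function_L2[OF \<phi>] b by (intro L2_tendsto_inner) (auto simp: L2v_def)
  have "(\<lambda>n. - (\<integral>x. (F n x \<bullet> b) * \<phi> x \<partial>M)) \<longlonglongrightarrow> - (\<integral>x. (G x \<bullet> b) * \<phi> x \<partial>M)"
    using assms(2) test_function_L2[OF \<phi>] b by (intro tendsto_minus L2_tendsto_inner) (auto simp: L2v_tendsto_def)
  then have 2: "(\<lambda>n. \<integral>x. U n x * (grad \<phi> x \<bullet> b) \<partial>M) \<longlonglongrightarrow> - (\<integral>x. (G x \<bullet> b) * \<phi> x \<partial>M)"
    using has_weak_gradientD(2)[OF assms(3) \<phi> b] by simp
  show "(\<integral>x. u x * (grad \<phi> x \<bullet> b) \<partial>M) = - (\<integral>x. (G x \<bullet> b) * \<phi> x \<partial>M)"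
    by (rule LIMSEQ_unique[OF 1 2])
qed

lemma H1_norm_eq:
  assumes "u \<in> L2 M" "has_weak_gradient \<Omega> u G"
  shows "H1_norm \<Omega> u = sqrt ((L2_norm M u)\<^sup>2 + (L2_norm M (\<lambda>x. norm (G x)))\<^sup>2)"
proof -
  have "L2_norm M (\<lambda>x. norm (weak_grad \<Omega> u x)) = L2_norm M (\<lambda>x. norm (G x))"
    using weak_grad_AE[OF assms]
    by (intro L2_norm_cong_AE L2_D(1)[OF L2v_norm] has_weak_gradientD(1)[OF H1_D(2)[OF H1_I[OF assms]]]
        has_weak_gradientD(1)[OF assms(2)]) auto
  then show ?thesis
    unfolding H1_norm_def L2_norm_square[symmetric] by simp
qed

text \<open>The limit field \<open>G\<close> is explicit instead of
  \<open>weak_grad \<Omega> u\<close>, so that computed gradients can be carried through algebraic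
  operations. Together with convergence of the boundary values this is the form in which traces are
  produced and consumed.\<close>

definition H1_tendsto :: "(nat \<Rightarrow> 'a \<Rightarrow> real) \<Rightarrow> ('a \<Rightarrow> real) \<Rightarrow> ('a \<Rightarrow> 'a) \<Rightarrow> bool" where
  "H1_tendsto \<Phi> u G \<longleftrightarrow> (\<forall>n. smooth_up_to_boundary \<Omega> (\<Phi> n)) \<and> L2_tendsto M \<Phi> u \<and>
     L2v_tendsto M (\<lambda>n. grad (\<Phi> n)) G"

lemma smooth_up_to_boundaryD:
  assumes "smooth_up_to_boundary \<Omega> f"
  shows "f \<in> L2 M" "L2v M (grad f)" "has_weak_gradient \<Omega> f (grad f)" "continuous_on (closure \<Omega>) f"
    "\<And>x. x \<in> closure \<Omega> \<Longrightarrow> (f has_derivative (\<lambda>h. grad f x \<bullet> h)) (at x)" "continuous_on (closure \<Omega>) (grad f)"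
proof -
  obtain U where U: "open U" "closure \<Omega> \<subseteq> U" "smooth_on U f"
    using assms unfolding smooth_up_to_boundary_def by auto
  show "f \<in> L2 M" "L2v M (grad f)" "has_weak_gradient \<Omega> f (grad f)"
    using smooth_up_L2[OF U] has_weak_gradient_smooth[OF U] by auto
  show "continuous_on (closure \<Omega>) f" "continuous_on (closure \<Omega>) (grad f)"
    using U smooth_on_continuous smooth_on_continuous_grad continuous_on_subset by blast+
  show "(f has_derivative (\<lambda>h. grad f x \<bullet> h)) (at x)" if "x \<in> closure \<Omega>" for x
    using smooth_on_has_derivative[OF U(3,1)] U(2) that by auto
qed

lemma H1_tendstoD:
  assumes "H1_tendsto \<Phi> u G"
  shows "\<And>n. smooth_up_to_boundary \<Omega> (\<Phi> n)" "L2_tendsto M \<Phi> u" "L2v_tendsto M (\<lambda>n. grad (\<Phi> n)) G"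
    "has_weak_gradient \<Omega> u G" "u \<in> L2 M" "L2v M G" "u \<in> H1 \<Omega>"
proof -
  show *: "\<And>n. smooth_up_to_boundary \<Omega> (\<Phi> n)" "L2_tendsto M \<Phi> u" "L2v_tendsto M (\<lambda>n. grad (\<Phi> n)) G"
    using assms by (auto simp: H1_tendsto_def)
  show **: "has_weak_gradient \<Omega> u G"
    by (rule has_weak_gradient_tendsto[OF *(2,3)]) (rule smooth_up_to_boundaryD(3)[OF *(1)])
  show "u \<in> L2 M" "L2v M G" using * by (auto dest: L2_tendstoD L2v_tendstoD)
  then show "u \<in> H1 \<Omega>" using ** by (intro H1_I)
qed

lemma H1_norm_tendsto_iff:
  assumes "\<And>n. smooth_up_to_boundary \<Omega> (\<Phi> n)" "u \<in> L2 M" "has_weak_gradient \<Omega> u G"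
  shows "(\<lambda>n. H1_norm \<Omega> (\<lambda>x. \<Phi> n x - u x)) \<longlonglongrightarrow> 0 \<longleftrightarrow> H1_tendsto \<Phi> u G"
proof -
  note S = smooth_up_to_boundaryD[OF assms(1)]
  note G = has_weak_gradientD(1)[OF assms(3)]
  have eq: "H1_norm \<Omega> (\<lambda>x. \<Phi> n x - u x) =
      sqrt ((L2_norm M (\<lambda>x. \<Phi> n x - u x))\<^sup>2 + (L2_norm M (\<lambda>x. norm (grad (\<Phi> n) x - G x)))\<^sup>2)" for n
    by (intro H1_norm_eq L2_diff has_weak_gradient_diff S assms)
  have Ln: "L2v M (\<lambda>x. grad (\<Phi> n) x - G x)" for n
    using S G by (intro L2v_diff)
  show ?thesis
  proof
    assume H: "H1_tendsto \<Phi> u G"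
    have "(\<lambda>n. sqrt ((L2_norm M (\<lambda>x. \<Phi> n x - u x))\<^sup>2 + (L2_norm M (\<lambda>x. norm (grad (\<Phi> n) x - G x)))\<^sup>2)) \<longlonglongrightarrow> sqrt (0\<^sup>2 + 0\<^sup>2)"
      using H1_tendstoD(2,3)[OF H] by (intro tendsto_intros L2_tendstoD(3) L2v_tendsto_norm_diff)
    then show "(\<lambda>n. H1_norm \<Omega> (\<lambda>x. \<Phi> n x - u x)) \<longlonglongrightarrow> 0"
      by (simp add: eq)
  next
    assume lim: "(\<lambda>n. H1_norm \<Omega> (\<lambda>x. \<Phi> n x - u x)) \<longlonglongrightarrow> 0"
    have "L2_tendsto M \<Phi> u"
      by (rule L2_tendsto_boundI[OF S(1) assms(2) _ lim]) (simp add: eq real_le_rsqrt)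
    moreover have "L2v_tendsto M (\<lambda>n. grad (\<Phi> n)) G"
      unfolding L2v_tendsto_def
    proof
      fix b :: 'a assume b: "b \<in> Basis"
      show "L2_tendsto M (\<lambda>n x. grad (\<Phi> n) x \<bullet> b) (\<lambda>x. G x \<bullet> b)"
      proof (rule L2_tendsto_boundI[OF _ _ _ lim])
        show "L2_norm M (\<lambda>x. grad (\<Phi> n) x \<bullet> b - G x \<bullet> b) \<le> H1_norm \<Omega> (\<lambda>x. \<Phi> n x - u x)" for n
        proof -
          have "L2_norm M (\<lambda>x. grad (\<Phi> n) x \<bullet> b - G x \<bullet> b) \<le> L2_norm M (\<lambda>x. norm (grad (\<Phi> n) x - G x))"
            using Ln[of n] b Basis_le_norm[OF b]
            by (intro L2_norm_mono L2v_norm) (auto simp: inner_diff_left[symmetric] L2v_def dest: L2_D)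
          also have "\<dots> \<le> H1_norm \<Omega> (\<lambda>x. \<Phi> n x - u x)"
            by (simp add: eq real_le_rsqrt)
          finally show ?thesis .
        qed
      qed (use S(2) G b in \<open>auto simp: L2v_def\<close>)
    qed
    ultimately show "H1_tendsto \<Phi> u G" using assms(1) by (simp add: H1_tendsto_def)
  qed
qed

lemma has_traceE:
  assumes "has_trace \<Omega> \<sigma> u f"
  obtains \<Phi> where "H1_tendsto \<Phi> u (weak_grad \<Omega> u)" "f \<in> L2 \<sigma>" "(\<lambda>n. L2_norm \<sigma> (\<lambda>x. \<Phi> n x - f x)) \<longlonglongrightarrow> 0"
proof -
  obtain \<Phi> where \<Phi>: "u \<in> H1 \<Omega>" "f \<in> L2 \<sigma>" "\<And>n. smooth_up_to_boundary \<Omega> (\<Phi> n)"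
      "(\<lambda>n. H1_norm \<Omega> (\<lambda>x. \<Phi> n x - u x)) \<longlonglongrightarrow> 0" "(\<lambda>n. L2_norm \<sigma> (\<lambda>x. \<Phi> n x - f x)) \<longlonglongrightarrow> 0"
    using assms unfolding has_trace_def by blast
  show ?thesis
    by (rule that[OF iffD1[OF H1_norm_tendsto_iff[OF \<Phi>(3) H1_D[OF \<Phi>(1)]] \<Phi>(4)] \<Phi>(2,5)])
qed

lemma has_traceI:
  assumes "H1_tendsto \<Phi> u G" "f \<in> L2 \<sigma>" "(\<lambda>n. L2_norm \<sigma> (\<lambda>x. \<Phi> n x - f x)) \<longlonglongrightarrow> 0"
  shows "has_trace \<Omega> \<sigma> u f"
proof -
  note D = H1_tendstoD[OF assms(1)]
  have "(\<lambda>n. H1_norm \<Omega> (\<lambda>x. \<Phi> n x - u x)) \<longlonglongrightarrow> 0"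
    using H1_norm_tendsto_iff[of \<Phi> u G, OF D(1) D(5,4)] assms(1) by blast
  then show ?thesis
    unfolding has_trace_def using D(1,7) assms(2,3) by blast
qed

end

section \<open>The divergence theorem on the unit ball\<close>

lemma smooth_up_to_boundaryI:
  "open U \<Longrightarrow> closure \<Omega> \<subseteq> U \<Longrightarrow> smooth_on U f \<Longrightarrow> smooth_up_to_boundary \<Omega> f"
  by (auto simp: smooth_up_to_boundary_def)

lemma smooth_up_binary:
  assumes "smooth_up_to_boundary \<Omega> f" "smooth_up_to_boundary \<Omega> g"
    and "\<And>U. open U \<Longrightarrow> smooth_on U f \<Longrightarrow> smooth_on U g \<Longrightarrow> smooth_on U h"
  shows "smooth_up_to_boundary \<Omega> h"
proof -
  obtain U V where "open U" "closure \<Omega> \<subseteq> U" "smooth_on U f" "open V" "closure \<Omega> \<subseteq> V" "smooth_on V g"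
    using assms(1,2) unfolding smooth_up_to_boundary_def by blast
  then show ?thesis
    by (intro smooth_up_to_boundaryI[of "U \<inter> V"] assms(3)) (auto intro: smooth_on_subset)
qed

lemma smooth_up_mult:
  "smooth_up_to_boundary \<Omega> f \<Longrightarrow> smooth_up_to_boundary \<Omega> g \<Longrightarrow> smooth_up_to_boundary \<Omega> (\<lambda>x. f x * g x)"
  by (rule smooth_up_binary[of \<Omega> f g]) (auto intro: smooth_on_mult)

lemma smooth_up_add:
  "smooth_up_to_boundary \<Omega> f \<Longrightarrow> smooth_up_to_boundary \<Omega> g \<Longrightarrow> smooth_up_to_boundary \<Omega> (\<lambda>x. f x + g x)"
  by (rule smooth_up_binary[of \<Omega> f g]) (auto intro: smooth_on_add)

lemma smooth_up_diff:
  "smooth_up_to_boundary \<Omega> f \<Longrightarrow> smooth_up_to_boundary \<Omega> g \<Longrightarrow> smooth_up_to_boundary \<Omega> (\<lambda>x. f x - g x)"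
  by (rule smooth_up_binary[of \<Omega> f g]) (auto intro: smooth_on_diff)

lemma smooth_up_const: "smooth_up_to_boundary \<Omega> (\<lambda>x. c)"
  by (rule smooth_up_to_boundaryI[of UNIV]) auto

lemma smooth_up_cmult: "smooth_up_to_boundary \<Omega> f \<Longrightarrow> smooth_up_to_boundary \<Omega> (\<lambda>x. c * f x)"
  by (intro smooth_up_mult smooth_up_const)

lemma smooth_up_test_function: "test_function \<Omega> \<phi> \<Longrightarrow> smooth_up_to_boundary \<Omega> \<phi>"
  by (rule smooth_up_to_boundaryI[of UNIV]) (auto intro: test_function_smooth)

interpretation unit_ball: bounded_open "ball 0 1 :: 'a::euclidean_space set"
  by unfold_locales auto

abbreviation MB :: "'a::euclidean_space measure" where
  "MB \<equiv> volume_on (ball 0 1)"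

abbreviation smooth_up_ball :: "('a::euclidean_space \<Rightarrow> real) \<Rightarrow> bool" where
  "smooth_up_ball \<equiv> smooth_up_to_boundary (ball 0 1)"

text \<open>Compactness of the closed ball provides the margin. A concentric ball contains the
  segments to the origin along which \<open>radial_primitive\<close> integrates.\<close>

lemma smooth_up_ballE:
  assumes "smooth_up_ball f"
  obtains R where "1 < R" "smooth_on (ball 0 R) f"
proof -
  obtain U where U: "open U" "cball 0 1 \<subseteq> U" "smooth_on U f"
    using assms unfolding smooth_up_to_boundary_def by auto
  obtain e where e: "e > 0" "(\<Union>x\<in>cball 0 1. ball x e) \<subseteq> U"
    using compact_subset_open_imp_ball_epsilon_subset[OF compact_cball U(1,2)] by blast
  have "ball 0 (1 + e) \<subseteq> U"
  proof
    fix y :: 'a assume y: "y \<in> ball 0 (1 + e)"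
    show "y \<in> U"
    proof (cases "norm y \<le> 1")
      case True
      then show ?thesis using U by auto
    next
      case False
      have "y - sgn y = (1 - 1 / norm y) *\<^sub>R y"
        by (simp add: sgn_div_norm scaleR_left_diff_distrib divide_inverse)
      then have "dist (sgn y) y = \<bar>1 - 1 / norm y\<bar> * norm y"
        by (metis dist_commute dist_norm norm_scaleR)
      also have "\<dots> = norm y - 1"
      proof -
        have "1 < norm y" "y \<noteq> 0" using False by auto
        then show ?thesis by (simp add: abs_if field_simps)
      qed
      finally have "y \<in> ball (sgn y) e" using y by simp
      moreover have "sgn y \<in> cball 0 1" by (simp add: norm_sgn)
      ultimately show ?thesis using e(2) by blast
    qed
  qed
  then show ?thesis
    using e(1) U(3) by (intro that[of "1 + e"]) (auto intro: smooth_on_subset)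
qed

section \<open>Dilations and the surface measure of the sphere\<close>

lemma integral_lborel_scale:
  fixes f :: "'a::euclidean_space \<Rightarrow> real"
  assumes [measurable]: "f \<in> borel_measurable borel" and "0 < c"
  shows "(\<integral>x. f x \<partial>lborel) = c ^ DIM('a) * (\<integral>x. f (c *\<^sub>R x) \<partial>lborel)"
proof -
  have "(lborel :: 'a measure) = density (distr lborel borel (\<lambda>x. c *\<^sub>R x)) (\<lambda>_. ennreal (c ^ DIM('a)))"
    using lborel_affine[of c "0 :: 'a"] assms by (simp add: ennreal_power)
  then have "(\<integral>x. f x \<partial>lborel) = (\<integral>x. f x \<partial>density (distr lborel borel (\<lambda>x. c *\<^sub>R x)) (\<lambda>_. ennreal (c ^ DIM('a))))"
    by simp
  also have "\<dots> = (\<integral>x. c ^ DIM('a) *\<^sub>R f x \<partial>distr lborel borel (\<lambda>x. c *\<^sub>R x))"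
    using assms by (intro integral_density) auto
  also have "\<dots> = (\<integral>x. c ^ DIM('a) *\<^sub>R f (c *\<^sub>R x) \<partial>lborel)"
    by (intro integral_distr) auto
  finally show ?thesis by simp
qed

lemma continuous_cball_borel:
  fixes F :: "'a::euclidean_space \<Rightarrow> real"
  assumes "continuous_on (cball 0 1) F"
  shows "(\<lambda>x. indicator (cball 0 1) x * F x) \<in> borel_measurable borel"
  using borel_measurable_continuous_on_indicator[OF _ assms] by simp

lemma sgn_borel [measurable]: "(sgn :: 'a::euclidean_space \<Rightarrow> 'a) \<in> borel_measurable borel"
  unfolding sgn_div_norm[abs_def] by measurable

text \<open>The cone construction of \<open>sphere_measure\<close> is a scaled push-forward of
  volume under \<open>sgn\<close>, so a surface integral becomes a volume integral of the
  0-homogeneous extension of \<open>F\<close>.\<close>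

lemma integral_sphere:
  fixes F :: "'a::euclidean_space \<Rightarrow> real"
  assumes F: "continuous_on (cball 0 1) F"
  shows "(\<integral>x. F x \<partial>sphere_measure) = DIM('a) * (\<integral>x. F (sgn x) \<partial>MB)"
proof -
  define F' where "F' x = indicator (cball 0 1) x * F x" for x
  have [measurable]: "F' \<in> borel_measurable borel"
    unfolding F'_def[abs_def] by (rule continuous_cball_borel[OF F])
  have F': "F' (sgn x) = F (sgn x)" for x
    by (simp add: F'_def norm_sgn)
  let ?S = "restrict_space borel (sphere 0 1) :: 'a measure"
  let ?B = "restrict_space lborel (ball 0 1 - {0}) :: 'a measure"
  have sg: "sgn \<in> measurable ?B ?S"
    by (rule measurable_restrict_space2) (auto simp: space_restrict_space norm_sgn intro!: measurable_restrict_space1)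
  have FS: "F \<in> borel_measurable ?S"
    using F by (intro borel_measurable_continuous_on_restrict) (auto intro: continuous_on_subset)
  have sm: "sphere_measure = density (distr ?B ?S sgn) (\<lambda>_. ennreal (real DIM('a)))"
    unfolding sphere_measure_def
    by (rule measure_eqI) (auto simp: emeasure_density nn_integral_cmult_indicator ennreal_of_nat_eq_real_of_nat)
  have "(\<integral>x. F x \<partial>sphere_measure) = (\<integral>x. real DIM('a) *\<^sub>R F x \<partial>distr ?B ?S sgn)"
    unfolding sm using FS by (intro integral_density) auto
  also have "\<dots> = (\<integral>x. real DIM('a) *\<^sub>R F (sgn x) \<partial>?B)"
    using FS by (intro integral_distr[OF sg]) auto
  also have "\<dots> = real DIM('a) * (\<integral>x. F (sgn x) \<partial>?B)"
    by simp
  also have "(\<integral>x. F (sgn x) \<partial>?B) = (\<integral>x. indicator (ball 0 1 - {0}) x *\<^sub>R F' (sgn x) \<partial>lborel)"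
    by (subst integral_restrict_space) (auto simp: F')
  also have "\<dots> = (\<integral>x. indicator (ball 0 1) x *\<^sub>R F' (sgn x) \<partial>lborel)"
    using AE_lborel_singleton[of "0 :: 'a"]
    by (intro integral_cong_AE) (auto simp: indicator_def)
  also have "\<dots> = (\<integral>x. F (sgn x) \<partial>MB)"
    by (subst unit_ball.integral_M) (simp add: F')
  finally show ?thesis .
qed

lemma space_sphere_measure [simp]: "space (sphere_measure :: 'a::euclidean_space measure) = sphere 0 1"
  by (simp add: sphere_measure_def space_scale_measure space_restrict_space)

lemma finite_sphere_measure: "finite_measure (sphere_measure :: 'a::euclidean_space measure)"
proof (rule finite_measureI)
  let ?S = "restrict_space borel (sphere 0 1) :: 'a measure"
  let ?B = "restrict_space lborel (ball 0 1 - {0}) :: 'a measure"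
  have sg: "sgn \<in> measurable ?B ?S"
    by (rule measurable_restrict_space2) (auto simp: space_restrict_space norm_sgn intro!: measurable_restrict_space1)
  have "emeasure (distr ?B ?S sgn) (space (distr ?B ?S sgn)) = emeasure ?B (space ?B)"
    using sg by (subst emeasure_distr) (auto intro!: arg_cong[where f = "emeasure ?B"] dest: measurable_space
        simp: sets_restrict_space_iff space_restrict_space)
  also have "\<dots> = emeasure lborel (ball 0 1 - {0} :: 'a set)"
    by (simp add: emeasure_restrict_space space_restrict_space)
  also have "\<dots> < \<infinity>"
    by (rule emeasure_bounded_finite) (auto intro: bounded_diff)
  finally show "emeasure (sphere_measure :: 'a measure) (space sphere_measure) \<noteq> \<infinity>"
    unfolding sphere_measure_def
    by (simp add: space_scale_measure ennreal_mult_eq_top_iff)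
qed

lemma continuous_sphere_L2:
  fixes F :: "'a::euclidean_space \<Rightarrow> real"
  assumes F: "continuous_on (cball 0 1) F"
  shows "F \<in> L2 sphere_measure"
proof -
  have "compact (F ` sphere 0 1)"
    using F by (intro compact_continuous_image) (auto intro: continuous_on_subset)
  then obtain C where "\<forall>y\<in>F ` sphere 0 1. norm y \<le> C"
    using compact_imp_bounded bounded_iff by metis
  moreover have "F \<in> borel_measurable (restrict_space borel (sphere 0 1))"
    using F by (intro borel_measurable_continuous_on_restrict) (auto intro: continuous_on_subset)
  then have "F \<in> borel_measurable sphere_measure"
    by (simp add: sphere_measure_def measurable_cong_sets[OF sets_scale_measure refl])
  ultimately show ?thesis
    by (intro L2_bounded[OF finite_sphere_measure, of _ C]) auto
qed

lemma smooth_up_Lipschitz: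
  assumes "smooth_up_ball F"
  obtains L where "0 \<le> L" "\<And>x y. x \<in> cball 0 1 \<Longrightarrow> y \<in> cball 0 1 \<Longrightarrow> \<bar>F x - F y\<bar> \<le> L * norm (x - y)"
proof -
  note S = unit_ball.smooth_up_to_boundaryD[OF assms, unfolded closure_ball[OF zero_less_one]]
  have "compact (grad F ` cball 0 1)"
    using S(6) by (intro compact_continuous_image) auto
  then obtain L where L: "\<forall>y\<in>grad F ` cball 0 1. norm y \<le> L"
    using compact_imp_bounded bounded_iff by metis
  have "norm (F x - F y) \<le> L * norm (x - y)" if xy: "x \<in> cball 0 1" "y \<in> cball 0 1" for x y
  proof (rule differentiable_bound[of "cball 0 1" F "\<lambda>x h. grad F x \<bullet> h"])
    fix z :: 'a assume z: "z \<in> cball 0 1"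
    show "(F has_derivative (\<lambda>h. grad F z \<bullet> h)) (at z within cball 0 1)"
      using S(5)[OF z] by (rule has_derivative_at_withinI)
    show "onorm (\<lambda>h. grad F z \<bullet> h) \<le> L"
    proof (rule onorm_le)
      have "norm (grad F z) \<le> L" using L z by blast
      then show "norm (grad F z \<bullet> h) \<le> L * norm h" for h
        using Cauchy_Schwarz_ineq2[of "grad F z" h] mult_right_mono[of "norm (grad F z)" L "norm h"] by simp
    qed
  qed (use xy in auto)
  moreover have "0 \<le> L"
    using L norm_ge_zero[of "grad F 0"] by (metis centre_in_cball image_eqI order_trans zero_le_one)
  ultimately show ?thesis by (intro that[of L]) auto
qed

text \<open>Dilation by \<open>t\<close> turns the integral of \<open>F(x) - t^d F(t x)\<close> over
  the ball into the integral of \<open>F\<close> over the shell between the radii \<open>t\<close>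
  and 1. Divided by \<open>1 - t\<close>, the former tends to the integral of the divergence of
  \<open>F(x) x\<close>, while on the shell \<open>F\<close> differs from its boundary values only
  by a multiple of \<open>1 - t\<close>.\<close>

theorem divergence_ball:
  fixes F :: "'a::euclidean_space \<Rightarrow> real"
  assumes F: "smooth_up_ball F"
  shows "(\<integral>x. x \<bullet> grad F x + DIM('a) * F x \<partial>MB) = DIM('a) * (\<integral>x. F (sgn x) \<partial>MB)"
proof -
  define d where "d = DIM('a)"
  define t where "t n = 1 - 1 / real (Suc (Suc n))" for n
  have t: "0 < t n" "t n < 1" for n by (auto simp: t_def field_simps)
  have t_lim: "t \<longlonglongrightarrow> 1"
    unfolding t_def by real_asymp
  have t_at: "filterlim t (at 1) sequentially"
    using t_lim t(2) by (intro filterlim_atI) (auto simp: less_imp_neq)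
  note S = unit_ball.smooth_up_to_boundaryD[OF F, unfolded closure_ball[OF zero_less_one]]
  obtain L where L: "0 \<le> L" "\<And>x y. x \<in> cball 0 1 \<Longrightarrow> y \<in> cball 0 1 \<Longrightarrow> \<bar>F x - F y\<bar> \<le> L * norm (x - y)"
    using smooth_up_Lipschitz[OF F] by metis
  obtain C where C: "\<And>x. x \<in> cball 0 1 \<Longrightarrow> \<bar>F x\<bar> \<le> C"
  proof -
    have "compact (F ` cball 0 1)" using S(4) by (intro compact_continuous_image) auto
    then show ?thesis using that compact_imp_bounded bounded_iff by (metis image_eqI real_norm_def)
  qed
  have C0: "0 \<le> C" using C[of 0] by simp
  define F' where "F' x = indicator (cball 0 1) x * F x" for x
  have F'm [measurable]: "F' \<in> borel_measurable borel"
    unfolding F'_def[abs_def] by (rule continuous_cball_borel[OF S(4)])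
  have F': "F' x = F x" if "x \<in> cball 0 1" for x using that by (simp add: F'_def)
  have F'C: "\<bar>F' x\<bar> \<le> C" for x using C C0 by (simp add: F'_def indicator_def)
  \<comment> \<open>The 0-homogeneous extension of the boundary values: its integral over the shell
    is exactly \<open>1 - t^d\<close> times its integral over the ball.\<close>
  define P where "P x = F' (sgn x)" for x
  have Pm [measurable]: "P \<in> borel_measurable borel" unfolding P_def[abs_def] by measurable
  have P_scale: "P (c *\<^sub>R x) = P x" if "0 < c" for c x
    using that by (simp add: P_def sgn_scaleR)
  have P_eq: "P x = F (sgn x)" for x by (simp add: P_def F' norm_sgn)
  define D where "D x = F' x - P x" for x
  have Dm [measurable]: "D \<in> borel_measurable borel" unfolding D_def[abs_def] by measurable
  have PC: "\<bar>P x\<bar> \<le> C" for x using F'C by (simp add: P_def)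
  have DC: "\<bar>D x\<bar> \<le> 2 * C" for x using F'C[of x] PC[of x] by (simp add: D_def)
  have DL: "\<bar>D x\<bar> \<le> L * (1 - norm x)" if "norm x \<le> 1" for x
  proof (cases "x = 0")
    case True
    then show ?thesis using L by (simp add: D_def P_def)
  next
    case False
    have "x - sgn x = (1 - 1 / norm x) *\<^sub>R x"
      by (simp add: sgn_div_norm scaleR_left_diff_distrib divide_inverse)
    then have "norm (x - sgn x) = \<bar>1 - 1 / norm x\<bar> * norm x" by simp
    also have "\<dots> = 1 - norm x" using False that by (simp add: abs_if field_simps)
    finally show ?thesis
      using L(2)[of x "sgn x"] that by (simp add: D_def P_eq F' norm_sgn)
  qed
  define V where "V = (\<integral>x. indicator (ball 0 1 :: 'a set) x \<partial>lborel :: real)"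
  have int_bd: "integrable lborel (\<lambda>x. indicator (ball 0 r) x * g x)"
    if "g \<in> borel_measurable borel" "\<And>x. \<bar>g x\<bar> \<le> K" for r K and g :: "'a \<Rightarrow> real"
  proof (rule Bochner_Integration.integrable_bound)
    show "integrable lborel (\<lambda>x. K * indicator (ball 0 r) x :: real)"
      by (intro integrable_mult_right integrable_real_indicator emeasure_lborel_ball_finite) auto
    show "AE x in lborel. norm (indicator (ball 0 r) x * g x) \<le> norm (K * indicator (ball 0 r) x :: real)"
      using that(2) order_trans[OF that(2) abs_ge_self] by (intro AE_I2) (auto simp: indicator_def)
  qed (use that(1) in \<open>auto intro!: borel_measurable_times borel_measurable_indicator\<close>)
  have scale: "t n ^ d * (\<integral>x. indicator (ball 0 1) x * g (t n *\<^sub>R x) \<partial>lborel) = (\<integral>x. indicator (ball 0 (t n)) x * g x \<partial>lborel)"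
    if [measurable]: "g \<in> borel_measurable borel" for n and g :: "'a \<Rightarrow> real"
  proof -
    have "indicator (ball 0 (t n)) (t n *\<^sub>R x) = (indicator (ball 0 1) x :: real)" for x :: 'a
      using t[of n] by (simp add: indicator_def)
    moreover have "(\<lambda>x. indicator (ball 0 (t n)) x * g x) \<in> borel_measurable borel"
      by (intro borel_measurable_times borel_measurable_indicator) (use that in auto)
    ultimately show ?thesis
      using integral_lborel_scale[of "\<lambda>x. indicator (ball 0 (t n)) x * g x" "t n"] t[of n] by (simp add: d_def)
  qed
  define a where "a n = (\<integral>x. (F x - t n ^ d * F (t n *\<^sub>R x)) / (1 - t n) \<partial>MB)" for n
  have "a \<longlonglongrightarrow> (\<integral>x. x \<bullet> grad F x + DIM('a) * F x \<partial>MB)"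
    unfolding a_def
  proof (rule integral_dominated_convergence[where w = "\<lambda>x. L + real d * C"])
    show "(\<lambda>x. x \<bullet> grad F x + real DIM('a) * F x) \<in> borel_measurable MB"
      using S(4,6) by (intro unit_ball.continuous_measurable_M continuous_intros) (auto elim!: continuous_on_subset)
    show "(\<lambda>x. (F x - t n ^ d * F (t n *\<^sub>R x)) / (1 - t n)) \<in> borel_measurable MB" for n
      using t[of n]
      by (intro unit_ball.continuous_measurable_M continuous_intros continuous_on_compose2[OF S(4)])
         (auto intro!: mult_le_one intro: less_imp_le)
    show "integrable MB (\<lambda>x. L + real d * C)"
      by (rule finite_measure.integrable_const[OF unit_ball.finite_M])
    show "AE x in MB. (\<lambda>n. (F x - t n ^ d * F (t n *\<^sub>R x)) / (1 - t n)) \<longlonglongrightarrow> x \<bullet> grad F x + real DIM('a) * F x"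
    proof (rule AE_I2)
      fix x :: 'a assume "x \<in> space MB"
      then have x: "x \<in> cball 0 1" by simp
      have 1: "((\<lambda>\<tau>. \<tau> *\<^sub>R x) has_derivative (\<lambda>h. h *\<^sub>R x)) (at (1::real))"
        by (auto intro!: derivative_eq_intros)
      have "((\<lambda>\<tau>. F (\<tau> *\<^sub>R x)) has_derivative (\<lambda>h. grad F x \<bullet> (h *\<^sub>R x))) (at 1)"
        by (rule has_derivative_compose[OF 1, of F]) (use S(5)[OF x] in simp)
      then have "((\<lambda>\<tau>. F (\<tau> *\<^sub>R x)) has_real_derivative (x \<bullet> grad F x)) (at 1)"
        by (simp add: has_field_derivative_def inner_commute mult.commute[of _ "x \<bullet> grad F x"])
      then have "((\<lambda>\<tau>. \<tau> ^ d * F (\<tau> *\<^sub>R x)) has_real_derivative (x \<bullet> grad F x + real DIM('a) * F x)) (at 1)"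
        by (auto intro!: derivative_eq_intros simp: d_def)
      then have "((\<lambda>y. (y ^ d * F (y *\<^sub>R x) - F x) / (y - 1)) \<longlongrightarrow> x \<bullet> grad F x + real DIM('a) * F x) (at 1)"
        by (simp add: has_field_derivative_iff)
      from filterlim_compose[OF this t_at]
      have "(\<lambda>n. (t n ^ d * F (t n *\<^sub>R x) - F x) / (t n - 1)) \<longlonglongrightarrow> x \<bullet> grad F x + real DIM('a) * F x" .
      moreover have "(t n ^ d * F (t n *\<^sub>R x) - F x) / (t n - 1) = (F x - t n ^ d * F (t n *\<^sub>R x)) / (1 - t n)" for n
        by (metis minus_diff_eq minus_divide_divide)
      ultimately show "(\<lambda>n. (F x - t n ^ d * F (t n *\<^sub>R x)) / (1 - t n)) \<longlonglongrightarrow> x \<bullet> grad F x + real DIM('a) * F x"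
        by simp
    qed
    show "AE x in MB. norm ((F x - t n ^ d * F (t n *\<^sub>R x)) / (1 - t n)) \<le> L + real d * C" for n
    proof (rule AE_I2)
      fix x :: 'a assume "x \<in> space MB"
      then have x: "norm x \<le> 1" by simp
      have tx: "t n *\<^sub>R x \<in> cball 0 1" using t[of n] x by (auto intro!: mult_le_one intro: less_imp_le)
      have "x - t n *\<^sub>R x = (1 - t n) *\<^sub>R x" by (simp add: scaleR_left_diff_distrib)
      then have "norm (x - t n *\<^sub>R x) \<le> 1 - t n" using t[of n] x by (simp add: mult_left_le)
      then have 1: "\<bar>F x - F (t n *\<^sub>R x)\<bar> \<le> L * (1 - t n)"
        using L(2)[of x "t n *\<^sub>R x"] x tx L(1) by (auto intro: order_trans mult_left_mono)
      \<comment> \<open>Bernoulli's inequality bounds \<open>(1 - t^d) / (1 - t)\<close> by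
        \<open>d\<close>, which supplies the second part of the dominating constant.\<close>
      have "1 + real d * (t n - 1) \<le> (1 + (t n - 1)) ^ d"
        using t[of n] by (intro Bernoulli_inequality) auto
      then have "1 - t n ^ d \<le> real d * (1 - t n)" by (simp add: algebra_simps)
      moreover have "t n ^ d \<le> 1" using t[of n] by (intro power_le_one) auto
      ultimately have 2: "\<bar>(1 - t n ^ d) * F (t n *\<^sub>R x)\<bar> \<le> real d * (1 - t n) * C"
        unfolding abs_mult using C[OF tx] by (intro mult_mono) auto
      have "\<bar>F x - t n ^ d * F (t n *\<^sub>R x)\<bar> = \<bar>(F x - F (t n *\<^sub>R x)) + (1 - t n ^ d) * F (t n *\<^sub>R x)\<bar>"
        by (simp add: algebra_simps)
      also have "\<dots> \<le> L * (1 - t n) + real d * (1 - t n) * C" using 1 2 by linarith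
      finally show "norm ((F x - t n ^ d * F (t n *\<^sub>R x)) / (1 - t n)) \<le> L + real d * C"
        using t[of n] by (simp add: pos_divide_le_eq algebra_simps)
    qed
  qed
  moreover have "a \<longlonglongrightarrow> real d * (\<integral>x. F (sgn x) \<partial>MB)"
  proof -
    \<comment> \<open>The shell integral of the remainder \<open>D\<close>: the integrand is of size
      \<open>1 - t\<close> on a shell whose volume tends to 0, so it is negligible even after
      division by \<open>1 - t\<close>.\<close>
    define e where "e n = (\<integral>x. indicator (ball 0 1) x * D x \<partial>lborel) - t n ^ d * (\<integral>x. indicator (ball 0 1) x * D (t n *\<^sub>R x) \<partial>lborel)" for n
    have e_bound: "\<bar>e n\<bar> \<le> L * (1 - t n) * (V - t n ^ d * V)" for n
    proof -
      have "e n = (\<integral>x. indicator (ball 0 1) x * D x \<partial>lborel) - (\<integral>x. indicator (ball 0 (t n)) x * D x \<partial>lborel)"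
        unfolding e_def by (subst scale) auto
      also have "\<dots> = (\<integral>x. indicator (ball 0 1) x * D x - indicator (ball 0 (t n)) x * D x \<partial>lborel)"
        by (intro Bochner_Integration.integral_diff[symmetric] int_bd[OF Dm DC])
      finally have "\<bar>e n\<bar> \<le> (\<integral>x. \<bar>indicator (ball 0 1) x * D x - indicator (ball 0 (t n)) x * D x\<bar> \<partial>lborel)"
        by (simp add: integral_abs_bound)
      also have "\<dots> \<le> (\<integral>x. L * (1 - t n) * (indicator (ball 0 1 :: 'a set) x * 1 - indicator (ball 0 (t n)) x * 1) \<partial>lborel)"
      proof (rule Bochner_Integration.integral_mono)
        show "integrable lborel (\<lambda>x. \<bar>indicator (ball 0 1) x * D x - indicator (ball 0 (t n)) x * D x\<bar>)"
          by (intro integrable_abs Bochner_Integration.integrable_diff int_bd[OF Dm DC])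
        show "integrable lborel (\<lambda>x::'a. L * (1 - t n) * (indicator (ball 0 1) x * 1 - indicator (ball 0 (t n)) x * 1))"
          by (intro integrable_mult_right Bochner_Integration.integrable_diff int_bd[where K = 1]) auto
        fix x :: 'a
        have "\<bar>D x\<bar> \<le> L * (1 - t n)" if "norm x < 1" "\<not> norm x < t n"
        proof -
          have "L * (1 - norm x) \<le> L * (1 - t n)" using that L(1) by (intro mult_left_mono) auto
          then show ?thesis using DL[of x] that by linarith
        qed
        moreover have "norm x < t n \<Longrightarrow> norm x < 1" using t[of n] by linarith
        ultimately show "\<bar>indicator (ball 0 1) x * D x - indicator (ball 0 (t n)) x * D x\<bar>
            \<le> L * (1 - t n) * (indicator (ball 0 1) x * 1 - indicator (ball 0 (t n)) x * 1)"
          by (auto simp: indicator_def)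
      qed
      also have "\<dots> = L * (1 - t n) * (V - (\<integral>x. indicator (ball 0 (t n) :: 'a set) x * 1 \<partial>lborel))"
        using int_bd[of "\<lambda>x. 1" 1] by (simp add: V_def)
      also have "(\<integral>x. indicator (ball 0 (t n) :: 'a set) x * 1 \<partial>lborel) = t n ^ d * V"
        using scale[of "\<lambda>x. 1" n] by (simp add: V_def)
      finally show ?thesis .
    qed
    have a_eq: "a n = e n / (1 - t n) + (1 - t n ^ d) / (1 - t n) * (\<integral>x. F (sgn x) \<partial>MB)" for n
    proof -
      have eq: "indicator (ball 0 1) x *\<^sub>R ((F x - t n ^ d * F (t n *\<^sub>R x)) / (1 - t n)) =
         (1 / (1 - t n)) * (indicator (ball 0 1) x * D x - t n ^ d * (indicator (ball 0 1) x * D (t n *\<^sub>R x))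
         + (1 - t n ^ d) * (indicator (ball 0 1) x * P x))" for x
      proof (cases "x \<in> ball 0 1")
        case True
        then have "t n *\<^sub>R x \<in> cball 0 1" using t[of n] by (auto intro!: mult_le_one intro: less_imp_le)
        moreover have "x \<in> cball 0 1" using True by simp
        ultimately show ?thesis using True t[of n]
          by (simp add: D_def P_scale F' algebra_simps add_divide_distrib diff_divide_distrib)
      qed simp
      have i1: "integrable lborel (\<lambda>x. indicator (ball 0 1) x * D x)" by (rule int_bd[OF Dm DC])
      have i2: "integrable lborel (\<lambda>x. indicator (ball 0 1) x * D (t n *\<^sub>R x))"
        by (rule int_bd[where K = "2 * C"]) (use DC in auto)
      have i3: "integrable lborel (\<lambda>x. indicator (ball 0 1) x * P x)" by (rule int_bd[OF Pm PC])
      have "a n = (1 / (1 - t n)) * (e n + (1 - t n ^ d) * (\<integral>x. indicator (ball 0 1) x * P x \<partial>lborel))"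
        unfolding a_def unit_ball.integral_M eq e_def using i1 i2 i3 by simp
      also have "(\<integral>x. indicator (ball 0 1) x * P x \<partial>lborel) = (\<integral>x. F (sgn x) \<partial>MB)"
        unfolding unit_ball.integral_M by (simp add: P_eq)
      finally show ?thesis by (simp add: add_divide_distrib)
    qed
    have "(\<lambda>n. e n / (1 - t n)) \<longlonglongrightarrow> 0"
    proof (rule tendsto_rabs_zero_cancel, rule tendsto_sandwich[OF _ _ tendsto_const])
      show "\<forall>\<^sub>F n in sequentially. \<bar>e n / (1 - t n)\<bar> \<le> L * (V - t n ^ d * V)"
      proof (intro always_eventually allI)
        fix n
        have "\<bar>e n / (1 - t n)\<bar> = \<bar>e n\<bar> / (1 - t n)" using t[of n] by (simp add: abs_divide)
        also have "\<dots> \<le> (L * (1 - t n) * (V - t n ^ d * V)) / (1 - t n)"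
          using t[of n] e_bound[of n] by (intro divide_right_mono) auto
        also have "\<dots> = L * (V - t n ^ d * V)" using t[of n] by simp
        finally show "\<bar>e n / (1 - t n)\<bar> \<le> L * (V - t n ^ d * V)" .
      qed
      have "(\<lambda>n. L * (V - t n ^ d * V)) \<longlonglongrightarrow> L * (V - 1 ^ d * V)"
        by (intro tendsto_intros t_lim)
      then show "(\<lambda>n. L * (V - t n ^ d * V)) \<longlonglongrightarrow> 0" by simp
    qed auto
    moreover have "(\<lambda>n. (1 - t n ^ d) / (1 - t n)) \<longlonglongrightarrow> real d"
    proof -
      have "((\<lambda>\<tau>. \<tau> ^ d) has_real_derivative real d) (at (1::real))"
        by (auto intro!: derivative_eq_intros)
      then have "((\<lambda>y::real. (y ^ d - 1) / (y - 1)) \<longlongrightarrow> real d) (at 1)"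
        by (simp add: has_field_derivative_iff)
      from filterlim_compose[OF this t_at] have "(\<lambda>n. (t n ^ d - 1) / (t n - 1)) \<longlonglongrightarrow> real d" .
      moreover have "(t n ^ d - 1) / (t n - 1) = (1 - t n ^ d) / (1 - t n)" for n
        by (metis minus_diff_eq minus_divide_divide)
      ultimately show ?thesis by simp
    qed
    ultimately have "(\<lambda>n. e n / (1 - t n) + (1 - t n ^ d) / (1 - t n) * (\<integral>x. F (sgn x) \<partial>MB)) \<longlonglongrightarrow> 0 + real d * (\<integral>x. F (sgn x) \<partial>MB)"
      by (intro tendsto_intros)
    then show ?thesis by (simp add: a_eq[abs_def])
  qed
  ultimately show ?thesis
    using LIMSEQ_unique unfolding d_def by blast
qed

section \<open>Approximation by smooth functions\<close>

lemma has_derivative_inner_grad_mult: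
  assumes "(f has_derivative (\<lambda>h. F \<bullet> h)) (at x)" "(g has_derivative (\<lambda>h. G \<bullet> h)) (at x)"
  shows "((\<lambda>x. f x * g x) has_derivative (\<lambda>h. (f x *\<^sub>R G + g x *\<^sub>R F) \<bullet> h)) (at x)"
  by (rule has_derivative_eq_rhs[OF has_derivative_mult[OF assms]]) (auto simp: inner_add_left)

lemma smooth_up_ball_has_derivative:
  "smooth_up_ball f \<Longrightarrow> x \<in> ball 0 1 \<Longrightarrow> (f has_derivative (\<lambda>h. grad f x \<bullet> h)) (at x)"
  using unit_ball.smooth_up_to_boundaryD(5)[of f x] by auto

lemma H1_tendsto_add:
  assumes "unit_ball.H1_tendsto \<Phi> u G" "unit_ball.H1_tendsto \<Psi> v H"
  shows "unit_ball.H1_tendsto (\<lambda>n x. \<Phi> n x + \<Psi> n x) (\<lambda>x. u x + v x) (\<lambda>x. G x + H x)"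
proof -
  note D = unit_ball.H1_tendstoD[OF assms(1)] and E = unit_ball.H1_tendstoD[OF assms(2)]
  have g: "grad (\<lambda>x. \<Phi> n x + \<Psi> n x) x = grad (\<Phi> n) x + grad (\<Psi> n) x" if "x \<in> ball 0 1" for n x
    using smooth_up_ball_has_derivative[OF D(1) that, of n] smooth_up_ball_has_derivative[OF E(1) that, of n]
    by (intro grad_eqI) (auto simp: inner_add_left intro!: has_derivative_add)
  have "L2v_tendsto MB (\<lambda>n. grad (\<lambda>x. \<Phi> n x + \<Psi> n x)) (\<lambda>x. G x + H x)"
    by (rule L2v_tendsto_cong[OF L2v_tendsto_add[OF D(3) E(3)]]) (simp_all add: g)
  then show ?thesis
    unfolding unit_ball.H1_tendsto_def using D E by (blast intro: smooth_up_add L2_tendsto_add)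
qed

lemma H1_tendsto_mult:
  assumes a: "smooth_up_ball a" and "unit_ball.H1_tendsto \<Phi> u G"
  shows "unit_ball.H1_tendsto (\<lambda>n x. a x * \<Phi> n x) (\<lambda>x. a x * u x) (\<lambda>x. a x *\<^sub>R G x + u x *\<^sub>R grad a x)"
proof -
  note D = unit_ball.H1_tendstoD[OF assms(2)]
  note S = unit_ball.smooth_up_to_boundaryD[OF a]
  obtain C where C: "\<And>x. x \<in> ball 0 1 \<Longrightarrow> norm (a x) \<le> C"
    using unit_ball.continuous_closure_bounded[OF S(4)] by blast
  obtain C' where C': "\<And>x. x \<in> ball 0 1 \<Longrightarrow> norm (grad a x) \<le> C'"
    using unit_ball.continuous_closure_bounded[OF S(6)] by blast
  have m: "a \<in> borel_measurable MB" "grad a \<in> borel_measurable MB"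
    using S by (auto intro: unit_ball.continuous_closure_measurable)
  have g: "grad (\<lambda>x. a x * \<Phi> n x) x = a x *\<^sub>R grad (\<Phi> n) x + \<Phi> n x *\<^sub>R grad a x" if "x \<in> ball 0 1" for n x
    by (intro grad_eqI has_derivative_inner_grad_mult smooth_up_ball_has_derivative D a that)
  have "L2v_tendsto MB (\<lambda>n x. a x *\<^sub>R grad (\<Phi> n) x + \<Phi> n x *\<^sub>R grad a x) (\<lambda>x. a x *\<^sub>R G x + u x *\<^sub>R grad a x)"
    using C C' m by (intro L2v_tendsto_add L2v_tendsto_scaleR[OF D(3), where C = C] L2v_tendsto_scalar_field[OF D(2), where C = C']) auto
  then have "L2v_tendsto MB (\<lambda>n. grad (\<lambda>x. a x * \<Phi> n x)) (\<lambda>x. a x *\<^sub>R G x + u x *\<^sub>R grad a x)"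
    by (rule L2v_tendsto_cong) (simp_all add: g)
  moreover have "L2_tendsto MB (\<lambda>n x. a x * \<Phi> n x) (\<lambda>x. a x * u x)"
    using C by (intro L2_tendsto_bounded_mult[OF D(2) m(1), where C = C]) auto
  ultimately show ?thesis
    unfolding unit_ball.H1_tendsto_def using D(1) by (blast intro: smooth_up_mult a)
qed

lemma H1_tendsto_cmult:
  assumes "unit_ball.H1_tendsto \<Phi> u G"
  shows "unit_ball.H1_tendsto (\<lambda>n x. c * \<Phi> n x) (\<lambda>x. c * u x) (\<lambda>x. c *\<^sub>R G x)"
proof -
  have "grad (\<lambda>x::'a. c) x = 0" for x by (rule grad_eqI) simp
  then show ?thesis using H1_tendsto_mult[OF smooth_up_const assms, of c] by simp
qed

lemma smooth_up_sphere_L2: "smooth_up_ball f \<Longrightarrow> f \<in> L2 sphere_measure"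
  using unit_ball.smooth_up_to_boundaryD(4)[of f] by (intro continuous_sphere_L2) simp

lemma smooth_up_scaleR_L2v:
  assumes "smooth_up_ball a" "L2v MB F"
  shows "L2v MB (\<lambda>x. a x *\<^sub>R F x)"
proof -
  note a = unit_ball.smooth_up_to_boundaryD(4)[OF assms(1)]
  obtain C where "\<And>x. x \<in> ball 0 1 \<Longrightarrow> norm (a x) \<le> C"
    using unit_ball.continuous_closure_bounded[OF a] by blast
  then show ?thesis
    by (intro L2v_scaleR[where C = C] assms(2) unit_ball.continuous_closure_measurable[OF a]) auto
qed

lemma smooth_up_mult_L2:
  assumes "smooth_up_ball a" "f \<in> L2 MB"
  shows "(\<lambda>x. a x * f x) \<in> L2 MB"
proof -
  note a = unit_ball.smooth_up_to_boundaryD(4)[OF assms(1)]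
  obtain C where "\<And>x. x \<in> ball 0 1 \<Longrightarrow> norm (a x) \<le> C"
    using unit_ball.continuous_closure_bounded[OF a] by blast
  then show ?thesis
    by (intro L2_bounded_mult[where C = C] assms(2) unit_ball.continuous_closure_measurable[OF a]) auto
qed

lemma id_measurable_MB: "(\<lambda>x::'a::euclidean_space. x) \<in> borel_measurable MB"
  by (intro unit_ball.continuous_measurable_M continuous_intros)

section \<open>Hardy's inequality and cut-offs\<close>

lemma inner_self_le_1: "x \<in> cball 0 1 \<Longrightarrow> x \<bullet> x \<le> 1"
  by (simp add: norm_le_square flip: power2_norm_eq_inner)

lemma inner_self_less_1: "x \<in> ball 0 1 \<Longrightarrow> x \<bullet> x < 1"
  using power_less_one_iff[of "norm x" 2] by (simp add: power2_norm_eq_inner)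

text \<open>Integrate the divergence of \<open>f^2 \<mu> x\<close> with
  \<open>\<mu> = 1 / (e + 1 - |x|^2)\<close>. With \<open>p = f \<mu>\<close>, the squares coming
  from the gradient of \<mu> and from the dimension add up to at least \<open>2 p^2\<close>, and the
  mixed term \<open>2 p (x \<bullet> grad f)\<close> costs at most \<open>p^2 + |grad f|^2\<close>.
  On the sphere \<mu> is \<open>1 / e\<close>, whence the boundary term.\<close>

lemma Hardy_ball:
  fixes f :: "'a::euclidean_space \<Rightarrow> real"
  assumes f: "smooth_up_ball f" and e: "0 < e" and d: "2 \<le> DIM('a)"
  shows "(\<integral>x. (f x / (e + (1 - x \<bullet> x)))\<^sup>2 \<partial>MB) \<le>
    (L2_norm sphere_measure f)\<^sup>2 / e + (L2_norm MB (\<lambda>x. norm (grad f x)))\<^sup>2"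
proof -
  define \<mu> where "\<mu> x = inverse (e + (1 - x \<bullet> x))" for x :: 'a
  note s1 = inner_self_le_1[where 'a = 'a]
  have su: "smooth_up_ball \<mu>"
  proof (rule smooth_up_to_boundaryI[where U = "{x. x \<bullet> x < 1 + e}"])
    show "open {x::'a. x \<bullet> x < 1 + e}" by (intro open_Collect_less continuous_intros)
    then show "smooth_on {x. x \<bullet> x < 1 + e} \<mu>"
      unfolding \<mu>_def[abs_def]
      by (intro smooth_on_inverse smooth_on_add smooth_on_diff smooth_on_const smooth_on_inner_self) auto
    show "closure (ball 0 1) \<subseteq> {x::'a. x \<bullet> x < 1 + e}"
      using s1 e by force
  qed
  define F where "F x = f x * f x * \<mu> x" for x
  have suF: "smooth_up_ball F"
    unfolding F_def[abs_def] by (intro smooth_up_mult f su)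
  note Sf = unit_ball.smooth_up_to_boundaryD[OF f]
  note S\<mu> = unit_ball.smooth_up_to_boundaryD[OF su]
  note SF = unit_ball.smooth_up_to_boundaryD[OF suF]
  have lower: "(f x / (e + (1 - x \<bullet> x)))\<^sup>2 - (norm (grad f x))\<^sup>2 \<le> x \<bullet> grad F x + DIM('a) * F x" if x: "x \<in> ball 0 1" for x
  proof -
    let ?g = "grad f x" and ?s = "x \<bullet> x"
    define m where "m = \<mu> x"
    define p where "p = f x * m"
    have xc: "x \<in> cball 0 1" using x by auto
    have sl: "?s \<le> 1" using s1[OF xc] .
    have m: "0 < m" "m * (e + (1 - ?s)) = 1" using e sl by (auto simp: m_def \<mu>_def)
    have df: "(f has_derivative (\<lambda>h. ?g \<bullet> h)) (at x)" using Sf(5) xc by simp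
    have "((\<lambda>s. inverse (e + (1 - s))) has_real_derivative m\<^sup>2) (at ?s)"
      using e sl by (auto intro!: derivative_eq_intros simp: m_def \<mu>_def power2_eq_square)
    from has_derivative_radial[OF this]
    have d\<mu>: "(\<mu> has_derivative (\<lambda>h. ((2 * m\<^sup>2) *\<^sub>R x) \<bullet> h)) (at x)" by (simp add: \<mu>_def[abs_def])
    have "grad F x = (f x * f x) *\<^sub>R ((2 * m\<^sup>2) *\<^sub>R x) + \<mu> x *\<^sub>R (f x *\<^sub>R ?g + f x *\<^sub>R ?g)"
      unfolding F_def[abs_def]
      by (intro grad_eqI has_derivative_inner_grad_mult df d\<mu>)
    then have "x \<bullet> grad F x = (f x * f x) * (2 * m\<^sup>2) * ?s + 2 * m * f x * (x \<bullet> ?g)"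
      by (simp add: inner_add_right m_def algebra_simps)
    also have "\<dots> = 2 * p\<^sup>2 * ?s + 2 * p * (x \<bullet> ?g)"
      by (simp add: p_def power2_eq_square algebra_simps)
    finally have 1: "x \<bullet> grad F x = 2 * p\<^sup>2 * ?s + 2 * p * (x \<bullet> ?g)" .
    have "F x = f x * f x * m * (m * (e + (1 - ?s)))" using m by (simp add: F_def m_def)
    also have "\<dots> = p\<^sup>2 * (e + (1 - ?s))" by (simp add: p_def power2_eq_square algebra_simps)
    finally have 2: "F x = p\<^sup>2 * (e + (1 - ?s))" .
    have "0 \<le> F x" unfolding 2 using e sl by simp
    then have 3: "2 * F x \<le> DIM('a) * F x" using d by (intro mult_right_mono) auto
    have "\<bar>x \<bullet> ?g\<bar> \<le> norm x * norm ?g" by (rule Cauchy_Schwarz_ineq2)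
    also have "\<dots> \<le> 1 * norm ?g" using x by (intro mult_right_mono) auto
    finally have "(x \<bullet> ?g)\<^sup>2 \<le> (norm ?g)\<^sup>2" by (simp add: abs_le_square_iff[symmetric])
    moreover have "- (p\<^sup>2 + (x \<bullet> ?g)\<^sup>2) \<le> 2 * p * (x \<bullet> ?g)"
      using zero_le_power2[of "p + x \<bullet> ?g"] by (simp add: power2_sum)
    ultimately have 4: "- p\<^sup>2 - (norm ?g)\<^sup>2 \<le> 2 * p * (x \<bullet> ?g)" by linarith
    have "f x / (e + (1 - ?s)) = p" by (simp add: p_def m_def \<mu>_def divide_inverse)
    moreover have "p\<^sup>2 * ?s + p\<^sup>2 * (e + (1 - ?s)) = p\<^sup>2 + p\<^sup>2 * e" by (simp add: algebra_simps)
    moreover have "0 \<le> p\<^sup>2 * e" using e by simp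
    ultimately show ?thesis using 1 2 3 4 by simp
  qed
  have c1: "continuous_on (cball 0 1) (\<lambda>x. (f x / (e + (1 - x \<bullet> x))))"
  proof -
    have "\<forall>x\<in>cball (0::'a) 1. e + (1 - x \<bullet> x) \<noteq> (0::real)"
    proof
      fix x :: 'a assume "x \<in> cball 0 1"
      from s1[OF this] e show "e + (1 - x \<bullet> x) \<noteq> 0" by linarith
    qed
    then show ?thesis using Sf(4) by (intro continuous_intros) auto
  qed
  have i1: "integrable MB (\<lambda>x. (f x / (e + (1 - x \<bullet> x)))\<^sup>2)"
    by (intro L2_D(2) unit_ball.continuous_closure_L2) (use c1 in simp)
  have i2: "integrable MB (\<lambda>x. (norm (grad f x))\<^sup>2)"
    by (intro L2_D(2) L2v_norm Sf(2))
  have i3: "integrable MB (\<lambda>x. x \<bullet> grad F x + DIM('a) * F x)"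
    using SF(4,6) by (intro unit_ball.L2_integrable unit_ball.continuous_closure_L2 continuous_intros) auto
  have "(\<integral>x. (f x / (e + (1 - x \<bullet> x)))\<^sup>2 \<partial>MB) - (\<integral>x. (norm (grad f x))\<^sup>2 \<partial>MB) =
      (\<integral>x. (f x / (e + (1 - x \<bullet> x)))\<^sup>2 - (norm (grad f x))\<^sup>2 \<partial>MB)"
    using i1 i2 by simp
  also have "\<dots> \<le> (\<integral>x. x \<bullet> grad F x + DIM('a) * F x \<partial>MB)"
    using lower by (intro Bochner_Integration.integral_mono Bochner_Integration.integrable_diff i1 i2 i3) auto
  also have "\<dots> = (\<integral>x. F x \<partial>sphere_measure)"
    using divergence_ball[OF suF] integral_sphere[of F] SF(4) by simp
  also have "\<dots> = (\<integral>x. (f x)\<^sup>2 / e \<partial>sphere_measure)"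
    by (intro Bochner_Integration.integral_cong refl)
       (auto simp: F_def \<mu>_def norm_eq_1 power2_eq_square divide_inverse)
  also have "\<dots> = (L2_norm sphere_measure f)\<^sup>2 / e"
    by (simp add: L2_norm_square)
  finally show ?thesis by (simp add: L2_norm_square)
qed

text \<open>The order of limits matters: for fixed \<open>e\<close> the boundary term of
  \<open>Hardy_ball\<close> vanishes along \<Phi>, leaving a bound independent of \<open>e\<close>;
  only then does \<open>e\<close> tend to 0, by Fatou's lemma.\<close>

lemma Hardy_trace_zero:
  fixes z :: "'a::euclidean_space \<Rightarrow> real"
  assumes \<Phi>: "unit_ball.H1_tendsto \<Phi> z G" and tr: "(\<lambda>n. L2_norm sphere_measure (\<Phi> n)) \<longlonglongrightarrow> 0"
    and d: "2 \<le> DIM('a)"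
  shows "(\<lambda>x. z x / (1 - x \<bullet> x)) \<in> L2 MB"
proof -
  note D = unit_ball.H1_tendstoD[OF \<Phi>]
  define C where "C = (L2_norm MB (\<lambda>x. norm (G x)))\<^sup>2"
  note s1 = inner_self_less_1[where 'a = 'a]
  have zm [measurable]: "z \<in> borel_measurable MB" using D(5) by (rule L2_D)
  have bound: "(\<integral>x. (z x / (e + (1 - x \<bullet> x)))\<^sup>2 \<partial>MB) \<le> C"
    and L2e: "(\<lambda>x. z x / (e + (1 - x \<bullet> x))) \<in> L2 MB" if e: "0 < e" for e
  proof -
    have m: "(\<lambda>x::'a. 1 / (e + (1 - x \<bullet> x))) \<in> borel_measurable MB"
    proof (intro unit_ball.continuous_measurable_M continuous_intros ballI)
      fix x :: 'a assume "x \<in> ball 0 1"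
      from s1[OF this] e show "e + (1 - x \<bullet> x) \<noteq> 0" by linarith
    qed
    have b: "\<bar>1 / (e + (1 - x \<bullet> x))\<bar> \<le> 1 / e" if "x \<in> space MB" for x :: 'a
      using s1[of x] e that by (simp add: divide_simps)
    have t: "L2_tendsto MB (\<lambda>n x. \<Phi> n x / (e + (1 - x \<bullet> x))) (\<lambda>x. z x / (e + (1 - x \<bullet> x)))"
      using L2_tendsto_bounded_mult[OF D(2) m b] by simp
    show "(\<lambda>x. z x / (e + (1 - x \<bullet> x))) \<in> L2 MB" using t by (rule L2_tendstoD)
    have 1: "(\<lambda>n. \<integral>x. (\<Phi> n x / (e + (1 - x \<bullet> x)))\<^sup>2 \<partial>MB) \<longlonglongrightarrow> (\<integral>x. (z x / (e + (1 - x \<bullet> x)))\<^sup>2 \<partial>MB)"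
      using tendsto_power[OF L2_tendsto_norm[OF t], of 2] unfolding L2_norm_square .
    have "(\<lambda>n. (L2_norm sphere_measure (\<Phi> n))\<^sup>2 / e + (L2_norm MB (\<lambda>x. norm (grad (\<Phi> n) x)))\<^sup>2) \<longlonglongrightarrow> 0\<^sup>2 / e + C"
      unfolding C_def using e by (intro tendsto_intros tr L2v_tendsto_norm D(3)) auto
    then have 2: "(\<lambda>n. (L2_norm sphere_measure (\<Phi> n))\<^sup>2 / e + (L2_norm MB (\<lambda>x. norm (grad (\<Phi> n) x)))\<^sup>2) \<longlonglongrightarrow> C"
      by simp
    show "(\<integral>x. (z x / (e + (1 - x \<bullet> x)))\<^sup>2 \<partial>MB) \<le> C"
      by (rule LIMSEQ_le[OF 1 2]) (use Hardy_ball[OF D(1) e d] in blast)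
  qed
  have m1 [measurable]: "(\<lambda>x::'a. 1 - x \<bullet> x) \<in> borel_measurable MB"
    by (intro unit_ball.continuous_measurable_M continuous_intros)
  show ?thesis
  proof (rule L2_I)
    show meas: "(\<lambda>x. z x / (1 - x \<bullet> x)) \<in> borel_measurable MB" by measurable
    have "(\<integral>\<^sup>+x. ennreal ((z x / (1 - x \<bullet> x))\<^sup>2) \<partial>MB) =
        (\<integral>\<^sup>+x. liminf (\<lambda>n. ennreal ((z x / (1 / real (Suc n) + (1 - x \<bullet> x)))\<^sup>2)) \<partial>MB)"
    proof (rule nn_integral_cong)
      fix x :: 'a assume "x \<in> space MB"
      then have x: "1 - x \<bullet> x \<noteq> 0" using s1[of x] by auto
      have "(\<lambda>n. 1 / real (Suc n)) \<longlonglongrightarrow> 0" by real_asymp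
      then have "(\<lambda>n. ennreal ((z x / (1 / real (Suc n) + (1 - x \<bullet> x)))\<^sup>2)) \<longlonglongrightarrow> ennreal ((z x / (0 + (1 - x \<bullet> x)))\<^sup>2)"
        using x by (intro tendsto_intros tendsto_ennrealI) auto
      from lim_imp_Liminf[OF sequentially_bot this]
      show "ennreal ((z x / (1 - x \<bullet> x))\<^sup>2) = liminf (\<lambda>n. ennreal ((z x / (1 / real (Suc n) + (1 - x \<bullet> x)))\<^sup>2))"
        by simp
    qed
    also have "\<dots> \<le> liminf (\<lambda>n. \<integral>\<^sup>+x. ennreal ((z x / (1 / real (Suc n) + (1 - x \<bullet> x)))\<^sup>2) \<partial>MB)"
      by (intro nn_integral_liminf) measurable
    also have "\<dots> \<le> ennreal C"
    proof (intro Liminf_le always_eventually allI)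
      fix n
      have e: "0 < 1 / real (Suc n)" by simp
      have "(\<integral>\<^sup>+x. ennreal ((z x / (1 / real (Suc n) + (1 - x \<bullet> x)))\<^sup>2) \<partial>MB) =
          ennreal (\<integral>x. (z x / (1 / real (Suc n) + (1 - x \<bullet> x)))\<^sup>2 \<partial>MB)"
        by (intro nn_integral_eq_integral L2_D(2)[OF L2e[OF e]]) auto
      then show "(\<integral>\<^sup>+x. ennreal ((z x / (1 / real (Suc n) + (1 - x \<bullet> x)))\<^sup>2) \<partial>MB) \<le> ennreal C"
        using bound[OF e] by (simp add: ennreal_leI)
    qed simp
    finally show "integrable MB (\<lambda>x. (z x / (1 - x \<bullet> x))\<^sup>2)"
      using meas by (intro integrableI_bounded) (auto simp: le_less_trans)
  qed
qed

text \<open>The shift by 1 makes the function 0 where \<open>1 - |x|^2\<close> is at most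
  \<open>1 / (n + 1)\<close>, hence compactly supported in the open ball. Using
  \<open>x \<bullet> x\<close> keeps it smooth at the origin.\<close>

definition cutoff :: "nat \<Rightarrow> 'a::euclidean_space \<Rightarrow> real" where
  "cutoff n x = ramp (real (Suc n) * (1 - x \<bullet> x) - 1)"

lemma cutoff_bounds: "0 \<le> cutoff n x" "cutoff n x \<le> 1"
  by (auto simp: cutoff_def ramp_bounds)

lemma smooth_on_cutoff: "smooth_on UNIV (cutoff n)"
  unfolding cutoff_def[abs_def]
  by (intro smooth_on_exp_recip smooth_on_diff smooth_on_cmult smooth_on_const smooth_on_inner_self open_UNIV)

lemma test_function_cutoff:
  fixes f :: "'a::euclidean_space \<Rightarrow> real"
  assumes "smooth_up_ball f"
  shows "test_function (ball 0 1) (\<lambda>x. cutoff n x * f x)"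
proof -
  obtain U where U: "open U" "cball 0 1 \<subseteq> U" "smooth_on U f"
    using assms unfolding smooth_up_to_boundary_def by auto
  define K where "K = {x::'a. 1 \<le> real (Suc n) * (1 - x \<bullet> x)}"
  have KB: "K \<subseteq> ball 0 1"
  proof
    fix x assume "x \<in> K"
    then have "0 < real (Suc n) * (1 - x \<bullet> x)" by (simp add: K_def)
    then have "x \<bullet> x < 1" by (simp add: zero_less_mult_iff)
    then show "x \<in> ball 0 1"
      using power_less_one_iff[of "norm x" 2] by (simp add: power2_norm_eq_inner)
  qed
  have "closed K" unfolding K_def by (intro closed_Collect_le continuous_intros)
  moreover have "bounded K" using KB bounded_subset bounded_ball by blast
  ultimately have K: "compact K" by (simp add: compact_eq_bounded_closed)
  show ?thesis
  proof (rule test_functionI[OF U(1) _ K])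
    show "smooth_on U (\<lambda>x. cutoff n x * f x)"
      using U smooth_on_subset[OF smooth_on_cutoff] by (intro smooth_on_mult) auto
    show "cutoff n x * f x = 0" if "x \<notin> K" for x
      using that by (simp add: K_def cutoff_def ramp_eq_0)
  qed (use KB U(2) ball_subset_cball[of "0::'a" 1] in blast)+
qed

lemma cutoff_tendsto_1:
  assumes "x \<in> ball 0 1"
  shows "(\<lambda>n. cutoff n x) \<longlonglongrightarrow> 1"
  unfolding cutoff_def
proof (rule ramp_tendsto_1)
  have "0 < 1 - x \<bullet> x" using inner_self_less_1[OF assms] by simp
  then show "filterlim (\<lambda>n. real (Suc n) * (1 - x \<bullet> x) - 1) at_top sequentially"
    by real_asymp
qed

lemma grad_cutoff:
  "grad (cutoff n) x = (- (2 * real (Suc n) * exp_recip [:0, 0, 1:] (real (Suc n) * (1 - x \<bullet> x) - 1))) *\<^sub>R x"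
proof -
  have d1: "(ramp has_real_derivative exp_recip [:0, 0, 1:] t) (at t)" for t
    using exp_recip_has_derivative[of 1 t] by (simp add: pderiv_1)
  have "((\<lambda>s. ramp (real (Suc n) * (1 - s) - 1)) has_real_derivative
      exp_recip [:0, 0, 1:] (real (Suc n) * (1 - x \<bullet> x) - 1) * (- real (Suc n))) (at (x \<bullet> x))"
    by (rule DERIV_chain2[OF d1]) (auto intro!: derivative_eq_intros)
  from grad_radial[OF this] show ?thesis
    unfolding cutoff_def[abs_def]
    by (rule trans) (intro arg_cong2[where f = scaleR] refl, simp add: mult_ac del: of_nat_Suc)
qed

text \<open>\<open>exp_recip [:0, 0, 1:]\<close> is the derivative of \<open>ramp\<close>. With
  \<open>t = (n + 1) (1 - |x|^2)\<close> the estimate bounds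
  \<open>(1 - |x|^2) |grad (cutoff n)|\<close> uniformly in \<open>n\<close>. In terms of
  \<open>y = 1 / (t - 1)\<close> it reads \<open>(y + y^2) exp(-y) \<le> 3\<close>, which follows
  from \<open>exp y \<ge> 1 + y + y^2 / 2\<close>.\<close>

lemma ramp_deriv_bound: "0 < t \<Longrightarrow> t * exp_recip [:0, 0, 1:] (t - 1) \<le> 3"
proof (cases "t \<le> 1")
  case False
  define y where "y = 1 / (t - 1)"
  have y: "0 < y" "t = 1 + 1 / y" using False by (auto simp: y_def)
  have "t * exp_recip [:0, 0, 1:] (t - 1) = (y + y\<^sup>2) * exp (- y)"
    using False y(1) by (simp add: exp_recip_def y_def[symmetric] power2_eq_square) (simp add: y(2) field_simps)
  also have "\<dots> \<le> 3"
  proof -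
    have "0 \<le> 3 + 2 * y + y\<^sup>2 / 2" using y(1) by simp
    then have "y + y\<^sup>2 \<le> 3 * (1 + y + y\<^sup>2 / 2)" by argo
    also have "\<dots> \<le> 3 * exp y" using exp_lower_Taylor_quadratic[of y] y(1) by simp
    finally show ?thesis by (simp add: exp_minus field_simps)
  qed
  finally show ?thesis .
qed (simp add: exp_recip_def)

lemma ramp_deriv_nonneg: "0 \<le> exp_recip [:0, 0, 1:] t"
  by (simp add: exp_recip_def)

lemma norm_grad_cutoff:
  assumes "x \<in> ball 0 1"
  shows "norm (grad (cutoff n) x) \<le> 6 / (1 - x \<bullet> x)"
proof -
  let ?e = "exp_recip [:0, 0, 1:] (real (Suc n) * (1 - x \<bullet> x) - 1)"
  have s: "0 < 1 - x \<bullet> x" using inner_self_less_1[OF assms] by simp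
  have "norm (grad (cutoff n) x) = (2 * real (Suc n) * ?e) * norm x"
    unfolding grad_cutoff norm_scaleR using ramp_deriv_nonneg[of "real (Suc n) * (1 - x \<bullet> x) - 1"] by simp
  also have "\<dots> \<le> 2 * real (Suc n) * ?e"
    using assms ramp_deriv_nonneg by (intro mult_left_le) auto
  also have "\<dots> \<le> 6 / (1 - x \<bullet> x)"
  proof -
    have "2 * real (Suc n) * ?e * (1 - x \<bullet> x) = 2 * (real (Suc n) * (1 - x \<bullet> x) * ?e)"
      by (simp only: mult_ac)
    also have "\<dots> \<le> 2 * 3"
      using s by (intro mult_left_mono ramp_deriv_bound) auto
    finally show ?thesis using s by (simp add: pos_le_divide_eq)
  qed
  finally show ?thesis .
qed

lemma grad_cutoff_tendsto_0:
  assumes "x \<in> ball 0 1"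
  shows "(\<lambda>n. grad (cutoff n) x) \<longlonglongrightarrow> 0"
proof -
  define c where "c = 1 - x \<bullet> x"
  have c: "0 < c" using inner_self_less_1[OF assms] by (simp add: c_def)
  have "(\<lambda>n. - (2 * real (Suc n) * exp_recip [:0, 0, 1:] (real (Suc n) * c - 1))) \<longlonglongrightarrow> 0"
  proof (rule Lim_transform_eventually)
    show "(\<lambda>n. - (2 * real (Suc n) * ((1 / (real (Suc n) * c - 1))\<^sup>2 * exp (- (1 / (real (Suc n) * c - 1)))))) \<longlonglongrightarrow> 0"
      using c by real_asymp
    have "filterlim (\<lambda>n. real (Suc n) * c) at_top sequentially" using c by real_asymp
    then have "\<forall>\<^sub>F n in sequentially. 1 < real (Suc n) * c" by (simp add: filterlim_at_top_dense)
    then show "\<forall>\<^sub>F n in sequentially. - (2 * real (Suc n) * ((1 / (real (Suc n) * c - 1))\<^sup>2 * exp (- (1 / (real (Suc n) * c - 1))))) =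
        - (2 * real (Suc n) * exp_recip [:0, 0, 1:] (real (Suc n) * c - 1))"
      by eventually_elim (auto simp: exp_recip_def power2_eq_square)
  qed
  from tendsto_scaleR[OF this tendsto_const[of x]] show ?thesis
    unfolding grad_cutoff c_def by simp
qed

text \<open>The gradient of the cut-off is of order \<open>1 / (1 - \<bar>x\<bar>\<^sup>2)\<close> and tends to \<open>0\<close> pointwise,
  so the error terms vanish by dominated convergence as soon as \<open>z X / (1 - \<bar>x\<bar>\<^sup>2)\<close> is integrable.\<close>

lemma divergence_free_pairing:
  fixes X :: "'a::euclidean_space \<Rightarrow> 'a"
  assumes X: "L2v MB X" and div: "\<And>\<phi>. test_function (ball 0 1) \<phi> \<Longrightarrow> (\<integral>x. X x \<bullet> grad \<phi> x \<partial>MB) = 0"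
    and \<Phi>: "unit_ball.H1_tendsto \<Phi> z G"
    and W: "integrable MB W" "\<And>x. x \<in> ball 0 1 \<Longrightarrow> \<bar>z x\<bar> * norm (X x) \<le> (1 - x \<bullet> x) * W x"
  shows "(\<integral>x. X x \<bullet> G x \<partial>MB) = 0"
proof -
  note D = unit_ball.H1_tendstoD[OF \<Phi>]
  have cc: "continuous_on UNIV (cutoff n :: 'a \<Rightarrow> real)" "continuous_on UNIV (grad (cutoff n) :: 'a \<Rightarrow> 'a)" for n
    using smooth_on_continuous[OF smooth_on_cutoff] smooth_on_continuous_grad[OF smooth_on_cutoff] by auto
  have cm: "cutoff n \<in> borel_measurable (MB :: 'a measure)" "grad (cutoff n) \<in> borel_measurable (MB :: 'a measure)" for n
    using cc[of n] by (auto intro!: unit_ball.continuous_measurable_M intro: continuous_on_subset)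
  have L: "L2v_tendsto MB (\<lambda>k x. cutoff n x *\<^sub>R grad (\<Phi> k) x + \<Phi> k x *\<^sub>R grad (cutoff n) x)
      (\<lambda>x. cutoff n x *\<^sub>R G x + z x *\<^sub>R grad (cutoff n) x)" for n
  proof -
    obtain C where "\<And>x. x \<in> ball 0 1 \<Longrightarrow> norm (grad (cutoff n) x :: 'a) \<le> C"
      using unit_ball.continuous_closure_bounded[OF continuous_on_subset[OF cc(2)]] by blast
    then show ?thesis
      using cm
      by (intro L2v_tendsto_add L2v_tendsto_scaleR[OF D(3), where C = 1] L2v_tendsto_scalar_field[OF D(2), where C = C])
         (auto simp: abs_of_nonneg[OF cutoff_bounds(1)] cutoff_bounds(2))
  qed
  \<comment> \<open>For fixed \<open>n\<close> the products \<open>cutoff n * \<Phi> k\<close> are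
    test functions; the limit over \<open>k\<close> puts \<open>z\<close> and \<open>G\<close> in
    the place of \<open>\<Phi> k\<close> and its gradient.\<close>
  have zero: "(\<integral>x. (cutoff n x *\<^sub>R G x + z x *\<^sub>R grad (cutoff n) x) \<bullet> X x \<partial>MB) = 0" for n
  proof -
    have "(\<integral>x. (cutoff n x *\<^sub>R grad (\<Phi> k) x + \<Phi> k x *\<^sub>R grad (cutoff n) x) \<bullet> X x \<partial>MB) = 0" for k
    proof -
      have "grad (\<lambda>x. cutoff n x * \<Phi> k x) x = cutoff n x *\<^sub>R grad (\<Phi> k) x + \<Phi> k x *\<^sub>R grad (cutoff n) x"
        if "x \<in> ball 0 1" for x
        using unit_ball.smooth_up_to_boundaryD(5)[OF D(1)[of k], of x] that
          smooth_on_has_derivative[OF smooth_on_cutoff open_UNIV, of x n]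
        by (intro grad_eqI has_derivative_inner_grad_mult) auto
      then have "(\<integral>x. (cutoff n x *\<^sub>R grad (\<Phi> k) x + \<Phi> k x *\<^sub>R grad (cutoff n) x) \<bullet> X x \<partial>MB) =
          (\<integral>x. X x \<bullet> grad (\<lambda>x. cutoff n x * \<Phi> k x) x \<partial>MB)"
        by (intro Bochner_Integration.integral_cong refl) (simp add: inner_commute)
      then show ?thesis using div[OF test_function_cutoff[OF D(1)]] by simp
    qed
    then show ?thesis
      using L2v_tendsto_inner[OF L[of n] X] by (simp add: LIMSEQ_const_iff)
  qed
  have "(\<lambda>n. \<integral>x. (cutoff n x *\<^sub>R G x + z x *\<^sub>R grad (cutoff n) x) \<bullet> X x \<partial>MB) \<longlonglongrightarrow> (\<integral>x. G x \<bullet> X x \<partial>MB)"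
  proof (rule integral_dominated_convergence[where w = "\<lambda>x. norm (G x) * norm (X x) + 6 * W x"])
    show "(\<lambda>x. G x \<bullet> X x) \<in> borel_measurable MB"
      using L2v_inner_integrable[OF D(6) X] by auto
    show "(\<lambda>x. (cutoff n x *\<^sub>R G x + z x *\<^sub>R grad (cutoff n) x) \<bullet> X x) \<in> borel_measurable MB" for n
      using L2v_inner_integrable[OF L2v_tendstoD(2)[OF L[of n]] X] by auto
    show "integrable MB (\<lambda>x. norm (G x) * norm (X x) + 6 * W x)"
      by (intro Bochner_Integration.integrable_add integrable_mult_right W(1) L2_mult_integrable L2v_norm D(6) X)
    show "AE x in MB. (\<lambda>n. (cutoff n x *\<^sub>R G x + z x *\<^sub>R grad (cutoff n) x) \<bullet> X x) \<longlonglongrightarrow> G x \<bullet> X x"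
    proof (rule AE_I2)
      fix x :: 'a assume "x \<in> space MB"
      then have x: "x \<in> ball 0 1" by simp
      have "(\<lambda>n. (cutoff n x *\<^sub>R G x + z x *\<^sub>R grad (cutoff n) x) \<bullet> X x) \<longlonglongrightarrow> (1 *\<^sub>R G x + z x *\<^sub>R 0) \<bullet> X x"
        by (intro tendsto_intros cutoff_tendsto_1[OF x] grad_cutoff_tendsto_0[OF x])
      then show "(\<lambda>n. (cutoff n x *\<^sub>R G x + z x *\<^sub>R grad (cutoff n) x) \<bullet> X x) \<longlonglongrightarrow> G x \<bullet> X x" by simp
    qed
    show "AE x in MB. norm ((cutoff n x *\<^sub>R G x + z x *\<^sub>R grad (cutoff n) x) \<bullet> X x) \<le> norm (G x) * norm (X x) + 6 * W x" for n
    proof (rule AE_I2)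
      fix x :: 'a assume "x \<in> space MB"
      then have x: "x \<in> ball 0 1" by simp
      have s: "0 < 1 - x \<bullet> x" using inner_self_less_1[OF x] by simp
      have "\<bar>cutoff n x * (G x \<bullet> X x)\<bar> \<le> 1 * (norm (G x) * norm (X x))"
        unfolding abs_mult using cutoff_bounds[of n x] by (intro mult_mono Cauchy_Schwarz_ineq2) auto
      moreover have "\<bar>z x * (grad (cutoff n) x \<bullet> X x)\<bar> \<le> 6 * W x"
      proof -
        have "\<bar>z x * (grad (cutoff n) x \<bullet> X x)\<bar> \<le> \<bar>z x\<bar> * (6 / (1 - x \<bullet> x) * norm (X x))"
          unfolding abs_mult
          by (intro mult_left_mono order_trans[OF Cauchy_Schwarz_ineq2] mult_right_mono norm_grad_cutoff x) auto
        also have "\<dots> = 6 * (\<bar>z x\<bar> * norm (X x)) / (1 - x \<bullet> x)" by simp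
        also have "\<dots> \<le> 6 * W x"
          using W(2)[OF x] s by (simp add: pos_divide_le_eq algebra_simps)
        finally show ?thesis .
      qed
      ultimately show "norm ((cutoff n x *\<^sub>R G x + z x *\<^sub>R grad (cutoff n) x) \<bullet> X x) \<le> norm (G x) * norm (X x) + 6 * W x"
        by (simp add: inner_add_left)
    qed
  qed
  then show ?thesis
    unfolding zero by (simp add: LIMSEQ_const_iff inner_commute)
qed

text \<open>The decay comes from \<open>z\<close>: Hardy's inequality makes
  \<open>z / (1 - |x|^2)\<close> square integrable. Consequently the pairing of a divergence-free
  flux with an extension depends only on the boundary values of the extension.\<close>

lemma divergence_free_trace_zero:
  fixes X :: "'a::euclidean_space \<Rightarrow> 'a"
  assumes X: "L2v MB X" "\<And>\<phi>. test_function (ball 0 1) \<phi> \<Longrightarrow> (\<integral>x. X x \<bullet> grad \<phi> x \<partial>MB) = 0"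
    and \<Phi>: "unit_ball.H1_tendsto \<Phi> z G" "(\<lambda>n. L2_norm sphere_measure (\<Phi> n)) \<longlonglongrightarrow> 0" "2 \<le> DIM('a)"
  shows "(\<integral>x. X x \<bullet> G x \<partial>MB) = 0"
proof (rule divergence_free_pairing[OF X \<Phi>(1)])
  show "integrable MB (\<lambda>x. \<bar>z x / (1 - x \<bullet> x)\<bar> * norm (X x))"
    using Hardy_trace_zero[OF \<Phi>] by (intro L2_mult_integrable L2_abs L2v_norm X)
  show "\<bar>z x\<bar> * norm (X x) \<le> (1 - x \<bullet> x) * (\<bar>z x / (1 - x \<bullet> x)\<bar> * norm (X x))" if "x \<in> ball 0 1" for x
    using inner_self_less_1[OF that] by (simp add: abs_divide)
qed

text \<open>The decay comes from the field instead, so \<open>z\<close> may have arbitrary boundary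
  values; this is the situation of the averaged flux.\<close>

lemma divergence_free_vanishing_boundary:
  fixes X :: "'a::euclidean_space \<Rightarrow> 'a"
  assumes X: "L2v MB X" "\<And>\<phi>. test_function (ball 0 1) \<phi> \<Longrightarrow> (\<integral>x. X x \<bullet> grad \<phi> x \<partial>MB) = 0"
    and Y: "Y \<in> L2 MB" "\<And>x. x \<in> ball 0 1 \<Longrightarrow> norm (X x) \<le> (1 - x \<bullet> x) * Y x"
    and \<Phi>: "unit_ball.H1_tendsto \<Phi> z G"
  shows "(\<integral>x. X x \<bullet> G x \<partial>MB) = 0"
proof (rule divergence_free_pairing[OF X \<Phi>])
  show "integrable MB (\<lambda>x. \<bar>z x\<bar> * Y x)"
    using unit_ball.H1_tendstoD(5)[OF \<Phi>] by (intro L2_mult_integrable L2_abs Y)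
  show "\<bar>z x\<bar> * norm (X x) \<le> (1 - x \<bullet> x) * (\<bar>z x\<bar> * Y x)" if "x \<in> ball 0 1" for x
    using mult_left_mono[OF Y(2)[OF that], of "\<bar>z x\<bar>"] by (simp add: algebra_simps)
qed

section \<open>The Dirichlet problem for the Laplacian\<close>

text \<open>For \<open>\<phi>^2\<close> the divergence theorem has no boundary term and says that
  the dimension times the squared L2 norm of \<phi> is -2 times the L2 product of \<phi> and
  \<open>x \<bullet> grad \<phi>\<close>. Cauchy-Schwarz and \<open>|x| \<le> 1\<close>
  finish.\<close>

lemma Poincare_ball:
  fixes \<phi> :: "'a::euclidean_space \<Rightarrow> real"
  assumes \<phi>: "test_function (ball 0 1) \<phi>"
  shows "L2_norm MB \<phi> \<le> 2 * L2_norm MB (\<lambda>x. norm (grad \<phi> x))"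
proof -
  obtain K where K: "compact K" "K \<subseteq> ball 0 1" "\<forall>x. x \<notin> K \<longrightarrow> \<phi> x = 0"
    using \<phi> unfolding test_function_def by auto
  note S = unit_ball.smooth_up_to_boundaryD[OF smooth_up_test_function[OF \<phi>]]
  have su: "smooth_up_ball (\<lambda>x. \<phi> x * \<phi> x)"
    using smooth_up_test_function[OF \<phi>] by (intro smooth_up_mult)
  note Sq = unit_ball.smooth_up_to_boundaryD[OF su]
  have xL: "(\<lambda>x. x \<bullet> grad \<phi> x) \<in> L2 MB"
    using S by (intro unit_ball.continuous_closure_L2 continuous_intros)
  have "(\<integral>x. x \<bullet> grad (\<lambda>x. \<phi> x * \<phi> x) x + DIM('a) * (\<phi> x * \<phi> x) \<partial>MB) = (\<integral>x. \<phi> x * \<phi> x \<partial>sphere_measure)"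
    using divergence_ball[OF su] integral_sphere[of "\<lambda>x. \<phi> x * \<phi> x"] Sq(4) by simp
  also have "\<dots> = (\<integral>x. 0 \<partial>(sphere_measure :: 'a measure))"
  proof (intro Bochner_Integration.integral_cong refl)
    fix x :: 'a assume "x \<in> space sphere_measure"
    then have "x \<notin> K" using K(2) by auto
    then show "\<phi> x * \<phi> x = 0" using K(3) by simp
  qed
  finally have 0: "(\<integral>x. x \<bullet> grad (\<lambda>x. \<phi> x * \<phi> x) x + DIM('a) * (\<phi> x * \<phi> x) \<partial>MB) = 0" by simp
  have "grad (\<lambda>x. \<phi> x * \<phi> x) x = \<phi> x *\<^sub>R grad \<phi> x + \<phi> x *\<^sub>R grad \<phi> x" if "x \<in> ball 0 1" for x
    using grad_mult[of UNIV] test_function_smooth[OF \<phi>] by simp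
  then have "(\<integral>x. x \<bullet> grad (\<lambda>x. \<phi> x * \<phi> x) x + DIM('a) * (\<phi> x * \<phi> x) \<partial>MB) =
      (\<integral>x. 2 * (\<phi> x * (x \<bullet> grad \<phi> x)) + DIM('a) * (\<phi> x)\<^sup>2 \<partial>MB)"
    by (intro Bochner_Integration.integral_cong refl) (simp add: inner_add_right power2_eq_square)
  also have "\<dots> = 2 * (\<integral>x. \<phi> x * (x \<bullet> grad \<phi> x) \<partial>MB) + DIM('a) * (L2_norm MB \<phi>)\<^sup>2"
    using S(1) xL by (simp add: L2_norm_square L2_mult_integrable L2_D)
  finally have "DIM('a) * (L2_norm MB \<phi>)\<^sup>2 = - 2 * (\<integral>x. \<phi> x * (x \<bullet> grad \<phi> x) \<partial>MB)"
    using 0 by simp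
  also have "\<dots> \<le> 2 * (L2_norm MB \<phi> * L2_norm MB (\<lambda>x. x \<bullet> grad \<phi> x))"
    using L2_Cauchy_Schwarz[OF S(1) xL] by linarith
  also have "L2_norm MB (\<lambda>x. x \<bullet> grad \<phi> x) \<le> L2_norm MB (\<lambda>x. norm (grad \<phi> x))"
  proof (rule L2_norm_mono[OF L2_D(1)[OF xL] L2v_norm[OF S(2)]], rule AE_I2)
    fix x :: 'a assume "x \<in> space MB"
    then have "norm x * norm (grad \<phi> x) \<le> 1 * norm (grad \<phi> x)" by (intro mult_right_mono) auto
    then show "\<bar>x \<bullet> grad \<phi> x\<bar> \<le> \<bar>norm (grad \<phi> x)\<bar>"
      using Cauchy_Schwarz_ineq2[of x "grad \<phi> x"] by simp
  qed
  finally have *: "DIM('a) * (L2_norm MB \<phi>)\<^sup>2 \<le> 2 * (L2_norm MB \<phi> * L2_norm MB (\<lambda>x. norm (grad \<phi> x)))"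
    by (simp add: mult_left_mono)
  have "1 * (L2_norm MB \<phi>)\<^sup>2 \<le> DIM('a) * (L2_norm MB \<phi>)\<^sup>2"
    by (intro mult_right_mono) (auto simp: Suc_leI)
  with * have "L2_norm MB \<phi> * L2_norm MB \<phi> \<le> L2_norm MB \<phi> * (2 * L2_norm MB (\<lambda>x. norm (grad \<phi> x)))"
    by (simp add: power2_eq_square)
  then show ?thesis
    by (cases "L2_norm MB \<phi> = 0") (auto simp: mult_le_cancel_left less_le)
qed

lemma quadratic_nonneg_linear_0:
  fixes a b :: real
  assumes "\<And>t. 0 \<le> t\<^sup>2 * a - 2 * t * b"
  shows "b = 0"
proof (rule ccontr)
  assume b: "b \<noteq> 0"
  show False
  proof (cases "a = 0")
    case True
    then show False using assms[of b] b by (auto simp: mult_le_0_iff)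
  next
    case False
    have "a > 0" using assms[of 1] assms[of "-1"] False by (auto simp: less_le)
    then have "b * b \<le> 0"
      using assms[of "b / a"] by (simp add: field_simps power2_eq_square)
    then show False using b by (auto simp: mult_le_0_iff)
  qed
qed

text \<open>\<open>P\<close> is the orthogonal projection of \<open>G\<close> to the closure of the
  gradients of test functions. A minimising sequence of \<open>J\<close> is Cauchy in the gradients
  by the parallelogram identity and in the functions by \<open>Poincare_ball\<close>; orthogonality
  is the vanishing of the first variation.\<close>

lemma weak_Dirichlet_projection:
  fixes G :: "'a::euclidean_space \<Rightarrow> 'a"
  assumes G: "L2v MB G"
  shows "\<exists>\<phi> p P. (\<forall>n. test_function (ball 0 1) (\<phi> n)) \<and> unit_ball.H1_tendsto \<phi> p P \<and>
    (\<forall>\<psi>. test_function (ball 0 1) \<psi> \<longrightarrow> (\<integral>x. (G x - P x) \<bullet> grad \<psi> x \<partial>MB) = 0)"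
proof -
  let ?T = "test_function (ball 0 1) :: ('a \<Rightarrow> real) \<Rightarrow> bool"
  define J where "J \<phi> = (\<integral>x. (G x - grad \<phi> x) \<bullet> (G x - grad \<phi> x) \<partial>MB)" for \<phi>
  have TL: "L2v MB (grad \<phi>)" if "?T \<phi>" for \<phi> using unit_ball.test_function_L2[OF that] by simp
  have J0: "0 \<le> J \<phi>" for \<phi> by (simp add: J_def)
  define m where "m = (INF \<phi>\<in>Collect ?T. J \<phi>)"
  have ne: "Collect ?T \<noteq> {}"
  proof -
    have "?T (\<lambda>x. 0)" by (rule test_functionI[of UNIV _ "{}"]) auto
    then show ?thesis by blast
  qed
  have bdd: "bdd_below (J ` Collect ?T)" using J0 by (auto intro!: bdd_belowI[of _ 0])
  have m_le: "m \<le> J \<phi>" if "?T \<phi>" for \<phi>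
    unfolding m_def using that by (intro cINF_lower bdd) auto
  have "\<exists>\<phi>. ?T \<phi> \<and> J \<phi> < m + 1 / real (Suc n)" for n
    using cINF_less_iff[OF ne bdd, of "m + 1 / real (Suc n)"] unfolding m_def[symmetric] by auto
  then obtain \<phi> where T\<phi>: "\<And>n. ?T (\<phi> n)" and J\<phi>: "\<And>n. J (\<phi> n) < m + 1 / real (Suc n)"
    by metis
  have diff_bound: "(L2_norm MB (\<lambda>x. norm (grad (\<phi> n) x - grad (\<phi> k) x)))\<^sup>2 \<le> 2 / real (Suc n) + 2 / real (Suc k)" for n k
  proof -
    \<comment> \<open>The midpoint is again a test function, so \<open>J\<close> is at least
      \<open>m\<close> there; the parallelogram identity then forces the two gradients
      together.\<close>
    let ?mid = "\<lambda>x. (1/2) * (\<phi> n x + \<phi> k x)"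
    have Tm: "?T ?mid" by (intro test_function_cmult test_function_add T\<phi>)
    have gm: "grad ?mid x = (1/2) *\<^sub>R (grad (\<phi> n) x + grad (\<phi> k) x)" for x
      using test_function_smooth[OF T\<phi>] by (subst grad_cmult[of UNIV]) (auto intro: smooth_on_add simp: grad_add[of UNIV])
    have Ji: "integrable MB (\<lambda>x. (G x - grad \<psi> x) \<bullet> (G x - grad \<psi> x))" if "?T \<psi>" for \<psi>
      by (intro L2v_inner_integrable L2v_diff G TL that)
    have "(L2_norm MB (\<lambda>x. norm (grad (\<phi> n) x - grad (\<phi> k) x)))\<^sup>2 =
       (\<integral>x. 2 * ((G x - grad (\<phi> n) x) \<bullet> (G x - grad (\<phi> n) x)) + 2 * ((G x - grad (\<phi> k) x) \<bullet> (G x - grad (\<phi> k) x))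
          - 4 * ((G x - grad ?mid x) \<bullet> (G x - grad ?mid x)) \<partial>MB)"
      unfolding L2_norm_square
    proof (intro Bochner_Integration.integral_cong refl)
      fix x
      have "(norm (A - B))\<^sup>2 = 2 * ((g - A) \<bullet> (g - A)) + 2 * ((g - B) \<bullet> (g - B))
          - 4 * ((g - (1/2) *\<^sub>R (A + B)) \<bullet> (g - (1/2) *\<^sub>R (A + B)))" for g A B :: 'a
        unfolding power2_norm_eq_inner
        by (simp add: inner_diff_left inner_diff_right inner_add_left inner_add_right inner_commute field_simps)
      then show "(norm (grad (\<phi> n) x - grad (\<phi> k) x))\<^sup>2 = 2 * ((G x - grad (\<phi> n) x) \<bullet> (G x - grad (\<phi> n) x)) + 2 * ((G x - grad (\<phi> k) x) \<bullet> (G x - grad (\<phi> k) x))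
          - 4 * ((G x - grad ?mid x) \<bullet> (G x - grad ?mid x))"
        unfolding gm .
    qed
    also have "\<dots> = 2 * J (\<phi> n) + 2 * J (\<phi> k) - 4 * J ?mid"
      unfolding J_def using Ji[OF T\<phi>[of n]] Ji[OF T\<phi>[of k]] Ji[OF Tm] by simp
    also have "\<dots> \<le> 2 * (m + 1 / real (Suc n)) + 2 * (m + 1 / real (Suc k)) - 4 * m"
    proof -
      define j where "j = J ?mid"
      show ?thesis using J\<phi>[of n] J\<phi>[of k] m_le[OF Tm] unfolding j_def[symmetric] by argo
    qed
    finally show ?thesis
      by (simp del: of_nat_Suc)
  qed
  have small: "\<exists>N. \<forall>n\<ge>N. \<forall>k\<ge>N. L2_norm MB (\<lambda>x. norm (grad (\<phi> n) x - grad (\<phi> k) x)) < e" if e: "0 < e" for e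
  proof -
    obtain N where N: "4 / e\<^sup>2 < real N" using reals_Archimedean2 by blast
    have "L2_norm MB (\<lambda>x. norm (grad (\<phi> n) x - grad (\<phi> k) x)) < e" if "N \<le> n" "N \<le> k" for n k
    proof -
      have N0: "0 < real N" using N e by (smt (verit) divide_pos_pos zero_less_power)
      have "2 / real (Suc n) \<le> 2 / real N" "2 / real (Suc k) \<le> 2 / real N"
        using that N0 by (auto intro!: divide_left_mono)
      then have "(L2_norm MB (\<lambda>x. norm (grad (\<phi> n) x - grad (\<phi> k) x)))\<^sup>2 \<le> 4 / real N"
        using diff_bound[of n k] by simp
      also have "\<dots> < e\<^sup>2" using N e N0 by (simp add: field_simps)
      finally show ?thesis using e by (meson less_imp_le power2_less_imp_less)
    qed
    then show ?thesis by blast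
  qed
  have "\<exists>P. L2v_tendsto MB (\<lambda>n. grad (\<phi> n)) P"
  proof (rule L2v_complete)
    show "L2v MB (grad (\<phi> n))" for n by (rule TL[OF T\<phi>])
    fix b :: 'a and e :: real assume b: "b \<in> Basis" and "0 < e"
    then obtain N where N: "\<And>n k. n \<ge> N \<Longrightarrow> k \<ge> N \<Longrightarrow> L2_norm MB (\<lambda>x. norm (grad (\<phi> n) x - grad (\<phi> k) x)) < e"
      using small by blast
    have "L2_norm MB (\<lambda>x. grad (\<phi> n) x \<bullet> b - grad (\<phi> k) x \<bullet> b) \<le> L2_norm MB (\<lambda>x. norm (grad (\<phi> n) x - grad (\<phi> k) x))" for n k
      using L2v_diff[OF TL[OF T\<phi>[of n]] TL[OF T\<phi>[of k]]] b Basis_le_norm[OF b]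
      by (intro L2_norm_mono L2v_norm) (auto simp: inner_diff_left[symmetric] L2v_def dest: L2_D)
    with N show "\<exists>N. \<forall>n\<ge>N. \<forall>k\<ge>N. L2_norm MB (\<lambda>x. grad (\<phi> n) x \<bullet> b - grad (\<phi> k) x \<bullet> b) < e"
      by (meson le_less_trans)
  qed
  then obtain P where P: "L2v_tendsto MB (\<lambda>n. grad (\<phi> n)) P" by blast
  have "\<exists>p. L2_tendsto MB \<phi> p"
  proof (rule L2_complete)
    show "\<phi> n \<in> L2 MB" for n using unit_ball.test_function_L2[OF T\<phi>] by simp
    fix e :: real assume "0 < e"
    then have "0 < e / 2" by simp
    then obtain N where N: "\<And>n k. n \<ge> N \<Longrightarrow> k \<ge> N \<Longrightarrow> L2_norm MB (\<lambda>x. norm (grad (\<phi> n) x - grad (\<phi> k) x)) < e / 2"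
      using small by blast
    have "L2_norm MB (\<lambda>x. \<phi> n x - \<phi> k x) \<le> 2 * L2_norm MB (\<lambda>x. norm (grad (\<phi> n) x - grad (\<phi> k) x))" for n k
      using Poincare_ball[OF test_function_diff[OF T\<phi>[of n] T\<phi>[of k]]] test_function_smooth[OF T\<phi>]
      by (simp add: grad_diff[of UNIV])
    with N show "\<exists>N. \<forall>n\<ge>N. \<forall>k\<ge>N. L2_norm MB (\<lambda>x. \<phi> n x - \<phi> k x) < e"
      by (intro exI[of _ N]) (smt (verit) field_sum_of_halves)
  qed
  then obtain p where p: "L2_tendsto MB \<phi> p" by blast
  have H: "unit_ball.H1_tendsto \<phi> p P"
    unfolding unit_ball.H1_tendsto_def using p P smooth_up_test_function[OF T\<phi>] by blast
  have "(\<integral>x. (G x - P x) \<bullet> grad \<psi> x \<partial>MB) = 0" if \<psi>: "?T \<psi>" for \<psi>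
  proof (rule quadratic_nonneg_linear_0)
    fix t :: real
    let ?a = "\<integral>x. grad \<psi> x \<bullet> grad \<psi> x \<partial>MB"
    \<comment> \<open>The defect \<open>1 / (n + 1)\<close> replaces exact minimality of
      \<open>\<phi> n\<close>: it disappears in the limit and leaves a nonnegative quadratic in
      \<open>t\<close> with zero constant term.\<close>
    have ineq: "- (1 / real (Suc n)) \<le> t\<^sup>2 * ?a - 2 * t * (\<integral>x. (G x - grad (\<phi> n) x) \<bullet> grad \<psi> x \<partial>MB)" for n
    proof -
      let ?f = "\<lambda>x. \<phi> n x + t * \<psi> x"
      have Tf: "?T ?f" by (intro test_function_add test_function_cmult T\<phi> \<psi>)
      have gf: "grad ?f x = grad (\<phi> n) x + t *\<^sub>R grad \<psi> x" for x
        using test_function_smooth[OF T\<phi>] test_function_smooth[OF \<psi>]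
        by (subst grad_add[of UNIV]) (auto intro: smooth_on_cmult simp: grad_cmult[of UNIV])
      have "J ?f = (\<integral>x. (G x - grad (\<phi> n) x) \<bullet> (G x - grad (\<phi> n) x) - 2 * t * ((G x - grad (\<phi> n) x) \<bullet> grad \<psi> x)
          + t\<^sup>2 * (grad \<psi> x \<bullet> grad \<psi> x) \<partial>MB)"
        unfolding J_def gf
        by (intro Bochner_Integration.integral_cong refl)
           (simp add: inner_diff_left inner_diff_right inner_add_left inner_add_right inner_commute algebra_simps power2_eq_square)
      also have "\<dots> = J (\<phi> n) - 2 * t * (\<integral>x. (G x - grad (\<phi> n) x) \<bullet> grad \<psi> x \<partial>MB) + t\<^sup>2 * ?a"
        unfolding J_def using G TL[OF T\<phi>] TL[OF \<psi>] by (simp add: L2v_inner_integrable L2v_diff)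
      finally show ?thesis using m_le[OF Tf] J\<phi>[of n] by linarith
    qed
    have "L2v_tendsto MB (\<lambda>n x. G x - grad (\<phi> n) x) (\<lambda>x. G x - P x)"
      by (intro L2v_tendsto_diff L2v_tendsto_const G P)
    from L2v_tendsto_inner[OF this TL[OF \<psi>]]
    have "(\<lambda>n. t\<^sup>2 * ?a - 2 * t * (\<integral>x. (G x - grad (\<phi> n) x) \<bullet> grad \<psi> x \<partial>MB)) \<longlonglongrightarrow>
        t\<^sup>2 * ?a - 2 * t * (\<integral>x. (G x - P x) \<bullet> grad \<psi> x \<partial>MB)"
      by (intro tendsto_intros)
    moreover have "(\<lambda>n. - (1 / real (Suc n))) \<longlonglongrightarrow> 0" by real_asymp
    ultimately show "0 \<le> t\<^sup>2 * ?a - 2 * t * (\<integral>x. (G x - P x) \<bullet> grad \<psi> x \<partial>MB)"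
      using ineq by (intro LIMSEQ_le[of "\<lambda>n. - (1 / real (Suc n))"]) auto
  qed
  then show ?thesis using T\<phi> H by blast
qed

text \<open>From an arbitrary extension of \<open>f\<close> subtract the function \<open>p\<close>
  whose gradient is the projection of the gradient of the extension. As \<open>p\<close> is a limit
  of test functions, which vanish on the sphere, the boundary values stay \<open>f\<close>.\<close>

lemma harmonic_extension:
  fixes f :: "'a::euclidean_space \<Rightarrow> real"
  assumes "has_trace (ball 0 1) sphere_measure u f"
  obtains \<Phi> u0 G0 where "unit_ball.H1_tendsto \<Phi> u0 G0" "f \<in> L2 sphere_measure"
    "(\<lambda>n. L2_norm sphere_measure (\<lambda>x. \<Phi> n x - f x)) \<longlonglongrightarrow> 0"
    "\<And>\<psi>. test_function (ball 0 1) \<psi> \<Longrightarrow> (\<integral>x. G0 x \<bullet> grad \<psi> x \<partial>MB) = 0"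
proof -
  obtain \<Psi> where \<Psi>: "unit_ball.H1_tendsto \<Psi> u (weak_grad (ball 0 1) u)" "f \<in> L2 sphere_measure"
      "(\<lambda>n. L2_norm sphere_measure (\<lambda>x. \<Psi> n x - f x)) \<longlonglongrightarrow> 0"
    using unit_ball.has_traceE[OF assms] by blast
  let ?G = "weak_grad (ball 0 1) u"
  note D = unit_ball.H1_tendstoD[OF \<Psi>(1)]
  obtain \<phi> p P where \<phi>: "\<And>n. test_function (ball 0 1) (\<phi> n)" "unit_ball.H1_tendsto \<phi> p P"
      "\<And>\<psi>. test_function (ball 0 1) \<psi> \<Longrightarrow> (\<integral>x. (?G x - P x) \<bullet> grad \<psi> x \<partial>MB) = 0"
    using weak_Dirichlet_projection[OF D(6)] by blast
  have "unit_ball.H1_tendsto (\<lambda>n x. \<Psi> n x + (-1) * \<phi> n x) (\<lambda>x. u x + (-1) * p x) (\<lambda>x. ?G x + (-1) *\<^sub>R P x)"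
    by (intro H1_tendsto_add H1_tendsto_cmult \<Psi>(1) \<phi>(2))
  then have "unit_ball.H1_tendsto (\<lambda>n x. \<Psi> n x - \<phi> n x) (\<lambda>x. u x - p x) (\<lambda>x. ?G x - P x)"
    by simp
  moreover have "L2_norm sphere_measure (\<lambda>x. \<Psi> n x - \<phi> n x - f x) = L2_norm sphere_measure (\<lambda>x. \<Psi> n x - f x)" for n
  proof -
    obtain K where K: "K \<subseteq> ball 0 1" "\<forall>x. x \<notin> K \<longrightarrow> \<phi> n x = 0"
      using \<phi>(1)[of n] unfolding test_function_def by auto
    have "\<phi> n x = 0" if "x \<in> space sphere_measure" for x
    proof -
      have "x \<notin> K" using K(1) that by auto
      then show ?thesis using K(2) by simp
    qed
    then show ?thesis
      unfolding L2_norm_def by (intro arg_cong[where f = sqrt] Bochner_Integration.integral_cong refl) simp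
  qed
  ultimately show ?thesis
    using \<Psi>(2,3) \<phi>(3) by (intro that[of "\<lambda>n x. \<Psi> n x - \<phi> n x" "\<lambda>x. u x - p x" "\<lambda>x. ?G x - P x"]) auto
qed

section \<open>The radial primitive of a harmonic function\<close>

text \<open>\<open>radial_primitive p \<psi>\<close> is \<open>\<integral>\<^sub>0\<^sup>1 t\<^bsup>(p - 1) / 2\<^esup> \<psi> (t x) dt\<close> after the substitution \<open>t = \<tau>\<^sup>2\<close>,
  which makes the integrand smooth in \<open>\<tau>\<close>. It inverts \<open>x \<bullet> \<nabla> + (p + 1) / 2\<close>, and it commutes with
  the Laplacian up to a shift of \<open>p\<close>.\<close>

definition radial_primitive :: "nat \<Rightarrow> ('a::euclidean_space \<Rightarrow> real) \<Rightarrow> 'a \<Rightarrow> real" where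
  "radial_primitive p \<psi> x = integral {0..1} (\<lambda>\<tau>. 2 * \<tau> ^ p * \<psi> (\<tau>\<^sup>2 *\<^sub>R x))"

lemma square_mult_norm_less:
  "0 \<le> \<tau> \<Longrightarrow> \<tau> \<le> (1::real) \<Longrightarrow> norm x < R \<Longrightarrow> \<tau>\<^sup>2 * norm x < R"
  using mult_left_le_one_le[of "norm x" "\<tau>\<^sup>2"] by (simp add: power_le_one)

lemma square_scaleR_ball:
  fixes x :: "'a::real_normed_vector"
  shows "0 \<le> \<tau> \<Longrightarrow> \<tau> \<le> (1::real) \<Longrightarrow> x \<in> ball 0 R \<Longrightarrow> \<tau>\<^sup>2 *\<^sub>R x \<in> ball 0 R"
  using square_mult_norm_less[of \<tau> x R] by simp

lemma radial_integrand_continuous: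
  fixes \<psi> :: "'a::euclidean_space \<Rightarrow> 'b::real_normed_vector"
  assumes "continuous_on (ball 0 R) \<psi>"
  shows "continuous_on (ball 0 R \<times> {0..1}) (\<lambda>(x, \<tau>). (2 * \<tau> ^ p) *\<^sub>R \<psi> (\<tau>\<^sup>2 *\<^sub>R x))"
  unfolding case_prod_beta
  by (intro continuous_intros continuous_on_compose2[OF assms])
     (auto intro: square_mult_norm_less)

lemma radial_integrand_continuous':
  fixes \<psi> :: "'a::euclidean_space \<Rightarrow> 'b::real_normed_vector"
  assumes "continuous_on (ball 0 R) \<psi>" "x \<in> ball 0 R"
  shows "continuous_on {0..1} (\<lambda>\<tau>. (2 * \<tau> ^ p) *\<^sub>R \<psi> (\<tau>\<^sup>2 *\<^sub>R x))"
  by (intro continuous_intros continuous_on_compose2[OF assms(1)])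
     (use assms(2) in \<open>auto intro: square_mult_norm_less\<close>)

text \<open>Differentiation under the integral; the inner factor \<open>\<tau>^2\<close> raises the
  weight from \<open>p\<close> to \<open>p + 2\<close>. The Leibniz rule takes derivatives as
  bounded linear functions, hence the passage through \<open>blinfun_inner_right\<close>.\<close>

lemma radial_primitive_has_derivative:
  fixes \<psi> :: "'a::euclidean_space \<Rightarrow> real"
  assumes d: "\<And>x. x \<in> ball 0 R \<Longrightarrow> (\<psi> has_derivative (\<lambda>h. grad \<psi> x \<bullet> h)) (at x)"
    and c: "continuous_on (ball 0 R) (grad \<psi>)" and x: "x \<in> ball 0 R"
  shows "(radial_primitive p \<psi> has_derivative (\<lambda>h. radial_primitive (p + 2) (\<lambda>y. grad \<psi> y \<bullet> h) x)) (at x)"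
proof -
  let ?fx = "\<lambda>x \<tau>. (2 * \<tau> ^ (p + 2)) *\<^sub>R blinfun_inner_right (grad \<psi> (\<tau>\<^sup>2 *\<^sub>R x))"
  have c0: "continuous_on (ball 0 R) \<psi>"
    using d by (intro continuous_at_imp_continuous_on ballI has_derivative_continuous) auto
  have cb: "continuous_on (ball 0 R) (\<lambda>y. blinfun_inner_right (grad \<psi> y))"
    by (rule bounded_linear.continuous_on[OF bounded_linear_blinfun_inner_right c])
  have A: "((\<lambda>x. integral (cbox 0 1) (\<lambda>\<tau>. 2 * \<tau> ^ p * \<psi> (\<tau>\<^sup>2 *\<^sub>R x))) has_derivative
      blinfun_apply (integral (cbox 0 1) (?fx x))) (at x within ball 0 R)"
  proof (rule leibniz_rule[OF _ _ _ x convex_ball])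
    fix y :: 'a and \<tau> :: real assume y: "y \<in> ball 0 R" and \<tau>: "\<tau> \<in> cbox 0 1"
    have 1: "((\<lambda>x. \<tau>\<^sup>2 *\<^sub>R x) has_derivative (\<lambda>h. \<tau>\<^sup>2 *\<^sub>R h)) (at y within ball 0 R)"
      by (auto intro!: derivative_eq_intros)
    have 2: "(\<psi> has_derivative (\<lambda>h. grad \<psi> (\<tau>\<^sup>2 *\<^sub>R y) \<bullet> h)) (at (\<tau>\<^sup>2 *\<^sub>R y))"
      using d square_scaleR_ball[of \<tau> y R] y \<tau> by auto
    show "((\<lambda>x. 2 * \<tau> ^ p * \<psi> (\<tau>\<^sup>2 *\<^sub>R x)) has_derivative blinfun_apply (?fx y \<tau>)) (at y within ball 0 R)"
      by (rule has_derivative_eq_rhs[OF has_derivative_mult_right[OF has_derivative_compose[OF 1 2], of "2 * \<tau> ^ p"]])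
         (auto simp: fun_eq_iff power_add power2_eq_square scaleR_blinfun.rep_eq)
  next
    show "(\<lambda>\<tau>. 2 * \<tau> ^ p * \<psi> (\<tau>\<^sup>2 *\<^sub>R y)) integrable_on cbox 0 1" if "y \<in> ball 0 R" for y
      using radial_integrand_continuous'[OF c0 that, of p] by (auto intro!: integrable_continuous_interval)
    show "continuous_on (ball 0 R \<times> cbox 0 1) (\<lambda>(x, \<tau>). ?fx x \<tau>)"
      using radial_integrand_continuous[OF cb, of "p + 2"] by simp
  qed
  have B: "blinfun_apply (integral (cbox 0 1) (?fx x)) h = radial_primitive (p + 2) (\<lambda>y. grad \<psi> y \<bullet> h) x" for h
  proof -
    have "?fx x integrable_on {0..1}"
      by (intro integrable_continuous_interval radial_integrand_continuous'[OF cb x])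
    then have "(?fx x has_integral integral (cbox 0 1) (?fx x)) (cbox 0 1)"
      by (auto simp: has_integral_integral)
    from has_integral_linear[OF this blinfun.bounded_linear_left[of h]]
    show ?thesis
      unfolding radial_primitive_def
      by (intro integral_unique[symmetric]) (simp add: o_def scaleR_blinfun.rep_eq)
  qed
  have "radial_primitive p \<psi> = (\<lambda>x. integral (cbox 0 1) (\<lambda>\<tau>. 2 * \<tau> ^ p * \<psi> (\<tau>\<^sup>2 *\<^sub>R x)))"
    by (simp add: radial_primitive_def fun_eq_iff)
  then show ?thesis
    using has_derivative_eq_rhs[OF A[unfolded at_within_open[OF x open_ball]] ext[OF B]] by simp
qed

lemma Ck_on_radial_primitive:
  "Ck_on k (ball 0 R) \<psi> \<Longrightarrow> Ck_on k (ball 0 R) (radial_primitive p \<psi>)"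
proof (induction k arbitrary: p \<psi>)
  case 0
  then have "continuous_on (ball 0 R) \<psi>" by simp
  from radial_integrand_continuous[OF this, of p]
  have "continuous_on (ball 0 R \<times> cbox 0 1) (\<lambda>(x, \<tau>). 2 * \<tau> ^ p * \<psi> (\<tau>\<^sup>2 *\<^sub>R x))" by simp
  from integral_continuous_on_param[OF this] show ?case
    by (simp add: radial_primitive_def[abs_def])
next
  case (Suc k)
  show ?case
  proof (rule Ck_on_SucI'[OF open_ball])
    fix b :: 'a assume "b \<in> Basis"
    then show "Ck_on k (ball 0 R) (\<lambda>x. radial_primitive (p + 2) (\<lambda>y. grad \<psi> y \<bullet> b) x)"
      using Suc.IH[OF Ck_on_partial[OF Suc.prems]] by simp
  next
    fix x :: 'a assume x: "x \<in> ball 0 R"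
    have "continuous_on (ball 0 R) (\<lambda>x. grad \<psi> x \<bullet> b)" if "b \<in> Basis" for b
    proof -
      have "Ck_on j (ball 0 R) f \<Longrightarrow> continuous_on (ball 0 R) f" for j and f :: "'a \<Rightarrow> real"
        by (cases j) (auto intro: differentiable_imp_continuous_on)
      then show ?thesis using Ck_on_partial[OF Suc.prems that] by blast
    qed
    then have "continuous_on (ball 0 R) (grad \<psi>)"
      by (subst continuous_on_componentwise) auto
    then show "(radial_primitive p \<psi> has_derivative (\<lambda>h. radial_primitive (p + 2) (\<lambda>y. grad \<psi> y \<bullet> h) x)) (at x)"
      by (intro radial_primitive_has_derivative[OF _ _ x] Ck_on_has_derivative[OF Suc.prems open_ball])
  qed auto
qed

lemma smooth_on_radial_primitive:
  "smooth_on (ball 0 R) \<psi> \<Longrightarrow> smooth_on (ball 0 R) (radial_primitive p \<psi>)"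
  unfolding smooth_on_def using Ck_on_radial_primitive by blast

lemma grad_radial_primitive:
  assumes "smooth_on (ball 0 R) \<psi>" "x \<in> ball 0 R"
  shows "grad (radial_primitive p \<psi>) x \<bullet> v = radial_primitive (p + 2) (\<lambda>y. grad \<psi> y \<bullet> v) x"
  by (rule has_derivative_grad(1)[OF radial_primitive_has_derivative[OF smooth_on_has_derivative[OF assms(1) open_ball]
        smooth_on_continuous_grad[OF assms(1)] assms(2)]])

text \<open>The integrand belonging to the left-hand side is the derivative of
  \<open>\<tau>^(p + 1) \<psi>(\<tau>^2 x)\<close> in \<tau>, a function with the value
  \<open>\<psi> x\<close> at 1 and 0 at 0.\<close>

lemma Euler_radial_primitive:
  assumes "smooth_on (ball 0 R) \<psi>" "x \<in> ball 0 R"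
  shows "x \<bullet> grad (radial_primitive p \<psi>) x + (real p + 1) / 2 * radial_primitive p \<psi> x = \<psi> x"
proof -
  have c: "continuous_on (ball 0 R) \<psi>" "continuous_on (ball 0 R) (\<lambda>y. grad \<psi> y \<bullet> x)"
    using smooth_on_continuous[OF assms(1)] smooth_on_continuous_grad[OF assms(1)] by (auto intro: continuous_intros)
  let ?f = "\<lambda>\<tau>. 2 * \<tau> ^ (p + 2) * (grad \<psi> (\<tau>\<^sup>2 *\<^sub>R x) \<bullet> x)" and ?g = "\<lambda>\<tau>. 2 * \<tau> ^ p * \<psi> (\<tau>\<^sup>2 *\<^sub>R x)"
  have i: "?f integrable_on {0..1}" "?g integrable_on {0..1}"
    using radial_integrand_continuous'[OF c(1) assms(2), of p] radial_integrand_continuous'[OF c(2) assms(2), of "p + 2"]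
    by (auto intro!: integrable_continuous_interval)
  have "((\<lambda>\<tau>. ?f \<tau> + (real p + 1) / 2 * ?g \<tau>) has_integral
      (1 ^ (p + 1) * \<psi> (1\<^sup>2 *\<^sub>R x) - 0 ^ (p + 1) * \<psi> (0\<^sup>2 *\<^sub>R x))) {0..1}"
  proof (rule fundamental_theorem_of_calculus)
    fix \<tau> :: real assume \<tau>: "\<tau> \<in> {0..1}"
    have 1: "((\<lambda>\<tau>. \<tau>\<^sup>2 *\<^sub>R x) has_derivative (\<lambda>h. (2 * \<tau> * h) *\<^sub>R x)) (at \<tau>)"
      by (auto intro!: derivative_eq_intros simp: mult_ac)
    have "((\<lambda>\<tau>. \<psi> (\<tau>\<^sup>2 *\<^sub>R x)) has_derivative (\<lambda>h. grad \<psi> (\<tau>\<^sup>2 *\<^sub>R x) \<bullet> ((2 * \<tau> * h) *\<^sub>R x))) (at \<tau>)"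
      by (rule has_derivative_compose[OF 1 smooth_on_has_derivative[OF assms(1) open_ball square_scaleR_ball]])
         (use \<tau> assms(2) in auto)
    then have d: "((\<lambda>\<tau>. \<psi> (\<tau>\<^sup>2 *\<^sub>R x)) has_real_derivative (2 * \<tau> * (grad \<psi> (\<tau>\<^sup>2 *\<^sub>R x) \<bullet> x))) (at \<tau>)"
      unfolding has_field_derivative_def
      by (rule has_derivative_eq_rhs) (auto simp: fun_eq_iff)
    have "((\<lambda>\<tau>. \<tau> ^ (p + 1) * \<psi> (\<tau>\<^sup>2 *\<^sub>R x)) has_real_derivative
        \<tau> ^ (p + 1) * (2 * \<tau> * (grad \<psi> (\<tau>\<^sup>2 *\<^sub>R x) \<bullet> x)) + real (p + 1) * \<tau> ^ p * \<psi> (\<tau>\<^sup>2 *\<^sub>R x)) (at \<tau>)"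
      using DERIV_mult'[OF DERIV_pow[of "p + 1" \<tau>] d] by simp
    then have "((\<lambda>\<tau>. \<tau> ^ (p + 1) * \<psi> (\<tau>\<^sup>2 *\<^sub>R x)) has_real_derivative ?f \<tau> + (real p + 1) / 2 * ?g \<tau>) (at \<tau>)"
      by (rule DERIV_cong) (simp add: power2_eq_square algebra_simps)
    then show "((\<lambda>\<tau>. \<tau> ^ (p + 1) * \<psi> (\<tau>\<^sup>2 *\<^sub>R x)) has_vector_derivative ?f \<tau> + (real p + 1) / 2 * ?g \<tau>) (at \<tau> within {0..1})"
      by (auto simp: has_real_derivative_iff_has_vector_derivative intro: has_vector_derivative_at_within)
  qed auto
  moreover have "((\<lambda>\<tau>. ?f \<tau> + (real p + 1) / 2 * ?g \<tau>) has_integral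
      integral {0..1} ?f + (real p + 1) / 2 * integral {0..1} ?g) {0..1}"
    by (intro has_integral_add has_integral_mult_right integrable_integral i)
  ultimately have "1 ^ (p + 1) * \<psi> (1\<^sup>2 *\<^sub>R x) - 0 ^ (p + 1) * \<psi> (0\<^sup>2 *\<^sub>R x) =
      integral {0..1} ?f + (real p + 1) / 2 * integral {0..1} ?g"
    by (rule has_integral_unique)
  then show ?thesis
    using grad_radial_primitive[OF assms, of p x] by (simp add: radial_primitive_def inner_commute)
qed

text \<open>Multiply the Euler equation by \<open>h\<close> and integrate. In
  \<open>divergence_ball\<close> for \<open>h^2\<close> the boundary term is nonnegative, so the
  transport term is at least \<open>- d/2\<close> times the squared norm of \<open>h\<close>, with
  \<open>d\<close> the dimension; the condition on \<open>c\<close> leaves one full squared norm.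
  Applied to differences, the bound transfers the Cauchy property from functions to their radial
  primitives.\<close>

lemma Euler_L2_bound:
  fixes h f :: "'a::euclidean_space \<Rightarrow> real"
  assumes h: "smooth_up_ball h" and f: "f \<in> L2 MB"
    and E: "\<And>x. x \<in> ball 0 1 \<Longrightarrow> x \<bullet> grad h x + c * h x = f x" and c: "DIM('a) / 2 + 1 \<le> c"
  shows "L2_norm MB h \<le> L2_norm MB f"
proof -
  have su: "smooth_up_ball (\<lambda>x. h x * h x)" by (intro smooth_up_mult h)
  note S = unit_ball.smooth_up_to_boundaryD[OF h]
  have xL: "(\<lambda>x. x \<bullet> grad h x) \<in> L2 MB"
    using S by (intro unit_ball.continuous_closure_L2 continuous_intros)
  have "0 \<le> (\<integral>x. x \<bullet> grad (\<lambda>x. h x * h x) x + DIM('a) * (h x * h x) \<partial>MB)"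
    by (subst divergence_ball[OF su]) (auto intro!: mult_nonneg_nonneg integral_nonneg_AE)
  also have "\<dots> = (\<integral>x. 2 * (h x * (x \<bullet> grad h x)) + DIM('a) * (h x)\<^sup>2 \<partial>MB)"
  proof (intro Bochner_Integration.integral_cong refl)
    fix x :: 'a assume "x \<in> space MB"
    then have "x \<in> closure (ball 0 1)" by simp
    then have "grad (\<lambda>x. h x * h x) x = h x *\<^sub>R grad h x + h x *\<^sub>R grad h x"
      by (intro grad_eqI has_derivative_inner_grad_mult S(5))
    then show "x \<bullet> grad (\<lambda>x. h x * h x) x + DIM('a) * (h x * h x) = 2 * (h x * (x \<bullet> grad h x)) + DIM('a) * (h x)\<^sup>2"
      by (simp add: inner_add_right power2_eq_square)
  qed
  also have "\<dots> = 2 * (\<integral>x. h x * (x \<bullet> grad h x) \<partial>MB) + DIM('a) * (L2_norm MB h)\<^sup>2"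
    using S(1) xL by (simp add: L2_norm_square L2_mult_integrable L2_D)
  finally have 1: "0 \<le> (\<integral>x. h x * (x \<bullet> grad h x) \<partial>MB) + DIM('a) / 2 * (L2_norm MB h)\<^sup>2" by simp
  have "(\<integral>x. h x * f x \<partial>MB) = (\<integral>x. h x * (x \<bullet> grad h x) + c * (h x)\<^sup>2 \<partial>MB)"
    by (intro Bochner_Integration.integral_cong refl) (simp add: E[symmetric] power2_eq_square algebra_simps)
  also have "\<dots> = (\<integral>x. h x * (x \<bullet> grad h x) \<partial>MB) + c * (L2_norm MB h)\<^sup>2"
    using S(1) xL by (simp add: L2_norm_square L2_mult_integrable L2_D)
  finally have 2: "(\<integral>x. h x * f x \<partial>MB) = (\<integral>x. h x * (x \<bullet> grad h x) \<partial>MB) + c * (L2_norm MB h)\<^sup>2" .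
  have "(DIM('a) / 2 + 1) * (L2_norm MB h)\<^sup>2 \<le> c * (L2_norm MB h)\<^sup>2"
    using c by (intro mult_right_mono) auto
  then have "(L2_norm MB h)\<^sup>2 \<le> (\<integral>x. h x * f x \<partial>MB)"
    using 1 2 by (simp add: algebra_simps)
  also have "\<dots> \<le> L2_norm MB h * L2_norm MB f"
    using L2_Cauchy_Schwarz[OF S(1) f] by linarith
  finally show ?thesis
    by (cases "L2_norm MB h = 0") (auto simp: power2_eq_square mult_le_cancel_left less_le)
qed

text \<open>The bridge to gauge integrals over a box, for which
  \<open>integral_swap_continuous\<close> interchanges the integrations in \<open>x\<close> and
  \<tau>.\<close>

lemma ball_integral_eq_HK:
  fixes g :: "'a::euclidean_space \<Rightarrow> real"
  assumes g: "continuous_on (cbox (- One) One) g" and 0: "\<And>x. x \<notin> ball 0 1 \<Longrightarrow> g x = 0"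
  shows "(\<integral>x. g x \<partial>MB) = integral (cbox (- One) One) g"
proof -
  have sub: "x \<in> cbox (- One) One" if "x \<in> ball 0 1" for x :: 'a
    unfolding mem_box
  proof
    fix i :: 'a assume i: "i \<in> Basis"
    have "\<bar>x \<bullet> i\<bar> \<le> 1" using Basis_le_norm[OF i, of x] that by simp
    then show "- One \<bullet> i \<le> x \<bullet> i \<and> x \<bullet> i \<le> One \<bullet> i" using i by (simp add: abs_le_iff)
  qed
  have "set_integrable lborel (cbox (- One) One) g"
    unfolding set_integrable_def by (rule borel_integrable_compact[OF compact_cbox g])
  from set_borel_integral_eq_integral(2)[OF this]
  have "integral (cbox (- One) One) g = (\<integral>x. indicator (cbox (- One) One) x *\<^sub>R g x \<partial>lborel)"
    by (simp add: set_lebesgue_integral_def)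
  also have "\<dots> = (\<integral>x. indicator (ball 0 1) x *\<^sub>R g x \<partial>lborel)"
  proof (intro Bochner_Integration.integral_cong refl)
    fix x show "indicator (cbox (- One) One) x *\<^sub>R g x = indicator (ball 0 1) x *\<^sub>R g x"
      using sub[of x] 0[of x] by (cases "x \<in> ball 0 1") auto
  qed
  finally show ?thesis by (simp add: unit_ball.integral_M)
qed

text \<open>A change of variables moves the dilation from \<open>grad \<Phi>\<close> to the test
  function, which becomes \<open>\<phi>(x / c)\<close>, still supported in the ball. Its pairing
  with \<open>G\<close> is 0, so only the error \<open>grad \<Phi> - G\<close> remains. The power of
  \<open>c\<close> is the Jacobian, and the gradient bound \<open>L / c\<close> cancels against the
  chain rule factor \<open>c\<close>.\<close>

lemma scaled_pairing_bound:
  fixes \<phi> \<Phi> :: "'a::euclidean_space \<Rightarrow> real"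
  assumes \<phi>: "test_function (ball 0 1) \<phi>" and L: "\<And>x. norm (grad \<phi> x) \<le> L"
    and \<Phi>: "smooth_up_ball \<Phi>" and G: "L2v MB G"
    and harm: "\<And>\<psi>. test_function (ball 0 1) \<psi> \<Longrightarrow> (\<integral>x. G x \<bullet> grad \<psi> x \<partial>MB) = 0"
    and c: "0 < c" "c \<le> 1"
  shows "c ^ DIM('a) * \<bar>\<integral>x. grad \<Phi> (c *\<^sub>R x) \<bullet> grad \<phi> x \<partial>MB\<bar> \<le>
    L * L2_norm MB (\<lambda>x::'a. 1) * L2_norm MB (\<lambda>x. norm (grad \<Phi> x - G x))"
proof -
  obtain K where K: "compact K" "K \<subseteq> ball 0 1" "\<forall>x. x \<notin> K \<longrightarrow> \<phi> x = 0" and \<phi>s: "smooth_on UNIV \<phi>"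
    using \<phi> unfolding test_function_def by auto
  have L0: "0 \<le> L" using L[of 0] norm_ge_zero order_trans by blast
  have g0: "grad \<phi> x = 0" if "x \<notin> K" for x
    using grad_zero_outside[OF compact_imp_closed[OF K(1)] K(3) that] .
  define \<phi>c where "\<phi>c x = \<phi> ((1 / c) *\<^sub>R x)" for x
  have \<phi>c: "test_function (ball 0 1) \<phi>c"
  proof (rule test_functionI[where U = UNIV and K = "(\<lambda>x. c *\<^sub>R x) ` K"])
    show "smooth_on UNIV \<phi>c" unfolding \<phi>c_def[abs_def] by (rule smooth_on_scale[OF _ _ _ \<phi>s]) auto
    show "compact ((\<lambda>x. c *\<^sub>R x) ` K)" using K(1) by (rule compact_scaling)
    show "(\<lambda>x. c *\<^sub>R x) ` K \<subseteq> ball 0 1"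
    proof
      fix y assume "y \<in> (\<lambda>x. c *\<^sub>R x) ` K"
      then obtain x where x: "x \<in> K" "y = c *\<^sub>R x" by auto
      have "norm x < 1" using x K(2) by auto
      moreover have "c * norm x \<le> 1 * norm x" using c by (intro mult_right_mono) auto
      ultimately show "y \<in> ball 0 1" using x c by simp
    qed
    show "\<phi>c x = 0" if "x \<notin> (\<lambda>x. c *\<^sub>R x) ` K" for x
    proof -
      have "(1 / c) *\<^sub>R x \<notin> K"
      proof
        assume "(1 / c) *\<^sub>R x \<in> K"
        then have "c *\<^sub>R ((1 / c) *\<^sub>R x) \<in> (\<lambda>x. c *\<^sub>R x) ` K" by blast
        then show False using that c by simp
      qed
      then show ?thesis using K(3) by (simp add: \<phi>c_def)
    qed
  qed auto
  have gc: "grad \<phi>c x = (1 / c) *\<^sub>R grad \<phi> ((1 / c) *\<^sub>R x)" for x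
    unfolding \<phi>c_def[abs_def] by (rule grad_scale[OF \<phi>s]) auto
  note S = unit_ball.smooth_up_to_boundaryD[OF \<Phi>]
  define F where "F y = grad \<Phi> y \<bullet> grad \<phi> ((1 / c) *\<^sub>R y)" for y
  have Fc: "continuous_on (cball 0 1) F"
  proof -
    have "continuous_on (cball 0 1) (grad \<Phi>)" using S(6) by simp
    moreover have "continuous_on (cball 0 1) (\<lambda>y. grad \<phi> ((1 / c) *\<^sub>R y))"
      by (rule continuous_on_compose2[OF smooth_on_continuous_grad[OF \<phi>s]]) (auto intro!: continuous_intros)
    ultimately show ?thesis
      unfolding F_def[abs_def] by (rule continuous_on_inner)
  qed
  define g where "g y = indicator (cball 0 1) y * F y" for y
  have gm: "g \<in> borel_measurable borel" unfolding g_def[abs_def] by (rule continuous_cball_borel[OF Fc])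
  have "(\<integral>y. g y \<partial>lborel) = c ^ DIM('a) * (\<integral>x. g (c *\<^sub>R x) \<partial>lborel)"
    by (rule integral_lborel_scale[OF gm c(1)])
  also have "(\<integral>x. g (c *\<^sub>R x) \<partial>lborel) = (\<integral>x. indicator (ball 0 1) x *\<^sub>R (grad \<Phi> (c *\<^sub>R x) \<bullet> grad \<phi> x) \<partial>lborel)"
  proof (intro Bochner_Integration.integral_cong refl)
    fix x :: 'a
    show "g (c *\<^sub>R x) = indicator (ball 0 1) x *\<^sub>R (grad \<Phi> (c *\<^sub>R x) \<bullet> grad \<phi> x)"
    proof (cases "x \<in> ball 0 1")
      case True
      then have "c *\<^sub>R x \<in> cball 0 1" using c by (auto intro!: mult_le_one)
      then show ?thesis using True c by (simp add: g_def F_def)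
    next
      case False
      then have "x \<notin> K" using K(2) by auto
      then show ?thesis using False c by (simp add: g_def F_def g0)
    qed
  qed
  also have "\<dots> = (\<integral>x. grad \<Phi> (c *\<^sub>R x) \<bullet> grad \<phi> x \<partial>MB)"
    by (simp add: unit_ball.integral_M)
  finally have 1: "c ^ DIM('a) * (\<integral>x. grad \<Phi> (c *\<^sub>R x) \<bullet> grad \<phi> x \<partial>MB) = (\<integral>y. g y \<partial>lborel)" by simp
  have "(\<integral>y. g y \<partial>lborel) = (\<integral>y. indicator (ball 0 1) y *\<^sub>R (c * (grad \<Phi> y \<bullet> grad \<phi>c y)) \<partial>lborel)"
  proof (intro Bochner_Integration.integral_cong refl)
    fix y :: 'a
    show "g y = indicator (ball 0 1) y *\<^sub>R (c * (grad \<Phi> y \<bullet> grad \<phi>c y))"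
    proof (cases "y \<in> ball 0 1")
      case True
      then show ?thesis using c by (simp add: g_def F_def gc)
    next
      case False
      have "(1 / c) *\<^sub>R y \<notin> K"
      proof
        assume "(1 / c) *\<^sub>R y \<in> K"
        then have "norm ((1 / c) *\<^sub>R y) < 1" using K(2) by auto
        then have "norm y < c" using c by simp
        then show False using False c by simp
      qed
      then show ?thesis using False by (simp add: g_def F_def g0)
    qed
  qed
  also have "\<dots> = (\<integral>y. c * (grad \<Phi> y \<bullet> grad \<phi>c y) \<partial>MB)"
    by (rule unit_ball.integral_M[symmetric])
  also have "\<dots> = c * (\<integral>y. (grad \<Phi> y - G y) \<bullet> grad \<phi>c y \<partial>MB)"
    using harm[OF \<phi>c] S(2) G unit_ball.test_function_L2[OF \<phi>c]
    by (simp add: inner_diff_left L2v_inner_integrable)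
  finally have 2: "\<bar>\<integral>y. g y \<partial>lborel\<bar> = c * \<bar>\<integral>y. 1 * ((grad \<Phi> y - G y) \<bullet> grad \<phi>c y) \<partial>MB\<bar>"
    using c by (simp add: abs_mult)
  have "\<bar>\<integral>y. 1 * ((grad \<Phi> y - G y) \<bullet> grad \<phi>c y) \<partial>MB\<bar> \<le>
      1 * (L2_norm MB (\<lambda>x. norm (grad \<Phi> x - G x)) * L2_norm MB (\<lambda>x. norm (grad \<phi>c x)))"
    using S(2) G unit_ball.test_function_L2[OF \<phi>c] by (intro L2v_Cauchy_Schwarz L2v_diff) auto
  also have "L2_norm MB (\<lambda>x. norm (grad \<phi>c x)) \<le> L2_norm MB (\<lambda>x::'a. (L / c) * 1)"
  proof (rule L2_norm_mono)
    show "(\<lambda>x. norm (grad \<phi>c x)) \<in> borel_measurable MB"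
      using unit_ball.test_function_L2[OF \<phi>c] by (blast intro: L2_D L2v_norm)
    show "(\<lambda>x::'a. L / c * 1) \<in> L2 MB" by (intro unit_ball.continuous_closure_L2) auto
    show "AE x in MB. \<bar>norm (grad \<phi>c x)\<bar> \<le> \<bar>L / c * 1\<bar>"
      using L L0 c by (intro AE_I2) (simp add: gc divide_right_mono)
  qed
  also have "L2_norm MB (\<lambda>x::'a. (L / c) * 1) = L / c * L2_norm MB (\<lambda>x::'a. 1)"
    using L0 c by (subst L2_norm_cmult) simp
  finally have 3: "\<bar>\<integral>y. 1 * ((grad \<Phi> y - G y) \<bullet> grad \<phi>c y) \<partial>MB\<bar> \<le>
      L2_norm MB (\<lambda>x. norm (grad \<Phi> x - G x)) * (L / c * L2_norm MB (\<lambda>x::'a. 1))"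
    by (simp add: mult_left_mono)
  have "c ^ DIM('a) * \<bar>\<integral>x. grad \<Phi> (c *\<^sub>R x) \<bullet> grad \<phi> x \<partial>MB\<bar> = \<bar>\<integral>y. g y \<partial>lborel\<bar>"
    using c by (simp add: 1[symmetric] abs_mult)
  also have "\<dots> \<le> c * (L2_norm MB (\<lambda>x. norm (grad \<Phi> x - G x)) * (L / c * L2_norm MB (\<lambda>x::'a. 1)))"
    unfolding 2 using 3 c by (intro mult_left_mono) auto
  also have "\<dots> = L * L2_norm MB (\<lambda>x::'a. 1) * L2_norm MB (\<lambda>x. norm (grad \<Phi> x - G x))"
    using c by simp
  finally show ?thesis .
qed

text \<open>After interchanging the integrals the pairing is a weighted integral over \<tau> of
  pairings with dilations by \<open>\<tau>^2\<close>. The condition on \<open>p\<close> puts the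
  weight \<open>\<tau>^(p + 2)\<close> below the Jacobian of that dilation, so
  \<open>scaled_pairing_bound\<close> applies uniformly as \<tau> tends to 0.\<close>

lemma radial_primitive_pairing_bound:
  fixes \<phi> \<Phi> :: "'a::euclidean_space \<Rightarrow> real"
  assumes \<phi>: "test_function (ball 0 1) \<phi>" and L: "\<And>x. norm (grad \<phi> x) \<le> L"
    and R: "1 < R" and \<Phi>: "smooth_on (ball 0 R) \<Phi>" and G: "L2v MB G"
    and harm: "\<And>\<psi>. test_function (ball 0 1) \<psi> \<Longrightarrow> (\<integral>x. G x \<bullet> grad \<psi> x \<partial>MB) = 0"
    and p: "2 * DIM('a) \<le> p + 2"
  shows "\<bar>\<integral>x. grad (radial_primitive p \<Phi>) x \<bullet> grad \<phi> x \<partial>MB\<bar> \<le>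
    2 * (L * L2_norm MB (\<lambda>x::'a. 1) * L2_norm MB (\<lambda>x. norm (grad \<Phi> x - G x)))"
proof -
  obtain K where K: "compact K" "K \<subseteq> ball 0 1" "\<forall>x. x \<notin> K \<longrightarrow> \<phi> x = 0" and \<phi>s: "smooth_on UNIV \<phi>"
    using \<phi> unfolding test_function_def by auto
  have g0: "grad \<phi> x = 0" if "x \<notin> ball 0 1" for x
  proof -
    have "x \<notin> K" using K(2) that by auto
    then show ?thesis by (rule grad_zero_outside[OF compact_imp_closed[OF K(1)] K(3)])
  qed
  have su: "smooth_up_ball \<Phi>"
    using R by (intro smooth_up_to_boundaryI[OF open_ball _ \<Phi>]) auto
  let ?Q = "cbox (- One) One :: 'a set"
  define f where "f x \<tau> = 2 * \<tau> ^ (p + 2) * (grad \<Phi> (\<tau>\<^sup>2 *\<^sub>R x) \<bullet> grad \<phi> x)" for x :: 'a and \<tau> :: real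
  define C where "C = L * L2_norm MB (\<lambda>x::'a. 1) * L2_norm MB (\<lambda>x. norm (grad \<Phi> x - G x))"
  have C0: "0 \<le> C"
    unfolding C_def using order_trans[OF norm_ge_zero L[of 0]] by (intro mult_nonneg_nonneg) auto
  have f0: "f x \<tau> = 0" if "x \<notin> ball 0 1" for x \<tau> using g0[OF that] by (simp add: f_def)
  \<comment> \<open>Far from the origin \<Phi> is uncontrolled, but \<open>grad \<phi>\<close> is 0
    outside the ball; gluing along two closed sets gives continuity on the whole box.\<close>
  have fc: "continuous_on (?Q \<times> {0..1}) (\<lambda>(x, \<tau>). f x \<tau>)"
  proof -
    have 1: "continuous_on ((cball 0 1 \<inter> ?Q) \<times> {0..1}) (\<lambda>(x, \<tau>). f x \<tau>)"
    proof -
      have "continuous_on (ball 0 R \<times> {0..1}) (\<lambda>(x, \<tau>). (2 * \<tau> ^ (p + 2)) *\<^sub>R grad \<Phi> (\<tau>\<^sup>2 *\<^sub>R x))"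
        by (rule radial_integrand_continuous[OF smooth_on_continuous_grad[OF \<Phi>]])
      then have "continuous_on ((cball 0 1 \<inter> ?Q) \<times> {0..1}) (\<lambda>z. (2 * snd z ^ (p + 2)) *\<^sub>R grad \<Phi> ((snd z)\<^sup>2 *\<^sub>R fst z))"
        unfolding case_prod_beta by (rule continuous_on_subset) (use R in auto)
      moreover have "continuous_on ((cball 0 1 \<inter> ?Q) \<times> {0..1::real}) (\<lambda>z. grad \<phi> (fst z))"
        by (rule continuous_on_compose2[OF smooth_on_continuous_grad[OF \<phi>s] continuous_on_fst[OF continuous_on_id]]) auto
      ultimately have "continuous_on ((cball 0 1 \<inter> ?Q) \<times> {0..1}) (\<lambda>z. ((2 * snd z ^ (p + 2)) *\<^sub>R grad \<Phi> ((snd z)\<^sup>2 *\<^sub>R fst z)) \<bullet> grad \<phi> (fst z))"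
        by (rule continuous_on_inner)
      then show ?thesis by (simp add: f_def case_prod_beta)
    qed
    have 2: "continuous_on ((?Q - ball 0 1) \<times> {0..1}) (\<lambda>(x, \<tau>). f x \<tau>)"
    proof -
      have "continuous_on ((?Q - ball 0 1) \<times> {0..1::real}) (\<lambda>z. 0 :: real)" by simp
      then show ?thesis
        by (rule continuous_on_eq) (use f0 in auto)
    qed
    have "continuous_on ((cball 0 1 \<inter> ?Q) \<times> {0..1} \<union> (?Q - ball 0 1) \<times> {0..1}) (\<lambda>(x, \<tau>). f x \<tau>)"
      by (intro continuous_on_closed_Un closed_Times 1 2 closed_Int closed_cball closed_cbox closed_atLeastAtMost)
         (auto intro!: closed_Diff closed_cbox)
    then show ?thesis
      by (rule continuous_on_subset) auto
  qed
  have fx: "continuous_on ?Q (\<lambda>x. f x \<tau>)" if "\<tau> \<in> {0..1}" for \<tau>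
  proof -
    have "continuous_on ?Q (\<lambda>x. (x, \<tau>))" by (intro continuous_intros)
    moreover have "(\<lambda>x. (x, \<tau>)) ` ?Q \<subseteq> ?Q \<times> {0..1}" using that by auto
    ultimately show ?thesis using continuous_on_compose2[OF fc] by fastforce
  qed
  have inner: "integral {0..1} (f x) = grad (radial_primitive p \<Phi>) x \<bullet> grad \<phi> x" for x
  proof (cases "x \<in> ball 0 1")
    case True
    then have "x \<in> ball 0 R" using R by auto
    from grad_radial_primitive[OF \<Phi> this] show ?thesis by (simp add: radial_primitive_def f_def[abs_def])
  next
    case False
    then have "f x = (\<lambda>\<tau>. 0)" using f0[OF False] by auto
    then show ?thesis using g0[OF False] by simp
  qed
  have hc: "continuous_on ?Q (\<lambda>x. integral {0..1} (f x))"
    using integral_continuous_on_param[of ?Q 0 1 f] fc by simp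
  have "(\<integral>x. grad (radial_primitive p \<Phi>) x \<bullet> grad \<phi> x \<partial>MB) = integral ?Q (\<lambda>x. integral {0..1} (f x))"
    unfolding inner[symmetric] by (rule ball_integral_eq_HK[OF hc]) (simp add: inner g0)
  also have "\<dots> = integral {0..1} (\<lambda>\<tau>. integral ?Q (\<lambda>x. f x \<tau>))"
    using integral_swap_continuous[of "- One" 0 One 1 f] fc by (simp add: cbox_Pair_eq)
  finally have eq: "(\<integral>x. grad (radial_primitive p \<Phi>) x \<bullet> grad \<phi> x \<partial>MB) = integral {0..1} (\<lambda>\<tau>. integral ?Q (\<lambda>x. f x \<tau>))" .
  have "norm (integral {0..1} (\<lambda>\<tau>. integral ?Q (\<lambda>x. f x \<tau>))) \<le> 2 * C * (1 - 0)"
  proof (rule integral_bound)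
    have "continuous_on ({0..1} \<times> ?Q) (\<lambda>(\<tau>, x). f x \<tau>)"
      unfolding case_prod_beta
      by (rule continuous_on_compose2[OF fc[unfolded case_prod_beta], of _ "\<lambda>z. (snd z, fst z)", simplified])
         (auto intro!: continuous_intros)
    from integral_continuous_on_param[OF this]
    show "continuous_on {0..1} (\<lambda>\<tau>. integral ?Q (\<lambda>x. f x \<tau>))" .
    fix \<tau> :: real assume \<tau>: "\<tau> \<in> {0..1}"
    show "norm (integral ?Q (\<lambda>x. f x \<tau>)) \<le> 2 * C"
    proof (cases "\<tau> = 0")
      case True
      then show ?thesis using C0 by (simp add: f_def)
    next
      case False
      then have t: "0 < \<tau>" "\<tau> \<le> 1" using \<tau> by auto
      let ?A = "\<integral>x. grad \<Phi> (\<tau>\<^sup>2 *\<^sub>R x) \<bullet> grad \<phi> x \<partial>MB"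
      have "integral ?Q (\<lambda>x. f x \<tau>) = (\<integral>x. f x \<tau> \<partial>MB)"
        by (rule ball_integral_eq_HK[OF fx[OF \<tau>] f0, symmetric])
      also have "\<dots> = 2 * \<tau> ^ (p + 2) * ?A" by (simp add: f_def)
      finally have "norm (integral ?Q (\<lambda>x. f x \<tau>)) = 2 * (\<tau> ^ (p + 2) * \<bar>?A\<bar>)"
        using t by (simp add: abs_mult)
      also have "\<tau> ^ (p + 2) * \<bar>?A\<bar> \<le> \<tau> ^ (2 * DIM('a)) * \<bar>?A\<bar>"
        using t p by (intro mult_right_mono power_decreasing) auto
      also have "\<tau> ^ (2 * DIM('a)) * \<bar>?A\<bar> = (\<tau>\<^sup>2) ^ DIM('a) * \<bar>?A\<bar>" by (simp add: power_mult)
      also have "\<dots> \<le> C"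
        unfolding C_def using t by (intro scaled_pairing_bound[OF \<phi> L su G harm]) (auto simp: power_le_one)
      finally show ?thesis by simp
    qed
  qed auto
  then show ?thesis by (simp add: eq C_def)
qed

text \<open>Take radial primitives of the approximating functions. Their partial derivatives are
  radial primitives, with \<open>p + 2\<close>, of the partial derivatives, so
  \<open>Euler_L2_bound\<close> makes both converge. Weak harmonicity survives because the pairings
  with test functions are controlled by the error \<open>grad (\<Phi> n) - G\<close>. The first
  condition on \<open>p\<close> serves this pairing bound, the second the L2 bound.\<close>

theorem harmonic_radial_primitive:
  fixes u :: "'a::euclidean_space \<Rightarrow> real"
  assumes \<Phi>: "unit_ball.H1_tendsto \<Phi> u G"
    and harm: "\<And>\<psi>. test_function (ball 0 1) \<psi> \<Longrightarrow> (\<integral>x. G x \<bullet> grad \<psi> x \<partial>MB) = 0"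
    and p: "2 * DIM('a) \<le> p + 2" "DIM('a) + 1 \<le> p"
  obtains \<Psi> h H where "unit_ball.H1_tendsto \<Psi> h H"
    "\<And>\<psi>. test_function (ball 0 1) \<psi> \<Longrightarrow> (\<integral>x. H x \<bullet> grad \<psi> x \<partial>MB) = 0"
    "AE x in MB. x \<bullet> H x = u x - (real p + 1) / 2 * h x"
proof -
  note D = unit_ball.H1_tendstoD[OF \<Phi>]
  have "\<exists>R>1. smooth_on (ball 0 R) (\<Phi> n)" for n using smooth_up_ballE[OF D(1)] by metis
  then obtain R where R: "\<And>n. 1 < R n" "\<And>n. smooth_on (ball 0 (R n)) (\<Phi> n)" by metis
  define \<Psi> where "\<Psi> n = radial_primitive p (\<Phi> n)" for n
  have \<Psi>s: "smooth_on (ball 0 (R n)) (\<Psi> n)" for n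
    unfolding \<Psi>_def by (rule smooth_on_radial_primitive[OF R(2)])
  have upR: "smooth_up_ball g" if "smooth_on (ball 0 (R n)) g" for n g
    using R(1)[of n] that by (intro smooth_up_to_boundaryI[OF open_ball]) auto
  have \<Psi>u: "smooth_up_ball (\<Psi> n)" for n by (rule upR[OF \<Psi>s])
  have inR: "x \<in> ball 0 (R n)" if "x \<in> ball 0 1" for x :: 'a and n using that R(1)[of n] by auto
  have E1: "x \<bullet> grad (\<Psi> n) x + (real p + 1) / 2 * \<Psi> n x = \<Phi> n x" if "x \<in> ball 0 1" for x n
    unfolding \<Psi>_def by (rule Euler_radial_primitive[OF R(2) inR[OF that]])
  define \<Psi>b where "\<Psi>b b n = radial_primitive (p + 2) (\<lambda>y. grad (\<Phi> n) y \<bullet> b)" for b n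
  have \<Psi>b: "grad (\<Psi> n) x \<bullet> b = \<Psi>b b n x" if "x \<in> ball 0 1" for b n x
    unfolding \<Psi>b_def \<Psi>_def by (rule grad_radial_primitive[OF R(2) inR[OF that]])
  have \<Psi>bu: "smooth_up_ball (\<Psi>b b n)" if "b \<in> Basis" for b n
    unfolding \<Psi>b_def by (rule upR[of n], rule smooth_on_radial_primitive, rule smooth_on_partial[OF R(2) that])
  have E2: "x \<bullet> grad (\<Psi>b b n) x + (real (p + 2) + 1) / 2 * \<Psi>b b n x = grad (\<Phi> n) x \<bullet> b" if "x \<in> ball 0 1" "b \<in> Basis" for x b n
    unfolding \<Psi>b_def by (rule Euler_radial_primitive[OF smooth_on_partial[OF R(2) that(2)] inR[OF that(1)]])
  have gd: "grad (\<lambda>x. f x - g x) x = grad f x - grad g x" if "smooth_up_ball f" "smooth_up_ball g" "x \<in> ball 0 1" for f g and x :: 'a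
    using unit_ball.smooth_up_to_boundaryD(5)[OF that(1)] unit_ball.smooth_up_to_boundaryD(5)[OF that(2)] that(3)
    by (intro grad_eqI) (auto simp: inner_diff_left intro!: has_derivative_diff)
  have b1: "L2_norm MB (\<lambda>x. \<Psi> m x - \<Psi> n x) \<le> L2_norm MB (\<lambda>x. \<Phi> m x - \<Phi> n x)" for m n
  proof (rule Euler_L2_bound[where c = "(real p + 1) / 2"])
    show "smooth_up_ball (\<lambda>x. \<Psi> m x - \<Psi> n x)" by (intro smooth_up_diff \<Psi>u)
    show "(\<lambda>x. \<Phi> m x - \<Phi> n x) \<in> L2 MB" by (intro L2_diff L2_tendstoD(1)[OF D(2)])
    show "x \<bullet> grad (\<lambda>x. \<Psi> m x - \<Psi> n x) x + (real p + 1) / 2 * (\<Psi> m x - \<Psi> n x) = \<Phi> m x - \<Phi> n x" if "x \<in> ball 0 1" for x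
      unfolding gd[OF \<Psi>u \<Psi>u that] inner_diff_right right_diff_distrib
      using E1[OF that, of m] E1[OF that, of n] by linarith
  qed (use p in auto)
  have b2: "L2_norm MB (\<lambda>x. grad (\<Psi> m) x \<bullet> b - grad (\<Psi> n) x \<bullet> b) \<le> L2_norm MB (\<lambda>x. grad (\<Phi> m) x \<bullet> b - grad (\<Phi> n) x \<bullet> b)"
    if b: "b \<in> Basis" for m n b
  proof -
    have "L2_norm MB (\<lambda>x. grad (\<Psi> m) x \<bullet> b - grad (\<Psi> n) x \<bullet> b) = L2_norm MB (\<lambda>x. \<Psi>b b m x - \<Psi>b b n x)"
      unfolding L2_norm_def by (intro arg_cong[where f = sqrt] Bochner_Integration.integral_cong refl) (simp add: \<Psi>b)
    also have "\<dots> \<le> L2_norm MB (\<lambda>x. grad (\<Phi> m) x \<bullet> b - grad (\<Phi> n) x \<bullet> b)"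
    proof (rule Euler_L2_bound[where c = "(real (p + 2) + 1) / 2"])
      show "smooth_up_ball (\<lambda>x. \<Psi>b b m x - \<Psi>b b n x)" by (intro smooth_up_diff \<Psi>bu b)
      show "(\<lambda>x. grad (\<Phi> m) x \<bullet> b - grad (\<Phi> n) x \<bullet> b) \<in> L2 MB"
        using L2v_tendstoD(1)[OF D(3)] b by (intro L2_diff) (auto simp: L2v_def)
      show "x \<bullet> grad (\<lambda>x. \<Psi>b b m x - \<Psi>b b n x) x + (real (p + 2) + 1) / 2 * (\<Psi>b b m x - \<Psi>b b n x) = grad (\<Phi> m) x \<bullet> b - grad (\<Phi> n) x \<bullet> b"
        if "x \<in> ball 0 1" for x
        unfolding gd[OF \<Psi>bu[OF b] \<Psi>bu[OF b] that] inner_diff_right right_diff_distrib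
        using E2[OF that b, of m] E2[OF that b, of n] by linarith
    qed (use p in auto)
    finally show ?thesis .
  qed
  have "\<exists>h. L2_tendsto MB \<Psi> h"
  proof (rule L2_complete)
    show "\<Psi> n \<in> L2 MB" for n by (rule unit_ball.smooth_up_to_boundaryD(1)[OF \<Psi>u])
    show "\<exists>N. \<forall>m\<ge>N. \<forall>n\<ge>N. L2_norm MB (\<lambda>x. \<Psi> m x - \<Psi> n x) < e" if "0 < e" for e
      using L2_tendsto_Cauchy[OF D(2) that] b1 by (meson le_less_trans)
  qed
  then obtain h where h: "L2_tendsto MB \<Psi> h" by blast
  have "\<exists>H. L2v_tendsto MB (\<lambda>n. grad (\<Psi> n)) H"
  proof (rule L2v_complete)
    show "L2v MB (grad (\<Psi> n))" for n by (rule unit_ball.smooth_up_to_boundaryD(2)[OF \<Psi>u])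
    show "\<exists>N. \<forall>m\<ge>N. \<forall>n\<ge>N. L2_norm MB (\<lambda>x. grad (\<Psi> m) x \<bullet> b - grad (\<Psi> n) x \<bullet> b) < e" if "b \<in> Basis" "0 < e" for b e
    proof -
      have "L2_tendsto MB (\<lambda>n x. grad (\<Phi> n) x \<bullet> b) (\<lambda>x. G x \<bullet> b)"
        using D(3) that(1) by (simp add: L2v_tendsto_def)
      from L2_tendsto_Cauchy[OF this that(2)] show ?thesis using b2[OF that(1)] by (meson le_less_trans)
    qed
  qed
  then obtain H where H: "L2v_tendsto MB (\<lambda>n. grad (\<Psi> n)) H" by blast
  have 1: "unit_ball.H1_tendsto \<Psi> h H"
    unfolding unit_ball.H1_tendsto_def using \<Psi>u h H by blast
  have 2: "(\<integral>x. H x \<bullet> grad \<psi> x \<partial>MB) = 0" if \<psi>: "test_function (ball 0 1) \<psi>" for \<psi>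
  proof -
    obtain L where L: "0 \<le> L" "\<And>x. norm (grad \<psi> x) \<le> L" using test_function_bounded_grad[OF \<psi>] by blast
    have "(\<lambda>n. \<integral>x. grad (\<Psi> n) x \<bullet> grad \<psi> x \<partial>MB) \<longlonglongrightarrow> 0"
    proof (rule tendsto_rabs_zero_cancel, rule tendsto_sandwich[OF _ _ tendsto_const])
      show "\<forall>\<^sub>F n in sequentially. \<bar>\<integral>x. grad (\<Psi> n) x \<bullet> grad \<psi> x \<partial>MB\<bar> \<le>
          2 * (L * L2_norm MB (\<lambda>x::'a. 1) * L2_norm MB (\<lambda>x. norm (grad (\<Phi> n) x - G x)))"
        unfolding \<Psi>_def
      proof (intro always_eventually allI)
        show "\<bar>\<integral>x. grad (radial_primitive p (\<Phi> n)) x \<bullet> grad \<psi> x \<partial>MB\<bar> \<le>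
          2 * (L * L2_norm MB (\<lambda>x::'a. 1) * L2_norm MB (\<lambda>x. norm (grad (\<Phi> n) x - G x)))" for n
          by (rule radial_primitive_pairing_bound[OF \<psi> L(2) R(1)[of n] R(2)[of n] D(6) harm p(1)])
      qed
      have "(\<lambda>n. 2 * (L * L2_norm MB (\<lambda>x::'a. 1) * L2_norm MB (\<lambda>x. norm (grad (\<Phi> n) x - G x)))) \<longlonglongrightarrow>
          2 * (L * L2_norm MB (\<lambda>x::'a. 1) * 0)"
        by (intro tendsto_intros L2v_tendsto_norm_diff D)
      then show "(\<lambda>n. 2 * (L * L2_norm MB (\<lambda>x::'a. 1) * L2_norm MB (\<lambda>x. norm (grad (\<Phi> n) x - G x)))) \<longlonglongrightarrow> 0"
        by simp
    qed auto
    then show ?thesis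
      using LIMSEQ_unique L2v_tendsto_inner[OF H unit_ball.test_function_L2(2)[OF \<psi>]] by blast
  qed
  have t1: "L2_tendsto MB (\<lambda>n x. x \<bullet> grad (\<Psi> n) x) (\<lambda>x. x \<bullet> H x)"
    by (rule L2v_tendsto_inner_field[OF H id_measurable_MB, of 1]) auto
  have t2: "L2_tendsto MB (\<lambda>n x. x \<bullet> grad (\<Psi> n) x) (\<lambda>x. u x - (real p + 1) / 2 * h x)"
    by (rule L2_tendsto_cong[OF L2_tendsto_diff[OF D(2) L2_tendsto_cmult[OF h, of "(real p + 1) / 2"]]])
       (use E1 in \<open>auto simp: algebra_simps\<close>)
  have 3: "AE x in MB. x \<bullet> H x = u x - (real p + 1) / 2 * h x"
    by (rule L2_tendsto_unique_AE[OF t1 t2])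
  show ?thesis by (rule that[OF 1 2 3])
qed

section \<open>The Dirichlet-to-Neumann map of the unit ball\<close>

lemma has_trace_sphereE:
  assumes "has_trace (ball 0 1) sphere_measure u f"
  obtains \<Phi> where "unit_ball.H1_tendsto \<Phi> u (weak_grad (ball 0 1) u)" "L2_tendsto sphere_measure \<Phi> f"
proof (rule unit_ball.has_traceE[OF assms])
  fix \<Phi>
  assume *: "unit_ball.H1_tendsto \<Phi> u (weak_grad (ball 0 1) u)" "f \<in> L2 sphere_measure"
    "(\<lambda>n. L2_norm sphere_measure (\<lambda>x. \<Phi> n x - f x)) \<longlonglongrightarrow> 0"
  show ?thesis
    by (rule that[OF *(1)])
       (auto simp: L2_tendsto_def * intro!: smooth_up_sphere_L2 unit_ball.H1_tendstoD(1)[OF *(1)])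
qed

lemma has_trace_sphereI:
  assumes "unit_ball.H1_tendsto \<Phi> u G" "L2_tendsto sphere_measure \<Phi> f"
  shows "has_trace (ball 0 1) sphere_measure u f"
  using unit_ball.has_traceI[OF assms(1)] assms(2) by (simp add: L2_tendsto_def)

lemma has_trace_add:
  assumes "has_trace (ball 0 1) sphere_measure u f" "has_trace (ball 0 1) sphere_measure v g"
  shows "has_trace (ball 0 1) sphere_measure (\<lambda>x. u x + v x) (\<lambda>x. f x + g x)"
proof -
  obtain \<Phi> \<Psi> where
    "unit_ball.H1_tendsto \<Phi> u (weak_grad (ball 0 1) u)" "L2_tendsto sphere_measure \<Phi> f"
    "unit_ball.H1_tendsto \<Psi> v (weak_grad (ball 0 1) v)" "L2_tendsto sphere_measure \<Psi> g"
    using has_trace_sphereE[OF assms(1)] has_trace_sphereE[OF assms(2)] by metis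
  then show ?thesis
    by (blast intro: has_trace_sphereI H1_tendsto_add L2_tendsto_add)
qed

lemma has_trace_cmult:
  assumes "has_trace (ball 0 1) sphere_measure u f"
  shows "has_trace (ball 0 1) sphere_measure (\<lambda>x. c * u x) (\<lambda>x. c * f x)"
  by (rule has_trace_sphereE[OF assms]) (blast intro: has_trace_sphereI H1_tendsto_cmult L2_tendsto_cmult)

lemma weak_gradD:
  assumes "has_trace (ball 0 1) \<sigma> v g"
  shows "v \<in> L2 MB" "has_weak_gradient (ball 0 1) v (weak_grad (ball 0 1) v)" "L2v MB (weak_grad (ball 0 1) v)"
proof -
  have "v \<in> H1 (ball 0 1)" using assms by (simp add: has_trace_def)
  then show "v \<in> L2 MB" "has_weak_gradient (ball 0 1) v (weak_grad (ball 0 1) v)"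
    by (auto dest: unit_ball.H1_D)
  then show "L2v MB (weak_grad (ball 0 1) v)" by (blast dest: unit_ball.has_weak_gradientD)
qed

definition energy :: "('a::euclidean_space \<Rightarrow> real) \<Rightarrow> ('a \<Rightarrow> real) \<Rightarrow> ('a \<Rightarrow> real) \<Rightarrow> real" where
  "energy \<gamma> u v = (\<integral>x. \<gamma> x * (weak_grad (ball 0 1) u x \<bullet> weak_grad (ball 0 1) v x) \<partial>MB)"

locale ball_conductivity =
  fixes \<gamma> :: "'a::euclidean_space \<Rightarrow> real" and c C :: real
  assumes dim: "2 \<le> DIM('a)"
    and measurable: "\<gamma> \<in> borel_measurable MB"
    and bounds: "\<And>x. x \<in> ball 0 1 \<Longrightarrow> c \<le> \<gamma> x" "\<And>x. x \<in> ball 0 1 \<Longrightarrow> \<gamma> x \<le> C" "0 < c"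
begin

lemma abs_bound: "x \<in> ball 0 1 \<Longrightarrow> \<bar>\<gamma> x\<bar> \<le> C"
  using bounds(1,2)[of x] bounds(3) by linarith

lemma C_nonneg: "0 \<le> C"
  using abs_bound[of 0] by simp

lemma flux_L2v: "L2v MB G \<Longrightarrow> L2v MB (\<lambda>x. \<gamma> x *\<^sub>R G x)"
  using abs_bound by (intro L2v_scaleR[where C = C] measurable) auto

lemma energy_integrable: "L2v MB G \<Longrightarrow> L2v MB H \<Longrightarrow> integrable MB (\<lambda>x. \<gamma> x * (G x \<bullet> H x))"
  using L2v_inner_integrable[OF flux_L2v] by fastforce

lemma energy_eq:
  assumes "has_trace (ball 0 1) \<sigma> u f" "has_trace (ball 0 1) \<sigma>' v g"
    "AE x in MB. weak_grad (ball 0 1) u x = G x" "AE x in MB. weak_grad (ball 0 1) v x = H x" "L2v MB G" "L2v MB H"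
  shows "energy \<gamma> u v = (\<integral>x. \<gamma> x * (G x \<bullet> H x) \<partial>MB)"
  unfolding energy_def
proof (rule integral_cong_AE)
  show "(\<lambda>x. \<gamma> x * (weak_grad (ball 0 1) u x \<bullet> weak_grad (ball 0 1) v x)) \<in> borel_measurable MB"
    using energy_integrable[OF weak_gradD(3)[OF assms(1)] weak_gradD(3)[OF assms(2)]] by auto
  show "(\<lambda>x. \<gamma> x * (G x \<bullet> H x)) \<in> borel_measurable MB"
    using energy_integrable[OF assms(5,6)] by auto
  show "AE x in MB. \<gamma> x * (weak_grad (ball 0 1) u x \<bullet> weak_grad (ball 0 1) v x) = \<gamma> x * (G x \<bullet> H x)"
    using assms(3,4) by eventually_elim simp
qed

lemma energy_add:
  assumes u: "has_trace (ball 0 1) sphere_measure u f" and v: "has_trace (ball 0 1) sphere_measure v g"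
    and w: "has_trace (ball 0 1) sphere_measure w h"
  shows "energy \<gamma> u (\<lambda>x. v x + w x) = energy \<gamma> u v + energy \<gamma> u w"
proof -
  have "energy \<gamma> u (\<lambda>x. v x + w x) = (\<integral>x. \<gamma> x * (weak_grad (ball 0 1) u x \<bullet> (weak_grad (ball 0 1) v x + weak_grad (ball 0 1) w x)) \<partial>MB)"
    by (rule energy_eq[OF u has_trace_add[OF v w]])
       (auto intro!: unit_ball.weak_grad_AE L2_add L2v_add unit_ball.has_weak_gradient_add weak_gradD[OF u] weak_gradD[OF v] weak_gradD[OF w])
  also have "\<dots> = energy \<gamma> u v + energy \<gamma> u w"
    unfolding energy_def inner_add_right distrib_left
    by (intro Bochner_Integration.integral_add energy_integrable weak_gradD[OF u] weak_gradD[OF v] weak_gradD[OF w])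
  finally show ?thesis .
qed

lemma energy_cmult:
  assumes u: "has_trace (ball 0 1) sphere_measure u f" and v: "has_trace (ball 0 1) sphere_measure v g"
  shows "energy \<gamma> u (\<lambda>x. k * v x) = k * energy \<gamma> u v"
proof -
  have "energy \<gamma> u (\<lambda>x. k * v x) = (\<integral>x. \<gamma> x * (weak_grad (ball 0 1) u x \<bullet> (k *\<^sub>R weak_grad (ball 0 1) v x)) \<partial>MB)"
    by (rule energy_eq[OF u has_trace_cmult[OF v]])
       (auto intro!: unit_ball.weak_grad_AE L2_cmult L2v_cmult unit_ball.has_weak_gradient_cmult weak_gradD[OF u] weak_gradD[OF v])
  also have "\<dots> = (\<integral>x. k * (\<gamma> x * (weak_grad (ball 0 1) u x \<bullet> weak_grad (ball 0 1) v x)) \<partial>MB)"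
    by (simp add: mult_ac)
  finally show ?thesis by (simp add: energy_def)
qed

text \<open>Two extensions of \<open>g\<close> differ by a function with zero trace, and the flux of
  a solution is divergence free. This makes the conormal derivative well defined as a functional of
  boundary values.\<close>

lemma energy_trace_unique:
  assumes u: "weak_solution (ball 0 1) \<gamma> u" "has_trace (ball 0 1) sphere_measure u f"
    and v: "has_trace (ball 0 1) sphere_measure v g" and w: "has_trace (ball 0 1) sphere_measure w g"
  shows "energy \<gamma> u v = energy \<gamma> u w"
proof -
  let ?W = "weak_grad (ball 0 1)"
  obtain \<Phi> where \<Phi>: "unit_ball.H1_tendsto \<Phi> v (?W v)" "L2_tendsto sphere_measure \<Phi> g"
    using has_trace_sphereE[OF v] by blast
  obtain \<Psi> where \<Psi>: "unit_ball.H1_tendsto \<Psi> w (?W w)" "L2_tendsto sphere_measure \<Psi> g"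
    using has_trace_sphereE[OF w] by blast
  have H: "unit_ball.H1_tendsto (\<lambda>n x. \<Phi> n x + (-1) * \<Psi> n x) (\<lambda>x. v x + (-1) * w x) (\<lambda>x. ?W v x + (-1) *\<^sub>R ?W w x)"
    by (intro H1_tendsto_add H1_tendsto_cmult \<Phi> \<Psi>)
  have 0: "(\<lambda>n. L2_norm sphere_measure (\<lambda>x. \<Phi> n x + (-1) * \<Psi> n x)) \<longlonglongrightarrow> 0"
    using L2_tendsto_norm[OF L2_tendsto_diff[OF \<Phi>(2) \<Psi>(2)]] by (simp add: L2_norm_def)
  have X: "L2v MB (\<lambda>x. \<gamma> x *\<^sub>R ?W u x)" by (rule flux_L2v[OF weak_gradD(3)[OF u(2)]])
  have "(\<integral>x. (\<gamma> x *\<^sub>R ?W u x) \<bullet> (?W v x + (-1) *\<^sub>R ?W w x) \<partial>MB) = 0"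
    by (rule divergence_free_trace_zero[OF X _ H 0 dim]) (use u(1) in \<open>auto simp: weak_solution_def\<close>)
  moreover have "(\<integral>x. (\<gamma> x *\<^sub>R ?W u x) \<bullet> (?W v x + (-1) *\<^sub>R ?W w x) \<partial>MB) = energy \<gamma> u v - energy \<gamma> u w"
    unfolding energy_def
    using energy_integrable[OF weak_gradD(3)[OF u(2)] weak_gradD(3)[OF v]] energy_integrable[OF weak_gradD(3)[OF u(2)] weak_gradD(3)[OF w]]
    by (simp add: inner_add_right right_diff_distrib inner_diff_right)
  ultimately show ?thesis by simp
qed

text \<open>Both solutions extend \<open>f\<close>, so by \<open>energy_trace_unique\<close> each
  may replace the other in the second slot. Hence the energy of \<open>u - v\<close> is 0, and the
  positive lower bound of \<gamma> makes the gradients equal almost everywhere.\<close>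

lemma energy_solution_unique:
  assumes u: "weak_solution (ball 0 1) \<gamma> u" "has_trace (ball 0 1) sphere_measure u f"
    and v: "weak_solution (ball 0 1) \<gamma> v" "has_trace (ball 0 1) sphere_measure v f"
    and w: "has_trace (ball 0 1) sphere_measure w g"
  shows "energy \<gamma> u w = energy \<gamma> v w"
proof -
  let ?W = "weak_grad (ball 0 1)"
  note Lu = weak_gradD(3)[OF u(2)] and Lv = weak_gradD(3)[OF v(2)]
  have e: "energy \<gamma> u u = energy \<gamma> u v" "energy \<gamma> v u = energy \<gamma> v v"
    using energy_trace_unique[OF u u(2) v(2)] energy_trace_unique[OF v u(2) v(2)] by auto
  let ?D = "\<lambda>x. \<gamma> x * ((?W u x - ?W v x) \<bullet> (?W u x - ?W v x))"
  have int: "integrable MB ?D" by (intro energy_integrable L2v_diff Lu Lv)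
  have "(\<integral>x. ?D x \<partial>MB) = (\<integral>x. \<gamma> x * (?W u x \<bullet> ?W u x) - \<gamma> x * (?W u x \<bullet> ?W v x) - (\<gamma> x * (?W v x \<bullet> ?W u x) - \<gamma> x * (?W v x \<bullet> ?W v x)) \<partial>MB)"
    by (intro Bochner_Integration.integral_cong refl) (simp add: inner_diff_left inner_diff_right algebra_simps)
  also have "\<dots> = energy \<gamma> u u - energy \<gamma> u v - (energy \<gamma> v u - energy \<gamma> v v)"
    unfolding energy_def
    using energy_integrable[OF Lu Lu] energy_integrable[OF Lu Lv] energy_integrable[OF Lv Lu] energy_integrable[OF Lv Lv]
    by simp
  finally have "(\<integral>x. ?D x \<partial>MB) = 0" using e by simp
  moreover have nn: "AE x in MB. 0 \<le> ?D x"
    using bounds by (intro AE_I2) (auto intro!: mult_nonneg_nonneg dest: order_trans[OF less_imp_le])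
  ultimately have "AE x in MB. ?D x = 0"
    using integral_nonneg_eq_0_iff_AE[OF int nn] by simp
  then have "AE x in MB. ?W u x = ?W v x"
  proof (rule AE_mp, intro AE_I2 impI)
    fix x assume "x \<in> space MB" "?D x = 0"
    then show "?W u x = ?W v x" using bounds(1)[of x] bounds(3) by auto
  qed
  then show ?thesis
    using energy_eq[OF u(2) w _ _ Lv weak_gradD(3)[OF w]] by (simp add: energy_def)
qed

lemma weak_grad_norm_le_H1_norm:
  assumes "has_trace (ball 0 1) \<sigma> v g"
  shows "L2_norm MB (\<lambda>x. norm (weak_grad (ball 0 1) v x)) \<le> H1_norm (ball 0 1) v"
  using unit_ball.H1_norm_eq[OF weak_gradD(1,2)[OF assms]] by (simp add: real_le_rsqrt)

text \<open>One weak solution determines \<open>DN_map\<close>: the functional \<xi>, built with an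
  arbitrary choice of extensions, is a conormal derivative, and every candidate of the definite
  description coincides with it, on \<open>H_half\<close> by the uniqueness lemmas and elsewhere by
  extensionality.\<close>

lemma DN_map_ball:
  assumes u: "weak_solution (ball 0 1) \<gamma> u" "has_trace (ball 0 1) sphere_measure u f"
  shows "DN_map (ball 0 1) sphere_measure \<gamma> f \<in> extensional (H_half (ball 0 1) sphere_measure)"
    and "has_trace (ball 0 1) sphere_measure v g \<Longrightarrow> DN_map (ball 0 1) sphere_measure \<gamma> f g = energy \<gamma> u v"
proof -
  let ?H = "H_half (ball 0 1) sphere_measure :: ('a \<Rightarrow> real) set"
  let ?W = "weak_grad (ball 0 1)"
  define \<xi> where "\<xi> = (\<lambda>g\<in>?H. energy \<gamma> u (SOME v. has_trace (ball 0 1) sphere_measure v g))"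
  have \<xi>: "\<xi> g = energy \<gamma> u v" if "has_trace (ball 0 1) sphere_measure v g" for v g
  proof -
    have "has_trace (ball 0 1) sphere_measure (SOME v. has_trace (ball 0 1) sphere_measure v g) g"
      by (rule someI[of "\<lambda>v. has_trace (ball 0 1) sphere_measure v g", OF that])
    moreover have "g \<in> ?H" using that by (auto simp: H_half_def)
    ultimately show ?thesis
      unfolding \<xi>_def using energy_trace_unique[OF u _ that] by simp
  qed
  \<comment> \<open>The summand 1 makes \<open>C'\<close> positive, so that the estimate can be
    divided by it before the infimum over all extensions is taken.\<close>
  define C' where "C' = C * L2_norm MB (\<lambda>x. norm (?W u x)) + 1"
  have C': "0 < C'" unfolding C'_def using C_nonneg by (intro add_nonneg_pos mult_nonneg_nonneg) auto
  have bd: "\<bar>\<xi> g\<bar> \<le> C' * H1_norm (ball 0 1) v" if v: "has_trace (ball 0 1) sphere_measure v g" for v g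
  proof -
    have "\<bar>\<xi> g\<bar> \<le> C * (L2_norm MB (\<lambda>x. norm (?W u x)) * L2_norm MB (\<lambda>x. norm (?W v x)))"
      unfolding \<xi>[OF v] energy_def
      using abs_bound by (intro L2v_Cauchy_Schwarz weak_gradD(3)[OF u(2)] weak_gradD(3)[OF v] measurable C_nonneg) auto
    also have "\<dots> \<le> C' * L2_norm MB (\<lambda>x. norm (?W v x))"
      by (simp add: C'_def distrib_right mult.assoc)
    also have "\<dots> \<le> C' * H1_norm (ball 0 1) v"
      using C' by (intro mult_left_mono weak_grad_norm_le_H1_norm[OF v]) auto
    finally show ?thesis .
  qed
  have "\<xi> \<in> H_minus_half (ball 0 1) sphere_measure"
    unfolding H_minus_half_def
  proof (intro CollectI conjI ballI allI exI[of _ C'])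
    show "\<xi> \<in> extensional ?H" by (simp add: \<xi>_def)
    fix f g assume "f \<in> ?H" "g \<in> ?H"
    then obtain v w where v: "has_trace (ball 0 1) sphere_measure v f" and w: "has_trace (ball 0 1) sphere_measure w g"
      by (auto simp: H_half_def)
    show "\<xi> (\<lambda>x. f x + g x) = \<xi> f + \<xi> g"
      unfolding \<xi>[OF v] \<xi>[OF w] \<xi>[OF has_trace_add[OF v w]] by (rule energy_add[OF u(2) v w])
  next
    fix k f assume "f \<in> ?H"
    then obtain v where v: "has_trace (ball 0 1) sphere_measure v f" by (auto simp: H_half_def)
    show "\<xi> (\<lambda>x. k * f x) = k * \<xi> f"
      unfolding \<xi>[OF v] \<xi>[OF has_trace_cmult[OF v]] by (rule energy_cmult[OF u(2) v])
  next
    fix f assume "f \<in> ?H"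
    then have ne: "{v. has_trace (ball 0 1) sphere_measure v f} \<noteq> {}" by (auto simp: H_half_def)
    have "\<bar>\<xi> f\<bar> / C' \<le> H_half_norm (ball 0 1) sphere_measure f"
      unfolding H_half_norm_def
    proof (rule cINF_greatest[OF ne])
      show "\<bar>\<xi> f\<bar> / C' \<le> H1_norm (ball 0 1) v" if "v \<in> {v. has_trace (ball 0 1) sphere_measure v f}" for v
        using bd[of v f] that C' by (simp add: pos_divide_le_eq mult.commute)
    qed
    then show "\<bar>\<xi> f\<bar> \<le> C' * H_half_norm (ball 0 1) sphere_measure f"
      using C' by (simp add: pos_divide_le_eq mult.commute)
  qed
  then have conormal: "is_conormal_derivative (ball 0 1) sphere_measure \<gamma> u \<xi>"
    unfolding is_conormal_derivative_def using \<xi> by (auto simp: energy_def)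
  have "DN_map (ball 0 1) sphere_measure \<gamma> f = \<xi>"
    unfolding DN_map_def
  proof (rule the_equality)
    show "\<exists>u. weak_solution (ball 0 1) \<gamma> u \<and> has_trace (ball 0 1) sphere_measure u f \<and>
        is_conormal_derivative (ball 0 1) sphere_measure \<gamma> u \<xi>"
      using u conormal by blast
    fix \<eta> assume "\<exists>u. weak_solution (ball 0 1) \<gamma> u \<and> has_trace (ball 0 1) sphere_measure u f \<and>
        is_conormal_derivative (ball 0 1) sphere_measure \<gamma> u \<eta>"
    then obtain u' where u': "weak_solution (ball 0 1) \<gamma> u'" "has_trace (ball 0 1) sphere_measure u' f"
        "is_conormal_derivative (ball 0 1) sphere_measure \<gamma> u' \<eta>" by blast
    show "\<eta> = \<xi>"
    proof (rule extensionalityI[of _ ?H])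
      show "\<eta> \<in> extensional ?H" using u'(3) by (auto simp: is_conormal_derivative_def H_minus_half_def)
      show "\<xi> \<in> extensional ?H" by (simp add: \<xi>_def)
      fix g assume "g \<in> ?H"
      then obtain v where v: "has_trace (ball 0 1) sphere_measure v g" by (auto simp: H_half_def)
      have "\<eta> g = energy \<gamma> u' v" using u'(3) v by (auto simp: is_conormal_derivative_def energy_def)
      then show "\<eta> g = \<xi> g"
        using \<xi>[OF v] energy_solution_unique[OF u u'(1,2) v] by simp
    qed
  qed
  then show "DN_map (ball 0 1) sphere_measure \<gamma> f \<in> extensional ?H"
    and "has_trace (ball 0 1) sphere_measure v g \<Longrightarrow> DN_map (ball 0 1) sphere_measure \<gamma> f g = energy \<gamma> u v"
    using \<xi> by (auto simp: \<xi>_def)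
qed

end

section \<open>Darboux transformation of harmonic functions\<close>

text \<open>Compare \<open>x\<close> with its radial projection to the sphere, where
  \<open>a\<close> is 0; for \<open>|x| < 1\<close> the distance \<open>1 - |x|\<close> is at most
  \<open>1 - |x|^2\<close>.\<close>

lemma vanishing_boundary_bound:
  fixes a :: "'a::euclidean_space \<Rightarrow> real"
  assumes "smooth_up_ball a" "\<And>x. norm x = 1 \<Longrightarrow> a x = 0"
  obtains L where "0 \<le> L" "\<And>x. x \<in> ball 0 1 \<Longrightarrow> \<bar>a x\<bar> \<le> L * (1 - x \<bullet> x)"
proof -
  obtain L where L: "0 \<le> L" "\<And>x y. x \<in> cball 0 1 \<Longrightarrow> y \<in> cball 0 1 \<Longrightarrow> \<bar>a x - a y\<bar> \<le> L * norm (x - y)"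
    using smooth_up_Lipschitz[OF assms(1)] by metis
  have "\<bar>a x\<bar> \<le> L * (1 - x \<bullet> x)" if x: "x \<in> ball 0 1" for x
  proof -
    obtain e where e: "norm e = 1" "x = norm x *\<^sub>R e"
    proof (cases "x = 0")
      case True
      \<comment> \<open>The origin has no distinguished projection; any unit vector serves.\<close>
      then show ?thesis using that[of "SOME b. b \<in> Basis"] by (simp add: SOME_Basis)
    next
      case False
      then show ?thesis using that[of "sgn x"] by (simp add: norm_sgn sgn_div_norm)
    qed
    have n: "norm x < 1" using x by simp
    have "x - e = (norm x - 1) *\<^sub>R e" by (subst e(2)) (simp add: scaleR_left_diff_distrib)
    then have "norm (x - e) = 1 - norm x" using e(1) n by simp
    then have "\<bar>a x\<bar> \<le> L * (1 - norm x)" using L(2)[of x e] assms(2)[OF e(1)] x e(1) by simp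
    also have "\<dots> \<le> L * (1 - x \<bullet> x)"
    proof (intro mult_left_mono L(1))
      have "norm x * norm x \<le> 1 * norm x" using n by (intro mult_right_mono) auto
      then show "1 - norm x \<le> 1 - x \<bullet> x" by (simp add: power2_norm_eq_inner[symmetric] power2_eq_square)
    qed
    finally show ?thesis .
  qed
  then show ?thesis using L(1) that by blast
qed

text \<open>If \<open>u\<close> is harmonic and \<open>h\<close> is its radial primitive, the Darboux transform \<open>v = u + k h\<close>
  solves \<open>\<Delta>v = q v\<close> with \<open>q = 4 k'\<close>, and \<open>w = 1 + 2 k / 17\<close> solves the same equation, so
  \<open>v / w\<close> solves the conductivity equation for \<open>w\<^sup>2\<close>. Here \<open>k\<close>, \<open>k1\<close>, \<open>k2\<close> are
  a function of \<open>s = \<bar>x\<bar>\<^sup>2\<close> and its derivatives; the equation for \<open>k2\<close> is the derivative of the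
  Riccati equation \<open>2 s k' = (k + 8)\<^sup>2 - m\<^sup>2\<close>.\<close>

locale darboux =
  fixes k k1 k2 :: "real \<Rightarrow> real" and U :: "'a::euclidean_space set"
  assumes dim3: "DIM('a) = 3"
    and U: "open U" "cball 0 1 \<subseteq> U"
    and smooth: "smooth_on U (\<lambda>x. k (x \<bullet> x))" "smooth_on U (\<lambda>x. k1 (x \<bullet> x))"
    and deriv: "\<And>s. 0 \<le> s \<Longrightarrow> s \<le> 1 \<Longrightarrow> (k has_real_derivative k1 s) (at s)"
      "\<And>s. 0 \<le> s \<Longrightarrow> s \<le> 1 \<Longrightarrow> (k1 has_real_derivative k2 s) (at s)"
    and ode: "\<And>s. 0 \<le> s \<Longrightarrow> s \<le> 1 \<Longrightarrow> 2 * s * k2 s = (2 * k s + 14) * k1 s"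
    and k_1: "k 1 = 0"
    and w_pos: "\<And>s. 0 \<le> s \<Longrightarrow> s \<le> 1 \<Longrightarrow> 0 < 1 + 2 / 17 * k s"
begin

text \<open>The overview writes \<open>K\<close> for the function with boundary value 8; here it is
  that function minus 8, so that it vanishes on the sphere and \<open>W\<close> is 1 there.\<close>

definition K :: "'a \<Rightarrow> real" where "K x = k (x \<bullet> x)"
definition K1 :: "'a \<Rightarrow> real" where "K1 x = k1 (x \<bullet> x)"
definition W :: "'a \<Rightarrow> real" where "W x = 1 + 2 / 17 * K x"

text \<open>For \<open>v = u + K h\<close>, with \<open>G\<close> and \<open>H\<close> the gradients
  of \<open>u\<close> and \<open>h\<close>, this is \<open>W^2\<close> times the gradient of
  \<open>v / W\<close>, that is \<open>W grad v - v grad W\<close>, with the gradients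
  \<open>2 K1 x\<close> of \<open>K\<close> and \<open>4/17 K1 x\<close> of \<open>W\<close>
  inserted. The coefficient of \<open>h\<close> collapses to \<open>2 K1\<close> because
  \<open>W - 2/17 K = 1\<close>.\<close>

definition flux :: "('a \<Rightarrow> real) \<Rightarrow> ('a \<Rightarrow> 'a) \<Rightarrow> ('a \<Rightarrow> real) \<Rightarrow> ('a \<Rightarrow> 'a) \<Rightarrow> 'a \<Rightarrow> 'a" where
  "flux u G h H x = W x *\<^sub>R G x + (W x * K x) *\<^sub>R H x + (2 * K1 x * h x - 4 / 17 * K1 x * u x) *\<^sub>R x"

lemma s01: "x \<in> cball 0 1 \<Longrightarrow> 0 \<le> x \<bullet> x \<and> x \<bullet> x \<le> (1::real)" for x :: 'a
  using inner_self_le_1[of x] by simp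

lemma smooth_up: "smooth_up_ball K" "smooth_up_ball K1" "smooth_up_ball W"
proof -
  show K: "smooth_up_ball K" "smooth_up_ball K1"
    unfolding K_def[abs_def] K1_def[abs_def]
    using U smooth by (auto intro!: smooth_up_to_boundaryI[of U])
  show "smooth_up_ball W"
    unfolding W_def[abs_def] by (intro smooth_up_add smooth_up_cmult smooth_up_const K)
qed

lemma W_pos: "x \<in> cball 0 1 \<Longrightarrow> 0 < W x"
  using w_pos s01 by (simp add: W_def K_def)

lemma has_derivative_K:
  assumes "x \<in> ball 0 1"
  shows "(K has_derivative (\<lambda>h. ((2 * K1 x) *\<^sub>R x) \<bullet> h)) (at x)"
    "(K1 has_derivative (\<lambda>h. ((2 * k2 (x \<bullet> x)) *\<^sub>R x) \<bullet> h)) (at x)"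
    "(W has_derivative (\<lambda>h. ((4 / 17 * K1 x) *\<^sub>R x) \<bullet> h)) (at x)"
proof -
  have x: "x \<in> cball 0 1" using assms by auto
  show *: "(K has_derivative (\<lambda>h. ((2 * K1 x) *\<^sub>R x) \<bullet> h)) (at x)"
    unfolding K_def[abs_def] K1_def using s01[OF x] by (intro has_derivative_radial deriv) auto
  show "(K1 has_derivative (\<lambda>h. ((2 * k2 (x \<bullet> x)) *\<^sub>R x) \<bullet> h)) (at x)"
    unfolding K1_def[abs_def] using s01[OF x] by (intro has_derivative_radial deriv) auto
  have "((\<lambda>x. 1 + 2 / 17 * K x) has_derivative (\<lambda>h. 2 / 17 * (((2 * K1 x) *\<^sub>R x) \<bullet> h))) (at x)"
    by (rule has_derivative_eq_rhs[OF has_derivative_add[OF has_derivative_const has_derivative_mult_right[OF *]]]) simp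
  then show "(W has_derivative (\<lambda>h. ((4 / 17 * K1 x) *\<^sub>R x) \<bullet> h)) (at x)"
    unfolding W_def[abs_def] by (rule has_derivative_eq_rhs) (auto simp: fun_eq_iff)
qed

lemma smooth_up_inverse_W: "smooth_up_ball (\<lambda>x. inverse (W x))"
proof -
  define V where "V = U \<inter> W -` {0<..}"
  have sW: "smooth_on U W"
    unfolding W_def[abs_def] K_def by (intro smooth_on_add smooth_on_cmult smooth_on_const smooth U)
  have "open V"
    unfolding V_def by (rule continuous_open_preimage[OF smooth_on_continuous[OF sW] U(1) open_greaterThan])
  moreover have "cball 0 1 \<subseteq> V" using U(2) W_pos by (auto simp: V_def)
  moreover have "smooth_on V W" by (rule smooth_on_subset[OF sW]) (auto simp: V_def)
  ultimately show ?thesis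
    by (intro smooth_up_to_boundaryI[of V] smooth_on_inverse) (auto simp: V_def)
qed

lemma grad_inverse_W:
  assumes x: "x \<in> ball 0 1"
  shows "((\<lambda>x. inverse (W x)) has_derivative (\<lambda>h. ((- (4 / 17 * K1 x) / (W x)\<^sup>2) *\<^sub>R x) \<bullet> h)) (at x)"
proof -
  have "W x \<noteq> 0" using W_pos[of x] x by auto
  then show ?thesis
    using Deriv.has_derivative_inverse[OF _ has_derivative_K(3)[OF x]]
    by (rule_tac has_derivative_eq_rhs) (auto simp: fun_eq_iff power2_eq_square field_simps)
qed

section \<open>The transform of a weakly harmonic function and its radial primitive\<close>

context
  fixes \<Phi> \<Psi> :: "nat \<Rightarrow> 'a \<Rightarrow> real" and u h :: "'a \<Rightarrow> real" and G H :: "'a \<Rightarrow> 'a"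
  assumes \<Phi>: "unit_ball.H1_tendsto \<Phi> u G"
    and harm: "\<And>\<psi>. test_function (ball 0 1) \<psi> \<Longrightarrow> (\<integral>x. G x \<bullet> grad \<psi> x \<partial>MB) = 0"
    and \<Psi>: "unit_ball.H1_tendsto \<Psi> h H"
    and harm': "\<And>\<psi>. test_function (ball 0 1) \<psi> \<Longrightarrow> (\<integral>x. H x \<bullet> grad \<psi> x \<partial>MB) = 0"
    and Euler: "AE x in MB. x \<bullet> H x = u x - 17 / 2 * h x"
begin

definition transform :: "'a \<Rightarrow> real" where
  "transform x = inverse (W x) * u x + (inverse (W x) * K x) * h x"

lemma transform_H1:
  "unit_ball.H1_tendsto (\<lambda>n x. inverse (W x) * \<Phi> n x + (inverse (W x) * K x) * \<Psi> n x) transform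
    (\<lambda>x. (inverse (W x) *\<^sub>R G x + u x *\<^sub>R grad (\<lambda>x. inverse (W x)) x) +
      ((inverse (W x) * K x) *\<^sub>R H x + h x *\<^sub>R grad (\<lambda>x. inverse (W x) * K x) x))"
  unfolding transform_def[abs_def]
  by (intro H1_tendsto_add H1_tendsto_mult smooth_up_mult smooth_up_inverse_W smooth_up \<Phi> \<Psi>)

lemma transform_flux:
  assumes x: "x \<in> ball 0 1"
  shows "(W x)\<^sup>2 *\<^sub>R ((inverse (W x) *\<^sub>R G x + u x *\<^sub>R grad (\<lambda>x. inverse (W x)) x) +
      ((inverse (W x) * K x) *\<^sub>R H x + h x *\<^sub>R grad (\<lambda>x. inverse (W x) * K x) x)) = flux u G h H x"
proof -
  have w: "W x \<noteq> 0" using W_pos[of x] x by auto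
  note dW = grad_inverse_W[OF x] and dK = has_derivative_K(1)[OF x]
  have 1: "grad (\<lambda>x. inverse (W x)) x = (- (4 / 17 * K1 x) / (W x)\<^sup>2) *\<^sub>R x"
    by (rule grad_eqI[OF dW])
  have 2: "grad (\<lambda>x. inverse (W x) * K x) x = inverse (W x) *\<^sub>R ((2 * K1 x) *\<^sub>R x) + K x *\<^sub>R ((- (4 / 17 * K1 x) / (W x)\<^sup>2) *\<^sub>R x)"
    by (intro grad_eqI has_derivative_inner_grad_mult dW dK)
  have "(W x)\<^sup>2 * (inverse (W x) * (2 * K1 x)) + (W x)\<^sup>2 * (K x * (- (4 / 17 * K1 x) / (W x)\<^sup>2)) = 2 * K1 x * (W x - 2 / 17 * K x)"
    using w by (simp add: power2_eq_square field_simps)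
  also have "\<dots> = 2 * K1 x" by (simp add: W_def)
  finally have 3: "(W x)\<^sup>2 * (inverse (W x) * (2 * K1 x)) + (W x)\<^sup>2 * (K x * (- (4 / 17 * K1 x) / (W x)\<^sup>2)) = 2 * K1 x" .
  have "(W x)\<^sup>2 *\<^sub>R ((inverse (W x) *\<^sub>R G x + u x *\<^sub>R grad (\<lambda>x. inverse (W x)) x) +
      ((inverse (W x) * K x) *\<^sub>R H x + h x *\<^sub>R grad (\<lambda>x. inverse (W x) * K x) x)) =
     ((W x)\<^sup>2 * inverse (W x)) *\<^sub>R G x + ((W x)\<^sup>2 * inverse (W x) * K x) *\<^sub>R H x +
     (h x * ((W x)\<^sup>2 * (inverse (W x) * (2 * K1 x)) + (W x)\<^sup>2 * (K x * (- (4 / 17 * K1 x) / (W x)\<^sup>2))) +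
      u x * ((W x)\<^sup>2 * (- (4 / 17 * K1 x) / (W x)\<^sup>2))) *\<^sub>R x"
    unfolding 1 2 by (simp add: scaleR_add_right scaleR_add_left algebra_simps)
  also have "\<dots> = flux u G h H x"
    unfolding 3 flux_def using w by (simp add: power2_eq_square algebra_simps)
  finally show ?thesis .
qed

lemma flux_L2v: "L2v MB (flux u G h H)"
proof -
  note D = unit_ball.H1_tendstoD[OF \<Phi>] and E = unit_ball.H1_tendstoD[OF \<Psi>]
  have q: "(\<lambda>x. 2 * K1 x * h x - 4 / 17 * K1 x * u x) \<in> L2 MB"
    by (intro L2_diff smooth_up_mult_L2 smooth_up_cmult smooth_up D E)
  show ?thesis
    unfolding flux_def[abs_def]
    by (intro L2v_add smooth_up_scaleR_L2v smooth_up_mult smooth_up D E L2v_scalar_field[OF q id_measurable_MB, where C = 1]) auto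
qed

text \<open>The fields \<open>G\<close> and \<open>H\<close> are divergence free, so only the
  gradients of their coefficients contribute, and the divergence of \<open>q x\<close> is
  \<open>x \<bullet> Q + 3 q\<close>. Once \<open>Euler\<close> eliminates
  \<open>x \<bullet> H\<close> and \<open>ode\<close> eliminates \<open>k2\<close>, the terms in
  \<open>x \<bullet> G\<close>, \<open>u\<close> and \<open>h\<close> cancel separately.\<close>

lemma flux_divergence_free:
  assumes \<phi>: "test_function (ball 0 1) \<phi>"
  shows "(\<integral>x. flux u G h H x \<bullet> grad \<phi> x \<partial>MB) = 0"
proof -
  note D = unit_ball.H1_tendstoD[OF \<Phi>] and E = unit_ball.H1_tendstoD[OF \<Psi>]
  note T = unit_ball.test_function_L2[OF \<phi>]
  have bU: "ball 0 1 \<subseteq> U" using U(2) ball_subset_cball by blast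
  have sW: "smooth_on U W"
    unfolding W_def[abs_def] K_def by (intro smooth_on_add smooth_on_cmult smooth_on_const smooth U)
  have sWK: "smooth_on U (\<lambda>x. W x * K x)"
    using smooth_on_mult[OF U(1) sW smooth(1)] by (simp add: K_def[abs_def])
  have xL: "(\<lambda>x. x \<bullet> F x) \<in> L2 MB" if "L2v MB F" for F :: "'a \<Rightarrow> 'a"
    using L2_tendstoD(2)[OF L2v_tendsto_inner_field[OF L2v_tendsto_const[OF that] id_measurable_MB, of 1]] by auto
  define q where "q x = 2 * K1 x * h x - 4 / 17 * K1 x * u x" for x
  \<comment> \<open>The weak gradient of \<open>q\<close>; its terms with \<open>k2\<close> come
    from differentiating \<open>K1\<close>.\<close>
  define Q where "Q x = ((2 * K1 x) *\<^sub>R H x + h x *\<^sub>R ((4 * k2 (x \<bullet> x)) *\<^sub>R x)) -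
      ((4 / 17 * K1 x) *\<^sub>R G x + u x *\<^sub>R ((8 / 17 * k2 (x \<bullet> x)) *\<^sub>R x))" for x
  \<comment> \<open>Integration by parts with a smooth coefficient \<open>a\<close>: the
    divergence-free field is tested with \<open>a \<phi>\<close>.\<close>
  have product: "(\<integral>x. a x * (F x \<bullet> grad \<phi> x) \<partial>MB) = - (\<integral>x. \<phi> x * (F x \<bullet> A x) \<partial>MB)"
    if a: "smooth_on U a" and A: "\<And>x. x \<in> ball 0 1 \<Longrightarrow> (a has_derivative (\<lambda>h. A x \<bullet> h)) (at x)"
      and F: "L2v MB F" and div: "\<And>\<psi>. test_function (ball 0 1) \<psi> \<Longrightarrow> (\<integral>x. F x \<bullet> grad \<psi> x \<partial>MB) = 0"
    for a and F A :: "'a \<Rightarrow> 'a"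
  proof -
    have T': "test_function (ball 0 1) (\<lambda>x. a x * \<phi> x)"
      by (rule test_function_smooth_mult[OF \<phi> U(1) bU a])
    have su: "smooth_up_ball a" using U a by (intro smooth_up_to_boundaryI[of U]) auto
    have g: "grad (\<lambda>x. a x * \<phi> x) x = a x *\<^sub>R grad \<phi> x + \<phi> x *\<^sub>R A x" if "x \<in> ball 0 1" for x
      by (intro grad_eqI has_derivative_inner_grad_mult A that
          smooth_on_has_derivative[OF test_function_smooth[OF \<phi>] open_UNIV]) auto
    have i1: "integrable MB (\<lambda>x. a x * (F x \<bullet> grad \<phi> x))"
      using L2v_inner_integrable[OF smooth_up_scaleR_L2v[OF su F] T(2)] by simp
    have "integrable MB (\<lambda>x. F x \<bullet> grad (\<lambda>x. a x * \<phi> x) x - a x * (F x \<bullet> grad \<phi> x))"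
      by (intro Bochner_Integration.integrable_diff i1 L2v_inner_integrable F unit_ball.test_function_L2[OF T'])
    then have i2: "integrable MB (\<lambda>x. \<phi> x * (F x \<bullet> A x))"
      by (rule Bochner_Integration.integrable_cong[THEN iffD1, rotated -1]) (auto simp: g inner_add_right)
    have "0 = (\<integral>x. F x \<bullet> grad (\<lambda>x. a x * \<phi> x) x \<partial>MB)" using div[OF T'] by simp
    also have "\<dots> = (\<integral>x. a x * (F x \<bullet> grad \<phi> x) + \<phi> x * (F x \<bullet> A x) \<partial>MB)"
      by (intro Bochner_Integration.integral_cong refl) (simp add: g inner_add_right)
    also have "\<dots> = (\<integral>x. a x * (F x \<bullet> grad \<phi> x) \<partial>MB) + (\<integral>x. \<phi> x * (F x \<bullet> A x) \<partial>MB)"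
      by (rule Bochner_Integration.integral_add[OF i1 i2])
    finally show ?thesis by simp
  qed
  have p1: "(\<integral>x. W x * (G x \<bullet> grad \<phi> x) \<partial>MB) = - (\<integral>x. \<phi> x * (G x \<bullet> ((4 / 17 * K1 x) *\<^sub>R x)) \<partial>MB)"
    by (rule product[OF sW has_derivative_K(3) D(6) harm])
  have p2: "(\<integral>x. (W x * K x) * (H x \<bullet> grad \<phi> x) \<partial>MB) = - (\<integral>x. \<phi> x * (H x \<bullet> (W x *\<^sub>R ((2 * K1 x) *\<^sub>R x) + K x *\<^sub>R ((4 / 17 * K1 x) *\<^sub>R x))) \<partial>MB)"
    by (rule product[OF sWK has_derivative_inner_grad_mult[OF has_derivative_K(3) has_derivative_K(1)] E(6) harm'])
  have wq: "has_weak_gradient (ball 0 1) q Q" and qL: "q \<in> L2 MB"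
  proof -
    have gK: "grad (\<lambda>x. c * K1 x) x = (2 * c * k2 (x \<bullet> x)) *\<^sub>R x" if "x \<in> ball 0 1" for x c
      by (rule grad_eqI, rule has_derivative_eq_rhs[OF has_derivative_mult_right[OF has_derivative_K(2)[OF that]]]) auto
    have "unit_ball.H1_tendsto (\<lambda>n x. (2 * K1 x) * \<Psi> n x + (- 4 / 17 * K1 x) * \<Phi> n x)
        (\<lambda>x. (2 * K1 x) * h x + (- 4 / 17 * K1 x) * u x)
        (\<lambda>x. ((2 * K1 x) *\<^sub>R H x + h x *\<^sub>R grad (\<lambda>x. 2 * K1 x) x) + ((- 4 / 17 * K1 x) *\<^sub>R G x + u x *\<^sub>R grad (\<lambda>x. - 4 / 17 * K1 x) x))"
      by (intro H1_tendsto_add H1_tendsto_mult smooth_up_cmult smooth_up \<Phi> \<Psi>)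
    note N = unit_ball.H1_tendstoD(4,5)[OF this]
    have eqx: "q x = (2 * K1 x) * h x + (- 4 / 17 * K1 x) * u x" for x by (simp add: q_def)
    have eq: "(\<lambda>x. (2 * K1 x) * h x + (- 4 / 17 * K1 x) * u x) = q" by (simp add: q_def fun_eq_iff)
    show "q \<in> L2 MB" using N(2) unfolding eq .
    have eqQ: "((2 * K1 x) *\<^sub>R H x + h x *\<^sub>R grad (\<lambda>x. 2 * K1 x) x) + ((- 4 / 17 * K1 x) *\<^sub>R G x + u x *\<^sub>R grad (\<lambda>x. - 4 / 17 * K1 x) x) = Q x"
      if "x \<in> ball 0 1" for x
      unfolding gK[OF that] Q_def by (simp add: algebra_simps)
    show "has_weak_gradient (ball 0 1) q Q"
    proof (rule unit_ball.has_weak_gradientI)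
      show "L2v MB Q" by (rule L2v_cong[OF unit_ball.has_weak_gradientD(1)[OF N(1)]]) (rule eqQ, simp)
      fix \<psi> :: "'a \<Rightarrow> real" and b :: 'a assume \<psi>: "test_function (ball 0 1) \<psi>" "b \<in> Basis"
      have "(\<integral>x. q x * (grad \<psi> x \<bullet> b) \<partial>MB) = - (\<integral>x. ((((2 * K1 x) *\<^sub>R H x + h x *\<^sub>R grad (\<lambda>x. 2 * K1 x) x) + ((- 4 / 17 * K1 x) *\<^sub>R G x + u x *\<^sub>R grad (\<lambda>x. - 4 / 17 * K1 x) x)) \<bullet> b) * \<psi> x \<partial>MB)"
        unfolding eqx by (rule unit_ball.has_weak_gradientD(2)[OF N(1) \<psi>])
      also have "\<dots> = - (\<integral>x. (Q x \<bullet> b) * \<psi> x \<partial>MB)"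
        by (intro arg_cong[where f = uminus] Bochner_Integration.integral_cong refl) (simp only: eqQ unit_ball.space_M)
      finally show "(\<integral>x. q x * (grad \<psi> x \<bullet> b) \<partial>MB) = - (\<integral>x. (Q x \<bullet> b) * \<psi> x \<partial>MB)" .
    qed
  qed
  note QL = unit_ball.has_weak_gradientD(1)[OF wq]
  have iQ: "integrable MB (\<lambda>x. (q x *\<^sub>R x) \<bullet> grad \<phi> x)"
    by (rule L2v_inner_integrable[OF L2v_scalar_field[OF qL id_measurable_MB, of 1] T(2)]) auto
  \<comment> \<open>Integration by parts in each coordinate; the three summands \<open>q\<close>
    account for the divergence 3 of the field \<open>x\<close>.\<close>
  have p3: "(\<integral>x. q x * (x \<bullet> grad \<phi> x) \<partial>MB) = - (\<integral>x. \<phi> x * (x \<bullet> Q x + 3 * q x) \<partial>MB)"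
  proof -
    have part: "(\<integral>x. q x * ((x \<bullet> b) * (grad \<phi> x \<bullet> b)) \<partial>MB) = - (\<integral>x. \<phi> x * ((x \<bullet> b) * (Q x \<bullet> b) + q x) \<partial>MB)"
      and int1: "integrable MB (\<lambda>x. q x * ((x \<bullet> b) * (grad \<phi> x \<bullet> b)))"
      and int2: "integrable MB (\<lambda>x. \<phi> x * ((x \<bullet> b) * (Q x \<bullet> b) + q x))" if b: "b \<in> Basis" for b
    proof -
      have sb: "smooth_on UNIV (\<lambda>x::'a. x \<bullet> b)" by (intro smooth_on_linear bounded_linear_inner_left) auto
      have gb: "grad (\<lambda>x::'a. x \<bullet> b) x = b" for x
        by (rule grad_eqI) (auto intro!: derivative_eq_intros simp: inner_commute)
      have "has_weak_gradient (ball 0 1) (\<lambda>x. (x \<bullet> b) * q x) (\<lambda>x. (x \<bullet> b) *\<^sub>R Q x + q x *\<^sub>R b)"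
        using unit_ball.has_weak_gradient_mult[OF open_UNIV _ sb qL wq] by (simp add: gb)
      note N = unit_ball.has_weak_gradientD[OF this]
      have xb: "(\<lambda>x. (x \<bullet> b) * q x) \<in> L2 MB"
        by (rule smooth_up_mult_L2[OF smooth_up_to_boundaryI[OF open_UNIV _ sb] qL]) auto
      show "(\<integral>x. q x * ((x \<bullet> b) * (grad \<phi> x \<bullet> b)) \<partial>MB) = - (\<integral>x. \<phi> x * ((x \<bullet> b) * (Q x \<bullet> b) + q x) \<partial>MB)"
        using N(2)[OF \<phi> b] b by (simp add: inner_add_left mult_ac)
      have "(\<lambda>x. ((x \<bullet> b) *\<^sub>R Q x + q x *\<^sub>R b) \<bullet> b) \<in> L2 MB" using N(1) b by (simp add: L2v_def)
      from L2_mult_integrable[OF T(1) this] show "integrable MB (\<lambda>x. \<phi> x * ((x \<bullet> b) * (Q x \<bullet> b) + q x))"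
        using b by (simp add: inner_add_left)
      have "(\<lambda>x. grad \<phi> x \<bullet> b) \<in> L2 MB" using T(2) b by (simp add: L2v_def)
      from L2_mult_integrable[OF xb this] show "integrable MB (\<lambda>x. q x * ((x \<bullet> b) * (grad \<phi> x \<bullet> b)))"
        by (simp add: mult_ac)
    qed
    have "(\<integral>x. q x * (x \<bullet> grad \<phi> x) \<partial>MB) = (\<integral>x. (\<Sum>b\<in>Basis. q x * ((x \<bullet> b) * (grad \<phi> x \<bullet> b))) \<partial>MB)"
      by (intro Bochner_Integration.integral_cong refl) (subst euclidean_inner, simp add: sum_distrib_left)
    also have "\<dots> = (\<Sum>b\<in>Basis. \<integral>x. q x * ((x \<bullet> b) * (grad \<phi> x \<bullet> b)) \<partial>MB)"
      by (rule Bochner_Integration.integral_sum[OF int1])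
    also have "\<dots> = - (\<Sum>b\<in>Basis. \<integral>x. \<phi> x * ((x \<bullet> b) * (Q x \<bullet> b) + q x) \<partial>MB)"
      by (simp add: part sum_negf)
    also have "(\<Sum>b\<in>Basis. \<integral>x. \<phi> x * ((x \<bullet> b) * (Q x \<bullet> b) + q x) \<partial>MB) = (\<integral>x. (\<Sum>b\<in>Basis. \<phi> x * ((x \<bullet> b) * (Q x \<bullet> b) + q x)) \<partial>MB)"
      by (rule Bochner_Integration.integral_sum[OF int2, symmetric])
    also have "\<dots> = (\<integral>x. \<phi> x * (x \<bullet> Q x + 3 * q x) \<partial>MB)"
      by (intro Bochner_Integration.integral_cong refl)
         (subst (2) euclidean_inner, simp add: sum_distrib_left[symmetric] sum.distrib dim3)
    finally show ?thesis .
  qed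
  let ?A1 = "\<lambda>x. \<phi> x * (G x \<bullet> ((4 / 17 * K1 x) *\<^sub>R x))"
  let ?A2 = "\<lambda>x. \<phi> x * (H x \<bullet> (W x *\<^sub>R ((2 * K1 x) *\<^sub>R x) + K x *\<^sub>R ((4 / 17 * K1 x) *\<^sub>R x)))"
  let ?A3 = "\<lambda>x. \<phi> x * (x \<bullet> Q x + 3 * q x)"
  have j1: "integrable MB ?A1"
  proof -
    have "(\<lambda>x. (4 / 17 * K1 x) * (x \<bullet> G x)) \<in> L2 MB" by (intro smooth_up_mult_L2 smooth_up_cmult smooth_up xL D)
    from L2_mult_integrable[OF T(1) this] show ?thesis by (simp add: inner_commute)
  qed
  have j2: "integrable MB ?A2"
  proof -
    have "(\<lambda>x. (W x * (2 * K1 x) + K x * (4 / 17 * K1 x)) * (x \<bullet> H x)) \<in> L2 MB"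
      by (intro smooth_up_mult_L2 smooth_up_add smooth_up_mult smooth_up_cmult smooth_up_const smooth_up xL E)
    from L2_mult_integrable[OF T(1) this] show ?thesis by (simp add: inner_commute inner_add_right distrib_right)
  qed
  have j3: "integrable MB ?A3"
    by (intro L2_mult_integrable T L2_add L2_cmult xL QL qL)
  have i1: "integrable MB (\<lambda>x. W x * (G x \<bullet> grad \<phi> x))"
    using L2v_inner_integrable[OF smooth_up_scaleR_L2v[OF smooth_up(3) D(6)] T(2)] by simp
  have i2: "integrable MB (\<lambda>x. (W x * K x) * (H x \<bullet> grad \<phi> x))"
    using L2v_inner_integrable[OF smooth_up_scaleR_L2v[OF smooth_up_mult[OF smooth_up(3,1)] E(6)] T(2)] by simp
  have i3: "integrable MB (\<lambda>x. q x * (x \<bullet> grad \<phi> x))" using iQ by simp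
  have "(\<integral>x. flux u G h H x \<bullet> grad \<phi> x \<partial>MB) =
      (\<integral>x. W x * (G x \<bullet> grad \<phi> x) + (W x * K x) * (H x \<bullet> grad \<phi> x) + q x * (x \<bullet> grad \<phi> x) \<partial>MB)"
    by (intro Bochner_Integration.integral_cong refl) (simp add: flux_def q_def inner_add_left)
  also have "\<dots> = (\<integral>x. W x * (G x \<bullet> grad \<phi> x) \<partial>MB) + (\<integral>x. (W x * K x) * (H x \<bullet> grad \<phi> x) \<partial>MB) + (\<integral>x. q x * (x \<bullet> grad \<phi> x) \<partial>MB)"
    using i1 i2 i3 by simp
  also have "\<dots> = - (\<integral>x. ?A1 x + ?A2 x + ?A3 x \<partial>MB)"
    unfolding p1 p2 p3 using j1 j2 j3 by simp
  also have "(\<integral>x. ?A1 x + ?A2 x + ?A3 x \<partial>MB) = (\<integral>x. 0 \<partial>(MB :: 'a measure))"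
  proof (rule integral_cong_AE)
    show "(\<lambda>x. ?A1 x + ?A2 x + ?A3 x) \<in> borel_measurable MB"
      using j1 j2 j3 by (intro borel_measurable_add) auto
    have "AE x in MB. x \<in> ball 0 1" by (rule AE_I2) simp
    with Euler show "AE x in MB. ?A1 x + ?A2 x + ?A3 x = 0"
    proof eventually_elim
      case (elim x)
      define s where "s = x \<bullet> x"
      have x: "x \<in> cball 0 1" using elim(2) by auto
      have o: "2 * s * k2 s = (2 * K x + 14) * K1 x"
        using ode[of s] s01[OF x] by (simp add: s_def K_def K1_def)
      have xG: "G x \<bullet> x = x \<bullet> G x" "H x \<bullet> x = u x - 17 / 2 * h x" using elim(1) by (simp_all add: inner_commute)
      have "x \<bullet> Q x = 2 * K1 x * (u x - 17 / 2 * h x) + 2 * h x * (2 * s * k2 s) - 4 / 17 * K1 x * (x \<bullet> G x) - 4 / 17 * u x * (2 * s * k2 s)"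
        unfolding Q_def by (simp add: inner_diff_right inner_add_right elim(1) s_def[symmetric] algebra_simps)
      also have "\<dots> = 2 * K1 x * (u x - 17 / 2 * h x) + 2 * h x * ((2 * K x + 14) * K1 x) - 4 / 17 * K1 x * (x \<bullet> G x) - 4 / 17 * u x * ((2 * K x + 14) * K1 x)"
        unfolding o ..
      \<comment> \<open>Up to the factor \<open>K1\<close>, the constants of the \<open>u\<close>
        terms sum to \<open>4 - 56/17 - 12/17 = 0\<close>, where 12 is 4 times the dimension, and
        those of the \<open>h\<close> terms to \<open>- 17 - 17 + 28 + 6 = 0\<close>; the parts with
        \<open>K\<close> cancel as well.\<close>
      finally have "4 / 17 * K1 x * (x \<bullet> G x) + (W x * (2 * K1 x) + K x * (4 / 17 * K1 x)) * (u x - 17 / 2 * h x) + (x \<bullet> Q x + 3 * q x) = 0"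
        unfolding q_def W_def by (simp add: field_simps)
      then have "\<phi> x * (4 / 17 * K1 x * (x \<bullet> G x) + (W x * (2 * K1 x) + K x * (4 / 17 * K1 x)) * (u x - 17 / 2 * h x) + (x \<bullet> Q x + 3 * q x)) = 0"
        by simp
      then show ?case
        by (simp add: inner_add_right xG distrib_left distrib_right mult.assoc)
    qed
  qed auto
  finally show ?thesis by simp
qed

lemma transform_solution:
  assumes \<gamma>: "\<And>x. x \<in> ball 0 1 \<Longrightarrow> \<gamma> x = (W x)\<^sup>2"
    and tr: "f \<in> L2 sphere_measure" "(\<lambda>n. L2_norm sphere_measure (\<lambda>x. \<Phi> n x - f x)) \<longlonglongrightarrow> 0"
  shows "has_trace (ball 0 1) sphere_measure transform f"
    and "AE x in MB. \<gamma> x *\<^sub>R weak_grad (ball 0 1) transform x = flux u G h H x"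
    and "weak_solution (ball 0 1) \<gamma> transform"
proof -
  note T = transform_H1
  note D = unit_ball.H1_tendstoD[OF T]
  \<comment> \<open>On the sphere \<open>W = 1\<close> and \<open>K = 0\<close>, so the approximants
    of the transform have there the values of \<open>\<Phi> n\<close>, whatever
    \<open>\<Psi> n\<close> is.\<close>
  have "L2_norm sphere_measure (\<lambda>x. inverse (W x) * \<Phi> n x + (inverse (W x) * K x) * \<Psi> n x - f x) =
      L2_norm sphere_measure (\<lambda>x. \<Phi> n x - f x)" for n
    unfolding L2_norm_def
  proof (intro arg_cong[where f = sqrt] Bochner_Integration.integral_cong refl)
    fix x :: 'a assume "x \<in> space sphere_measure"
    then have "x \<bullet> x = 1" by (simp add: norm_eq_1)
    then show "(inverse (W x) * \<Phi> n x + (inverse (W x) * K x) * \<Psi> n x - f x)\<^sup>2 = (\<Phi> n x - f x)\<^sup>2"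
      by (simp add: W_def K_def k_1)
  qed
  then show tr': "has_trace (ball 0 1) sphere_measure transform f"
    using tr by (intro unit_ball.has_traceI[OF T]) auto
  have "AE x in MB. x \<in> ball 0 1" by (rule AE_I2) simp
  with unit_ball.weak_grad_AE[OF D(5,4)]
  show AEf: "AE x in MB. \<gamma> x *\<^sub>R weak_grad (ball 0 1) transform x = flux u G h H x"
  proof eventually_elim
    case (elim x)
    then show ?case using transform_flux[OF elim(2)] by (simp only: \<gamma>)
  qed
  have [measurable]: "flux u G h H \<in> borel_measurable MB" by (rule L2v_measurable[OF flux_L2v])
  show "weak_solution (ball 0 1) \<gamma> transform"
    unfolding weak_solution_def
  proof (intro conjI allI impI D(7))
    fix \<phi> :: "'a \<Rightarrow> real" assume \<phi>: "test_function (ball 0 1) \<phi>"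
    have gm: "\<gamma> \<in> borel_measurable MB"
    proof -
      have "(\<lambda>x. (W x)\<^sup>2) \<in> borel_measurable MB"
        using unit_ball.smooth_up_to_boundaryD(4)[OF smooth_up(3)]
        by (intro borel_measurable_power unit_ball.continuous_closure_measurable)
      then show ?thesis by (rule measurable_cong[THEN iffD1, rotated]) (simp add: \<gamma>)
    qed
    have wm: "weak_grad (ball 0 1) transform \<in> borel_measurable MB"
      by (rule L2v_measurable[OF weak_gradD(3)[OF tr']])
    have pm: "grad \<phi> \<in> borel_measurable MB"
      by (rule L2v_measurable[OF unit_ball.test_function_L2(2)[OF \<phi>]])
    have "(\<integral>x. \<gamma> x * (weak_grad (ball 0 1) transform x \<bullet> grad \<phi> x) \<partial>MB) = (\<integral>x. flux u G h H x \<bullet> grad \<phi> x \<partial>MB)"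
    proof (rule integral_cong_AE)
      show "AE x in MB. \<gamma> x * (weak_grad (ball 0 1) transform x \<bullet> grad \<phi> x) = flux u G h H x \<bullet> grad \<phi> x"
        using AEf by eventually_elim (metis inner_scaleR_left)
      show "(\<lambda>x. \<gamma> x * (weak_grad (ball 0 1) transform x \<bullet> grad \<phi> x)) \<in> borel_measurable MB"
        by (intro borel_measurable_times borel_measurable_inner gm wm pm)
      show "(\<lambda>x. flux u G h H x \<bullet> grad \<phi> x) \<in> borel_measurable MB"
        by (intro borel_measurable_inner L2v_measurable[OF flux_L2v] pm)
    qed
    then show "(\<integral>x. \<gamma> x * (weak_grad (ball 0 1) transform x \<bullet> grad \<phi> x) \<partial>MB) = 0"
      using flux_divergence_free[OF \<phi>] by simp
  qed
qed

end

end

section \<open>Real analyticity of radial functions\<close>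

text \<open>The disc of radius \<open>R - s\<close> about \<open>s\<close> lies in the disc of
  holomorphy, so the Taylor series of \<open>f\<close> at \<open>s\<close> converges there, and its
  real part expands \<open>F\<close>. Absolute convergence at \<open>q\<close> follows from
  convergence at a larger distance, halfway between \<open>q\<close> and
  \<open>R - s\<close>.\<close>

lemma holomorphic_real_power_series:
  fixes f :: "complex \<Rightarrow> complex" and F :: "real \<Rightarrow> real"
  assumes hol: "f holomorphic_on ball 0 R" and real: "\<And>t. \<bar>t\<bar> < R \<Longrightarrow> f (of_real t) = of_real (F t)"
    and s: "0 \<le> s" "s < R"
  obtains b :: "nat \<Rightarrow> real" where "\<And>t. \<bar>t - s\<bar> < R - s \<Longrightarrow> (\<lambda>n. b n * (t - s) ^ n) sums F t"
    "\<And>q. 0 \<le> q \<Longrightarrow> q < R - s \<Longrightarrow> summable (\<lambda>n. \<bar>b n\<bar> * q ^ n)"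
proof -
  define a where "a n = (deriv ^^ n) f (of_real s) / fact n" for n
  define b where "b n = Re (a n)" for n
  have sub: "ball (of_real s) (R - s) \<subseteq> ball (0 :: complex) R"
  proof
    fix z :: complex assume "z \<in> ball (of_real s) (R - s)"
    then have "norm (z - of_real s) < R - s" by (simp add: dist_norm norm_minus_commute)
    moreover have "norm z \<le> norm (z - of_real s) + norm (of_real s :: complex)"
      by (metis diff_add_cancel norm_triangle_ineq)
    ultimately show "z \<in> ball 0 R" using s by simp
  qed
  have sums: "(\<lambda>n. b n * (t - s) ^ n) sums F t" if t: "\<bar>t - s\<bar> < R - s" for t
  proof -
    have "dist (of_real s) (of_real t :: complex) = \<bar>t - s\<bar>"
      by (metis abs_minus_commute dist_norm norm_of_real of_real_diff)
    then have "of_real t \<in> ball (of_real s :: complex) (R - s)" using t by simp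
    from holomorphic_power_series[OF holomorphic_on_subset[OF hol sub] this]
    have "(\<lambda>n. a n * (of_real t - of_real s) ^ n) sums f (of_real t)" by (simp add: a_def)
    then have "(\<lambda>n. Re (a n * of_real ((t - s) ^ n))) sums Re (f (of_real t))"
      by (intro sums_Re) simp
    moreover have "\<bar>t\<bar> < R" using t s by linarith
    ultimately show ?thesis by (simp add: b_def real)
  qed
  have summable: "summable (\<lambda>n. \<bar>b n\<bar> * q ^ n)" if q: "0 \<le> q" "q < R - s" for q
  proof -
    define t where "t = s + (q + (R - s)) / 2"
    have "\<bar>t - s\<bar> < R - s" using q s by (simp add: t_def)
    from sums_summable[OF sums[OF this]]
    have "summable (\<lambda>n. norm (b n * q ^ n))"
      by (rule powser_insidea) (use q s in \<open>simp add: t_def\<close>)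
    then show ?thesis using q by (simp add: abs_mult)
  qed
  show ?thesis using that sums summable by blast
qed

text \<open>A list records which summand is taken from each factor. Ordered choices turn the
  multinomial theorem into plain distributivity; multiplicities appear only when lists with equal
  exponents are grouped.\<close>

lemma sum_lists_prod:
  fixes g :: "'j::finite \<Rightarrow> real"
  shows "(\<Sum>l | length l = n. prod_list (map g l)) = (\<Sum>j\<in>UNIV. g j) ^ n"
proof (induction n)
  case 0
  have "{l :: 'j list. length l = 0} = {[]}" by auto
  then show ?case by simp
next
  case (Suc n)
  have "{l :: 'j list. length l = Suc n} = (\<lambda>p. fst p # snd p) ` (UNIV \<times> {l. length l = n})"
    by (auto simp: length_Suc_conv image_iff)
  moreover have "inj_on (\<lambda>p. fst p # snd p) (UNIV \<times> {l :: 'j list. length l = n})"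
    by (auto simp: inj_on_def)
  ultimately have "(\<Sum>l | length l = Suc n. prod_list (map g l)) =
      (\<Sum>(j, l)\<in>UNIV \<times> {l. length l = n}. g j * prod_list (map g l))"
    by (simp add: sum.reindex case_prod_beta)
  also have "\<dots> = (\<Sum>j\<in>UNIV. g j) * (\<Sum>l | length l = n. prod_list (map g l))"
    by (simp add: sum.cartesian_product[symmetric] sum_product)
  finally show ?case using Suc by simp
qed

text \<open>\<open>\<bar>a + y\<bar>\<^sup>2 - \<bar>a\<bar>\<^sup>2\<close> is the sum of the monomials \<open>2 a\<^sub>i y\<^sub>i\<close> and \<open>y\<^sub>i\<^sup>2\<close>; its powers are sums over
  lists of such monomials, which are finally grouped by their exponents.\<close>

definition monom_coeff :: "real ^ 'n \<Rightarrow> 'n \<times> bool \<Rightarrow> real" where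
  "monom_coeff a j = (if snd j then 1 else 2 * a $ fst j)"

definition monom_exp :: "'n \<times> bool \<Rightarrow> 'n \<Rightarrow> nat" where
  "monom_exp j i = (if fst j = i then (if snd j then 2 else 1) else 0)"

definition list_coeff :: "real ^ 'n \<Rightarrow> ('n \<times> bool) list \<Rightarrow> real" where
  "list_coeff a l = prod_list (map (monom_coeff a) l)"

definition list_exp :: "('n \<times> bool) list \<Rightarrow> 'n \<Rightarrow> nat" where
  "list_exp l i = sum_list (map (\<lambda>j. monom_exp j i) l)"

definition monom_value :: "real ^ 'n::finite \<Rightarrow> real ^ 'n \<Rightarrow> 'n \<times> bool \<Rightarrow> real" where
  "monom_value a y j = monom_coeff a j * (\<Prod>i\<in>UNIV. y $ i ^ monom_exp j i)"

lemma monom_value_eq: "monom_value a y (i, d) = (if d then (y $ i)\<^sup>2 else 2 * a $ i * y $ i)"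
proof -
  have "(\<Prod>k\<in>UNIV. y $ k ^ monom_exp (i, d) k) = (\<Prod>k\<in>UNIV. if k = i then y $ i ^ (if d then 2 else 1) else 1)"
    by (intro prod.cong) (auto simp: monom_exp_def)
  then show ?thesis by (simp add: monom_value_def monom_coeff_def)
qed

lemma list_value: "prod_list (map (monom_value a y) l) = list_coeff a l * (\<Prod>i\<in>UNIV. y $ i ^ list_exp l i)"
  by (induction l)
     (auto simp: list_coeff_def list_exp_def monom_value_def power_add prod.distrib)

lemma sum_monom_value: "(\<Sum>j\<in>UNIV. monom_value a y j) = (a + y) \<bullet> (a + y) - a \<bullet> a"
proof -
  have "(\<Sum>j\<in>UNIV. monom_value a y j) = (\<Sum>i\<in>UNIV. \<Sum>d\<in>UNIV. monom_value a y (i, d))"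
    by (simp add: sum.cartesian_product UNIV_Times_UNIV)
  also have "\<dots> = (\<Sum>i\<in>UNIV. 2 * a $ i * y $ i + (y $ i)\<^sup>2)"
    by (simp add: UNIV_bool monom_value_eq)
  also have "\<dots> = (a + y) \<bullet> (a + y) - a \<bullet> a"
    by (simp add: inner_vec_def sum_subtractf[symmetric] power2_eq_square algebra_simps)
  finally show ?thesis .
qed

lemma length_le_list_exp: "length l \<le> (\<Sum>i\<in>UNIV. list_exp l (i :: 'n::finite))"
proof (induction l)
  case (Cons j l)
  have "1 \<le> (\<Sum>i\<in>UNIV. monom_exp j i)"
    by (rule order_trans[OF _ member_le_sum[of "fst j"]]) (auto simp: monom_exp_def)
  then show ?case using Cons by (simp add: list_exp_def sum.distrib)
qed simp

text \<open>Each monomial has degree at least 1, so the total degree bounds the length of the list.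
  Hence the coefficient of a multi-index is a finite sum.\<close>

lemma finite_list_exp: "finite {l. list_exp l = (\<alpha> :: 'n::finite \<Rightarrow> nat)}"
proof (rule finite_subset)
  show "{l. list_exp l = \<alpha>} \<subseteq> {l. set l \<subseteq> UNIV \<and> length l \<le> (\<Sum>i\<in>UNIV. \<alpha> i)}"
    using length_le_list_exp by auto
qed (rule finite_lists_length_le, simp)

text \<open>The absolute values over the lists of length \<open>n\<close> sum to
  \<open>|b n|\<close> times the \<open>n\<close>-th power of the sum of all \<open>|g j|\<close>.
  The second assumption therefore gives absolute summability over all lists at once, and summing by
  length identifies the value.\<close>

lemma has_sum_lists:
  fixes b :: "nat \<Rightarrow> real" and g :: "'j::finite \<Rightarrow> real"
  assumes "(\<lambda>n. b n * (\<Sum>j\<in>UNIV. g j) ^ n) sums S" "summable (\<lambda>n. \<bar>b n\<bar> * (\<Sum>j\<in>UNIV. \<bar>g j\<bar>) ^ n)"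
  shows "((\<lambda>l. b (length l) * prod_list (map g l)) has_sum S) UNIV"
proof -
  let ?G = "\<lambda>p. b (fst p) * prod_list (map g (snd p))"
  have fin: "finite {l :: 'j list. length l = n}" for n
    using finite_lists_length_eq[of "UNIV :: 'j set" n] by simp
  have abs_prod: "\<bar>prod_list (map g l)\<bar> = prod_list (map (\<lambda>j. \<bar>g j\<bar>) l)" for l
    by (induction l) (auto simp: abs_mult)
  have le: "\<bar>(\<Sum>j\<in>UNIV. g j)\<bar> \<le> (\<Sum>j\<in>UNIV. \<bar>g j\<bar>)" by (rule sum_abs)
  have "(\<lambda>p. norm (?G p)) summable_on (SIGMA n:UNIV. {l. length l = n})"
  proof (rule summable_on_SigmaI)
    show "((\<lambda>l. norm (?G (n, l))) has_sum (\<bar>b n\<bar> * (\<Sum>j\<in>UNIV. \<bar>g j\<bar>) ^ n)) {l. length l = n}" for n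
    proof (rule has_sum_finiteI[OF fin])
      have "(\<Sum>l | length l = n. norm (?G (n, l))) = \<bar>b n\<bar> * (\<Sum>l | length l = n. prod_list (map (\<lambda>j. \<bar>g j\<bar>) l))"
        by (simp add: abs_mult abs_prod sum_distrib_left)
      then show "\<bar>b n\<bar> * (\<Sum>j\<in>UNIV. \<bar>g j\<bar>) ^ n = (\<Sum>l | length l = n. norm (?G (n, l)))"
        by (simp add: sum_lists_prod)
    qed
    have "norm (\<bar>b n\<bar> * (\<Sum>j\<in>UNIV. \<bar>g j\<bar>) ^ n) = \<bar>b n\<bar> * (\<Sum>j\<in>UNIV. \<bar>g j\<bar>) ^ n" for n
      by (simp add: abs_mult sum_nonneg)
    then show "(\<lambda>n. \<bar>b n\<bar> * (\<Sum>j\<in>UNIV. \<bar>g j\<bar>) ^ n) summable_on UNIV"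
      using assms(2) by (intro norm_summable_imp_summable_on) presburger
  qed auto
  then have 1: "?G summable_on (SIGMA n:UNIV. {l. length l = n})"
    by (rule abs_summable_summable)
  have 2: "((\<lambda>n. b n * (\<Sum>j\<in>UNIV. g j) ^ n) has_sum S) UNIV"
  proof (rule norm_summable_imp_has_sum[OF _ assms(1)])
    show "summable (\<lambda>n. norm (b n * (\<Sum>j\<in>UNIV. g j) ^ n))"
      by (rule summable_comparison_test'[OF assms(2), of 0])
         (auto simp: abs_mult power_abs intro!: mult_left_mono power_mono le)
  qed
  have "(?G has_sum S) (SIGMA n:UNIV. {l. length l = n})"
  proof (rule has_sum_SigmaI[OF _ 2 1])
    show "((\<lambda>l. ?G (n, l)) has_sum (b n * (\<Sum>j\<in>UNIV. g j) ^ n)) {l. length l = n}" for n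
      by (rule has_sum_finiteI[OF fin]) (simp add: sum_lists_prod sum_distrib_left[symmetric])
  qed
  moreover have "bij_betw (\<lambda>l. (length l, l)) UNIV (SIGMA n:UNIV. {l :: 'j list. length l = n})"
    by (rule bij_betwI[where g = snd]) auto
  ultimately show ?thesis
    using has_sum_reindex_bij_betw[of "\<lambda>l. (length l, l)" UNIV "SIGMA n:UNIV. {l :: 'j list. length l = n}" ?G S] by simp
qed

text \<open>Insert \<open>|x|^2 - |a|^2\<close>, a polynomial in \<open>y = x - a\<close> with zero
  constant term, into the power series of \<open>F\<close> about \<open>|a|^2\<close>. The sum
  \<open>q y\<close> of the absolute values of its monomials tends to 0 with \<open>y\<close>, so
  near \<open>a\<close> the expanded series converges absolutely and may be regrouped by
  multi-index.\<close>

theorem real_analytic_radial: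
  fixes f :: "complex \<Rightarrow> complex" and F :: "real \<Rightarrow> real"
  assumes hol: "f holomorphic_on ball 0 R" and real: "\<And>t. \<bar>t\<bar> < R \<Longrightarrow> f (of_real t) = of_real (F t)"
  shows "real_analytic_on {x :: real ^ 'n. x \<bullet> x < R} (\<lambda>x. F (x \<bullet> x))"
  unfolding real_analytic_on_def
proof
  fix a :: "real ^ 'n" assume a: "a \<in> {x. x \<bullet> x < R}"
  define s where "s = a \<bullet> a"
  have s: "0 \<le> s" "s < R" using a by (auto simp: s_def)
  obtain b where b: "\<And>t. \<bar>t - s\<bar> < R - s \<Longrightarrow> (\<lambda>n. b n * (t - s) ^ n) sums F t"
    "\<And>q. 0 \<le> q \<Longrightarrow> q < R - s \<Longrightarrow> summable (\<lambda>n. \<bar>b n\<bar> * q ^ n)"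
    using holomorphic_real_power_series[OF hol real s] by blast
  define q where "q y = (\<Sum>j\<in>UNIV. \<bar>monom_value a y j\<bar>)" for y
  have "((\<lambda>y. q y) \<longlongrightarrow> q 0) (at 0)"
    unfolding q_def monom_value_def by (intro tendsto_intros)
  moreover have q0: "q 0 = 0" proof -
    have "monom_value a 0 j = 0" for j by (cases j) (simp add: monom_value_eq)
    then show ?thesis by (simp add: q_def)
  qed
  ultimately have "\<forall>\<^sub>F y in at 0. q y < R - s"
    using s(2) by (intro order_tendstoD(2)) auto
  then obtain \<rho> where \<rho>: "0 < \<rho>" "\<And>y. y \<noteq> 0 \<Longrightarrow> norm y < \<rho> \<Longrightarrow> q y < R - s"
    unfolding eventually_at by (auto simp: dist_norm)
  have q_less: "q y < R - s" if "norm y < \<rho>" for y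
    using \<rho>(2)[of y] that q0 s(2) by (cases "y = 0") auto
  define c where "c \<alpha> = (\<Sum>l | list_exp l = \<alpha>. b (length l) * list_coeff a l)" for \<alpha>
  have "((\<lambda>\<alpha>. c \<alpha> * (\<Prod>i\<in>UNIV. (x $ i - a $ i) ^ \<alpha> i)) has_sum F (x \<bullet> x)) UNIV" if x: "x \<in> ball a \<rho>" for x
  proof -
    define y where "y = x - a"
    have y: "norm y < \<rho>" "x = a + y" using x by (auto simp: y_def dist_norm norm_minus_commute)
    have sm: "(\<Sum>j\<in>UNIV. monom_value a y j) = x \<bullet> x - s" by (simp add: sum_monom_value y(2) s_def)
    have q: "0 \<le> q y" "q y < R - s" using q_less[OF y(1)] by (auto simp: q_def intro: sum_nonneg)
    have "\<bar>x \<bullet> x - s\<bar> \<le> q y" unfolding sm[symmetric] q_def by (rule sum_abs)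
    then have "(\<lambda>n. b n * (x \<bullet> x - s) ^ n) sums F (x \<bullet> x)" using q by (intro b(1)) linarith
    then have H: "((\<lambda>l. b (length l) * prod_list (map (monom_value a y) l)) has_sum F (x \<bullet> x)) UNIV"
      using b(2)[OF q] by (intro has_sum_lists) (simp_all add: sm q_def)
    let ?G = "\<lambda>p. b (length (snd p)) * prod_list (map (monom_value a y) (snd p))"
    have "bij_betw (\<lambda>l. (list_exp l, l)) UNIV (SIGMA \<alpha>:UNIV. {l. list_exp l = \<alpha>})"
      by (rule bij_betwI[where g = snd]) auto
    from has_sum_reindex_bij_betw[OF this, of ?G "F (x \<bullet> x)"] H
    have "(?G has_sum F (x \<bullet> x)) (SIGMA \<alpha>:UNIV. {l. list_exp l = \<alpha>})" by simp
    then show ?thesis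
    proof (rule has_sum_SigmaD)
      fix \<alpha> :: "'n \<Rightarrow> nat"
      show "((\<lambda>l. ?G (\<alpha>, l)) has_sum (c \<alpha> * (\<Prod>i\<in>UNIV. (x $ i - a $ i) ^ \<alpha> i))) {l. list_exp l = \<alpha>}"
      proof (rule has_sum_finiteI[OF finite_list_exp])
        have "(\<Sum>l | list_exp l = \<alpha>. ?G (\<alpha>, l)) = (\<Sum>l | list_exp l = \<alpha>. b (length l) * list_coeff a l * (\<Prod>i\<in>UNIV. y $ i ^ \<alpha> i))"
          by (intro sum.cong) (auto simp: list_value)
        then show "c \<alpha> * (\<Prod>i\<in>UNIV. (x $ i - a $ i) ^ \<alpha> i) = (\<Sum>l | list_exp l = \<alpha>. ?G (\<alpha>, l))"
          by (simp add: c_def y_def sum_distrib_right)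
      qed
    qed
  qed
  then show "\<exists>\<rho>>0. \<exists>c. \<forall>x\<in>ball a \<rho>. ((\<lambda>\<alpha>. c \<alpha> * (\<Prod>i\<in>UNIV. (x $ i - a $ i) ^ \<alpha> i)) has_sum F (x \<bullet> x)) UNIV"
    using \<rho>(1) by blast
qed

section \<open>Averaging Dirichlet-to-Neumann maps\<close>

context darboux
begin

lemma ball_conductivity:
  assumes \<gamma>: "\<And>x. x \<in> ball 0 1 \<Longrightarrow> \<gamma> x = (W x)\<^sup>2"
  obtains c C where "ball_conductivity \<gamma> c C"
proof -
  have cW: "continuous_on (cball 0 1) (\<lambda>x. (W x)\<^sup>2)"
    using unit_ball.smooth_up_to_boundaryD(4)[OF smooth_up(3)] by (intro continuous_intros) simp
  obtain a where a: "a \<in> cball 0 1" "\<And>x. x \<in> cball 0 1 \<Longrightarrow> (W a)\<^sup>2 \<le> (W x)\<^sup>2"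
    using continuous_attains_inf[OF compact_cball _ cW] by auto
  obtain b where b: "b \<in> cball 0 1" "\<And>x. x \<in> cball 0 1 \<Longrightarrow> (W x)\<^sup>2 \<le> (W b)\<^sup>2"
    using continuous_attains_sup[OF compact_cball _ cW] by auto
  have "(\<lambda>x. (W x)\<^sup>2) \<in> borel_measurable MB"
    using cW by (intro unit_ball.continuous_closure_measurable) simp
  then have m: "\<gamma> \<in> borel_measurable MB"
    by (rule measurable_cong[THEN iffD1, rotated]) (simp add: \<gamma>)
  have "ball_conductivity \<gamma> ((W a)\<^sup>2) ((W b)\<^sup>2)"
    using dim3 W_pos[OF a(1)] a(2) b m \<gamma> by unfold_locales auto
  then show ?thesis by (rule that)
qed

text \<open>The conductivity is absorbed into \<open>flux\<close>, which depends on it only through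
  \<open>W\<close>, \<open>K\<close> and \<open>K1\<close>. Thus the maps of different
  conductivities become pairings of one and the same gradient with fields built from the same
  \<open>u\<close> and \<open>h\<close>.\<close>

lemma DN_map_flux:
  assumes H: "unit_ball.H1_tendsto \<Phi> u G"
      "\<And>\<psi>. test_function (ball 0 1) \<psi> \<Longrightarrow> (\<integral>x. G x \<bullet> grad \<psi> x \<partial>MB) = 0"
      "unit_ball.H1_tendsto \<Psi> h H"
      "\<And>\<psi>. test_function (ball 0 1) \<psi> \<Longrightarrow> (\<integral>x. H x \<bullet> grad \<psi> x \<partial>MB) = 0"
      "AE x in MB. x \<bullet> H x = u x - 17 / 2 * h x"
    and \<gamma>: "\<And>x. x \<in> ball 0 1 \<Longrightarrow> \<gamma> x = (W x)\<^sup>2"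
    and tr: "f \<in> L2 sphere_measure" "(\<lambda>n. L2_norm sphere_measure (\<lambda>x. \<Phi> n x - f x)) \<longlonglongrightarrow> 0"
  shows "DN_map (ball 0 1) sphere_measure \<gamma> f \<in> extensional (H_half (ball 0 1) sphere_measure)"
    and "has_trace (ball 0 1) sphere_measure v g \<Longrightarrow>
      DN_map (ball 0 1) sphere_measure \<gamma> f g = (\<integral>x. flux u G h H x \<bullet> weak_grad (ball 0 1) v x \<partial>MB)"
proof -
  have S: "has_trace (ball 0 1) sphere_measure (transform u h) f"
    "AE x in MB. \<gamma> x *\<^sub>R weak_grad (ball 0 1) (transform u h) x = flux u G h H x"
    "weak_solution (ball 0 1) \<gamma> (transform u h)"
    by (rule transform_solution[OF H \<gamma> tr]; assumption)+
  have L: "L2v MB (flux u G h H)" by (rule flux_L2v[OF H])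
  obtain c C where "ball_conductivity \<gamma> c C" using ball_conductivity[OF \<gamma>] by blast
  then interpret ball_conductivity \<gamma> c C .
  show "DN_map (ball 0 1) sphere_measure \<gamma> f \<in> extensional (H_half (ball 0 1) sphere_measure)"
    by (rule DN_map_ball(1)[OF S(3,1)])
  assume v: "has_trace (ball 0 1) sphere_measure v g"
  have "DN_map (ball 0 1) sphere_measure \<gamma> f g = energy \<gamma> (transform u h) v"
    by (rule DN_map_ball(2)[OF S(3,1) v])
  also have "\<dots> = (\<integral>x. flux u G h H x \<bullet> weak_grad (ball 0 1) v x \<partial>MB)"
    unfolding energy_def
  proof (rule integral_cong_AE)
    show "(\<lambda>x. \<gamma> x * (weak_grad (ball 0 1) (transform u h) x \<bullet> weak_grad (ball 0 1) v x)) \<in> borel_measurable MB"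
      using energy_integrable[OF weak_gradD(3)[OF S(1)] weak_gradD(3)[OF v]] by auto
    show "(\<lambda>x. flux u G h H x \<bullet> weak_grad (ball 0 1) v x) \<in> borel_measurable MB"
      using L2v_inner_integrable[OF L weak_gradD(3)[OF v]] by auto
    show "AE x in MB. \<gamma> x * (weak_grad (ball 0 1) (transform u h) x \<bullet> weak_grad (ball 0 1) v x) =
        flux u G h H x \<bullet> weak_grad (ball 0 1) v x"
      using S(2) by eventually_elim (metis inner_scaleR_left)
  qed
  finally show "DN_map (ball 0 1) sphere_measure \<gamma> f g = (\<integral>x. flux u G h H x \<bullet> weak_grad (ball 0 1) v x \<partial>MB)" .
qed

end

text \<open>All three fluxes come from the same \<open>u\<close> and \<open>h\<close>. Since \<open>w = 1\<close> and \<open>k = 0\<close> on the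
  sphere, the condition on the derivatives of \<open>k\<close> at \<open>1\<close> makes the coefficients of the averaged
  flux vanish there, so that it pairs to zero with every gradient.\<close>

theorem DN_map_average:
  fixes U V Z :: "'a::euclidean_space set" and \<gamma> \<gamma>1 \<gamma>2 f :: "'a \<Rightarrow> real"
  assumes D: "darboux k k1 k2 U" "darboux l l1 l2 V" "darboux m m1 m2 Z"
    and avg: "k1 1 = 1/2 * l1 1 + 1/2 * m1 1"
    and \<gamma>: "\<And>x. x \<in> ball 0 1 \<Longrightarrow> \<gamma> x = (1 + 2 / 17 * k (x \<bullet> x))\<^sup>2"
    and \<gamma>1: "\<And>x. x \<in> ball 0 1 \<Longrightarrow> \<gamma>1 x = (1 + 2 / 17 * l (x \<bullet> x))\<^sup>2"
    and \<gamma>2: "\<And>x. x \<in> ball 0 1 \<Longrightarrow> \<gamma>2 x = (1 + 2 / 17 * m (x \<bullet> x))\<^sup>2"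
    and f: "f \<in> H_half (ball 0 1) sphere_measure"
  shows "DN_map (ball 0 1) sphere_measure \<gamma> f = (\<lambda>g\<in>H_half (ball 0 1) sphere_measure.
    1/2 * DN_map (ball 0 1) sphere_measure \<gamma>1 f g + 1/2 * DN_map (ball 0 1) sphere_measure \<gamma>2 f g)"
proof -
  interpret A: darboux k k1 k2 U by (rule D)
  interpret B: darboux l l1 l2 V by (rule D)
  interpret C: darboux m m1 m2 Z by (rule D)
  obtain u' where "has_trace (ball 0 1) sphere_measure u' f" using f by (auto simp: H_half_def)
  then obtain \<Phi> u G where \<Phi>: "unit_ball.H1_tendsto \<Phi> u G"
    and tr: "f \<in> L2 sphere_measure" "(\<lambda>n. L2_norm sphere_measure (\<lambda>x. \<Phi> n x - f x)) \<longlonglongrightarrow> 0"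
    and harm: "\<And>\<psi>. test_function (ball 0 1) \<psi> \<Longrightarrow> (\<integral>x. G x \<bullet> grad \<psi> x \<partial>MB) = 0"
    using harmonic_extension by blast
  \<comment> \<open>The choice \<open>p = 16\<close> gives the Euler constant
    \<open>(16 + 1) / 2 = 17/2\<close>, which is \<open>1/2 + K\<close> on the sphere; in dimension
    3 it meets both conditions on \<open>p\<close>.\<close>
  obtain \<Psi> h H where \<Psi>: "unit_ball.H1_tendsto \<Psi> h H"
    and harm': "\<And>\<psi>. test_function (ball 0 1) \<psi> \<Longrightarrow> (\<integral>x. H x \<bullet> grad \<psi> x \<partial>MB) = 0"
    and Euler: "AE x in MB. x \<bullet> H x = u x - (real 16 + 1) / 2 * h x"
    using harmonic_radial_primitive[OF \<Phi> harm, of 16] A.dim3 by auto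
  have Euler': "AE x in MB. x \<bullet> H x = u x - 17 / 2 * h x" using Euler by simp
  note H = \<Phi> harm \<Psi> harm' Euler'
  note E = unit_ball.H1_tendstoD[OF \<Phi>] and E' = unit_ball.H1_tendstoD[OF \<Psi>]
  have FA: "x \<in> ball 0 1 \<Longrightarrow> \<gamma> x = (A.W x)\<^sup>2" and FB: "x \<in> ball 0 1 \<Longrightarrow> \<gamma>1 x = (B.W x)\<^sup>2"
    and FC: "x \<in> ball 0 1 \<Longrightarrow> \<gamma>2 x = (C.W x)\<^sup>2" for x
    by (simp_all add: \<gamma> \<gamma>1 \<gamma>2 A.W_def A.K_def B.W_def B.K_def C.W_def C.K_def)
  have ext: "DN_map (ball 0 1) sphere_measure \<gamma> f \<in> extensional (H_half (ball 0 1) sphere_measure)"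
    by (rule A.DN_map_flux(1)[OF H FA tr])
  have DA: "DN_map (ball 0 1) sphere_measure \<gamma> f g = (\<integral>x. A.flux u G h H x \<bullet> weak_grad (ball 0 1) v x \<partial>MB)"
    and DB: "DN_map (ball 0 1) sphere_measure \<gamma>1 f g = (\<integral>x. B.flux u G h H x \<bullet> weak_grad (ball 0 1) v x \<partial>MB)"
    and DC: "DN_map (ball 0 1) sphere_measure \<gamma>2 f g = (\<integral>x. C.flux u G h H x \<bullet> weak_grad (ball 0 1) v x \<partial>MB)"
    if "has_trace (ball 0 1) sphere_measure v g" for v g
    by (rule A.DN_map_flux(2)[OF H FA tr that], assumption+)
       (rule B.DN_map_flux(2)[OF H FB tr that], assumption+, rule C.DN_map_flux(2)[OF H FC tr that])
  have LA: "L2v MB (A.flux u G h H)" by (rule A.flux_L2v[OF H])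
  have LB: "L2v MB (B.flux u G h H)" by (rule B.flux_L2v[OF H])
  have LC: "L2v MB (C.flux u G h H)" by (rule C.flux_L2v[OF H])
  define X where "X x = A.flux u G h H x - (1/2) *\<^sub>R B.flux u G h H x - (1/2) *\<^sub>R C.flux u G h H x" for x
  define a where "a x = A.W x - 1/2 * B.W x - 1/2 * C.W x" for x
  define b where "b x = A.W x * A.K x - 1/2 * (B.W x * B.K x) - 1/2 * (C.W x * C.K x)" for x
  define e where "e x = A.K1 x - 1/2 * B.K1 x - 1/2 * C.K1 x" for x
  have X_eq: "X x = a x *\<^sub>R G x + b x *\<^sub>R H x + (2 * e x * h x - 4 / 17 * e x * u x) *\<^sub>R x" for x
    unfolding X_def a_def b_def e_def A.flux_def B.flux_def C.flux_def
    by (simp add: algebra_simps scaleR_left.add scaleR_left.diff)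
  have XL: "L2v MB X" unfolding X_def by (intro L2v_diff L2v_cmult LA LB LC)
  have pair: "(\<integral>x. X x \<bullet> F x \<partial>MB) = (\<integral>x. A.flux u G h H x \<bullet> F x \<partial>MB) - 1/2 * (\<integral>x. B.flux u G h H x \<bullet> F x \<partial>MB)
      - 1/2 * (\<integral>x. C.flux u G h H x \<bullet> F x \<partial>MB)" if F: "L2v MB F" for F
    using L2v_inner_integrable[OF LA F] L2v_inner_integrable[OF LB F] L2v_inner_integrable[OF LC F]
    unfolding X_def by (simp add: inner_diff_left)
  have div: "(\<integral>x. X x \<bullet> grad \<phi> x \<partial>MB) = 0" if \<phi>: "test_function (ball 0 1) \<phi>" for \<phi>
  proof -
    have "(\<integral>x. A.flux u G h H x \<bullet> grad \<phi> x \<partial>MB) = 0" by (rule A.flux_divergence_free[OF H \<phi>])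
    moreover have "(\<integral>x. B.flux u G h H x \<bullet> grad \<phi> x \<partial>MB) = 0" by (rule B.flux_divergence_free[OF H \<phi>])
    moreover have "(\<integral>x. C.flux u G h H x \<bullet> grad \<phi> x \<partial>MB) = 0" by (rule C.flux_divergence_free[OF H \<phi>])
    ultimately show ?thesis
      unfolding pair[OF unit_ball.test_function_L2(2)[OF \<phi>]] by simp
  qed
  have su: "smooth_up_ball a" "smooth_up_ball b" "smooth_up_ball e"
    unfolding a_def[abs_def] b_def[abs_def] e_def[abs_def]
    by (intro smooth_up_diff smooth_up_cmult smooth_up_mult A.smooth_up B.smooth_up C.smooth_up)+
  have zero: "a x = 0" "b x = 0" "e x = 0" if "norm x = 1" for x
  proof -
    have "x \<bullet> x = 1" using that by (simp add: norm_eq_1)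
    then show "a x = 0" "b x = 0" "e x = 0"
      by (simp_all add: a_def b_def e_def A.W_def A.K_def B.W_def B.K_def C.W_def C.K_def A.K1_def B.K1_def C.K1_def
          A.k_1 B.k_1 C.k_1 avg)
  qed
  obtain La where La: "0 \<le> La" "\<And>x. x \<in> ball 0 1 \<Longrightarrow> \<bar>a x\<bar> \<le> La * (1 - x \<bullet> x)"
    using vanishing_boundary_bound[OF su(1) zero(1)] by blast
  obtain Lb where Lb: "0 \<le> Lb" "\<And>x. x \<in> ball 0 1 \<Longrightarrow> \<bar>b x\<bar> \<le> Lb * (1 - x \<bullet> x)"
    using vanishing_boundary_bound[OF su(2) zero(2)] by blast
  obtain Le where Le: "0 \<le> Le" "\<And>x. x \<in> ball 0 1 \<Longrightarrow> \<bar>e x\<bar> \<le> Le * (1 - x \<bullet> x)"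
    using vanishing_boundary_bound[OF su(3) zero(3)] by blast
  \<comment> \<open>The linear decay of the three coefficients at the sphere, with the common factor
    \<open>1 - |x|^2\<close> taken out.\<close>
  define Y where "Y x = La * norm (G x) + Lb * norm (H x) + Le * \<bar>2 * h x - 4 / 17 * u x\<bar>" for x
  have YL: "Y \<in> L2 MB"
    unfolding Y_def[abs_def] by (intro L2_add L2_cmult L2_abs L2_diff L2v_norm E E')
  have XY: "norm (X x) \<le> (1 - x \<bullet> x) * Y x" if x: "x \<in> ball 0 1" for x
  proof -
    have "norm (X x) \<le> \<bar>a x\<bar> * norm (G x) + \<bar>b x\<bar> * norm (H x) + \<bar>e x\<bar> * (\<bar>2 * h x - 4 / 17 * u x\<bar> * norm x)"
    proof -
      have "2 * e x * h x - 4 / 17 * e x * u x = e x * (2 * h x - 4 / 17 * u x)" by (simp add: algebra_simps)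
      then have "norm ((2 * e x * h x - 4 / 17 * e x * u x) *\<^sub>R x) = \<bar>e x\<bar> * (\<bar>2 * h x - 4 / 17 * u x\<bar> * norm x)"
        by (simp add: abs_mult)
      then show ?thesis
        unfolding X_eq
        by (metis (no_types, lifting) norm_add_rule_thm norm_scaleR order_refl)
    qed
    also have "\<dots> \<le> La * (1 - x \<bullet> x) * norm (G x) + Lb * (1 - x \<bullet> x) * norm (H x) + Le * (1 - x \<bullet> x) * (\<bar>2 * h x - 4 / 17 * u x\<bar> * 1)"
      using x inner_self_less_1[OF x] La(1) Lb(1) Le(1)
      by (intro add_mono mult_mono La(2)[OF x] Lb(2)[OF x] Le(2)[OF x]) auto
    also have "\<dots> = (1 - x \<bullet> x) * Y x" by (simp add: Y_def algebra_simps)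
    finally show ?thesis .
  qed
  show ?thesis
  proof (rule extensionalityI[of _ "H_half (ball 0 1) sphere_measure"])
    show "DN_map (ball 0 1) sphere_measure \<gamma> f \<in> extensional (H_half (ball 0 1) sphere_measure)" by (rule ext)
    fix g :: "'a \<Rightarrow> real" assume g: "g \<in> H_half (ball 0 1) sphere_measure"
    then obtain v where v: "has_trace (ball 0 1) sphere_measure v g" by (auto simp: H_half_def)
    obtain \<Xi> where \<Xi>: "unit_ball.H1_tendsto \<Xi> v (weak_grad (ball 0 1) v)" using unit_ball.has_traceE[OF v] by blast
    have "(\<integral>x. X x \<bullet> weak_grad (ball 0 1) v x \<partial>MB) = 0"
      by (rule divergence_free_vanishing_boundary[OF XL div YL XY \<Xi>])
    then show "DN_map (ball 0 1) sphere_measure \<gamma> f g = (\<lambda>g\<in>H_half (ball 0 1) sphere_measure.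
        1/2 * DN_map (ball 0 1) sphere_measure \<gamma>1 f g + 1/2 * DN_map (ball 0 1) sphere_measure \<gamma>2 f g) g"
      using g unfolding pair[OF weak_gradD(3)[OF v]] by (simp add: DA[OF v] DB[OF v] DC[OF v])
  qed simp
qed

section \<open>The soliton potentials\<close>

definition soliton :: "nat \<Rightarrow> real \<Rightarrow> real \<Rightarrow> real" where
  "soliton m c s = real m * (c + s ^ m) / (c - s ^ m) - 8"

definition soliton1 :: "nat \<Rightarrow> real \<Rightarrow> real \<Rightarrow> real" where
  "soliton1 m c s = 2 * (real m)\<^sup>2 * c * s ^ (m - 1) / (c - s ^ m)\<^sup>2"

text \<open>For \<open>m = 1\<close> the exponent \<open>m - 2\<close> is truncated to 0, which is
  harmless because the factor \<open>m - 1\<close> vanishes.\<close>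

definition soliton2 :: "nat \<Rightarrow> real \<Rightarrow> real \<Rightarrow> real" where
  "soliton2 m c s = 2 * (real m)\<^sup>2 * c *
     (real (m - 1) * s ^ (m - 2) / (c - s ^ m)\<^sup>2 + 2 * real m * s ^ (m - 1) * s ^ (m - 1) / (c - s ^ m) ^ 3)"

text \<open>The assumption \<open>mc\<close> normalises \<open>soliton m c\<close> to 0 at
  \<open>s = 1\<close> and means \<open>c = (8 + m) / (8 - m)\<close>. Since
  \<open>soliton m c s + 8\<close> is nonnegative on the unit interval, the conductivity root is at
  least \<open>1/17\<close>. The equation for the second derivative is checked over the common
  denominator \<open>(c - s^m)^3\<close>.\<close>

lemma darboux_soliton:
  assumes dim: "DIM('a::euclidean_space) = 3" and m: "1 \<le> m" and c: "1 < c" and mc: "real m * (c + 1) = 8 * (c - 1)"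
  shows "darboux (soliton m c) (soliton1 m c) (soliton2 m c) {x::'a. (x \<bullet> x) ^ m < c}"
proof
  let ?U = "{x::'a. (x \<bullet> x) ^ m < c}"
  have pos: "0 < c - s ^ m" if "0 \<le> s" "s \<le> 1" for s :: real
    using power_le_one[OF that, of m] c by linarith
  show "DIM('a) = 3" by (rule dim)
  show oU: "open ?U" by (intro open_Collect_less continuous_intros)
  show "cball 0 1 \<subseteq> ?U"
  proof
    fix x :: 'a assume "x \<in> cball 0 1"
    then have "x \<bullet> x \<le> 1" by (simp add: norm_le_square flip: power2_norm_eq_inner)
    then show "x \<in> ?U" using pos[of "x \<bullet> x"] by simp
  qed
  show "smooth_on ?U (\<lambda>x. soliton m c (x \<bullet> x))"
    unfolding soliton_def
    by (intro smooth_on_diff smooth_on_divide smooth_on_cmult smooth_on_add smooth_on_power smooth_on_const smooth_on_inner_self oU) auto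
  show "smooth_on ?U (\<lambda>x. soliton1 m c (x \<bullet> x))"
    unfolding soliton1_def
    by (intro smooth_on_divide smooth_on_cmult smooth_on_diff smooth_on_power smooth_on_const smooth_on_inner_self oU) auto
  show "soliton m c 1 = 0"
    using mc c by (simp add: soliton_def field_simps)
  fix s :: real assume s: "0 \<le> s" "s \<le> 1"
  define r where "r = c - s ^ m"
  have r: "0 < r" using pos[OF s] by (simp add: r_def)
  have sm: "s * s ^ (m - 1) = s ^ m" using m by (metis power_eq_if not_one_le_zero)
  have dr: "((\<lambda>s. c - s ^ m) has_real_derivative - (real m * s ^ (m - 1))) (at s)"
    by (auto intro!: derivative_eq_intros)
  have d: "((\<lambda>s. real m * (c + s ^ m) / (c - s ^ m) - 8) has_real_derivative
      (real m * (real m * s ^ (m - 1)) * r - real m * (c + s ^ m) * - (real m * s ^ (m - 1))) / (r * r)) (at s)"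
    unfolding r_def using pos[OF s] by (auto intro!: derivative_eq_intros)
  have "(real m * (real m * s ^ (m - 1)) * r - real m * (c + s ^ m) * - (real m * s ^ (m - 1))) / (r * r) = soliton1 m c s"
    unfolding soliton1_def r_def by (simp add: power2_eq_square algebra_simps)
  with d show "(soliton m c has_real_derivative soliton1 m c s) (at s)"
    unfolding soliton_def[abs_def] by simp
  have "((\<lambda>s. 2 * (real m)\<^sup>2 * c * s ^ (m - 1) / (c - s ^ m)\<^sup>2) has_real_derivative
      (2 * (real m)\<^sup>2 * c * (real (m - 1) * s ^ (m - 2)) * r\<^sup>2 - 2 * (real m)\<^sup>2 * c * s ^ (m - 1) * (2 * r * - (real m * s ^ (m - 1)))) / (r\<^sup>2 * r\<^sup>2)) (at s)"
    unfolding r_def using pos[OF s] by (auto intro!: derivative_eq_intros simp: numeral_2_eq_2)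
  moreover have "(2 * (real m)\<^sup>2 * c * (real (m - 1) * s ^ (m - 2)) * r\<^sup>2 - 2 * (real m)\<^sup>2 * c * s ^ (m - 1) * (2 * r * - (real m * s ^ (m - 1)))) / (r\<^sup>2 * r\<^sup>2) = soliton2 m c s"
    unfolding soliton2_def r_def[symmetric] using r by (simp add: field_simps power2_eq_square power3_eq_cube)
  ultimately show "(soliton1 m c has_real_derivative soliton2 m c s) (at s)"
    unfolding soliton1_def[abs_def] by simp
  have s2: "real (m - 1) * (s * s ^ (m - 2)) = (real m - 1) * s ^ (m - 1)"
  proof (cases "m = 1")
    case False
    then have "m - 1 = Suc (m - 2)" using m by simp
    then show ?thesis using m by (simp add: of_nat_diff)
  qed simp
  have "2 * s * soliton2 m c s = 4 * (real m)\<^sup>2 * c * (real (m - 1) * (s * s ^ (m - 2)) / r\<^sup>2 + 2 * real m * (s * s ^ (m - 1)) * s ^ (m - 1) / r ^ 3)"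
    unfolding soliton2_def r_def[symmetric] by (simp add: algebra_simps)
  also have "\<dots> = 4 * (real m)\<^sup>2 * c * s ^ (m - 1) / r ^ 3 * ((real m - 1) * r + 2 * real m * s ^ m)"
    unfolding s2 sm using r by (simp add: field_simps power2_eq_square power3_eq_cube)
  also have "(real m - 1) * r + 2 * real m * s ^ m = real m * (c + s ^ m) - r"
    by (simp add: r_def algebra_simps)
  also have "4 * (real m)\<^sup>2 * c * s ^ (m - 1) / r ^ 3 * (real m * (c + s ^ m) - r) = (2 * soliton m c s + 14) * soliton1 m c s"
    unfolding soliton_def soliton1_def r_def[symmetric] using r by (simp add: field_simps power2_eq_square power3_eq_cube)
  finally show "2 * s * soliton2 m c s = (2 * soliton m c s + 14) * soliton1 m c s" .
  define t where "t = real m * (c + s ^ m) / (c - s ^ m)"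
  have "0 \<le> t" unfolding t_def using pos[OF s] s c by simp
  then show "0 < 1 + 2 / 17 * soliton m c s" unfolding soliton_def t_def[symmetric] by argo
qed

text \<open>The poles of the rational function of \<open>z\<close> satisfy
  \<open>|z|^n = p / q\<close>, which is at least \<open>R^n\<close>, so the function is holomorphic
  on the open disc of radius \<open>R\<close>.\<close>

lemma real_analytic_rational:
  fixes a b p q :: real
  assumes q: "0 < q" "q * R ^ n \<le> p" and R: "0 < R" "0 < n"
  shows "real_analytic_on {x :: real ^ 'n. x \<bullet> x < R} (\<lambda>x. ((a + b * (x \<bullet> x) ^ n) / (17 * (p - q * (x \<bullet> x) ^ n)))\<^sup>2)"
proof (rule real_analytic_radial[where f = "\<lambda>z. ((of_real a + of_real b * z ^ n) / (17 * (of_real p - of_real q * z ^ n)))\<^sup>2"])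
  have "of_real p - of_real q * z ^ n \<noteq> 0" if z: "z \<in> ball 0 R" for z :: complex
  proof
    assume "of_real p - of_real q * z ^ n = 0"
    then have "of_real p = of_real q * z ^ n" by simp
    then have "norm (of_real p :: complex) = norm (of_real q * z ^ n)" by simp
    then have "\<bar>p\<bar> = q * norm z ^ n" using q by (simp add: norm_mult norm_power)
    moreover have "norm z ^ n < R ^ n" using z R by (intro power_strict_mono) auto
    then have "q * norm z ^ n < q * R ^ n" using q by simp
    ultimately show False using q by linarith
  qed
  then show "(\<lambda>z. ((of_real a + of_real b * z ^ n) / (17 * (of_real p - of_real q * z ^ n)))\<^sup>2) holomorphic_on ball 0 R"
    by (intro holomorphic_intros) auto
qed simp

section \<open>The three conductivities\<close>

lemma norm_power_even: "norm x ^ (2 * n) = (x \<bullet> x) ^ n"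
  by (simp add: power_mult power2_norm_eq_inner)

theorem propositionA1:
  fixes w w1 w2 :: "real \<Rightarrow> real"
    and \<gamma> \<gamma>1 \<gamma>2 :: "real ^ 3 \<Rightarrow> real"
  assumes w1: "w1 = (\<lambda>r. (27 + 7 * r ^ 2) / (17 * (9 - 7 * r ^ 2)))"
    and w: "w = (\<lambda>r. (143 + 27 * r ^ 10) / (17 * (13 - 3 * r ^ 10)))"
    and w2: "w2 = (\<lambda>r. (225 + 13 * r ^ 14) / (17 * (15 - r ^ 14)))"
    and \<gamma>1: "\<gamma>1 = (\<lambda>x. (w1 (norm x))\<^sup>2)"
    and \<gamma>: "\<gamma> = (\<lambda>x. (w (norm x))\<^sup>2)"
    and \<gamma>2: "\<gamma>2 = (\<lambda>x. (w2 (norm x))\<^sup>2)"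
  shows "(\<exists>U. open U \<and> cball 0 1 \<subseteq> U \<and>
            (\<forall>\<kappa>\<in>{\<gamma>, \<gamma>1, \<gamma>2}. (\<forall>x\<in>U. \<kappa> x > 0) \<and> real_analytic_on U \<kappa> \<and> radial_on U \<kappa>)) \<and>
         (\<exists>x\<in>ball 0 1. \<gamma> x \<noteq> \<gamma>1 x) \<and>
         (\<exists>x\<in>ball 0 1. \<gamma> x \<noteq> \<gamma>2 x) \<and>
         (\<exists>x\<in>ball 0 1. \<gamma>1 x \<noteq> \<gamma>2 x) \<and>
         (\<forall>f\<in>H_half_sphere.
            DN_ball \<gamma> f = (\<lambda>g\<in>H_half_sphere. 1/2 * DN_ball \<gamma>1 f g + 1/2 * DN_ball \<gamma>2 f g))"
proof (intro conjI ballI)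
  have g: "\<gamma> = (\<lambda>x. ((143 + 27 * (x \<bullet> x) ^ 5) / (17 * (13 - 3 * (x \<bullet> x) ^ 5)))\<^sup>2)"
    using norm_power_even[of "_ :: real ^ 3" 5] by (simp add: \<gamma> w)
  have g1: "\<gamma>1 = (\<lambda>x. ((27 + 7 * (x \<bullet> x) ^ 1) / (17 * (9 - 7 * (x \<bullet> x) ^ 1)))\<^sup>2)"
    using norm_power_even[of "_ :: real ^ 3" 1] by (simp add: \<gamma>1 w1)
  have g2: "\<gamma>2 = (\<lambda>x. ((225 + 13 * (x \<bullet> x) ^ 7) / (17 * (15 - 1 * (x \<bullet> x) ^ 7)))\<^sup>2)"
    using norm_power_even[of "_ :: real ^ 3" 7] by (simp add: \<gamma>2 w2)
  \<comment> \<open>As functions of \<open>x \<bullet> x\<close> the conductivities have their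
    positive real poles at \<open>9/7\<close>, \<open>(13/3)^(1/5)\<close> and
    \<open>15^(1/7)\<close>; any bound strictly between 1 and \<open>9/7\<close> would do.\<close>
  define U where "U = {x :: real ^ 3. x \<bullet> x < 11 / 10}"
  have "open U" unfolding U_def by (intro open_Collect_less continuous_intros)
  moreover have "cball 0 1 \<subseteq> U"
  proof
    fix x :: "real ^ 3" assume "x \<in> cball 0 1"
    then have "x \<bullet> x \<le> 1" by (simp add: norm_le_square flip: power2_norm_eq_inner)
    then show "x \<in> U" by (simp add: U_def)
  qed
  moreover have "\<forall>\<kappa>\<in>{\<gamma>, \<gamma>1, \<gamma>2}. radial_on U \<kappa>"
    by (auto simp: radial_on_def \<gamma> \<gamma>1 \<gamma>2)
  moreover have "\<forall>\<kappa>\<in>{\<gamma>, \<gamma>1, \<gamma>2}. real_analytic_on U \<kappa>"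
  proof -
    have "real_analytic_on U \<gamma>"
      unfolding U_def g by (rule real_analytic_rational) (auto simp: power_divide)
    moreover have "real_analytic_on U \<gamma>1"
      unfolding U_def g1 by (rule real_analytic_rational) auto
    moreover have "real_analytic_on U \<gamma>2"
      unfolding U_def g2 by (rule real_analytic_rational) (auto simp: power_divide)
    ultimately show ?thesis by blast
  qed
  moreover have "\<forall>\<kappa>\<in>{\<gamma>, \<gamma>1, \<gamma>2}. \<forall>x\<in>U. 0 < \<kappa> x"
  proof -
    have pos: "0 < ((a + b * (x \<bullet> x) ^ n) / (17 * (p - q * (x \<bullet> x) ^ n)))\<^sup>2"
      if "x \<in> U" "0 < a" "0 < b" "0 < q" "q * (11 / 10) ^ n < p" for x n and a b p q :: real
    proof -
      have "(x \<bullet> x) ^ n \<le> (11 / 10) ^ n" using that(1) by (intro power_mono) (auto simp: U_def)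
      then have "q * (x \<bullet> x) ^ n \<le> q * (11 / 10) ^ n" using that by (intro mult_left_mono) auto
      then have "0 < p - q * (x \<bullet> x) ^ n" using that by linarith
      moreover have "0 < a + b * (x \<bullet> x) ^ n" using that by (intro add_pos_nonneg) auto
      ultimately show ?thesis by simp
    qed
    have "0 < \<gamma> x" if "x \<in> U" for x unfolding g by (rule pos[OF that]) (simp_all add: power_divide)
    moreover have "0 < \<gamma>1 x" if "x \<in> U" for x unfolding g1 by (rule pos[OF that]) simp_all
    moreover have "0 < \<gamma>2 x" if "x \<in> U" for x unfolding g2 by (rule pos[OF that]) (simp_all add: power_divide)
    ultimately show ?thesis by blast
  qed
  ultimately show "\<exists>U. open U \<and> cball 0 1 \<subseteq> U \<and>
      (\<forall>\<kappa>\<in>{\<gamma>, \<gamma>1, \<gamma>2}. (\<forall>x\<in>U. \<kappa> x > 0) \<and> real_analytic_on U \<kappa> \<and> radial_on U \<kappa>)"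
    by blast
  \<comment> \<open>At the origin \<open>w1\<close>, \<open>w\<close> and \<open>w2\<close> have the
    values \<open>3/17\<close>, \<open>11/17\<close> and \<open>15/17\<close>, that is
    \<open>(2 m + 1) / 17\<close>.\<close>
  show "\<exists>x\<in>ball 0 1. \<gamma> x \<noteq> \<gamma>1 x" "\<exists>x\<in>ball 0 1. \<gamma> x \<noteq> \<gamma>2 x" "\<exists>x\<in>ball 0 1. \<gamma>1 x \<noteq> \<gamma>2 x"
    by (rule bexI[of _ 0]; simp add: g g1 g2 power2_eq_square)+
  fix f :: "real ^ 3 \<Rightarrow> real" assume f: "f \<in> H_half_sphere"
  \<comment> \<open>The constants are \<open>(8 + m) / (8 - m)\<close> for
    \<open>m = 5, 1, 7\<close>.\<close>
  have D: "darboux (soliton 5 (13/3)) (soliton1 5 (13/3)) (soliton2 5 (13/3)) {x :: real ^ 3. (x \<bullet> x) ^ 5 < 13/3}"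
    "darboux (soliton 1 (9/7)) (soliton1 1 (9/7)) (soliton2 1 (9/7)) {x :: real ^ 3. (x \<bullet> x) ^ 1 < 9/7}"
    "darboux (soliton 7 15) (soliton1 7 15) (soliton2 7 15) {x :: real ^ 3. (x \<bullet> x) ^ 7 < 15}"
    by (rule darboux_soliton; simp)+
  have lt: "(x \<bullet> x) ^ n < 1" if "x \<in> ball 0 1" "0 < n" for x :: "real ^ 3" and n
    using inner_self_less_1[OF that(1)] that(2) by (simp add: power_less_one_iff)
  show "DN_ball \<gamma> f = (\<lambda>g\<in>H_half_sphere. 1/2 * DN_ball \<gamma>1 f g + 1/2 * DN_ball \<gamma>2 f g)"
    unfolding DN_ball_def H_half_sphere_def
  proof (rule DN_map_average[OF D _ _ _ _ f[unfolded H_half_sphere_def]])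
    \<comment> \<open>The derivatives at 1 are \<open>(64 - m^2) / 2\<close>, so the claim is
      \<open>39/2 = (63/2 + 15/2) / 2\<close>; here the choice of the three exponents
      enters.\<close>
    show "soliton1 5 (13/3) 1 = 1/2 * soliton1 1 (9/7) 1 + 1/2 * soliton1 7 15 1"
      by (simp add: soliton1_def power2_eq_square)
    fix x :: "real ^ 3" assume x: "x \<in> ball 0 1"
    show "\<gamma> x = (1 + 2 / 17 * soliton 5 (13/3) (x \<bullet> x))\<^sup>2"
      unfolding g soliton_def using lt[OF x, of 5] by (intro arg_cong[where f = "\<lambda>t. t\<^sup>2"]) (simp add: field_simps)
    show "\<gamma>1 x = (1 + 2 / 17 * soliton 1 (9/7) (x \<bullet> x))\<^sup>2"
      unfolding g1 soliton_def using lt[OF x, of 1] by (intro arg_cong[where f = "\<lambda>t. t\<^sup>2"]) (simp add: field_simps)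
    show "\<gamma>2 x = (1 + 2 / 17 * soliton 7 15 (x \<bullet> x))\<^sup>2"
      unfolding g2 soliton_def using lt[OF x, of 7] by (intro arg_cong[where f = "\<lambda>t. t\<^sup>2"]) (simp add: field_simps)
  qed
qed

end
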